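(* Let $a,b\in\mathbb{C}$ with $\mathrm{Re}\,a,\mathrm{Re}\,b>0$, and let $\alpha\in\mathbb{C}\setminus\{0\}$ in part 1 and in (2a), (2b) below. 1. Let $-1/4<\mathrm{Re}\,\alpha<1/2$. Then $$\int_0^\infty I_\alpha(a x)K_\alpha(a x) K_\alpha^2(b x) \,\mathrm{d}x=\frac{\pi^2}{8b}\bigg\{\frac{\sec(\pi\alpha)}{\alpha}\, {}_4F_3\bigg({\frac{1}{2},\frac{1}{2},\alpha+\frac{1}{2},\frac{1}{2}-\alpha \atop 1,\alpha+1,1-\alpha}\;\bigg|\;\frac{a^2}{b^2}\bigg)$$ $$-\frac{\Gamma(\alpha+\frac{1}{2})\Gamma(2\alpha+\frac{1}{2})\csc(\pi\alpha)}{\Gamma^3(\alpha+1)}\Big(\frac{a}{2b}\Big)^{2\alpha} {}_4F_3\bigg({\frac{1}{2},\alpha+\frac{1}{2},\alpha+\frac{1}{2},2\alpha+\frac{1}{2} \atop \alpha+1,\alpha+1,2\alpha+1}\;\bigg|\;\frac{a^2}{b^2}\bigg)\bigg\}.$$ 2. Suppose that $-1/2<\mathrm{Re}\,\alpha<1$. (2a) For $a\neq b$, $$\int_0^\infty x I_\alpha(ax)K_\alpha(ax)K_\alpha^2(bx)\,\mathrm{d}x=\frac{\pi\csc(\pi\alpha)}{4b^2}\bigg\{\frac{b}{a}\tanh^{-1}\Big(\frac{a}{b}\Big)-\frac{(a/b)^{2\alpha}}{1+2\alpha}\,{}_2F_1\bigg({1,\frac{1}{2}+\alpha \atop \frac{3}{2}+\alpha}\;\bigg|\;\frac{a^2}{b^2}\bigg)\bigg\}.$$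 (2b) If $a=b$, $$\int_0^\infty xI_\alpha(ax)K_\alpha^3(ax)\,\mathrm{d}x=\frac{\pi}{8a^2}\csc(\pi\alpha)\Big\{\psi\big(\tfrac{1}{2}+\alpha\big)+2\ln(2)+\gamma\Big\}.$$ (2c) When $\alpha=0$: for $|a/b|\leq1$ and $a\neq b$, $$\int_0^\infty x I_0(ax)K_0(ax)K_0^2(bx)\,\mathrm{d}x=\frac{1}{4ab}\bigg\{\mathrm{Li}_2\Big(\frac{a}{b}\Big)-\mathrm{Li}_2\Big(-\frac{a}{b}\Big)-2\ln\Big(\frac{a}{b}\Big)\tanh^{-1}\Big(\frac{a}{b}\Big)\bigg\};$$ for $|a/b|\geq1$ and $a\neq b$, $$\int_0^\infty x I_0(ax)K_0(ax)K_0^2(bx)\,\mathrm{d}x=\frac{1}{4ab}\bigg\{\frac{\pi^2}{2}-\mathrm{Li}_2\Big(\frac{b}{a}\Big)+\mathrm{Li}_2\Big(-\frac{b}{a}\Big)+2\ln\Big(\frac{b}{a}\Big)\tanh^{-1}\Big(\frac{b}{a}\Big)\bigg\};$$ and, for $a=b$, $$\int_0^\infty xK_0^3(ax)I_0(ax)\,\mathrm{d}x=\frac{\pi^2}{16a^2}.$$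
   Context: $I_\nu$ and $K_\nu$ denote the modified Bessel functions of the first and second kind: $I_\nu(z)=\sum_{k=0}^\infty \frac{1}{k!\,\Gamma(k+\nu+1)}(z/2)^{2k+\nu}$ and, for $\mathrm{Re}\,z>0$, $K_\nu(z)=\int_0^\infty e^{-z\cosh t}\cosh(\nu t)\,\mathrm{d}t$. $\psi(z)=\Gamma'(z)/\Gamma(z)$ is the digamma function, $\gamma=0.57721\ldots$ is the Euler–Mascheroni constant, and $\mathrm{Li}_2(z)=\sum_{k=1}^\infty z^k/k^2$ ($|z|\le 1$) is the dilogarithm. ${}_pF_q\big({a_1,\ldots,a_p\atop b_1,\ldots,b_q}\,\big|\,z\big)=\sum_{k=0}^\infty\frac{(a_1)_k\cdots(a_p)_k}{(b_1)_k\cdots(b_q)_k}\frac{z^k}{k!}$ for $|z|<1$ and by analytic continuation to $\mathbb{C}\setminus[1,\infty)$ (at $z=1$ by the series when convergent), with $(v)_k=v(v+1)\cdots(v+k-1)$. Complex powers and logarithms of $a/b$ are principal and $\tanh^{-1}(z)=\frac12(\ln(1+z)-\ln(1-z))$. When $a/b$ is real and greater than $1$, so that arguments in part 1 and (2a) lie on branch cuts, all functions on the right-hand side are taken as boundary values as $a/b$ is approached from the same side of the real axis (either side). *)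

theory Defs
  imports "HOL-Analysis.Analysis"
begin

(* The power is principal, and rGamma = 1 / Gamma is entire. *)
definition bessel_I :: "complex \<Rightarrow> complex \<Rightarrow> complex" where
  "bessel_I \<nu> z =
     (\<Sum>k. rGamma (of_nat k + \<nu> + 1) / fact k * (z / 2) powr (2 * of_nat k + \<nu>))"

(* Only meaningful for Re z > 0, where the integral converges absolutely. *)
definition bessel_K :: "complex \<Rightarrow> complex \<Rightarrow> complex" where
  "bessel_K \<nu> z =
     integral {0..} (\<lambda>t::real. exp (- z * cosh (of_real t)) * cosh (\<nu> * of_real t))"

(* Only meaningful for norm z <= 1. *)
definition dilog :: "complex \<Rightarrow> complex" where
  "dilog z = (\<Sum>k. z ^ Suc k / of_nat (Suc k) ^ 2)"

(* The library's artanh is Ln ((1 + z) / (1 - z)) / 2, which takes a different value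
   on the cut (1, oo). *)
definition arctanh :: "complex \<Rightarrow> complex" where
  "arctanh z = (Ln (1 + z) - Ln (1 - z)) / 2"

definition hypergeo_series :: "complex list \<Rightarrow> complex list \<Rightarrow> complex \<Rightarrow> complex" where
  "hypergeo_series as bs z = eval_fps (fps_hypergeo as bs 1) z"

definition slit_plane :: "complex set" where
  "slit_plane = - (complex_of_real ` {1..})"

(* The slit plane is connected, so there is at most one such continuation. *)
definition hypergeo_continuation :: "complex list \<Rightarrow> complex list \<Rightarrow> complex \<Rightarrow> complex" where
  "hypergeo_continuation as bs =
     (SOME f. f holomorphic_on slit_plane \<and>
              (\<forall>z. norm z < 1 \<longrightarrow> f z = hypergeo_series as bs z))"

(* Only meaningful on the slit plane and, if the series converges there, at z = 1. *)
definition hypergeo :: "complex list \<Rightarrow> complex list \<Rightarrow> complex \<Rightarrow> complex" where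
  "hypergeo as bs z =
     (if z = 1 then hypergeo_series as bs 1 else hypergeo_continuation as bs z)"

(* For z on the cut (1, oo) this is the boundary value of f at z from the upper (s = 1) or
   the lower (s = -1) half plane; for all other z it is just f z. *)
definition side_value :: "real \<Rightarrow> (complex \<Rightarrow> complex) \<Rightarrow> complex \<Rightarrow> complex" where
  "side_value s f z =
     (if z \<in> complex_of_real ` {1<..} then Lim (at z within {w. 0 < s * Im w}) f else f z)"

end

theory Submission
  imports Defs "HOL-Complex_Analysis.Complex_Analysis"
begin

text \<open>
Fix \<open>b\<close> and write \<open>w = a / b\<close>. For small real \<open>a\<close> the integrals can be computed by expanding
the factor \<open>I K\<close> at \<open>a x\<close> in powers of \<open>x\<close>. For \<open>\<alpha>\<close> not an integer, \<open>K\<close> is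
\<open>\<pi> / (2 sin (\<pi> \<alpha>))\<close> times the difference of \<open>I\<close> at the orders \<open>- \<alpha>\<close> and \<open>\<alpha>\<close>
(\<open>bessel_K_connection\<close>), and products of two functions \<open>I\<close> have explicit power series
(\<open>product_coeff_sums\<close>). So only the moments of the square of \<open>K\<close> at \<open>b x\<close> are needed. They are
quotients of Gamma values (\<open>bessel_K_square_moment\<close>), because \<open>2 K\<^sup>2\<close> is a double integral
of an exponential in which the two variables separate once the integral over \<open>x\<close> is done. The result
(\<open>core_series\<close>) is a difference of two power series in \<open>w\<^sup>2\<close>, the second one multiplied by
\<open>w\<close> to the power \<open>2 \<alpha>\<close>. The coefficients are those of the hypergeometric series of the statement.

Both sides are holomorphic in \<open>a\<close>: the integral on \<open>Re a > 0\<close> (\<open>bessel_integral_holomorphic\<close>),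
and the right-hand side wherever \<open>w\<close> avoids the cuts, because the hypergeometric functions continue
to the plane slit along \<open>[1, \<infinity>)\<close>. The identity therefore extends to all such \<open>a\<close>
(\<open>bessel_integral_continuation\<close>). The integral is even continuous across the ray \<open>w > 1\<close>, so there it
equals the limit of the right-hand side from either side (\<open>bessel_integral_side_value\<close>). That these one-sided
limits exist needs a proof for the hypergeometric functions: they are iterated Euler integrals of
\<open>(1 - z)\<close> to the power \<open>- 1/2\<close>, respectively of \<open>1 / (1 - z)\<close>, and bending the path
of integration away from the cut makes the limit visible (\<open>euler_transform_side_limit\<close>).

At \<open>a = b\<close> one lets \<open>w\<close> tend to 1 inside the unit disc. The 4F3 series converge absolutely on the closed
disc, their coefficients being \<open>O(1/k\<^sup>2)\<close> (\<open>summable_4F3_coefficients\<close>). For the first moment two logarithmic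
singularities cancel (\<open>first_moment_bracket\<close>), and what remains at \<open>w = 1\<close> is the series of a difference of
digamma values.

For \<open>\<alpha> = 0\<close> one takes the limit of the first moment as \<open>\<alpha>\<close> decreases to 0, which gives a dilogarithm
expression on the unit disc (\<open>first_moment_integral_zero_series\<close>). Its derivative is
\<open>2 Ln w / (w\<^sup>2 - 1)\<close>, which is regular at \<open>w = 1\<close> and so has a primitive on the whole plane cut along
the negative axis (\<open>log_quotient_primitive\<close>). This primitive describes the integral for every \<open>w\<close>; its invariance
under \<open>w \<mapsto> 1 / w\<close>, up to sign and a constant, turns the formula for \<open>|w| \<le> 1\<close> into the one
for \<open>|w| \<ge> 1\<close>, and its value at 1 is the case \<open>a = b\<close>.
\<close>

section \<open>Integrals over subsets of the line and the beta integral\<close>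

text \<open>Bochner integrals against this measure are used throughout, because dominated convergence, Fubini and
holomorphic dependence on parameters are available for them; \<open>lborel_on_bridge\<close> leads back to the gauge integral.\<close>

abbreviation lborel_on :: "real set \<Rightarrow> real measure" where
  "lborel_on S \<equiv> restrict_space lborel S"

lemma borel_measurable_lborel_on:
  assumes "continuous_on S f"
  shows "f \<in> borel_measurable (lborel_on S)"
  using borel_measurable_continuous_on_restrict[OF assms]
  by (simp cong: measurable_cong_sets sets_restrict_space_cong)

lemma lborel_on_bridge:
  fixes f :: "real \<Rightarrow> 'a::euclidean_space"
  assumes S: "S \<in> sets borel" and f: "f \<in> borel_measurable (lborel_on S)"
  shows "integrable (lborel_on S) f \<longleftrightarrow> f absolutely_integrable_on S"
    and "integrable (lborel_on S) f \<Longrightarrow> integral\<^sup>L (lborel_on S) f = integral S f"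
    and "integrable (lborel_on S) f \<Longrightarrow> (f has_integral integral\<^sup>L (lborel_on S) f) S"
proof -
  have m: "(\<lambda>x. indicator S x *\<^sub>R f x) \<in> borel_measurable lborel"
    using f S by (subst (asm) borel_measurable_restrict_space_iff) (auto)
  show iff: "integrable (lborel_on S) f \<longleftrightarrow> f absolutely_integrable_on S"
    unfolding set_integrable_def using S m
    by (subst integrable_restrict_space) (auto simp: integrable_completion)
  show eq: "integral\<^sup>L (lborel_on S) f = integral S f" if "integrable (lborel_on S) f"
  proof -
    have "integral\<^sup>L (lborel_on S) f = integral\<^sup>L lborel (\<lambda>x. indicator S x *\<^sub>R f x)"
      using S by (subst integral_restrict_space) auto
    also have "\<dots> = (LINT x:S|lebesgue. f x)"
      unfolding set_lebesgue_integral_def using m by (subst integral_completion) auto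
    also have "\<dots> = integral S f"
      using that iff by (intro set_lebesgue_integral_eq_integral) auto
    finally show ?thesis .
  qed
  show "(f has_integral integral\<^sup>L (lborel_on S) f) S" if "integrable (lborel_on S) f"
    using that eq iff by (metis absolutely_integrable_on_def integrable_integral)
qed

text \<open>Differentiation under the integral sign with only a local bound on the integrand itself: Cauchy's estimate
turns that bound into one for the difference quotients.\<close>

lemma holomorphic_on_parameter_integral:
  fixes f :: "'a \<Rightarrow> complex \<Rightarrow> complex"
  assumes S: "open S"
    and hol: "\<And>x. x \<in> space M \<Longrightarrow> f x holomorphic_on S"
    and meas: "\<And>z. z \<in> S \<Longrightarrow> (\<lambda>x. f x z) \<in> borel_measurable M"
    and dom: "\<And>z. z \<in> S \<Longrightarrow> \<exists>r>0. \<exists>g. integrable M g \<and> ball z r \<subseteq> S \<and>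
                (\<forall>x\<in>space M. \<forall>w\<in>ball z r. norm (f x w) \<le> g x)"
  shows "(\<lambda>z. integral\<^sup>L M (\<lambda>x. f x z)) holomorphic_on S"
proof -
  have "\<exists>D. ((\<lambda>z. integral\<^sup>L M (\<lambda>x. f x z)) has_field_derivative D) (at z0)" if z0: "z0 \<in> S" for z0
  proof -
    obtain r g where r: "r > 0" and g: "integrable M g" and sub: "ball z0 r \<subseteq> S"
      and bd: "\<And>x w. x \<in> space M \<Longrightarrow> w \<in> ball z0 r \<Longrightarrow> norm (f x w) \<le> g x"
      using dom[OF z0] by blast
    have int: "integrable M (\<lambda>x. f x w)" if "w \<in> ball z0 r" for w
      by (rule Bochner_Integration.integrable_bound[OF g meas])
         (use that sub bd in \<open>auto intro!: AE_I2 intro: order_trans[OF _ abs_ge_self]\<close>)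
    have lip: "norm (f x w - f x z0) \<le> 3 * g x / r * norm (w - z0)"
      if x: "x \<in> space M" and w: "w \<in> ball z0 (r/2)" for x w
    proof (rule field_differentiable_bound[of "ball z0 (r/2)" "f x" "deriv (f x)"])
      have hol': "f x holomorphic_on ball z0 r" using hol[OF x] sub holomorphic_on_subset by blast
      show "(f x has_field_derivative deriv (f x) u) (at u within ball z0 (r/2))"
        if "u \<in> ball z0 (r/2)" for u
        using that r by (intro has_field_derivative_at_within[OF holomorphic_derivI[OF hol']]) auto
      show "norm (deriv (f x) u) \<le> 3 * g x / r" if u: "u \<in> ball z0 (r/2)" for u
      proof -
        have c: "cball u (r/3) \<subseteq> ball z0 r"
        proof
          fix y assume "y \<in> cball u (r/3)"
          moreover have "dist z0 y \<le> dist z0 u + dist u y" by (rule dist_triangle)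
          ultimately show "y \<in> ball z0 r" using u r by simp
        qed
        have "norm ((deriv ^^ 1) (f x) u) \<le> fact 1 * g x / (r/3) ^ 1"
        proof (rule Cauchy_inequality)
          show "f x holomorphic_on ball u (r/3)" "continuous_on (cball u (r/3)) (f x)"
            using holomorphic_on_subset[OF hol' c] holomorphic_on_subset[OF hol', of "ball u (r/3)"] c
              ball_subset_cball[of u "r/3"] holomorphic_on_imp_continuous_on by blast+
          show "norm (f x y) \<le> g x" if "norm (u - y) = r/3" for y
            using c that x by (intro bd) (auto simp: dist_norm subset_iff)
        qed (use r in auto)
        thus ?thesis by (simp add: mult.commute)
      qed
    qed (use w r in auto)
    define D where "D = integral\<^sup>L M (\<lambda>x. deriv (f x) z0)"
    have "((\<lambda>w. (integral\<^sup>L M (\<lambda>x. f x w) - integral\<^sup>L M (\<lambda>x. f x z0)) / (w - z0)) \<longlongrightarrow> D) (at z0)"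
      unfolding tendsto_at_iff_sequentially comp_def
    proof (intro allI impI)
      fix X :: "nat \<Rightarrow> complex" assume X: "\<forall>i. X i \<in> UNIV - {z0}" "X \<longlonglongrightarrow> z0"
      have "eventually (\<lambda>i. X i \<in> ball z0 (r/2)) sequentially"
        using X(2) r by (intro topological_tendstoD) auto
      then obtain N where N: "\<And>i. i \<ge> N \<Longrightarrow> X i \<in> ball z0 (r/2)"
        unfolding eventually_sequentially by blast
      define Y where "Y = (\<lambda>i. X (i + N))"
      have Y: "Y i \<in> ball z0 (r/2)" "Y i \<noteq> z0" for i using N[of "i+N"] X(1) by (auto simp: Y_def)
      have Yr: "Y i \<in> ball z0 r" for i using Y(1)[of i] r by auto
      have Ylim: "Y \<longlonglongrightarrow> z0" unfolding Y_def using X(2) by (rule LIMSEQ_ignore_initial_segment)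
      have pt: "(\<lambda>i. (f x (Y i) - f x z0) / (Y i - z0)) \<longlonglongrightarrow> deriv (f x) z0" if x: "x \<in> space M" for x
      proof -
        have "(f x has_field_derivative deriv (f x) z0) (at z0)"
          using hol[OF x] S z0 by (rule holomorphic_derivI)
        hence "((\<lambda>w. (f x w - f x z0) / (w - z0)) \<longlongrightarrow> deriv (f x) z0) (at z0)"
          unfolding has_field_derivative_iff .
        moreover have "filterlim Y (at z0) sequentially"
          using Ylim Y(2) by (intro filterlim_atI) auto
        ultimately show ?thesis by (rule filterlim_compose)
      qed
      have m1: "(\<lambda>x. (f x (Y i) - f x z0) / (Y i - z0)) \<in> borel_measurable M" for i
      proof -
        have "Y i \<in> S" using sub Yr by blast
        thus ?thesis using meas[of z0] meas[of "Y i"] z0 by measurable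
      qed
      have m2: "(\<lambda>x. deriv (f x) z0) \<in> borel_measurable M"
        by (rule borel_measurable_LIMSEQ_metric[OF m1 pt])
      have "(\<lambda>i. integral\<^sup>L M (\<lambda>x. (f x (Y i) - f x z0) / (Y i - z0))) \<longlonglongrightarrow> D"
        unfolding D_def
      proof (rule integral_dominated_convergence[OF m2 m1])
        show "integrable M (\<lambda>x. 3 * g x / r)" using g by auto
        show "AE x in M. norm ((f x (Y i) - f x z0) / (Y i - z0)) \<le> 3 * g x / r" for i
          using lip Y by (intro AE_I2) (simp add: norm_divide divide_le_eq)
      qed (use pt in auto)
      also have "(\<lambda>i. integral\<^sup>L M (\<lambda>x. (f x (Y i) - f x z0) / (Y i - z0))) =
                 (\<lambda>i. (integral\<^sup>L M (\<lambda>x. f x (Y i)) - integral\<^sup>L M (\<lambda>x. f x z0)) / (Y i - z0))"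
        using int Yr r by (subst integral_divide_zero, subst Bochner_Integration.integral_diff) auto
      finally show "(\<lambda>i. (integral\<^sup>L M (\<lambda>x. f x (X i)) - integral\<^sup>L M (\<lambda>x. f x z0)) / (X i - z0)) \<longlonglongrightarrow> D"
        unfolding Y_def by (rule LIMSEQ_offset)
    qed
    hence "((\<lambda>z. integral\<^sup>L M (\<lambda>x. f x z)) has_field_derivative D) (at z0)"
      unfolding has_field_derivative_iff .
    thus ?thesis by blast
  qed
  thus ?thesis unfolding holomorphic_on_open[OF S] by blast
qed

lemma of_real_powr_exp:
  assumes "x > 0"
  shows "complex_of_real x powr p = exp (p * of_real (ln x))"
  using assms by (simp add: powr_def Ln_of_real)

lemma norm_of_real_powr:
  assumes "x \<ge> 0"
  shows "norm (complex_of_real x powr p) = x powr Re p"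
  using assms by (cases "x = 0") (auto simp: norm_powr_real_powr)

lemma powr_le_powr_of_le_1:
  fixes t :: real
  assumes "0 < t" "t \<le> 1" "a \<le> b"
  shows "t powr b \<le> t powr a"
  using assms by (simp add: powr_mono')

definition beta_kernel :: "complex \<Rightarrow> complex \<Rightarrow> real \<Rightarrow> complex" where
  "beta_kernel p q t = of_real t powr (p - 1) * of_real (1 - t) powr (q - 1)"

lemma norm_beta_kernel:
  assumes "t \<in> {0<..<1}"
  shows "norm (beta_kernel p q t) = t powr (Re p - 1) * (1 - t) powr (Re q - 1)"
  using assms norm_of_real_powr[of t "p - 1"] norm_of_real_powr[of "1 - t" "q - 1"]
  by (simp add: beta_kernel_def norm_mult)

lemma continuous_on_beta_kernel: "continuous_on {0<..<1} (beta_kernel p q)"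
  unfolding beta_kernel_def
  by (intro continuous_intros) (auto simp: complex_nonpos_Reals_iff)

lemma beta_kernel_measurable [measurable]:
  "beta_kernel p q \<in> borel_measurable (lborel_on {0<..<1})"
  by (intro borel_measurable_lborel_on continuous_on_beta_kernel)

lemma integrable_real_beta:
  assumes "a > 0" "b > (0::real)"
  shows "integrable (lborel_on {0<..<1}) (\<lambda>t. t powr (a - 1) * (1 - t) powr (b - 1))"
proof -
  have "set_integrable lborel {0<..<1} (\<lambda>t. t powr (a - 1) * (1 - t) powr (b - 1))"
    by (rule set_integrable_subset[OF integrable_Beta[OF assms]]) auto
  thus ?thesis unfolding set_integrable_def by (subst integrable_restrict_space) auto
qed

lemma integrable_norm_beta_kernel:
  assumes "Re p > 0" "Re q > 0"
  shows "integrable (lborel_on {0<..<1}) (\<lambda>t. norm (beta_kernel p q t))"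
proof -
  have "integrable (lborel_on {0<..<1}) (\<lambda>t. norm (beta_kernel p q t)) \<longleftrightarrow>
        integrable (lborel_on {0<..<1}) (\<lambda>t. t powr (Re p - 1) * (1 - t) powr (Re q - 1))"
    by (rule Bochner_Integration.integrable_cong) (auto simp: norm_beta_kernel space_restrict_space)
  thus ?thesis using integrable_real_beta[OF assms] by simp
qed

lemma integrable_beta_kernel:
  assumes "Re p > 0" "Re q > 0"
  shows "integrable (lborel_on {0<..<1}) (beta_kernel p q)"
  using integrable_norm_beta_kernel[OF assms] by (simp add: integrable_norm_iff)

lemma beta_kernel_mono:
  assumes "t \<in> {0<..<1}" "Re p \<le> Re p'" "Re q \<le> Re q'"
  shows "norm (beta_kernel p' q' t) \<le> norm (beta_kernel p q t)"
  using assms by (auto simp: norm_beta_kernel intro!: mult_mono powr_le_powr_of_le_1)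

text \<open>This carries the beta integral from real to complex parameters in \<open>beta_integral\<close>.\<close>

lemma beta_integral_holomorphic:
  shows "Re q > 0 \<Longrightarrow> (\<lambda>p. integral\<^sup>L (lborel_on {0<..<1}) (\<lambda>t. beta_kernel p q t)) holomorphic_on {p. Re p > 0}"
    and "Re p > 0 \<Longrightarrow> (\<lambda>q. integral\<^sup>L (lborel_on {0<..<1}) (\<lambda>t. beta_kernel p q t)) holomorphic_on {p. Re p > 0}"
proof -
  have b: "Re z / 2 \<le> Re w" "0 < Re w" if "w \<in> ball z (Re z / 2)" "Re z > 0" for z w
    using that abs_Re_le_cmod[of "z - w"] by (auto simp: dist_norm abs_le_iff)
  show "(\<lambda>p. integral\<^sup>L (lborel_on {0<..<1}) (\<lambda>t. beta_kernel p q t)) holomorphic_on {p. Re p > 0}"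
    if q: "Re q > 0"
  proof (rule holomorphic_on_parameter_integral[where f = "\<lambda>t p. beta_kernel p q t"])
    fix z assume z: "z \<in> {p. Re p > 0}"
    show "\<exists>r>0. \<exists>g. integrable (lborel_on {0<..<1}) g \<and> ball z r \<subseteq> {p. Re p > 0} \<and>
            (\<forall>x\<in>space (lborel_on {0<..<1}). \<forall>w\<in>ball z r. norm (beta_kernel w q x) \<le> g x)"
      using z q b
      by (intro exI[of _ "Re z / 2"] exI[of _ "\<lambda>t. norm (beta_kernel (of_real (Re z / 2)) q t)"] conjI
            integrable_norm_beta_kernel ballI beta_kernel_mono)
         (auto simp: space_restrict_space)
  next
    show "(\<lambda>p. beta_kernel p q x) holomorphic_on {p. Re p > 0}"
      if "x \<in> space (lborel_on {0<..<1})" for x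
      using that unfolding beta_kernel_def
      by (auto simp: space_restrict_space intro!: holomorphic_intros)
  qed (auto simp: open_halfspace_Re_gt)
  show "(\<lambda>q. integral\<^sup>L (lborel_on {0<..<1}) (\<lambda>t. beta_kernel p q t)) holomorphic_on {p. Re p > 0}"
    if p: "Re p > 0"
  proof (rule holomorphic_on_parameter_integral[where f = "\<lambda>t q. beta_kernel p q t"])
    fix z assume z: "z \<in> {p. Re p > 0}"
    show "\<exists>r>0. \<exists>g. integrable (lborel_on {0<..<1}) g \<and> ball z r \<subseteq> {p. Re p > 0} \<and>
            (\<forall>x\<in>space (lborel_on {0<..<1}). \<forall>w\<in>ball z r. norm (beta_kernel p w x) \<le> g x)"
      using z p b
      by (intro exI[of _ "Re z / 2"] exI[of _ "\<lambda>t. norm (beta_kernel p (of_real (Re z / 2)) t)"] conjI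
            integrable_norm_beta_kernel ballI beta_kernel_mono)
         (auto simp: space_restrict_space)
  next
    show "(\<lambda>q. beta_kernel p q x) holomorphic_on {p. Re p > 0}"
      if "x \<in> space (lborel_on {0<..<1})" for x
      using that unfolding beta_kernel_def
      by (auto simp: space_restrict_space intro!: holomorphic_intros)
  qed (auto simp: open_halfspace_Re_gt)
qed

lemma holomorphic_eq_of_eq_on_reals:
  assumes hol: "f holomorphic_on S" "g holomorphic_on S" and S: "open S" "connected S"
    and ab: "a < b" "\<And>x. a < x \<Longrightarrow> x < b \<Longrightarrow> of_real x \<in> S"
    and eq: "\<And>x::real. a < x \<Longrightarrow> x < b \<Longrightarrow> f (of_real x) = g (of_real x)"
    and z: "z \<in> S"
  shows "f z = g z"
proof -
  define m where "m = (a + b) / 2"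
  have m: "a < m" "m < b" using ab by (auto simp: m_def)
  have "f z - g z = 0"
  proof (rule analytic_continuation[of "\<lambda>z. f z - g z" S "of_real ` {a<..<b}" "of_real m"])
    have "m islimpt {a<..<b}" using m by (intro interior_limit_point) (simp add: interior_open)
    hence "complex_of_real m islimpt complex_of_real ` {a<..<b}"
      unfolding islimpt_approachable
      by (metis (no_types, lifting) dist_of_real image_eqI of_real_eq_iff)
    thus "complex_of_real m islimpt complex_of_real ` {a<..<b}" .
  qed (use assms m in \<open>auto intro: holomorphic_intros\<close>)
  thus ?thesis by simp
qed

text \<open>For positive real parameters this is the real beta integral; both sides are holomorphic in each parameter
separately, so the identity extends one variable at a time.\<close>

lemma beta_integral:
  assumes "Re p > 0" "Re q > 0"
  shows "integral\<^sup>L (lborel_on {0<..<1}) (beta_kernel p q) = Beta p q"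
proof -
  let ?I = "\<lambda>p q. integral\<^sup>L (lborel_on {0<..<1}) (\<lambda>t. beta_kernel p q t)"
  have half: "open {p. Re p > 0}" "connected {p. Re p > 0}"
    by (auto simp: open_halfspace_Re_gt convex_halfspace_Re_gt intro: convex_connected)
  have nn: "z \<notin> \<int>\<^sub>\<le>\<^sub>0" if "Re z > 0" for z using that by (auto elim!: nonpos_Ints_cases)
  have real: "?I (of_real x) (of_real y) = Beta (of_real x) (of_real y)" if "x > 0" "y > 0" for x y
  proof -
    have "((\<lambda>t. t powr (x - 1) * (1 - t) powr (y - 1)) has_integral Beta x y) {0<..<1}"
      using has_integral_Beta_real[OF that] by (simp add: has_integral_Icc_iff_Ioo)
    moreover have "((\<lambda>t. t powr (x - 1) * (1 - t) powr (y - 1)) has_integral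
         integral\<^sup>L (lborel_on {0<..<1}) (\<lambda>t. t powr (x - 1) * (1 - t) powr (y - 1))) {0<..<1}"
      using integrable_real_beta[OF that] by (intro lborel_on_bridge(3)) (auto dest: borel_measurable_integrable)
    ultimately have "integral\<^sup>L (lborel_on {0<..<1}) (\<lambda>t. t powr (x - 1) * (1 - t) powr (y - 1)) = Beta x y"
      by (rule has_integral_unique[symmetric])
    moreover have "?I (of_real x) (of_real y) =
        integral\<^sup>L (lborel_on {0<..<1}) (\<lambda>t. of_real (t powr (x - 1) * (1 - t) powr (y - 1)))"
    proof (rule Bochner_Integration.integral_cong[OF refl])
      fix t assume "t \<in> space (lborel_on {0<..<1})"
      hence t: "0 < t" "t < 1" by (auto simp: space_restrict_space)
      have "of_real x - 1 = complex_of_real (x - 1)" "of_real y - 1 = complex_of_real (y - 1)" by auto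
      thus "beta_kernel (of_real x) (of_real y) t = of_real (t powr (x - 1) * (1 - t) powr (y - 1))"
        using t by (simp only: beta_kernel_def powr_of_real of_real_mult)
    qed
    ultimately have "?I (of_real x) (of_real y) = of_real (Beta x y)"
      by (simp only: integral_complex_of_real)
    thus ?thesis
      by (simp add: Beta_def Gamma_complex_of_real flip: of_real_add)
  qed
  have one: "?I p (of_real y) = Beta p (of_real y)" if "Re p > 0" "y > 0" for p y
    by (rule holomorphic_eq_of_eq_on_reals[OF beta_integral_holomorphic(1) _ half, of _ _ 0 1])
       (use that real in \<open>auto simp: Beta_def Gamma_eq_zero_iff nn intro!: holomorphic_intros nn\<close>)
  show ?thesis
    by (rule holomorphic_eq_of_eq_on_reals[OF beta_integral_holomorphic(2) _ half, of _ _ 0 1])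
       (use assms one in \<open>auto simp: Beta_def Gamma_eq_zero_iff nn intro!: holomorphic_intros nn\<close>)
qed

text \<open>Multiplying a power series coefficientwise by beta values is integration against the beta kernel. This is the
source both of the Euler integrals and of the Poisson integral for \<open>I\<close>.\<close>

lemma beta_integral_power_series:
  fixes c :: "nat \<Rightarrow> complex"
  assumes p: "Re p > 0" and q: "Re q > 0" and c: "summable (\<lambda>k. norm (c k))"
  shows "integrable (lborel_on {0<..<1}) (\<lambda>t. beta_kernel p q t * (\<Sum>k. c k * of_real t ^ k))"
    and "(\<lambda>k. c k * Beta (p + of_nat k) q) sums
           integral\<^sup>L (lborel_on {0<..<1}) (\<lambda>t. beta_kernel p q t * (\<Sum>k. c k * of_real t ^ k))"
proof -
  let ?M = "lborel_on {0<..<1::real}"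
  define s where "s = (\<lambda>n t. \<Sum>k<n. c k * beta_kernel (p + of_nat k) q t)"
  define f where "f = (\<lambda>t. beta_kernel p q t * (\<Sum>k. c k * of_real t ^ k))"
  define w where "w = (\<lambda>t. norm (beta_kernel p q t) * (\<Sum>k. norm (c k)))"
  have s_eq: "s n t = beta_kernel p q t * (\<Sum>k<n. c k * of_real t ^ k)" if "t \<in> {0<..<1}" for n t
  proof -
    have "beta_kernel (p + of_nat k) q t = beta_kernel p q t * of_real t ^ k" for k
    proof -
      have "p + of_nat k - 1 = (p - 1) + of_nat k" by simp
      moreover have "complex_of_real t powr ((p - 1) + of_nat k) = of_real t powr (p - 1) * of_real t ^ k"
        using that by (subst powr_add) (simp add: powr_nat')
      ultimately show ?thesis by (simp only: beta_kernel_def mult_ac)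
    qed
    thus ?thesis by (simp add: s_def sum_distrib_left mult_ac)
  qed
  have le: "norm (c k * of_real t ^ k) \<le> norm (c k)" if "t \<in> {0<..<1}" for k t
    using that by (auto simp: norm_mult norm_power intro!: mult_left_le power_le_one)
  have sm: "summable (\<lambda>k. c k * of_real t ^ k)" "summable (\<lambda>k. norm (c k * of_real t ^ k))" if "t \<in> {0<..<1}" for t
    by (rule summable_comparison_test[OF _ c]; use le that in auto)+
  have lim: "(\<lambda>n. s n t) \<longlonglongrightarrow> f t" if "t \<in> {0<..<1}" for t
    unfolding s_eq[OF that] f_def by (intro tendsto_intros summable_LIMSEQ sm that)
  have bd: "norm (s n t) \<le> w t" if "t \<in> {0<..<1}" for n t
  proof -
    have "norm (\<Sum>k<n. c k * of_real t ^ k) \<le> (\<Sum>k<n. norm (c k))"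
      using le[OF that] by (intro sum_norm_le) auto
    also have "\<dots> \<le> (\<Sum>k. norm (c k))" by (intro sum_le_suminf c) auto
    finally show ?thesis unfolding s_eq[OF that] w_def norm_mult by (intro mult_left_mono) auto
  qed
  have sp: "space ?M = {0<..<1}" by (auto simp: space_restrict_space)
  have ms [measurable]: "s n \<in> borel_measurable ?M" for n unfolding s_def by measurable
  have mf: "f \<in> borel_measurable ?M"
    by (rule borel_measurable_LIMSEQ_metric[where f = s, OF ms]) (use lim sp in auto)
  have wi: "integrable ?M w" unfolding w_def using integrable_norm_beta_kernel[OF p q] by auto
  have AE1: "AE t in ?M. (\<lambda>n. s n t) \<longlonglongrightarrow> f t"
    by (rule AE_I2) (use lim sp in auto)
  have AE2: "AE t in ?M. norm (s n t) \<le> w t" for n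
    by (rule AE_I2) (use bd sp in auto)
  show "integrable ?M (\<lambda>t. beta_kernel p q t * (\<Sum>k. c k * of_real t ^ k))"
    using integrable_dominated_convergence[OF mf ms wi AE1 AE2] by (simp add: f_def)
  have "(\<lambda>n. integral\<^sup>L ?M (s n)) \<longlonglongrightarrow> integral\<^sup>L ?M f"
    by (rule integral_dominated_convergence[OF mf ms wi AE1 AE2])
  moreover have "integral\<^sup>L ?M (s n) = (\<Sum>k<n. c k * Beta (p + of_nat k) q)" for n
    unfolding s_def using p q
    by (subst Bochner_Integration.integral_sum)
       (auto simp: beta_integral intro!: integrable_beta_kernel)
  ultimately show "(\<lambda>k. c k * Beta (p + of_nat k) q) sums
      integral\<^sup>L ?M (\<lambda>t. beta_kernel p q t * (\<Sum>k. c k * of_real t ^ k))"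
    by (simp add: sums_def f_def)
qed

section \<open>Hypergeometric functions on the slit plane and their boundary values\<close>

lemma slit_plane_iff: "z \<in> slit_plane \<longleftrightarrow> Im z \<noteq> 0 \<or> Re z < 1"
proof -
  have "z \<in> complex_of_real ` {1..} \<longleftrightarrow> Im z = 0 \<and> Re z \<ge> 1"
    by (auto simp: complex_eq_iff image_iff intro!: bexI[of _ "Re z"])
  thus ?thesis by (auto simp: slit_plane_def)
qed

lemma slit_plane_scale:
  assumes "z \<in> slit_plane" "0 \<le> t" "t \<le> 1"
  shows "of_real t * z \<in> slit_plane"
proof (cases "Im z = 0")
  case True
  hence "t * Re z < 1"
    using assms mult_left_le_one_le[of "Re z" t] mult_nonneg_nonpos[of t "Re z"]
    by (cases "Re z \<ge> 0") (auto simp: slit_plane_iff)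
  thus ?thesis by (simp add: slit_plane_iff)
next
  case False
  thus ?thesis using assms by (cases "t = 0") (auto simp: slit_plane_iff)
qed

lemma open_slit_plane: "open slit_plane"
proof -
  have "slit_plane = {z. Im z \<noteq> 0} \<union> {z. Re z < 1}" by (auto simp: slit_plane_iff)
  moreover have "open {z. Im z \<noteq> 0}" by (intro open_Collect_neq continuous_intros)
  ultimately show ?thesis using open_halfspace_Re_lt[of 1] by (metis open_Un)
qed

lemma connected_slit_plane: "connected slit_plane"
proof (rule starlike_imp_connected)
  have "closed_segment 0 x \<subseteq> slit_plane" if "x \<in> slit_plane" for x
    using that by (auto simp: closed_segment_def scaleR_conv_of_real intro!: slit_plane_scale)
  thus "starlike slit_plane"
    unfolding starlike_def by (intro bexI[of _ 0] ballI) (auto simp: slit_plane_iff[of 0])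
qed

lemma ball_subset_slit_plane: "norm z < 1 \<Longrightarrow> z \<in> slit_plane"
  unfolding slit_plane_iff using complex_Re_le_cmod[of z] by linarith

text \<open>The condition under which an Euler integral inherits one-sided limits on the cut from its integrand: the values
on the segment from 0 to \<open>z\<close> stay bounded as \<open>z\<close> approaches the cut from one side.\<close>

definition cut_bounded :: "(complex \<Rightarrow> complex) \<Rightarrow> bool" where
  "cut_bounded f \<longleftrightarrow> f holomorphic_on slit_plane \<and>
     (\<forall>s\<in>{1, - 1 :: real}. \<forall>r>1. \<exists>B. \<exists>d>0. \<forall>z\<in>ball (complex_of_real r) d. s * Im z > 0 \<longrightarrow> norm (f z) \<le> B)"

text \<open>Euler's integral, without its normalising beta factor. It raises a \<open>pFq\<close> to a \<open>(p+1)F(q+1)\<close>.\<close>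

definition euler_transform :: "complex \<Rightarrow> complex \<Rightarrow> (complex \<Rightarrow> complex) \<Rightarrow> complex \<Rightarrow> complex" where
  "euler_transform p q f z = integral\<^sup>L (lborel_on {0<..<1}) (\<lambda>t. beta_kernel p q t * f (of_real t * z))"

lemma bounded_on_compact_image:
  fixes f :: "complex \<Rightarrow> complex"
  assumes "continuous_on S f" "compact K" "continuous_on K g" "g ` K \<subseteq> S"
  shows "\<exists>B\<ge>0. \<forall>x\<in>K. norm (f (g x)) \<le> B"
proof -
  have "compact ((\<lambda>x. f (g x)) ` K)"
    by (rule compact_continuous_image[OF continuous_on_compose2[OF assms(1,3,4)] assms(2)])
  hence "bounded ((\<lambda>x. f (g x)) ` K)" by (rule compact_imp_bounded)
  then obtain B where B: "\<forall>x\<in>K. norm (f (g x)) \<le> B" unfolding bounded_iff by auto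
  show ?thesis using B by (intro exI[of _ "max 0 B"]) (auto simp: le_max_iff_disj)
qed

lemma space_lborel_on [simp]: "space (lborel_on S) = S"
  by (subst space_restrict_space) simp

lemma euler_transform_holomorphic:
  assumes p: "Re p > 0" and q: "Re q > 0" and f: "f holomorphic_on slit_plane"
  shows "euler_transform p q f holomorphic_on slit_plane"
proof -
  note fc = holomorphic_on_imp_continuous_on[OF f]
  have h1: "(\<lambda>z. beta_kernel p q t * f (of_real t * z)) holomorphic_on slit_plane"
    if "t \<in> space (lborel_on {0<..<1})" for t
    using that slit_plane_scale
    by (intro holomorphic_intros holomorphic_on_compose_gen[OF _ f, unfolded o_def]) auto
  have h2: "(\<lambda>t. beta_kernel p q t * f (of_real t * z)) \<in> borel_measurable (lborel_on {0<..<1})"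
    if "z \<in> slit_plane" for z
    using that slit_plane_scale
    by (intro borel_measurable_lborel_on continuous_intros continuous_on_beta_kernel
          continuous_on_compose2[OF fc]) auto
  have h3: "\<exists>r>0. \<exists>g. integrable (lborel_on {0<..<1}) g \<and> ball z r \<subseteq> slit_plane \<and>
          (\<forall>t\<in>space (lborel_on {0<..<1}). \<forall>w\<in>ball z r. norm (beta_kernel p q t * f (of_real t * w)) \<le> g t)"
    if z: "z \<in> slit_plane" for z
  proof -
    obtain r where r: "r > 0" "cball z r \<subseteq> slit_plane"
      using open_slit_plane z open_contains_cball by blast
    have "\<exists>B\<ge>0. \<forall>x\<in>{0..1} \<times> cball z r. norm (f ((\<lambda>(t,w). of_real t * w) x)) \<le> B"
      using r slit_plane_scale
      by (intro bounded_on_compact_image[OF fc] compact_Times)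
         (auto simp: case_prod_unfold intro!: continuous_intros)
    then obtain B where B: "B \<ge> 0" "\<And>t w. t \<in> {0..1} \<Longrightarrow> w \<in> cball z r \<Longrightarrow> norm (f (of_real t * w)) \<le> B"
      by auto
    show ?thesis
    proof (intro exI[of _ r] exI[of _ "\<lambda>t. norm (beta_kernel p q t) * B"] conjI ballI)
      show "integrable (lborel_on {0<..<1}) (\<lambda>t. norm (beta_kernel p q t) * B)"
        using integrable_norm_beta_kernel[OF p q] by auto
    qed (use r B in \<open>auto simp: norm_mult subset_iff intro!: mult_left_mono\<close>)
  qed
  have "(\<lambda>z. integral\<^sup>L (lborel_on {0<..<1}) (\<lambda>t. beta_kernel p q t * f (of_real t * z))) holomorphic_on slit_plane"
  proof (rule holomorphic_on_parameter_integral[OF open_slit_plane], goal_cases)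
    case (1 t) thus ?case by (rule h1)
  next
    case (2 z) thus ?case by (rule h2)
  next
    case (3 z) thus ?case by (rule h3)
  qed
  thus ?thesis unfolding euler_transform_def .
qed

lemma euler_transform_sums:
  assumes p: "Re p > 0" and q: "Re q > 0" and z: "norm z < 1"
    and c: "summable (\<lambda>k. norm (c k * z ^ k))"
    and f: "\<And>w. norm w < 1 \<Longrightarrow> f w = (\<Sum>k. c k * w ^ k)"
  shows "(\<lambda>k. c k * Beta (p + of_nat k) q * z ^ k) sums euler_transform p q f z"
proof -
  let ?I = "integral\<^sup>L (lborel_on {0<..<1}) (\<lambda>t. beta_kernel p q t * (\<Sum>k. (c k * z ^ k) * of_real t ^ k))"
  have sums: "(\<lambda>k. (c k * z ^ k) * Beta (p + of_nat k) q) sums ?I"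
    using beta_integral_power_series(2)[where c = "\<lambda>k. c k * z ^ k", OF p q c] .
  have I: "?I = euler_transform p q f z"
    unfolding euler_transform_def
  proof (rule Bochner_Integration.integral_cong[OF refl])
    fix t assume "t \<in> space (lborel_on {0<..<1})"
    hence "t * norm z \<le> norm z" "0 < t" by (auto intro: mult_left_le_one_le)
    hence n: "norm (of_real t * z) < 1" using z by (simp add: norm_mult)
    show "beta_kernel p q t * (\<Sum>k. (c k * z ^ k) * of_real t ^ k) = beta_kernel p q t * f (of_real t * z)"
      unfolding f[OF n] power_mult_distrib by (simp add: mult_ac)
  qed
  have "(\<lambda>k. (c k * z ^ k) * Beta (p + of_nat k) q) = (\<lambda>k. c k * Beta (p + of_nat k) q * z ^ k)"
    by (simp add: mult_ac)
  thus ?thesis using sums unfolding I by (simp only:)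
qed

text \<open>The substitution \<open>t = u / (u + c (1 - u))\<close>, a Moebius map of \<open>(0, 1)\<close> onto itself for real \<open>c > 0\<close>.
For non-real \<open>c\<close> the same map traces a circular arc from 0 to 1.\<close>

lemma euler_transform_substitution_real:
  assumes p: "Re p > 0" and q: "Re q > 0" and c: "c > 0"
    and f: "continuous_on slit_plane f" and z: "z \<in> slit_plane"
  shows "euler_transform p q f z = integral\<^sup>L (lborel_on {0<..<1})
     (\<lambda>u. of_real c powr q * beta_kernel p q u * of_real (u + c * (1 - u)) powr (- p - q) *
           f (of_real (u / (u + c * (1 - u))) * z))"
proof -
  let ?S = "{0<..<1::real}"
  define g where "g u = u / (u + c * (1 - u))" for u
  define h where "h u = c / (u + c * (1 - u))\<^sup>2" for u
  define F where "F t = beta_kernel p q t * f (of_real t * z)" for t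
  define G where "G u = of_real c powr q * beta_kernel p q u * of_real (u + c * (1 - u)) powr (- p - q) *
           f (of_real (g u) * z)" for u
  have D: "u + c * (1 - u) > 0" if "u \<in> ?S" for u
    using that c by (intro add_pos_pos mult_pos_pos) auto
  have gS: "g u \<in> ?S" if "u \<in> ?S" for u using that D[OF that] c by (auto simp: g_def divide_less_eq)
  have gd: "(g has_field_derivative h u) (at u within ?S)" if "u \<in> ?S" for u
    unfolding g_def h_def using D[OF that]
    by (auto intro!: derivative_eq_intros simp: divide_simps power2_eq_square) (simp add: algebra_simps)
  have inj: "inj_on g ?S"
  proof (rule inj_onI)
    fix x y assume xy: "x \<in> ?S" "y \<in> ?S" "g x = g y"
    hence "x * (y + c * (1 - y)) = y * (x + c * (1 - x))"
      using D[of x] D[of y] by (simp add: g_def field_simps)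
    hence "c * (x - y) = 0" by (simp add: algebra_simps)
    thus "x = y" using c by simp
  qed
  have img: "g ` ?S = ?S"
  proof
    show "g ` ?S \<subseteq> ?S" using gS by blast
    show "?S \<subseteq> g ` ?S"
    proof
      fix t assume t: "t \<in> ?S"
      define u where "u = c * t / (1 - t + c * t)"
      have pos: "1 - t + c * t > 0" using t c by (intro add_pos_pos mult_pos_pos) auto
      have "u \<in> ?S" using t c pos by (auto simp: u_def divide_less_eq)
      moreover have "g u = t"
      proof -
        have "1 - u = (1 - t) / (1 - t + c * t)" using pos by (simp add: u_def field_simps)
        hence "u + c * (1 - u) = (c * t + c * (1 - t)) / (1 - t + c * t)"
          by (simp add: u_def add_divide_distrib)
        hence "u + c * (1 - u) = c / (1 - t + c * t)" by (simp add: algebra_simps)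
        thus ?thesis using c pos by (simp add: g_def u_def)
      qed
      ultimately show "t \<in> g ` ?S" by force
    qed
  qed
  have Feq: "\<bar>h u\<bar> *\<^sub>R F (g u) = G u" if u: "u \<in> ?S" for u
  proof -
    define d where "d = u + c * (1 - u)"
    have d: "d > 0" and u': "u > 0" "1 - u > 0" using D[OF u] u by (auto simp: d_def)
    have gu: "g u = u / d" by (simp add: g_def d_def)
    have "1 - g u = (d - u) / d" unfolding gu using d by (simp add: diff_divide_distrib)
    hence g1: "1 - g u = c * (1 - u) / d" by (simp add: d_def)
    have hu: "\<bar>h u\<bar> = c / d\<^sup>2" using c by (simp add: h_def d_def)
    have e: "complex_of_real (c / d\<^sup>2) = exp (of_real (ln c - 2 * ln d))"
      unfolding exp_of_real using c d by (simp add: exp_diff exp_double)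
    have gp: "g u > 0" "1 - g u > 0" using gS[OF u] by auto
    have lg: "ln (g u) = ln u - ln d" "ln (1 - g u) = ln c + ln (1 - u) - ln d"
      unfolding gu g1[unfolded gu] using u' c d by (simp_all add: ln_div ln_mult)
    have "of_real (c / d\<^sup>2) * beta_kernel p q (g u) =
          exp (of_real (ln c - 2 * ln d) + ((p - 1) * of_real (ln u - ln d) + (q - 1) * of_real (ln c + ln (1 - u) - ln d)))"
      unfolding beta_kernel_def e of_real_powr_exp[OF gp(1)] of_real_powr_exp[OF gp(2)] lg by (simp only: exp_add)
    also have "\<dots> = exp (q * of_real (ln c) + ((p - 1) * of_real (ln u) + (q - 1) * of_real (ln (1 - u))) + (- p - q) * of_real (ln d))"
      by (rule arg_cong[where f = exp]) (simp add: algebra_simps)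
    also have "\<dots> = of_real c powr q * beta_kernel p q u * of_real d powr (- p - q)"
      unfolding beta_kernel_def of_real_powr_exp[OF c] of_real_powr_exp[OF u'(1)] of_real_powr_exp[OF u'(2)]
        of_real_powr_exp[OF d(1)] by (simp only: exp_add)
    finally have "of_real (c / d\<^sup>2) * beta_kernel p q (g u) =
          of_real c powr q * beta_kernel p q u * of_real d powr (- p - q)" .
    from arg_cong[where f = "\<lambda>x. x * f (of_real (g u) * z)", OF this] show ?thesis
      unfolding F_def G_def scaleR_conv_of_real hu d_def[symmetric] by (simp only: mult.assoc)
  qed
  have cg: "continuous_on ?S g" unfolding g_def using D by (intro continuous_intros) force
  have mF: "F \<in> borel_measurable (lborel_on ?S)" unfolding F_def
    using z slit_plane_scale
    by (intro borel_measurable_lborel_on continuous_intros continuous_on_beta_kernel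
          continuous_on_compose2[OF f]) auto
  have Dn: "complex_of_real (u + c * (1 - u)) \<notin> \<real>\<^sub>\<le>\<^sub>0" if "u \<in> ?S" for u
    using D[OF that] by (subst complex_nonpos_Reals_iff) simp
  have cf: "continuous_on ?S (\<lambda>u. f (of_real (g u) * z))"
    using z gS by (intro continuous_on_compose2[OF f] continuous_intros cg) (force intro: slit_plane_scale)
  have cp: "continuous_on ?S (\<lambda>u. complex_of_real (u + c * (1 - u)) powr (- p - q))"
  proof (rule continuous_on_powr_complex)
    show "?S \<subseteq> {u. 0 \<le> Re (complex_of_real (u + c * (1 - u))) \<or> Im (complex_of_real (u + c * (1 - u))) \<noteq> 0}"
      using D by (auto simp: less_imp_le simp del: of_real_add of_real_mult of_real_diff)
    show "Re (- p - q) > 0" if "u \<in> ?S" "complex_of_real (u + c * (1 - u)) = 0" for u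
      using that D[of u] unfolding of_real_eq_0_iff by simp
  qed (intro continuous_intros)+
  have mG: "G \<in> borel_measurable (lborel_on ?S)" unfolding G_def
    by (rule borel_measurable_lborel_on)
       (intro continuous_on_mult continuous_on_const continuous_on_beta_kernel cf cp)
  have iF: "integrable (lborel_on ?S) F"
  proof -
    have "\<exists>B\<ge>0. \<forall>x\<in>{0..1}. norm (f ((\<lambda>t. of_real t * z) x)) \<le> B"
      using z slit_plane_scale
      by (intro bounded_on_compact_image[OF f]) (auto intro!: continuous_intros)
    then obtain B where B: "B \<ge> 0" "\<And>t. t \<in> {0..1} \<Longrightarrow> norm (f (of_real t * z)) \<le> B" by auto
    show ?thesis
      by (rule Bochner_Integration.integrable_bound[OF integrable_mult_left[OF integrable_norm_beta_kernel[OF p q], of B] mF])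
         (use B in \<open>auto intro!: AE_I2 mult_left_mono simp: F_def norm_mult\<close>)
  qed
  have "F absolutely_integrable_on g ` ?S \<and> integral (g ` ?S) F = integral ?S F"
    using lborel_on_bridge(1)[OF _ mF] iF by (simp add: img)
  hence "(\<lambda>u. \<bar>h u\<bar> *\<^sub>R F (g u)) absolutely_integrable_on ?S \<and>
         integral ?S (\<lambda>u. \<bar>h u\<bar> *\<^sub>R F (g u)) = integral ?S F"
    using gd inj by (subst has_absolute_integral_change_of_variables_real) auto
  moreover have "(\<lambda>u. \<bar>h u\<bar> *\<^sub>R F (g u)) absolutely_integrable_on ?S \<longleftrightarrow> G absolutely_integrable_on ?S"
    by (rule set_integrable_cong) (use Feq in auto)
  moreover have "integral ?S (\<lambda>u. \<bar>h u\<bar> *\<^sub>R F (g u)) = integral ?S G"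
    by (rule Henstock_Kurzweil_Integration.integral_cong) (use Feq in auto)
  ultimately have *: "G absolutely_integrable_on ?S" "integral ?S G = integral ?S F"
    by simp_all
  hence "integral\<^sup>L (lborel_on ?S) G = integral\<^sup>L (lborel_on ?S) F"
    using lborel_on_bridge(1,2)[OF _ mG] lborel_on_bridge(2)[OF _ mF] iF by simp
  thus ?thesis unfolding euler_transform_def F_def G_def g_def by (rule sym)
qed

lemma side_Im_inverse:
  assumes "s * Im z > 0"
  shows "s * Im (1 / z) < 0"
proof -
  have "z \<noteq> 0" using assms by auto
  hence "s * Im z / (norm z)\<^sup>2 > 0" using assms by simp
  thus ?thesis by (simp add: Im_divide')
qed

text \<open>The right-hand side is holomorphic in \<open>c\<close> on a convex open set that contains the positive reals, so the value
does not change when the segment of integration is bent into an arc: compare with real \<open>c\<close> and use the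
identity theorem. The condition on \<open>c / z\<close> keeps the arc, scaled by \<open>z\<close>, on the same side of the real axis as \<open>z\<close>.\<close>

lemma euler_transform_contour:
  assumes p: "Re p > 0" and q: "Re q > 0" and f: "f holomorphic_on slit_plane"
    and z: "s * Im z > 0" and c: "Re c > 0" "s * Im (c / z) < 0"
  shows "euler_transform p q f z = integral\<^sup>L (lborel_on {0<..<1})
     (\<lambda>u. c powr q * beta_kernel p q u * (of_real u + c * of_real (1 - u)) powr (- p - q) *
           f (of_real u / (of_real u + c * of_real (1 - u)) * z))"
proof -
  define D where "D = {c. Re c > 0 \<and> s * Im (c / z) < 0}"
  define d where "d c u = complex_of_real u + c * of_real (1 - u)" for c u
  define W where "W c u = c powr q * (d c u powr (- p - q) * f (of_real u / d c u * z))" for c u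
  note fc = holomorphic_on_imp_continuous_on[OF f]
  have z0: "z \<noteq> 0" using z by auto
  have zs: "z \<in> slit_plane" using z by (auto simp: slit_plane_iff)
  have D_alt: "D = {c. Re c > 0} \<inter> {c. s * Im (c / z) < 0}" by (auto simp: D_def)
  have openD: "open D"
    unfolding D_alt using z0 by (intro open_Int open_halfspace_Re_gt open_Collect_less continuous_intros) auto
  have "convex D"
    unfolding convex_def
  proof (intro ballI allI impI)
    fix x y :: complex and u v :: real assume xy: "x \<in> D" "y \<in> D" and uv: "u \<ge> 0" "v \<ge> 0" "u + v = 1"
    have *: "u * a + v * b > 0" if "a > 0" "b > 0" for a b :: real
      using that uv by (cases "u = 0") (auto intro: add_pos_nonneg)
    have "- (s * Im ((u *\<^sub>R x + v *\<^sub>R y) / z)) = u * (- (s * Im (x / z))) + v * (- (s * Im (y / z)))"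
      by (simp add: add_divide_distrib scaleR_conv_of_real Im_divide algebra_simps)
    hence "s * Im ((u *\<^sub>R x + v *\<^sub>R y) / z) < 0"
      using *[of "- (s * Im (x / z))" "- (s * Im (y / z))"] xy by (simp add: D_def)
    moreover have "Re (u *\<^sub>R x + v *\<^sub>R y) > 0" using *[of "Re x" "Re y"] xy by (simp add: D_def)
    ultimately show "u *\<^sub>R x + v *\<^sub>R y \<in> D" by (simp add: D_def)
  qed
  hence connD: "connected D" by (rule convex_connected)
  have dpos: "Re (d c u) > 0" if "c \<in> D" "u \<in> {0..1}" for c u
  proof (cases "u = 1")
    case False
    thus ?thesis using that unfolding d_def D_def
      by (auto intro!: add_nonneg_pos mult_pos_pos)
  qed (simp add: d_def)
  have arg: "of_real u / d c u * z \<in> slit_plane" if cu: "c \<in> D" "u \<in> {0..1}" for c u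
  proof (cases "u = 0")
    case False
    hence u: "u > 0" using cu by auto
    define w where "w = of_real u / d c u * z"
    have "d c u \<noteq> 0" using dpos[OF cu] by auto
    hence "1 / w = 1 / z + of_real ((1 - u) / u) * (c / z)"
      using u z0 by (simp add: w_def d_def field_simps)
    hence "s * Im (1 / w) = s * Im (1 / z) + (1 - u) / u * (s * Im (c / z))"
      by (simp only: plus_complex.sel times_complex.sel Re_complex_of_real Im_complex_of_real) (simp add: algebra_simps)
    moreover have "s * Im (1 / z) < 0" by (rule side_Im_inverse[OF z])
    moreover have "(1 - u) / u * (s * Im (c / z)) \<le> 0"
      using cu u by (intro mult_nonneg_nonpos[of "(1 - u) / u"]) (auto simp: D_def)
    ultimately have "Im (1 / w) \<noteq> 0" by auto
    hence "Im w \<noteq> 0" by (auto simp: Im_divide)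
    thus ?thesis by (simp add: w_def slit_plane_iff)
  qed (simp add: slit_plane_iff)
  have contd: "continuous_on (D \<times> {0..1}) (\<lambda>x. d (fst x) (snd x))"
    unfolding d_def by (intro continuous_intros)
  have contW: "continuous_on (D \<times> {0..1}) (\<lambda>x. W (fst x) (snd x))"
    unfolding W_def
  proof (intro continuous_on_mult)
    show "continuous_on (D \<times> {0..1}) (\<lambda>x. fst x powr q)"
      by (rule continuous_on_powr_complex) (auto simp: D_def intro!: continuous_intros)
    show "continuous_on (D \<times> {0..1}) (\<lambda>x. d (fst x) (snd x) powr (- p - q))"
    proof (rule continuous_on_powr_complex[OF _ _ contd continuous_on_const])
      show "D \<times> {0..1} \<subseteq> {x. 0 \<le> Re (d (fst x) (snd x)) \<or> Im (d (fst x) (snd x)) \<noteq> 0}"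
        using dpos by (auto simp: less_imp_le)
      show "Re (- p - q) > 0" if "x \<in> D \<times> {0..1}" "d (fst x) (snd x) = 0" for x
        using dpos[of "fst x" "snd x"] that by (auto simp: mem_Times_iff)
    qed
    show "continuous_on (D \<times> {0..1}) (\<lambda>x. f (of_real (snd x) / d (fst x) (snd x) * z))"
    proof (rule continuous_on_compose2[OF fc])
      show "continuous_on (D \<times> {0..1}) (\<lambda>x. of_real (snd x) / d (fst x) (snd x) * z)"
        using dpos by (intro continuous_intros contd) force
      show "(\<lambda>x. of_real (snd x) / d (fst x) (snd x) * z) ` (D \<times> {0..1}) \<subseteq> slit_plane"
        using arg by auto
    qed
  qed
  define K where "K u c = beta_kernel p q u * W c u" for u c
  have holK: "(\<lambda>c. integral\<^sup>L (lborel_on {0<..<1}) (\<lambda>u. K u c)) holomorphic_on D"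
  proof (rule holomorphic_on_parameter_integral[OF openD])
    show "K u holomorphic_on D" if "u \<in> space (lborel_on {0<..<1})" for u
    proof -
      have u: "u \<in> {0..1}" using that by auto
      have n1: "c \<notin> \<real>\<^sub>\<le>\<^sub>0" "d c u \<notin> \<real>\<^sub>\<le>\<^sub>0" "d c u \<noteq> 0" if "c \<in> D" for c
        using that dpos[OF that u] by (auto simp: D_def complex_nonpos_Reals_iff)
      have hd: "(\<lambda>c. d c u) holomorphic_on D" unfolding d_def by (intro holomorphic_intros)
      have "(\<lambda>c. f (of_real u / d c u * z)) holomorphic_on D"
        using arg[OF _ u] n1 by (intro holomorphic_on_compose_gen[OF _ f, unfolded o_def] holomorphic_intros hd) auto
      thus ?thesis unfolding K_def W_def
        using n1 by (intro holomorphic_intros hd) auto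
    qed
    show "(\<lambda>u. K u c) \<in> borel_measurable (lborel_on {0<..<1})" if "c \<in> D" for c
    proof -
      have "continuous_on {0<..<1} (\<lambda>u. W (fst (c, u)) (snd (c, u)))"
        by (rule continuous_on_compose2[OF contW]) (use that in \<open>auto intro!: continuous_intros\<close>)
      hence "continuous_on {0<..<1} (\<lambda>u. W c u)" by simp
      thus ?thesis unfolding K_def
        by (intro borel_measurable_lborel_on continuous_on_mult continuous_on_beta_kernel)
    qed
    show "\<exists>r>0. \<exists>g. integrable (lborel_on {0<..<1}) g \<and> ball c r \<subseteq> D \<and>
            (\<forall>u\<in>space (lborel_on {0<..<1}). \<forall>w\<in>ball c r. norm (K u w) \<le> g u)" if "c \<in> D" for c
    proof -
      obtain r where r: "r > 0" "cball c r \<subseteq> D"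
        using openD \<open>c \<in> D\<close> open_contains_cball by blast
      have "compact ((\<lambda>x. W (fst x) (snd x)) ` (cball c r \<times> {0..1}))"
        by (rule compact_continuous_image[OF continuous_on_subset[OF contW]]) (use r in \<open>auto intro!: compact_Times\<close>)
      hence "bounded ((\<lambda>x. W (fst x) (snd x)) ` (cball c r \<times> {0..1}))" by (rule compact_imp_bounded)
      then obtain B where B: "\<And>w u. w \<in> cball c r \<Longrightarrow> u \<in> {0..1} \<Longrightarrow> norm (W w u) \<le> B"
        unfolding bounded_iff by force
      show ?thesis
      proof (intro exI[of _ r] exI[of _ "\<lambda>t. norm (beta_kernel p q t) * B"] conjI ballI)
        show "integrable (lborel_on {0<..<1}) (\<lambda>t. norm (beta_kernel p q t) * B)"
          using integrable_norm_beta_kernel[OF p q] by auto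
        show "norm (K u w) \<le> norm (beta_kernel p q u) * B"
          if "u \<in> space (lborel_on {0<..<1})" "w \<in> ball c r" for u w
          unfolding K_def norm_mult using that by (intro mult_left_mono B) auto
        show "ball c r \<subseteq> D" using r(2) ball_subset_cball by blast
      qed (use r in auto)
    qed
  qed
  have "(\<lambda>_. euler_transform p q f z) c = (\<lambda>c. integral\<^sup>L (lborel_on {0<..<1}) (\<lambda>u. K u c)) c"
  proof (rule holomorphic_eq_of_eq_on_reals[OF _ holK openD connD, of _ 0 1])
    have s1: "s * Im (1 / z) < 0" by (rule side_Im_inverse[OF z])
    show "complex_of_real x \<in> D" if "0 < x" for x
    proof -
      have "s * Im (complex_of_real x / z) = x * (s * Im (1 / z))"
        unfolding Im_divide' by simp
      also have "\<dots> < 0" using that s1 by (rule mult_pos_neg)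
      finally have "s * Im (complex_of_real x / z) < 0" .
      thus ?thesis using that unfolding D_def by (intro CollectI conjI) auto
    qed
    show "euler_transform p q f z = integral\<^sup>L (lborel_on {0<..<1}) (\<lambda>u. K u (complex_of_real x))"
      if "0 < x" for x
      unfolding euler_transform_substitution_real[OF p q that fc zs]
      by (rule Bochner_Integration.integral_cong) (auto simp: K_def W_def d_def mult_ac)
    show "c \<in> D" using c by (simp add: D_def)
  qed auto
  thus ?thesis by (simp add: K_def W_def d_def mult_ac)
qed

text \<open>With \<open>c = 1 - s \<i>\<close> the arc scaled by \<open>z\<close> leaves the real axis immediately, even for \<open>z\<close> on the cut.
So the integrand converges as \<open>z\<close> tends to \<open>r\<close> from the side \<open>s\<close>; near the endpoint \<open>u = 1\<close>, where the
arc does meet the cut, the boundedness of \<open>f\<close> on that side gives a dominating function.\<close>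

lemma euler_transform_side_limit:
  assumes p: "Re p > 0" and q: "Re q > 0" and F: "cut_bounded f" and s: "s \<in> {1, - 1 :: real}" and r: "r > 1"
  shows "\<exists>l. (euler_transform p q f \<longlongrightarrow> l) (at (complex_of_real r) within {w. 0 < s * Im w})"
proof -
  have f: "f holomorphic_on slit_plane" using F by (simp add: cut_bounded_def)
  note fc = holomorphic_on_imp_continuous_on[OF f]
  have ss: "s * s = 1" using s by auto
  define c where "c = Complex 1 (- s)"
  define d where "d u = complex_of_real u + c * of_real (1 - u)" for u
  define T where "T u = complex_of_real u / d u" for u
  have dRe: "Re (d u) = 1" and dIm: "Im (d u) = - s * (1 - u)" for u by (simp_all add: d_def c_def)
  have d0: "d u \<noteq> 0" for u using dRe[of u] by auto
  have normd: "norm (d u) \<ge> 1" for u using complex_Re_le_cmod[of "d u"] dRe[of u] by simp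
  have side: "s * Im (T u * z) > 0"
    if "0 < u" "u \<le> 1" "s * Im z \<ge> 0" "Re z > 0" "s * Im z > 0 \<or> u < 1" for u z
  proof -
    have "T u * z = of_real u * (z / d u)" by (simp add: T_def)
    hence "s * Im (T u * z) = u * (s * Im (z / d u))"
      by (simp only: times_complex.sel Re_complex_of_real Im_complex_of_real) simp
    also have "s * Im (z / d u) = (s * Im z + Re z * (1 - u) * (s * s)) / (norm (d u))\<^sup>2"
      unfolding Im_divide' dRe dIm by (simp add: algebra_simps)
    also have "\<dots> = (s * Im z + Re z * (1 - u)) / (norm (d u))\<^sup>2" by (simp add: ss)
    also have "u * \<dots> > 0"
    proof -
      have "s * Im z + Re z * (1 - u) > 0"
        using that by (cases "u < 1") (auto intro: add_nonneg_pos)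
      thus ?thesis using that d0 by simp
    qed
    finally show ?thesis .
  qed
  have slit: "w \<in> slit_plane" if "s * Im w > 0" for w using that by (auto simp: slit_plane_iff)
  have normc: "norm c \<le> 2" using cmod_le[of c] s by (auto simp: c_def)
  have T1: "norm (T u * z - of_real r) \<le> norm (z - of_real r) + 2 * r * (1 - u)" if "u \<in> {0..1}" for u z
  proof -
    have dge: "norm x / norm (d u) \<le> norm x" for x :: complex
      using normd[of u] mult_left_mono[of 1 "norm (d u)" "norm x"] by (simp add: divide_le_eq d0)
    have "T u * z - of_real r = T u * (z - of_real r) + of_real r * (T u - 1)" by (simp add: algebra_simps)
    also have "norm \<dots> \<le> norm (T u) * norm (z - of_real r) + norm (of_real r :: complex) * norm (T u - 1)"
      by (intro order_trans[OF norm_triangle_ineq]) (simp add: norm_mult)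
    also have "\<dots> \<le> 1 * norm (z - of_real r) + r * (2 * (1 - u))"
    proof (intro add_mono mult_mono)
      show "norm (T u) \<le> 1"
        using dge[of "of_real u"] that by (simp add: T_def norm_divide)
      have "T u - 1 = - (c * of_real (1 - u)) / d u" using d0[of u] by (simp add: T_def field_simps) (simp add: d_def algebra_simps)
      hence "norm (T u - 1) \<le> norm (c * of_real (1 - u))"
        using dge[of "c * of_real (1 - u)"] by (simp add: norm_divide)
      also have "\<dots> = norm c * (1 - u)" using that by (auto simp: norm_mult simp del: of_real_diff)
      also have "\<dots> \<le> 2 * (1 - u)" using that normc by (intro mult_right_mono) auto
      finally show "norm (T u - 1) \<le> 2 * (1 - u)" .
    qed (use r in auto)
    finally show ?thesis by (simp add: algebra_simps)
  qed
  obtain B1 d1 where B1: "d1 > 0" "\<And>z. z \<in> ball (of_real r) d1 \<Longrightarrow> s * Im z > 0 \<Longrightarrow> norm (f z) \<le> B1"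
    using F s r unfolding cut_bounded_def by metis
  \<comment> \<open>Beyond \<open>u1\<close> the scaled arc stays in the disc around \<open>r\<close> on which \<open>f\<close> is bounded.\<close>
  define u1 where "u1 = max 0 (1 - d1 / (4 * r))"
  have u1: "0 \<le> u1" "u1 < 1" using B1(1) r by (auto simp: u1_def)
  define C where "C = (cball (complex_of_real r) (1/2) \<inter> {z. s * Im z \<ge> 0}) \<times> {0..u1}"
  have ReC: "Re z > 0" if "dist (complex_of_real r) z \<le> 1/2" for z
    using that r abs_Re_le_cmod[of "complex_of_real r - z"] by (simp add: dist_norm)
  have compC: "compact C"
    unfolding C_def by (intro compact_Times compact_Int_closed compact_cball compact_Icc closed_Collect_le continuous_intros)
  have contT: "continuous_on A T" for A unfolding T_def d_def
    using d0 by (intro continuous_intros) (simp add: d_def)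
  have "\<exists>B\<ge>0. \<forall>x\<in>C. norm (f (T (snd x) * fst x)) \<le> B"
  proof (rule bounded_on_compact_image[OF fc compC])
    show "continuous_on C (\<lambda>x. T (snd x) * fst x)"
      by (intro continuous_intros continuous_on_compose2[OF contT[of UNIV]]) auto
    show "(\<lambda>x. T (snd x) * fst x) ` C \<subseteq> slit_plane"
    proof (intro image_subsetI)
      fix x assume x: "x \<in> C"
      show "T (snd x) * fst x \<in> slit_plane"
      proof (cases "snd x = 0")
        case True thus ?thesis by (simp add: T_def slit_plane_iff)
      next
        case False
        thus ?thesis using x u1 ReC[of "fst x"] by (intro slit side) (auto simp: C_def)
      qed
    qed
  qed
  then obtain B2 where B2: "\<And>x. x \<in> C \<Longrightarrow> norm (f (T (snd x) * fst x)) \<le> B2" by blast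
  define \<delta> where "\<delta> = min (1/2) (d1/2)"
  have \<delta>: "\<delta> > 0" using B1(1) by (simp add: \<delta>_def)
  have bd: "norm (f (T u * z)) \<le> max B1 B2"
    if z: "z \<in> ball (of_real r) \<delta>" "s * Im z > 0" and u: "u \<in> {0<..<1}" for z u
  proof (cases "u \<le> u1")
    case True
    hence "(z, u) \<in> C" using z u by (auto simp: C_def \<delta>_def)
    thus ?thesis using B2[of "(z, u)"] by simp
  next
    case False
    have "1 - u < d1 / (4 * r)" using False by (simp add: u1_def)
    hence "(1 - u) * (4 * r) < d1" using r by (subst (asm) pos_less_divide_eq) auto
    hence "2 * r * (1 - u) < d1 / 2" by (simp add: algebra_simps)
    moreover have "norm (z - of_real r) < d1 / 2" using z(1) by (simp add: \<delta>_def dist_norm norm_minus_commute)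
    ultimately have "T u * z \<in> ball (of_real r) d1" using T1[of u z] u by (simp add: dist_norm norm_minus_commute)
    moreover have "s * Im (T u * z) > 0"
      using z u ReC[of z] by (intro side) (auto simp: \<delta>_def)
    ultimately show ?thesis using B1(2) by (simp add: le_max_iff_disj)
  qed
  define k where "k u = c powr q * beta_kernel p q u * d u powr (- p - q)" for u
  define l where "l = integral\<^sup>L (lborel_on {0<..<1}) (\<lambda>u. k u * f (T u * of_real r))"
  have contd: "continuous_on A d" for A unfolding d_def by (intro continuous_intros)
  have contdp: "continuous_on A (\<lambda>u. d u powr (- p - q))" for A
    by (rule continuous_on_powr_complex[OF _ _ contd continuous_on_const]) (use dRe d0 in auto)
  have contk: "continuous_on {0<..<1} k"
    unfolding k_def by (intro continuous_on_mult continuous_on_const continuous_on_beta_kernel contdp)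
  obtain M where M: "\<And>u. u \<in> {0..1} \<Longrightarrow> norm (d u powr (- p - q)) \<le> M"
  proof -
    have "bounded ((\<lambda>u. d u powr (- p - q)) ` {0..1})"
      by (intro compact_imp_bounded compact_continuous_image contdp compact_Icc)
    then obtain a where "\<And>u. u \<in> {0..1} \<Longrightarrow> norm (d u powr (- p - q)) \<le> a"
      unfolding bounded_iff by blast
    thus ?thesis by (rule that)
  qed
  have intk: "integrable (lborel_on {0<..<1}) (\<lambda>u. norm (k u))"
  proof (rule Bochner_Integration.integrable_bound)
    show "integrable (lborel_on {0<..<1}) (\<lambda>u. norm (c powr q) * norm (beta_kernel p q u) * M)"
      using integrable_norm_beta_kernel[OF p q] by auto
    show "AE u in lborel_on {0<..<1}. norm (norm (k u)) \<le> norm (norm (c powr q) * norm (beta_kernel p q u) * M)"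
    proof (rule AE_I2)
      fix u assume "u \<in> space (lborel_on {0<..<1})"
      hence "u \<in> {0..1}" by auto
      hence "norm (k u) \<le> norm (c powr q) * norm (beta_kernel p q u) * M"
        unfolding k_def norm_mult by (intro mult_left_mono M) auto
      thus "norm (norm (k u)) \<le> norm (norm (c powr q) * norm (beta_kernel p q u) * M)" by simp
    qed
  qed (use borel_measurable_lborel_on[OF contk] in auto)
  have meas: "(\<lambda>u. k u * f (T u * z)) \<in> borel_measurable (lborel_on {0<..<1})"
    if "s * Im z \<ge> 0" "Re z > 0" for z
  proof -
    have "continuous_on {0<..<1} (\<lambda>u. T u * z)" by (intro continuous_intros contT)
    moreover have "(\<lambda>u. T u * z) ` {0<..<1} \<subseteq> slit_plane"
      using that by (intro image_subsetI slit side) auto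
    ultimately have "continuous_on {0<..<1} (\<lambda>u. f (T u * z))"
      by (rule continuous_on_compose2[OF fc])
    thus ?thesis by (intro borel_measurable_lborel_on continuous_on_mult contk)
  qed
  have eq: "euler_transform p q f z = integral\<^sup>L (lborel_on {0<..<1}) (\<lambda>u. k u * f (T u * z))"
    if "s * Im z > 0" "Re z > 0" for z
  proof -
    have "s * Im (c / z) = (- (s * Im z) - Re z * (s * s)) / (norm z)\<^sup>2"
      by (simp add: Im_divide' c_def algebra_simps)
    also have "\<dots> = - ((s * Im z + Re z) / (norm z)\<^sup>2)"
      unfolding ss by (simp add: minus_divide_left)
    also have "\<dots> < 0" using that by (auto intro!: divide_pos_pos)
    finally have "s * Im (c / z) < 0" .
    hence "euler_transform p q f z = integral\<^sup>L (lborel_on {0<..<1})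
     (\<lambda>u. c powr q * beta_kernel p q u * (of_real u + c * of_real (1 - u)) powr (- p - q) *
           f (of_real u / (of_real u + c * of_real (1 - u)) * z))"
      by (intro euler_transform_contour[OF p q f that(1)]) (simp_all add: c_def)
    thus ?thesis by (simp only: k_def T_def d_def)
  qed
  have "(euler_transform p q f \<longlongrightarrow> l) (at (complex_of_real r) within {w. 0 < s * Im w})"
    unfolding tendsto_at_iff_sequentially comp_def
  proof (intro allI impI)
    fix X :: "nat \<Rightarrow> complex"
    assume X: "\<forall>i. X i \<in> {w. 0 < s * Im w} - {complex_of_real r}" "X \<longlonglongrightarrow> complex_of_real r"
    have "eventually (\<lambda>i. X i \<in> ball (of_real r) \<delta>) sequentially"
      using X(2) \<delta> by (intro topological_tendstoD) auto
    then obtain N where N: "\<And>i. i \<ge> N \<Longrightarrow> X i \<in> ball (of_real r) \<delta>"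
      unfolding eventually_sequentially by blast
    define Y where "Y i = X (i + N)" for i
    have Y: "Y i \<in> ball (of_real r) \<delta>" "s * Im (Y i) > 0" for i using N[of "i+N"] X(1) by (auto simp: Y_def)
    have YRe: "Re (Y i) > 0" for i using Y(1)[of i] by (intro ReC) (auto simp: \<delta>_def)
    have Ylim: "Y \<longlonglongrightarrow> of_real r" unfolding Y_def using X(2) by (rule LIMSEQ_ignore_initial_segment)
    have pt: "(\<lambda>i. k u * f (T u * Y i)) \<longlonglongrightarrow> k u * f (T u * of_real r)" if "u \<in> {0<..<1}" for u
    proof -
      have "T u * of_real r \<in> slit_plane" using that r by (intro slit side) auto
      hence "isCont f (T u * of_real r)"
        using fc open_slit_plane continuous_on_eq_continuous_at by blast
      thus ?thesis by (intro tendsto_mult tendsto_const isCont_tendsto_compose[of _ f] Ylim)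
    qed
    have "(\<lambda>i. integral\<^sup>L (lborel_on {0<..<1}) (\<lambda>u. k u * f (T u * Y i))) \<longlonglongrightarrow> l"
      unfolding l_def
    proof (rule integral_dominated_convergence)
      show "integrable (lborel_on {0<..<1}) (\<lambda>u. norm (k u) * max B1 B2)" using intk by auto
      show "(\<lambda>u. k u * f (T u * complex_of_real r)) \<in> borel_measurable (lborel_on {0<..<1})"
        using r by (intro meas) auto
      show "(\<lambda>u. k u * f (T u * Y i)) \<in> borel_measurable (lborel_on {0<..<1})" for i
        using Y(2)[of i] YRe[of i] by (intro meas) auto
      show "AE u in lborel_on {0<..<1}. (\<lambda>i. k u * f (T u * Y i)) \<longlonglongrightarrow> k u * f (T u * of_real r)"
        by (rule AE_I2) (use pt in simp)
      show "AE u in lborel_on {0<..<1}. norm (k u * f (T u * Y i)) \<le> norm (k u) * max B1 B2" for i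
        unfolding norm_mult by (rule AE_I2) (intro mult_left_mono bd Y, auto)
    qed
    hence "(\<lambda>i. euler_transform p q f (Y i)) \<longlonglongrightarrow> l" using eq Y(2) YRe by simp
    thus "(\<lambda>i. euler_transform p q f (X i)) \<longlonglongrightarrow> l"
      unfolding Y_def by (rule LIMSEQ_offset)
  qed
  thus ?thesis by blast
qed

definition has_side_limits :: "(complex \<Rightarrow> complex) \<Rightarrow> bool" where
  "has_side_limits f \<longleftrightarrow> (\<forall>s\<in>{1, - 1 :: real}. \<forall>r>1. \<exists>l. (f \<longlongrightarrow> l) (at (complex_of_real r) within {w. 0 < s * Im w}))"

definition continues_power_series :: "(nat \<Rightarrow> complex) \<Rightarrow> (complex \<Rightarrow> complex) \<Rightarrow> bool" where
  "continues_power_series c f \<longleftrightarrow> cut_bounded f \<and> (\<forall>z. norm z < 1 \<longrightarrow> (\<lambda>k. c k * z ^ k) sums f z)"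

lemma cut_bounded_of_side_limits:
  assumes "f holomorphic_on slit_plane" "has_side_limits f"
  shows "cut_bounded f"
  unfolding cut_bounded_def
proof (intro conjI ballI allI impI)
  fix s r :: real assume s: "s \<in> {1, - 1}" and r: "r > 1"
  then obtain l where "(f \<longlongrightarrow> l) (at (complex_of_real r) within {w. 0 < s * Im w})"
    using assms(2) unfolding has_side_limits_def by blast
  hence "eventually (\<lambda>w. dist (f w) l < 1) (at (complex_of_real r) within {w. 0 < s * Im w})"
    by (rule tendstoD) simp
  then obtain d where d: "d > 0" "\<And>w. 0 < s * Im w \<Longrightarrow> w \<noteq> of_real r \<Longrightarrow> dist w (of_real r) < d \<Longrightarrow> dist (f w) l < 1"
    unfolding eventually_at by blast
  show "\<exists>B. \<exists>d>0. \<forall>z\<in>ball (complex_of_real r) d. 0 < s * Im z \<longrightarrow> norm (f z) \<le> B"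
  proof (rule exI[of _ "norm l + 1"], rule exI[of _ d], intro conjI ballI impI d(1))
    fix z assume z: "z \<in> ball (complex_of_real r) d" "0 < s * Im z"
    hence "dist (f z) l < 1" by (intro d(2)) (auto simp: dist_commute)
    thus "norm (f z) \<le> norm l + 1"
      using norm_triangle_ineq[of "f z - l" l] by (simp add: dist_norm)
  qed
qed (use assms in auto)

lemma Beta_shift:
  assumes "Re p > 0" "Re q > 0"
  shows "Beta (p + of_nat k) q = Beta p q * (pochhammer p k / pochhammer (p + q) k)" "Beta p q \<noteq> 0"
proof -
  have nn: "z \<notin> \<int>\<^sub>\<le>\<^sub>0" if "Re z > 0" for z using that by (auto elim!: nonpos_Ints_cases)
  have g: "Gamma p \<noteq> 0" "Gamma q \<noteq> 0" "Gamma (p + q) \<noteq> 0"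
    using assms nn by (auto simp: Gamma_eq_zero_iff)
  show "Beta p q \<noteq> 0" using g by (simp add: Beta_def)
  show "Beta (p + of_nat k) q = Beta p q * (pochhammer p k / pochhammer (p + q) k)"
    using assms nn[of p] nn[of "p + q"] g by (simp add: pochhammer_Gamma Beta_def add_ac)
qed

text \<open>The induction step that builds a \<open>(p+1)F(q+1)\<close> from a \<open>pFq\<close> together with its regularity at the cut.\<close>

lemma euler_transform_continues:
  assumes p: "Re p > 0" and q: "Re q > 0" and f: "continues_power_series c f"
  defines "g \<equiv> (\<lambda>z. euler_transform p q f z / Beta p q)"
  shows "continues_power_series (\<lambda>k. c k * (pochhammer p k / pochhammer (p + q) k)) g"
    and "has_side_limits g"
proof -
  have cb: "cut_bounded f" and su: "\<And>z. norm z < 1 \<Longrightarrow> (\<lambda>k. c k * z ^ k) sums f z"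
    using f by (auto simp: continues_power_series_def)
  show lim: "has_side_limits g"
    unfolding has_side_limits_def
  proof (intro ballI allI impI)
    fix s r :: real assume "s \<in> {1, - 1}" "r > 1"
    from euler_transform_side_limit[OF p q cb this] obtain l
      where "(euler_transform p q f \<longlongrightarrow> l) (at (complex_of_real r) within {w. 0 < s * Im w})" by blast
    hence "(g \<longlongrightarrow> l / Beta p q) (at (complex_of_real r) within {w. 0 < s * Im w})"
      unfolding g_def using Beta_shift(2)[OF p q] by (intro tendsto_divide tendsto_const)
    thus "\<exists>l. (g \<longlongrightarrow> l) (at (complex_of_real r) within {w. 0 < s * Im w})" by blast
  qed
  have hol: "g holomorphic_on slit_plane"
    unfolding g_def using cb Beta_shift(2)[OF p q]
    by (intro holomorphic_intros euler_transform_holomorphic p q) (auto simp: cut_bounded_def)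
  show "continues_power_series (\<lambda>k. c k * (pochhammer p k / pochhammer (p + q) k)) g"
    unfolding continues_power_series_def
  proof (intro conjI allI impI cut_bounded_of_side_limits hol lim)
    fix z :: complex assume z: "norm z < 1"
    obtain y where y: "norm z < y" "y < 1" using dense[OF z] by blast
    have "summable (\<lambda>k. norm (c k * z ^ k))"
      by (rule powser_insidea[of c "of_real y"]) (use su[of "of_real y"] y norm_ge_zero[of z] in \<open>auto simp: sums_iff simp del: norm_ge_zero\<close>)
    hence "(\<lambda>k. c k * Beta (p + of_nat k) q * z ^ k) sums euler_transform p q f z"
      using su by (intro euler_transform_sums p q z) (auto simp: sums_iff)
    hence "(\<lambda>k. c k * Beta (p + of_nat k) q * z ^ k / Beta p q) sums g z"
      unfolding g_def by (rule sums_divide)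
    also have "(\<lambda>k. c k * Beta (p + of_nat k) q * z ^ k / Beta p q) =
               (\<lambda>k. c k * (pochhammer p k / pochhammer (p + q) k) * z ^ k)"
      unfolding Beta_shift(1)[OF p q] using Beta_shift(2)[OF p q] by (simp add: fun_eq_iff)
    finally show "(\<lambda>k. c k * (pochhammer p k / pochhammer (p + q) k) * z ^ k) sums g z" .
  qed
qed

text \<open>Here the modulus depends only on the distance to 1 and is thus continuous across the cut, although the
function itself jumps there.\<close>

lemma continuous_imp_cut_bounded:
  assumes hol: "f holomorphic_on slit_plane"
    and n: "\<And>z. z \<noteq> 1 \<Longrightarrow> norm (f z) = h (norm (1 - z))" and h: "continuous_on {0<..} h"
  shows "cut_bounded f"
  unfolding cut_bounded_def
proof (intro conjI ballI allI impI hol)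
  fix s r :: real assume r: "r > 1"
  define d where "d = (r - 1) / 2"
  have d: "d > 0" using r by (simp add: d_def)
  have "bounded (h ` {d..3 * d})"
    using d h by (intro compact_imp_bounded compact_continuous_image compact_Icc)
       (auto intro: continuous_on_subset)
  then obtain B where B: "\<And>x. x \<in> {d..3 * d} \<Longrightarrow> norm (h x) \<le> B"
    using r d unfolding bounded_iff by (force simp: d_def)
  show "\<exists>B. \<exists>d>0. \<forall>z\<in>ball (complex_of_real r) d. 0 < s * Im z \<longrightarrow> norm (f z) \<le> B"
  proof (rule exI[of _ B], rule exI[of _ d], intro conjI ballI impI d)
    fix z assume z: "z \<in> ball (complex_of_real r) d" "0 < s * Im z"
    have "norm (z - of_real r) < d" using z(1) by (simp add: dist_norm norm_minus_commute)
    moreover have "norm (of_real r - 1 :: complex) = 2 * d"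
    proof -
      have "norm (of_real r - 1 :: complex) = norm (of_real (r - 1) :: complex)" by simp
      also have "\<dots> = 2 * d" unfolding norm_of_real using r by (simp add: d_def)
      finally show ?thesis .
    qed
    ultimately have "norm (1 - z) \<in> {d..3 * d}"
      using norm_triangle_ineq2[of "of_real r - 1 :: complex" "of_real r - z"]
        norm_triangle_ineq[of "of_real r - 1 :: complex" "z - of_real r"]
      by (simp add: norm_minus_commute)
    moreover have "z \<noteq> 1" using z by auto
    ultimately show "norm (f z) \<le> B" using B[of "norm (1 - z)"] n[of z] by simp
  qed
qed

lemma inverse_sqrt_continues:
  "continues_power_series (\<lambda>k. pochhammer (1/2) k / fact k) (\<lambda>z. (1 - z) powr (- 1/2))"
  unfolding continues_power_series_def
proof (intro conjI allI impI)
  show "cut_bounded (\<lambda>z. (1 - z) powr (- 1/2))"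
  proof (rule continuous_imp_cut_bounded[where h = "\<lambda>x. x powr (- 1/2)"])
    show "(\<lambda>z. (1 - z) powr (- 1/2)) holomorphic_on slit_plane"
      by (intro holomorphic_intros) (auto simp: slit_plane_iff complex_nonpos_Reals_iff)
    show "norm ((1 - z) powr (- 1/2)) = norm (1 - z) powr (- 1/2)" if "z \<noteq> 1" for z :: complex
      by (subst norm_powr_real_powr') auto
  qed (intro continuous_intros, auto)
  fix z :: complex assume z: "norm z < 1"
  have "(\<lambda>k. ((- 1/2) gchoose k) * (- z) ^ k) sums (1 + - z) powr (- 1/2)"
    by (rule gen_binomial_complex) (use z in auto)
  moreover have "((- 1/2 :: complex) gchoose k) * (- z) ^ k = pochhammer (1/2) k / fact k * z ^ k" for k
    by (subst power_minus) (simp add: gbinomial_pochhammer mult_ac flip: power_mult_distrib power_add)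
  ultimately show "(\<lambda>k. pochhammer (1/2) k / fact k * z ^ k) sums (1 - z) powr (- 1/2)" by simp
qed

lemma geometric_continues: "continues_power_series (\<lambda>k. 1) (\<lambda>z. 1 / (1 - z))"
  unfolding continues_power_series_def
proof (intro conjI allI impI)
  show "cut_bounded (\<lambda>z. 1 / (1 - z))"
  proof (rule continuous_imp_cut_bounded[where h = "\<lambda>x. 1 / x"])
    show "(\<lambda>z. 1 / (1 - z)) holomorphic_on slit_plane"
      by (intro holomorphic_intros) (auto simp: slit_plane_iff)
  qed (auto simp: norm_divide intro!: continuous_intros)
qed (use geometric_sums in auto)

text \<open>All that is used later about a hypergeometric function: it is holomorphic on the slit plane, has limits from both
sides on the cut, and is given by its series in the unit disc.\<close>

definition hypergeo_regular :: "complex list \<Rightarrow> complex list \<Rightarrow> bool" where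
  "hypergeo_regular as bs \<longleftrightarrow> hypergeo as bs holomorphic_on slit_plane \<and> has_side_limits (hypergeo as bs) \<and>
     (\<forall>z. norm z < 1 \<longrightarrow> (\<lambda>k. fps_nth (fps_hypergeo as bs 1) k * z ^ k) sums hypergeo as bs z)"

text \<open>The continuation is unique because the slit plane is connected, so any explicit continuation can be used for it.\<close>

lemma hypergeo_regularI:
  assumes f: "continues_power_series c f" and lim: "has_side_limits f"
    and c: "\<And>k. fps_nth (fps_hypergeo as bs 1) k = c k"
  shows "hypergeo_regular as bs"
proof -
  have hol: "f holomorphic_on slit_plane" and su: "\<And>z. norm z < 1 \<Longrightarrow> (\<lambda>k. c k * z ^ k) sums f z"
    using f by (auto simp: continues_power_series_def cut_bounded_def)
  have ser: "hypergeo_series as bs z = f z" if "norm z < 1" for z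
    using su[OF that] by (simp add: hypergeo_series_def eval_fps_def c sums_iff del: fps_hypergeo_nth)
  define g where "g = hypergeo_continuation as bs"
  have g: "g holomorphic_on slit_plane \<and> (\<forall>z. norm z < 1 \<longrightarrow> g z = hypergeo_series as bs z)"
    unfolding g_def hypergeo_continuation_def by (rule someI[of _ f]) (use hol ser in auto)
  have gf: "g z = f z" if "z \<in> slit_plane" for z
    by (rule analytic_continuation_open[of "ball 0 1" slit_plane])
       (use that g hol ser in \<open>auto simp: open_slit_plane connected_slit_plane ball_subset_slit_plane\<close>)
  have hf: "hypergeo as bs z = f z" if "z \<in> slit_plane" for z
    using gf[OF that] that by (auto simp: hypergeo_def g_def slit_plane_iff)
  have "hypergeo as bs holomorphic_on slit_plane"
    using hol hf by (simp cong: holomorphic_cong)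
  moreover have "has_side_limits (hypergeo as bs)"
    unfolding has_side_limits_def
  proof (intro ballI allI impI)
    fix s r :: real assume "s \<in> {1, - 1}" "r > 1"
    then obtain l where l: "(f \<longlongrightarrow> l) (at (complex_of_real r) within {w. 0 < s * Im w})"
      using lim unfolding has_side_limits_def by blast
    have eq: "f w = hypergeo as bs w" if "0 < s * Im w" for w
      by (rule hf[symmetric]) (use that in \<open>auto simp: slit_plane_iff\<close>)
    have "eventually (\<lambda>w. f w = hypergeo as bs w) (at (complex_of_real r) within {w. 0 < s * Im w})"
      unfolding eventually_at_topological by (rule exI[of _ UNIV]) (simp add: eq)
    with l have "(hypergeo as bs \<longlongrightarrow> l) (at (complex_of_real r) within {w. 0 < s * Im w})"
      by (rule Lim_transform_eventually)
    thus "\<exists>l. (hypergeo as bs \<longlongrightarrow> l) (at (complex_of_real r) within {w. 0 < s * Im w})" by blast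
  qed
  ultimately show ?thesis
    unfolding hypergeo_regular_def using su hf by (auto simp: c ball_subset_slit_plane simp del: fps_hypergeo_nth)
qed

text \<open>The function arises from \<open>(1 - z)\<close> to the power \<open>- 1/2\<close> by three Euler integrals with
parameters \<open>p\<close> and \<open>1/2\<close>, since every quotient of parameters here is \<open>p\<close> over \<open>p + 1/2\<close>.\<close>

lemma hypergeo_4F3_regular:
  assumes "Re p1 > 0" "Re p2 > 0" "Re p3 > 0"
  defines "c \<equiv> (\<lambda>k. pochhammer (1/2) k / fact k * (pochhammer p1 k / pochhammer (p1 + 1/2) k) *
       (pochhammer p2 k / pochhammer (p2 + 1/2) k) * (pochhammer p3 k / pochhammer (p3 + 1/2) k))"
  assumes "\<And>k. fps_nth (fps_hypergeo as bs 1) k = c k"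
  shows "hypergeo_regular as bs"
proof -
  have h: "Re (1/2) > 0" by simp
  note 1 = euler_transform_continues[OF assms(1) h inverse_sqrt_continues]
  note 2 = euler_transform_continues[OF assms(2) h 1(1)]
  note 3 = euler_transform_continues[OF assms(3) h 2(1)]
  show ?thesis by (rule hypergeo_regularI[OF 3]) (simp only: assms(5) c_def)
qed

lemma hypergeo_2F1_regular:
  assumes "Re p > 0"
  shows "hypergeo_regular [1, p] [p + 1]"
proof -
  have h: "Re 1 > 0" by simp
  show ?thesis
    by (rule hypergeo_regularI[OF euler_transform_continues[OF assms h geometric_continues]])
       (simp add: pochhammer_fact[symmetric])
qed

section \<open>Bounds for the modified Bessel functions\<close>

lemma Re_pos_notin_nonpos_Ints: "Re z > 0 \<Longrightarrow> z \<notin> \<int>\<^sub>\<le>\<^sub>0"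
  by (auto elim!: nonpos_Ints_cases)

definition bessel_coeff :: "complex \<Rightarrow> nat \<Rightarrow> complex" where
  "bessel_coeff \<nu> k = rGamma (of_nat k + \<nu> + 1) / fact k"

text \<open>A lower bound for \<open>|\<nu> + i| / i\<close> over all \<open>i \<ge> 1\<close>; its powers measure how fast \<open>bessel_coeff\<close> decays.\<close>

definition coeff_decay :: "complex \<Rightarrow> real" where
  "coeff_decay \<nu> = min 1 (Re \<nu> + 1)"

lemma norm_bessel_coeff_le:
  assumes "Re \<nu> > - 1"
  shows "norm (bessel_coeff \<nu> k) \<le> norm (rGamma (\<nu> + 1)) / (coeff_decay \<nu> ^ k * (fact k)\<^sup>2)"
proof -
  define \<delta> where "\<delta> = coeff_decay \<nu>"
  have \<delta>: "\<delta> > 0" "\<delta> \<le> 1" "\<delta> \<le> Re \<nu> + 1" using assms by (auto simp: \<delta>_def coeff_decay_def)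
  have "norm (rGamma (of_nat k + \<nu> + 1)) \<le> norm (rGamma (\<nu> + 1)) / (\<delta> ^ k * fact k)"
  proof (induction k)
    case (Suc k)
    let ?z = "of_nat k + \<nu> + 1"
    have "\<delta> * (1 + real k) \<le> Re \<nu> + 1 + real k"
      using \<delta> mult_right_mono[of \<delta> 1 "real k"] by (simp add: algebra_simps)
    also have "\<dots> = Re ?z" by simp
    also have "\<dots> \<le> norm ?z" by (rule complex_Re_le_cmod)
    finally have z: "\<delta> * (1 + real k) \<le> norm ?z" .
    have "\<delta> * (1 + real k) > 0" using \<delta> by (intro mult_pos_pos) auto
    have "norm (rGamma (of_nat (Suc k) + \<nu> + 1)) * (\<delta> * (1 + real k)) \<le> norm (rGamma (?z + 1)) * norm ?z"
      using \<open>\<delta> * (1 + real k) > 0\<close> by (intro mult_mono z) (simp_all add: add_ac less_imp_le)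
    also have "\<dots> = norm (rGamma ?z)"
      using rGamma_plus1[of ?z] by (metis mult.commute norm_mult)
    also have "\<dots> \<le> norm (rGamma (\<nu> + 1)) / (\<delta> ^ k * fact k)" by (rule Suc.IH)
    finally have "norm (rGamma (of_nat (Suc k) + \<nu> + 1)) \<le> norm (rGamma (\<nu> + 1)) / (\<delta> ^ k * fact k) / (\<delta> * (1 + real k))"
      using \<open>\<delta> * (1 + real k) > 0\<close> by (simp only: pos_le_divide_eq)
    thus ?case by (simp add: mult_ac)
  qed simp
  hence "norm (bessel_coeff \<nu> k) \<le> norm (rGamma (\<nu> + 1)) / (\<delta> ^ k * fact k) / fact k"
    unfolding bessel_coeff_def norm_divide norm_fact by (intro divide_right_mono) auto
  thus ?thesis by (simp add: \<delta>_def power2_eq_square mult_ac)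
qed

text \<open>The factor \<open>exp (2 y)\<close> dominates the series of \<open>y\<close> to the power \<open>2 k\<close> over \<open>(k!)\<^sup>2\<close>, whose terms
are squares of those of the exponential series. This crude rate of growth decides how small \<open>a\<close> has to be for termwise
integration.\<close>

lemma bessel_coeff_summable:
  fixes u :: complex
  assumes "Re \<nu> > - 1"
  defines "y \<equiv> sqrt (norm u / coeff_decay \<nu>)"
  shows "summable (\<lambda>k. norm (bessel_coeff \<nu> k * u ^ k))"
    and "(\<Sum>k. norm (bessel_coeff \<nu> k * u ^ k)) \<le> norm (rGamma (\<nu> + 1)) * exp (2 * y)"
proof -
  have \<delta>: "coeff_decay \<nu> > 0" using assms by (auto simp: coeff_decay_def)
  have y: "y \<ge> 0" "y\<^sup>2 = norm u / coeff_decay \<nu>" using \<delta> by (auto simp: y_def)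
  have ex: "(\<lambda>k. y ^ k / fact k) sums exp y" using exp_converges[of y] by (simp add: field_simps)
  have le: "norm (bessel_coeff \<nu> k * u ^ k) \<le> norm (rGamma (\<nu> + 1)) * exp y * (y ^ k / fact k)" for k
  proof -
    have "y ^ k / fact k \<le> (\<Sum>k. y ^ k / fact k)"
      using sum_le_suminf[of "\<lambda>k. y ^ k / fact k" "{k}"] ex y by (simp add: sums_iff)
    hence yk: "y ^ k / fact k \<le> exp y" using ex by (simp add: sums_iff)
    have "norm (bessel_coeff \<nu> k * u ^ k) \<le> norm (rGamma (\<nu> + 1)) / (coeff_decay \<nu> ^ k * (fact k)\<^sup>2) * norm u ^ k"
      unfolding norm_mult norm_power using norm_bessel_coeff_le[OF assms(1)] by (intro mult_right_mono) auto
    also have "\<dots> = norm (rGamma (\<nu> + 1)) * ((y\<^sup>2) ^ k / (fact k)\<^sup>2)"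
      by (simp add: y(2) power_divide)
    also have "\<dots> = norm (rGamma (\<nu> + 1)) * ((y ^ k / fact k) * (y ^ k / fact k))"
      by (simp add: power2_eq_square power_mult_distrib)
    also have "\<dots> \<le> norm (rGamma (\<nu> + 1)) * (exp y * (y ^ k / fact k))"
      using y by (intro mult_left_mono mult_right_mono yk) auto
    finally show ?thesis by (simp add: mult_ac)
  qed
  have S: "(\<lambda>k. norm (rGamma (\<nu> + 1)) * exp y * (y ^ k / fact k)) sums (norm (rGamma (\<nu> + 1)) * exp y * exp y)"
    by (intro sums_mult ex)
  show sm: "summable (\<lambda>k. norm (bessel_coeff \<nu> k * u ^ k))"
    by (rule summable_comparison_test[OF _ sums_summable[OF S]]) (use le in auto)
  have "(\<Sum>k. norm (bessel_coeff \<nu> k * u ^ k)) \<le> norm (rGamma (\<nu> + 1)) * exp y * exp y"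
    using suminf_le[OF le sm sums_summable[OF S]] S by (simp add: sums_iff)
  thus "(\<Sum>k. norm (bessel_coeff \<nu> k * u ^ k)) \<le> norm (rGamma (\<nu> + 1)) * exp (2 * y)"
    by (simp add: mult_exp_exp mult.assoc)
qed

lemma bessel_I_eq:
  assumes "z \<noteq> 0" "Re \<nu> > - 1"
  shows "bessel_I \<nu> z = (z / 2) powr \<nu> * (\<Sum>k. bessel_coeff \<nu> k * (z\<^sup>2 / 4) ^ k)"
proof -
  have eq: "rGamma (of_nat k + \<nu> + 1) / fact k * (z / 2) powr (2 * of_nat k + \<nu>) =
        (z / 2) powr \<nu> * (bessel_coeff \<nu> k * (z\<^sup>2 / 4) ^ k)" for k
  proof -
    have "(z / 2) powr (2 * of_nat k + \<nu>) = (z / 2) powr of_nat (2 * k) * (z / 2) powr \<nu>"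
      by (simp add: powr_add)
    also have "(z / 2) powr of_nat (2 * k) = (z / 2) ^ (2 * k)"
      using assms by (subst powr_nat) simp
    also have "\<dots> = (z\<^sup>2 / 4) ^ k" by (simp add: power_mult power_divide)
    finally show ?thesis by (simp add: mult_ac bessel_coeff_def)
  qed
  show ?thesis unfolding bessel_I_def eq
    by (rule suminf_mult[OF summable_norm_cancel[OF bessel_coeff_summable(1)[OF assms(2)]]])
qed

lemma cosh_sqrt_sums:
  assumes "t \<ge> 0"
  shows "(\<lambda>k. (z\<^sup>2) ^ k / fact (2 * k) * of_real t ^ k) sums cosh (z * of_real (sqrt t) :: complex)"
proof -
  let ?w = "z * of_real (sqrt t)"
  have "(\<lambda>n. if even n then ?w ^ n /\<^sub>R fact n else 0) sums cosh ?w" by (rule cosh_converges)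
  moreover have "strict_mono (\<lambda>k. 2 * k :: nat)" by (auto simp: strict_mono_def)
  moreover have "(if even n then ?w ^ n /\<^sub>R fact n else 0) = 0" if "n \<notin> range (\<lambda>k. 2 * k)" for n
    using that by (metis evenE rangeI)
  ultimately have "(\<lambda>k. ?w ^ (2 * k) /\<^sub>R fact (2 * k)) sums cosh ?w"
    using sums_mono_reindex[of "\<lambda>k. 2 * k" "\<lambda>n. if even n then ?w ^ n /\<^sub>R fact n else 0" "cosh ?w"]
    by auto
  moreover have "?w ^ (2 * k) /\<^sub>R fact (2 * k) = (z\<^sup>2) ^ k / fact (2 * k) * of_real t ^ k" for k
  proof -
    have "?w\<^sup>2 = z\<^sup>2 * of_real t"
      using assms by (simp add: power_mult_distrib flip: of_real_power)
    hence "?w ^ (2 * k) = (z\<^sup>2) ^ k * of_real t ^ k" by (metis power_mult power_mult_distrib)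
    thus ?thesis by (simp add: scaleR_conv_of_real field_simps)
  qed
  ultimately show ?thesis by (simp only:)
qed

lemma norm_cosh_le: "norm (cosh (w :: complex)) \<le> exp \<bar>Re w\<bar>"
proof -
  have "norm (cosh w) = norm (exp w + exp (- w)) / 2"
    unfolding cosh_field_def by (simp add: norm_divide)
  also have "\<dots> \<le> (exp (Re w) + exp (- Re w)) / 2"
    using norm_triangle_ineq[of "exp w" "exp (- w)"] by (simp add: norm_exp_eq_Re)
  also have "\<dots> \<le> exp \<bar>Re w\<bar>" by (cases "Re w \<ge> 0") auto
  finally show ?thesis .
qed

text \<open>Poisson's integral. In contrast to the power series it shows growth like \<open>exp |Re z|\<close> rather than \<open>exp |z|\<close>.\<close>

lemma bessel_I_Poisson:
  assumes "Re \<nu> > - 1/2"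
  defines "M \<equiv> lborel_on {0<..<1}"
  shows "(\<lambda>k. bessel_coeff \<nu> k * (z\<^sup>2 / 4) ^ k) sums
           (rGamma (\<nu> + 1/2) / of_real (sqrt pi) *
            integral\<^sup>L M (\<lambda>t. beta_kernel (1/2) (\<nu> + 1/2) t * cosh (z * of_real (sqrt t))))"
    and "integrable M (\<lambda>t. beta_kernel (1/2) (\<nu> + 1/2) t * cosh (z * of_real (sqrt t)))"
proof -
  define c where "c k = (z\<^sup>2) ^ k / fact (2 * k)" for k
  have p: "Re (1/2) > 0" and q: "Re (\<nu> + 1/2) > 0" using assms by auto
  have "(\<lambda>k. norm (c k)) = (\<lambda>k. ((of_real (norm z))\<^sup>2) ^ k / fact (2 * k) * of_real 1 ^ k)"
    by (auto simp: c_def norm_divide norm_power)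
  have c_sum: "summable (\<lambda>k. norm (c k))"
  proof (rule summable_comparison_test)
    show "summable (\<lambda>k. norm (z\<^sup>2) ^ k / fact k)" using summable_exp[of "norm (z\<^sup>2)"] by (simp add: field_simps)
    have "(fact k :: real) \<le> fact (2 * k)" for k by (intro fact_mono) auto
    thus "\<exists>N. \<forall>k\<ge>N. norm (norm (c k)) \<le> norm (z\<^sup>2) ^ k / fact k"
      by (auto simp: c_def norm_divide norm_power intro!: divide_left_mono)
  qed
  have C: "(\<Sum>k. c k * of_real t ^ k) = cosh (z * of_real (sqrt t))" if "t \<in> {0<..<1}" for t
    using cosh_sqrt_sums[of t z] that by (simp add: c_def sums_iff)
  have Beq: "c k * Beta (1/2 + of_nat k) (\<nu> + 1/2) =
        of_real (sqrt pi) * Gamma (\<nu> + 1/2) * (bessel_coeff \<nu> k * (z\<^sup>2 / 4) ^ k)" for k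
  proof -
    have "Gamma (1/2 + of_nat k) = pochhammer (1/2) k * (of_real (sqrt pi) :: complex)"
      by (subst pochhammer_Gamma) (simp_all add: Gamma_one_half_complex Re_pos_notin_nonpos_Ints)
    moreover have "(fact (2 * k) :: complex) = 2 ^ (2 * k) * pochhammer (1/2) k * fact k" by (rule fact_double)
    moreover have "pochhammer (1/2 :: complex) k \<noteq> 0"
      using fact_double[of k, where ?'a = complex] fact_nonzero[of "2 * k", where ?'a = complex] by (metis mult_zero_left mult_zero_right)
    moreover have "1/2 + of_nat k + (\<nu> + 1/2) = of_nat k + \<nu> + 1" by simp
    moreover have "(2 :: complex) ^ (2 * k) = 4 ^ k" by (simp add: power_mult)
    ultimately show ?thesis
      unfolding c_def Beta_altdef bessel_coeff_def by (simp add: power_divide add_ac mult_ac)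
  qed
  note B = beta_integral_power_series[OF p q c_sum]
  have eqI: "integral\<^sup>L M (\<lambda>t. beta_kernel (1/2) (\<nu> + 1/2) t * (\<Sum>k. c k * of_real t ^ k)) =
        integral\<^sup>L M (\<lambda>t. beta_kernel (1/2) (\<nu> + 1/2) t * cosh (z * of_real (sqrt t)))"
    by (rule Bochner_Integration.integral_cong) (simp_all add: C M_def)
  have G: "Gamma (\<nu> + 1/2) \<noteq> 0"
    using Re_pos_notin_nonpos_Ints[OF q] by (simp add: Gamma_eq_zero_iff)
  have "(\<lambda>k. of_real (sqrt pi) * Gamma (\<nu> + 1/2) * (bessel_coeff \<nu> k * (z\<^sup>2 / 4) ^ k)) sums
        integral\<^sup>L M (\<lambda>t. beta_kernel (1/2) (\<nu> + 1/2) t * cosh (z * of_real (sqrt t)))"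
    using B(2) unfolding Beq M_def[symmetric] eqI .
  from sums_mult[OF this, of "rGamma (\<nu> + 1/2) / of_real (sqrt pi)"]
  show "(\<lambda>k. bessel_coeff \<nu> k * (z\<^sup>2 / 4) ^ k) sums
           (rGamma (\<nu> + 1/2) / of_real (sqrt pi) *
            integral\<^sup>L M (\<lambda>t. beta_kernel (1/2) (\<nu> + 1/2) t * cosh (z * of_real (sqrt t))))"
    using G by (simp add: rGamma_inverse_Gamma mult.assoc[symmetric])
  have "integrable M (\<lambda>t. beta_kernel (1/2) (\<nu> + 1/2) t * (\<Sum>k. c k * of_real t ^ k)) \<longleftrightarrow>
        integrable M (\<lambda>t. beta_kernel (1/2) (\<nu> + 1/2) t * cosh (z * of_real (sqrt t)))"
    by (rule Bochner_Integration.integrable_cong) (simp_all add: C M_def)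
  thus "integrable M (\<lambda>t. beta_kernel (1/2) (\<nu> + 1/2) t * cosh (z * of_real (sqrt t)))"
    using B(1) by (simp add: M_def)
qed

definition poisson_const :: "complex \<Rightarrow> real" where
  "poisson_const \<nu> = norm (rGamma (\<nu> + 1/2)) / sqrt pi * integral\<^sup>L (lborel_on {0<..<1}) (\<lambda>t. norm (beta_kernel (1/2) (\<nu> + 1/2) t))"

lemma poisson_const_nonneg: "poisson_const \<nu> \<ge> 0"
  unfolding poisson_const_def
  by (intro mult_nonneg_nonneg divide_nonneg_nonneg Bochner_Integration.integral_nonneg norm_ge_zero) simp

lemma bessel_series_bound:
  assumes "Re \<nu> > - 1/2"
  shows "norm (\<Sum>k. bessel_coeff \<nu> k * (z\<^sup>2 / 4) ^ k) \<le> poisson_const \<nu> * exp \<bar>Re z\<bar>"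
proof -
  let ?M = "lborel_on {0<..<1::real}"
  let ?f = "\<lambda>t. beta_kernel (1/2) (\<nu> + 1/2) t * cosh (z * of_real (sqrt t))"
  have p: "Re (1/2) > 0" and q: "Re (\<nu> + 1/2) > 0" using assms by auto
  have "norm (integral\<^sup>L ?M ?f) \<le> integral\<^sup>L ?M (\<lambda>t. norm (?f t))" by (rule integral_norm_bound)
  also have "\<dots> \<le> integral\<^sup>L ?M (\<lambda>t. norm (beta_kernel (1/2) (\<nu> + 1/2) t) * exp \<bar>Re z\<bar>)"
  proof (rule integral_mono)
    show "integrable ?M (\<lambda>t. norm (?f t))" using bessel_I_Poisson(2)[OF assms] by (rule integrable_norm)
    show "integrable ?M (\<lambda>t. norm (beta_kernel (1/2) (\<nu> + 1/2) t) * exp \<bar>Re z\<bar>)"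
      using integrable_norm_beta_kernel[OF p q] by auto
    fix t assume "t \<in> space ?M"
    hence t: "0 < t" "t < 1" by auto
    have "norm (cosh (z * of_real (sqrt t))) \<le> exp \<bar>Re (z * of_real (sqrt t))\<bar>" by (rule norm_cosh_le)
    also have "\<bar>Re (z * of_real (sqrt t))\<bar> \<le> \<bar>Re z\<bar>"
    proof -
      have "\<bar>Re (z * of_real (sqrt t))\<bar> = \<bar>Re z\<bar> * sqrt t" using t by (simp add: abs_mult)
      also have "\<dots> \<le> \<bar>Re z\<bar> * 1" using t by (intro mult_left_mono) auto
      finally show ?thesis by simp
    qed
    finally show "norm (?f t) \<le> norm (beta_kernel (1/2) (\<nu> + 1/2) t) * exp \<bar>Re z\<bar>"
      unfolding norm_mult by (intro mult_left_mono) auto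
  qed
  also have "\<dots> = integral\<^sup>L ?M (\<lambda>t. norm (beta_kernel (1/2) (\<nu> + 1/2) t)) * exp \<bar>Re z\<bar>" by simp
  finally have *: "norm (integral\<^sup>L ?M ?f) \<le> integral\<^sup>L ?M (\<lambda>t. norm (beta_kernel (1/2) (\<nu> + 1/2) t)) * exp \<bar>Re z\<bar>" .
  have "norm (\<Sum>k. bessel_coeff \<nu> k * (z\<^sup>2 / 4) ^ k) =
        norm (rGamma (\<nu> + 1/2)) / sqrt pi * norm (integral\<^sup>L ?M ?f)"
    unfolding sums_unique[OF bessel_I_Poisson(1)[OF assms, of z], symmetric] norm_mult norm_divide norm_of_real
    by simp
  also have "\<dots> \<le> norm (rGamma (\<nu> + 1/2)) / sqrt pi *
      (integral\<^sup>L ?M (\<lambda>t. norm (beta_kernel (1/2) (\<nu> + 1/2) t)) * exp \<bar>Re z\<bar>)"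
    by (intro mult_left_mono *) auto
  finally show ?thesis unfolding poisson_const_def by (simp only: mult.assoc)
qed

lemma norm_powr_le:
  assumes "w \<noteq> 0"
  shows "norm (w powr \<nu> :: complex) \<le> norm w powr Re \<nu> * exp (pi * \<bar>Im \<nu>\<bar>)"
proof -
  have "- (Im \<nu> * Im (Ln w)) \<le> \<bar>Im \<nu>\<bar> * \<bar>Im (Ln w)\<bar>" unfolding abs_mult[symmetric] by (rule abs_ge_minus_self)
  also have "\<dots> \<le> \<bar>Im \<nu>\<bar> * pi"
    using mpi_less_Im_Ln[OF assms] Im_Ln_le_pi[OF assms] by (intro mult_left_mono) auto
  finally have *: "- (Im \<nu> * Im (Ln w)) \<le> \<bar>Im \<nu>\<bar> * pi" .
  have "norm (w powr \<nu>) = exp (Re \<nu> * Re (Ln w) - Im \<nu> * Im (Ln w))"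
    using assms by (simp add: powr_def)
  also have "\<dots> = exp (Re \<nu> * ln (norm w)) * exp (- (Im \<nu> * Im (Ln w)))"
    using assms by (simp add: exp_diff exp_minus divide_inverse)
  also have "\<dots> \<le> exp (Re \<nu> * ln (norm w)) * exp (pi * \<bar>Im \<nu>\<bar>)"
    using * by (intro mult_left_mono) (simp_all add: mult.commute)
  also have "exp (Re \<nu> * ln (norm w)) = norm w powr Re \<nu>"
    using assms by (simp add: powr_def)
  finally show ?thesis .
qed

text \<open>The growth is governed by \<open>Re z\<close>, exactly compensated by the decay of \<open>K\<close>. This is what makes the moment
integral converge for every \<open>a\<close> with positive real part, whatever the size of \<open>a / b\<close>.\<close>

lemma bessel_I_bound:
  assumes "Re \<nu> > - 1/2" "z \<noteq> 0"
  shows "norm (bessel_I \<nu> z) \<le> norm (z / 2) powr Re \<nu> * exp (pi * \<bar>Im \<nu>\<bar>) * poisson_const \<nu> * exp \<bar>Re z\<bar>"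
proof -
  have "norm (bessel_I \<nu> z) \<le> (norm (z / 2) powr Re \<nu> * exp (pi * \<bar>Im \<nu>\<bar>)) * (poisson_const \<nu> * exp \<bar>Re z\<bar>)"
  proof -
    have "Re \<nu> > - 1" using assms by simp
    hence "bessel_I \<nu> z = (z / 2) powr \<nu> * (\<Sum>k. bessel_coeff \<nu> k * (z\<^sup>2 / 4) ^ k)"
      using assms by (intro bessel_I_eq)
    hence "norm (bessel_I \<nu> z) = norm ((z / 2) powr \<nu>) * norm (\<Sum>k. bessel_coeff \<nu> k * (z\<^sup>2 / 4) ^ k)"
      by (simp only: norm_mult)
    also have "\<dots> \<le> (norm (z / 2) powr Re \<nu> * exp (pi * \<bar>Im \<nu>\<bar>)) * (poisson_const \<nu> * exp \<bar>Re z\<bar>)"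
    proof (rule mult_mono)
      show "norm ((z / 2) powr \<nu>) \<le> norm (z / 2) powr Re \<nu> * exp (pi * \<bar>Im \<nu>\<bar>)"
        by (rule norm_powr_le) (use assms in simp)
      show "norm (\<Sum>k. bessel_coeff \<nu> k * (z\<^sup>2 / 4) ^ k) \<le> poisson_const \<nu> * exp \<bar>Re z\<bar>"
        by (rule bessel_series_bound[OF assms(1)])
    qed (simp_all)
    finally show ?thesis .
  qed
  thus ?thesis by (simp only: mult_ac)
qed

lemma bessel_I_holomorphic:
  assumes "Re \<nu> > - 1"
  shows "bessel_I \<nu> holomorphic_on {z. Re z > 0}"
proof -
  have ball: "(\<lambda>u. \<Sum>k. bessel_coeff \<nu> k * u ^ k) holomorphic_on ball 0 R" for R
    by (rule power_series_holomorphic[where a = "bessel_coeff \<nu>"])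
       (use summable_sums[OF summable_norm_cancel[OF bessel_coeff_summable(1)[OF assms]]] in simp)
  have entire: "(\<lambda>u. \<Sum>k. bessel_coeff \<nu> k * u ^ k) holomorphic_on UNIV"
    unfolding holomorphic_on_def
  proof
    fix u :: complex
    have "(\<lambda>u. \<Sum>k. bessel_coeff \<nu> k * u ^ k) field_differentiable at u"
      by (rule holomorphic_on_imp_differentiable_at[OF ball[of "norm u + 1"]]) auto
    thus "(\<lambda>u. \<Sum>k. bessel_coeff \<nu> k * u ^ k) field_differentiable at u within UNIV" by simp
  qed
  have "(\<lambda>z. (z / 2) powr \<nu> * ((\<lambda>u. \<Sum>k. bessel_coeff \<nu> k * u ^ k) \<circ> (\<lambda>z. z\<^sup>2 / 4)) z) holomorphic_on {z. Re z > 0}"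
    by (intro holomorphic_intros holomorphic_on_compose_gen[OF _ entire])
       (auto simp: complex_nonpos_Reals_iff)
  thus ?thesis
    by (rule holomorphic_transform) (subst bessel_I_eq, use assms in auto)
qed

lemma exp_minus_powr_bound:
  fixes y \<tau> :: real
  assumes "y \<ge> 0" "\<tau> > 0"
  shows "exp (- y) \<le> max \<tau> 1 powr max \<tau> 1 * (1 + y) powr (- \<tau>)"
proof -
  define n where "n = max \<tau> 1"
  have n: "n \<ge> 1" "n \<ge> \<tau>" by (auto simp: n_def)
  have "1 + y \<le> n * (1 + y / n)" using n by (simp add: algebra_simps)
  also have "\<dots> \<le> n * exp (y / n)" using n exp_ge_add_one_self[of "y / n"] by (intro mult_left_mono) auto
  finally have 1: "1 + y \<le> n * exp (y / n)" .
  have "(1 + y) powr \<tau> \<le> (1 + y) powr n" using assms n by (intro powr_mono) auto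
  also have "\<dots> \<le> (n * exp (y / n)) powr n" using assms n 1 by (intro powr_mono2) auto
  also have "\<dots> = n powr n * exp y" using n by (simp add: powr_mult powr_def[of "exp _"])
  finally have "(1 + y) powr \<tau> \<le> n powr n * exp y" .
  hence "exp (- y) * (1 + y) powr \<tau> \<le> exp (- y) * (n powr n * exp y)" by (intro mult_left_mono) auto
  also have "\<dots> = n powr n" by (simp add: exp_minus field_simps)
  finally have "exp (- y) * (1 + y) powr \<tau> \<le> n powr n" .
  moreover have "(1 + y) powr \<tau> > 0" using assms by simp
  ultimately show ?thesis
    by (simp add: n_def powr_minus field_simps)
qed

definition K_const :: "real \<Rightarrow> real" where
  "K_const \<tau> = max \<tau> 1 powr max \<tau> 1 * 2 powr \<tau>"

lemma K_const_nonneg: "K_const \<tau> \<ge> 0"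
  by (simp add: K_const_def)

text \<open>The factor \<open>exp (- x)\<close> is the decay at infinity and the power of \<open>x\<close> the singularity at 0. The remaining factor
makes the bound integrable in \<open>t\<close>; it comes from spending \<open>x (cosh t - 1)\<close> on a power of \<open>exp t\<close>.\<close>

lemma exp_cosh_le:
  assumes x: "x > 0" and t: "t \<ge> 0" and \<tau>: "\<tau> > 0"
  shows "exp (- x * cosh t) * exp (\<sigma> * t) \<le> K_const \<tau> * exp (- x) * (1 + x powr (- \<tau>)) * exp (- (\<tau> - \<sigma>) * t)"
proof -
  define C where "C = max \<tau> 1 powr max \<tau> 1"
  have C: "C \<ge> 0" by (simp add: C_def)
  have c1: "cosh t \<ge> 1" by (rule cosh_real_ge_1)
  have c2: "cosh t \<ge> exp t / 2" by (simp add: cosh_def)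
  define y where "y = x * (cosh t - 1)"
  have y: "y \<ge> 0" using x c1 by (simp add: y_def)
  have y1: "(1 + y) powr (- \<tau>) \<le> (1 + x powr (- \<tau>)) * cosh t powr (- \<tau>)"
  proof (cases "x \<ge> 1")
    case True
    have "cosh t \<le> 1 + y" using True c1 mult_right_mono[of 1 x "cosh t - 1"] by (simp add: y_def)
    hence "(1 + y) powr (- \<tau>) \<le> cosh t powr (- \<tau>)"
      using c1 \<tau> by (intro powr_mono2') auto
    also have "\<dots> \<le> (1 + x powr (- \<tau>)) * cosh t powr (- \<tau>)" by (simp add: distrib_right)
    finally show ?thesis .
  next
    case False
    have "x * cosh t \<le> 1 + y" using False by (simp add: y_def algebra_simps)
    hence "(1 + y) powr (- \<tau>) \<le> (x * cosh t) powr (- \<tau>)"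
      using c1 x \<tau> by (intro powr_mono2') auto
    also have "\<dots> = x powr (- \<tau>) * cosh t powr (- \<tau>)" by (rule powr_mult)
    also have "\<dots> \<le> (1 + x powr (- \<tau>)) * cosh t powr (- \<tau>)" by (simp add: distrib_right)
    finally show ?thesis .
  qed
  have "cosh t powr (- \<tau>) \<le> (exp t / 2) powr (- \<tau>)"
    using c2 \<tau> by (intro powr_mono2') auto
  also have "(exp t / 2) powr (- \<tau>) = exp (\<tau> * ln 2 - \<tau> * t)"
    by (simp add: powr_def ln_div algebra_simps)
  also have "\<dots> = 2 powr \<tau> * exp (- \<tau> * t)"
    by (simp add: powr_def exp_diff exp_minus divide_inverse)
  finally have "cosh t powr (- \<tau>) \<le> 2 powr \<tau> * exp (- \<tau> * t)" .
  hence "(1 + x powr (- \<tau>)) * cosh t powr (- \<tau>) \<le> (1 + x powr (- \<tau>)) * (2 powr \<tau> * exp (- \<tau> * t))"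
    by (intro mult_left_mono) auto
  with y1 have 1: "(1 + y) powr (- \<tau>) \<le> (1 + x powr (- \<tau>)) * (2 powr \<tau> * exp (- \<tau> * t))"
    by (rule order_trans)
  have "exp (- x * cosh t) = exp (- x) * exp (- y)" unfolding y_def exp_add[symmetric] by (simp add: algebra_simps)
  also have "\<dots> \<le> exp (- x) * (C * (1 + y) powr (- \<tau>))"
    using exp_minus_powr_bound[OF y \<tau>] by (intro mult_left_mono) (auto simp: C_def)
  also have "\<dots> \<le> exp (- x) * (C * ((1 + x powr (- \<tau>)) * (2 powr \<tau> * exp (- \<tau> * t))))"
    using C 1 by (intro mult_left_mono) auto
  finally have "exp (- x * cosh t) * exp (\<sigma> * t) \<le>
      exp (- x) * (C * ((1 + x powr (- \<tau>)) * (2 powr \<tau> * exp (- \<tau> * t)))) * exp (\<sigma> * t)"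
    by (intro mult_right_mono) auto
  also have "\<dots> = K_const \<tau> * exp (- x) * (1 + x powr (- \<tau>)) * (exp (- \<tau> * t) * exp (\<sigma> * t))"
    by (simp add: K_const_def C_def mult_ac)
  also have "exp (- \<tau> * t) * exp (\<sigma> * t) = exp (- (\<tau> - \<sigma>) * t)"
    unfolding exp_add[symmetric] by (simp add: algebra_simps)
  finally show ?thesis .
qed

lemma integrable_exp_decay:
  assumes "(a::real) > 0"
  shows "integrable (lborel_on {0..}) (\<lambda>t. exp (- a * t))"
proof -
  have m: "(\<lambda>t. exp (- a * t)) \<in> borel_measurable (lborel_on {0..})"
    by (intro borel_measurable_lborel_on continuous_intros)
  have "(\<lambda>t. exp (- a * t)) integrable_on {0..}"
    using integrable_on_exp_minus_to_infinity[OF assms, of 0] by simp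
  hence "(\<lambda>t. exp (- a * t)) absolutely_integrable_on {0..}"
    by (subst absolutely_integrable_on_iff_nonneg) auto
  thus ?thesis using lborel_on_bridge(1)[OF _ m] by simp
qed

text \<open>Half of the integrand of \<open>K\<close>, with \<open>cosh\<close> split into its two exponentials.\<close>

definition K_kernel :: "complex \<Rightarrow> complex \<Rightarrow> real \<Rightarrow> complex" where
  "K_kernel \<nu> z t = exp (- z * cosh (of_real t)) * exp (\<nu> * of_real t)"

lemma norm_K_kernel: "norm (K_kernel \<nu> z t) = exp (- Re z * cosh t) * exp (Re \<nu> * t)"
proof -
  have "cosh (complex_of_real t) = of_real (cosh t)" by (simp add: cosh_field_def exp_of_real[symmetric] flip: exp_of_real of_real_minus)
  thus ?thesis by (simp add: K_kernel_def norm_mult)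
qed

lemma norm_K_kernel_le:
  assumes x: "0 < x" "x \<le> Re z" and t: "t \<ge> 0" and s: "Re \<nu> \<le> \<sigma>" and \<tau>: "\<tau> > 0"
  shows "norm (K_kernel \<nu> z t) \<le> K_const \<tau> * exp (- x) * (1 + x powr (- \<tau>)) * exp (- (\<tau> - \<sigma>) * t)"
proof -
  have "norm (K_kernel \<nu> z t) \<le> exp (- x * cosh t) * exp (\<sigma> * t)"
    unfolding norm_K_kernel using x t s cosh_real_ge_1[of t]
    by (intro mult_mono) (auto intro!: mult_right_mono)
  also have "\<dots> \<le> K_const \<tau> * exp (- x) * (1 + x powr (- \<tau>)) * exp (- (\<tau> - \<sigma>) * t)"
    by (rule exp_cosh_le[OF x(1) t \<tau>])
  finally show ?thesis .
qed

lemma K_kernel_measurable: "K_kernel \<nu> z \<in> borel_measurable (lborel_on S)"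
  unfolding K_kernel_def cosh_field_def by (intro borel_measurable_lborel_on continuous_intros) auto

lemma integrable_K_dominator:
  assumes "\<sigma> < \<tau>"
  shows "integrable (lborel_on {0..}) (\<lambda>t. K_const \<tau> * exp (- x) * (1 + x powr (- \<tau>)) * exp (- (\<tau> - \<sigma>) * t))"
  using integrable_exp_decay[of "\<tau> - \<sigma>"] assms by (intro integrable_mult_right) auto

lemma integrable_K_kernel:
  assumes "Re z > 0"
  shows "integrable (lborel_on {0..}) (K_kernel \<nu> z)"
proof -
  define \<tau> where "\<tau> = max (Re \<nu>) 0 + 1"
  have \<tau>: "\<tau> > 0" "Re \<nu> < \<tau>" by (auto simp: \<tau>_def)
  show ?thesis
  proof (rule Bochner_Integration.integrable_bound[OF integrable_K_dominator[OF \<tau>(2)] K_kernel_measurable], rule AE_I2)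
    fix t assume "t \<in> space (lborel_on {0..})"
    hence "norm (K_kernel \<nu> z t) \<le> K_const \<tau> * exp (- Re z) * (1 + Re z powr (- \<tau>)) * exp (- (\<tau> - Re \<nu>) * t)"
      using assms \<tau> by (intro norm_K_kernel_le) auto
    also have "\<dots> \<le> norm \<dots>" by simp
    finally show "norm (K_kernel \<nu> z t) \<le> norm (K_const \<tau> * exp (- Re z) * (1 + Re z powr (- \<tau>)) * exp (- (\<tau> - Re \<nu>) * t))" .
  qed
qed

lemma bessel_K_eq:
  assumes "Re z > 0"
  shows "bessel_K \<nu> z = (integral\<^sup>L (lborel_on {0..}) (K_kernel \<nu> z) + integral\<^sup>L (lborel_on {0..}) (K_kernel (- \<nu>) z)) / 2"
proof -
  have eq: "exp (- z * cosh (of_real t)) * cosh (\<nu> * of_real t) = (K_kernel \<nu> z t + K_kernel (- \<nu>) z t) / 2" for t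
    by (simp add: K_kernel_def cosh_field_def[of "\<nu> * _"] algebra_simps)
  have i: "integrable (lborel_on {0..}) (\<lambda>t. (K_kernel \<nu> z t + K_kernel (- \<nu>) z t) / 2)"
    using integrable_K_kernel[OF assms] by auto
  have "bessel_K \<nu> z = integral\<^sup>L (lborel_on {0..}) (\<lambda>t. (K_kernel \<nu> z t + K_kernel (- \<nu>) z t) / 2)"
    unfolding bessel_K_def eq
    by (rule lborel_on_bridge(2)[symmetric, OF _ borel_measurable_integrable[OF i] i]) auto
  also have "\<dots> = (integral\<^sup>L (lborel_on {0..}) (K_kernel \<nu> z) + integral\<^sup>L (lborel_on {0..}) (K_kernel (- \<nu>) z)) / 2"
    using integrable_K_kernel[OF assms] by simp
  finally show ?thesis .
qed

definition K_bound_const :: "real \<Rightarrow> real \<Rightarrow> real" where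
  "K_bound_const \<sigma> \<tau> = K_const \<tau> * integral\<^sup>L (lborel_on {0..}) (\<lambda>t. exp (- (\<tau> - \<sigma>) * t))"

lemma bessel_K_bound:
  assumes z: "Re z > 0" and \<nu>: "\<bar>Re \<nu>\<bar> \<le> \<sigma>" and \<sigma>: "\<sigma> < \<tau>"
  shows "norm (bessel_K \<nu> z) \<le> K_bound_const \<sigma> \<tau> * exp (- Re z) * (1 + Re z powr (- \<tau>))"
proof -
  let ?M = "lborel_on {0..}"
  define A where "A = K_const \<tau> * exp (- Re z) * (1 + Re z powr (- \<tau>))"
  have \<tau>: "\<tau> > 0" using \<nu> \<sigma> by auto
  have b: "norm (integral\<^sup>L ?M (K_kernel \<mu> z)) \<le> A * integral\<^sup>L ?M (\<lambda>t. exp (- (\<tau> - \<sigma>) * t))"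
    if "Re \<mu> \<le> \<sigma>" for \<mu>
  proof -
    have "norm (integral\<^sup>L ?M (K_kernel \<mu> z)) \<le> integral\<^sup>L ?M (\<lambda>t. norm (K_kernel \<mu> z t))" by (rule integral_norm_bound)
    also have "\<dots> \<le> integral\<^sup>L ?M (\<lambda>t. A * exp (- (\<tau> - \<sigma>) * t))"
      unfolding A_def
      by (rule integral_mono[OF integrable_norm[OF integrable_K_kernel[OF z]] integrable_K_dominator[OF \<sigma>]],
          rule norm_K_kernel_le[OF z order_refl _ that \<tau>]) simp
    finally show ?thesis by simp
  qed
  have "norm (bessel_K \<nu> z) \<le> (norm (integral\<^sup>L ?M (K_kernel \<nu> z)) + norm (integral\<^sup>L ?M (K_kernel (- \<nu>) z))) / 2"
    unfolding bessel_K_eq[OF z] norm_divide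
    using norm_triangle_ineq[of "integral\<^sup>L ?M (K_kernel \<nu> z)" "integral\<^sup>L ?M (K_kernel (- \<nu>) z)"] by simp
  also have "\<dots> \<le> A * integral\<^sup>L ?M (\<lambda>t. exp (- (\<tau> - \<sigma>) * t))"
  proof -
    have "Re \<nu> \<le> \<sigma>" "Re (- \<nu>) \<le> \<sigma>" using \<nu> by auto
    moreover have "(x + y) / 2 \<le> c" if "x \<le> c" "y \<le> c" for x y c :: real using that by simp
    ultimately show ?thesis using b by blast
  qed
  also have "\<dots> = K_bound_const \<sigma> \<tau> * exp (- Re z) * (1 + Re z powr (- \<tau>))"
    unfolding A_def K_bound_const_def by (simp only: mult_ac)
  finally show ?thesis .
qed

lemma K_bound_const_nonneg: "K_bound_const \<sigma> \<tau> \<ge> 0"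
  unfolding K_bound_const_def
  by (intro mult_nonneg_nonneg K_const_nonneg Bochner_Integration.integral_nonneg) simp

lemma bessel_K_holomorphic: "bessel_K \<nu> holomorphic_on {z. Re z > 0}"
proof -
  have hol: "(\<lambda>z. integral\<^sup>L (lborel_on {0..}) (\<lambda>t. K_kernel \<mu> z t)) holomorphic_on {z. Re z > 0}" for \<mu>
  proof (rule holomorphic_on_parameter_integral)
    show "open {z. Re z > 0}" by (rule open_halfspace_Re_gt)
    show "(\<lambda>z. K_kernel \<mu> z t) holomorphic_on {z. Re z > 0}" for t
      unfolding K_kernel_def by (intro holomorphic_intros)
    show "(\<lambda>t. K_kernel \<mu> z t) \<in> borel_measurable (lborel_on {0..})" for z by (rule K_kernel_measurable)
    fix z assume "z \<in> {z. Re z > 0}"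
    hence z: "Re z > 0" by simp
    have near: "Re z / 2 \<le> Re w" if "w \<in> ball z (Re z / 2)" for w
      using that abs_Re_le_cmod[of "z - w"] by (auto simp: dist_norm abs_le_iff)
    define \<tau> where "\<tau> = max (Re \<mu>) 0 + 1"
    have \<tau>: "\<tau> > 0" "Re \<mu> < \<tau>" by (auto simp: \<tau>_def)
    show "\<exists>r>0. \<exists>g. integrable (lborel_on {0..}) g \<and> ball z r \<subseteq> {z. Re z > 0} \<and>
            (\<forall>t\<in>space (lborel_on {0..}). \<forall>w\<in>ball z r. norm (K_kernel \<mu> w t) \<le> g t)"
    proof (rule exI[of _ "Re z / 2"], rule conjI, use z in simp, rule exI, intro conjI ballI)
      show "integrable (lborel_on {0..}) (\<lambda>t. K_const \<tau> * exp (- (Re z / 2)) * (1 + (Re z / 2) powr (- \<tau>)) * exp (- (\<tau> - Re \<mu>) * t))"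
        by (rule integrable_K_dominator[OF \<tau>(2)])
      show "ball z (Re z / 2) \<subseteq> {z. Re z > 0}" using near z by force
      show "norm (K_kernel \<mu> w t) \<le> K_const \<tau> * exp (- (Re z / 2)) * (1 + (Re z / 2) powr (- \<tau>)) * exp (- (\<tau> - Re \<mu>) * t)"
        if "t \<in> space (lborel_on {0..})" "w \<in> ball z (Re z / 2)" for t w
        using that near z \<tau> by (intro norm_K_kernel_le) auto
    qed
  qed
  have "(\<lambda>z. (integral\<^sup>L (lborel_on {0..}) (K_kernel \<nu> z) + integral\<^sup>L (lborel_on {0..}) (K_kernel (- \<nu>) z)) / 2) holomorphic_on {z. Re z > 0}"
    by (intro holomorphic_intros hol) auto
  thus ?thesis by (rule holomorphic_transform) (simp add: bessel_K_eq)
qed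

lemma Gamma_kernel_integrable:
  assumes s: "Re s > 0" and b: "Re b > 0"
  shows "integrable (lborel_on {0<..}) (\<lambda>x. of_real x powr (s - 1) * exp (- b * of_real x))"
proof -
  have m: "(\<lambda>x. of_real x powr (s - 1) * exp (- c * of_real x)) \<in> borel_measurable (lborel_on {0<..})" for c :: complex
    by (intro borel_measurable_lborel_on continuous_intros) (auto simp: complex_nonpos_Reals_iff)
  have "(\<lambda>t. complex_of_real t powr (s - 1) / of_real (exp (Re b * t))) absolutely_integrable_on {0<..}"
    by (rule absolutely_integrable_Gamma_integral[OF s b])
  hence "(\<lambda>t. complex_of_real t powr (s - 1) * exp (- of_real (Re b) * of_real t)) absolutely_integrable_on {0<..}"
    by (simp add: exp_minus field_simps flip: exp_of_real)
  hence i: "integrable (lborel_on {0<..}) (\<lambda>t. complex_of_real t powr (s - 1) * exp (- of_real (Re b) * of_real t))"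
    using lborel_on_bridge(1)[OF _ m] by simp
  show ?thesis
    by (rule Bochner_Integration.integrable_bound[OF i m]) (auto simp: norm_mult)
qed

lemma Gamma_integral_scaled:
  assumes s: "Re s > 0" and b: "Re b > 0"
  shows "integral\<^sup>L (lborel_on {0<..}) (\<lambda>x. of_real x powr (s - 1) * exp (- b * of_real x)) = Gamma s * b powr (- s)"
proof -
  let ?F = "\<lambda>b. integral\<^sup>L (lborel_on {0<..}) (\<lambda>x. of_real x powr (s - 1) * exp (- b * of_real x))"
  have hol: "?F holomorphic_on {b. Re b > 0}"
  proof (rule holomorphic_on_parameter_integral)
    show "open {z. Re z > 0}" by (rule open_halfspace_Re_gt)
    show "(\<lambda>b. of_real x powr (s - 1) * exp (- b * of_real x)) holomorphic_on {z. Re z > 0}" for x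
      by (intro holomorphic_intros)
    show "(\<lambda>x. of_real x powr (s - 1) * exp (- b * of_real x)) \<in> borel_measurable (lborel_on {0<..})"
      if "b \<in> {z. Re z > 0}" for b
      using Gamma_kernel_integrable[OF s, of b] that by auto
    fix z assume "z \<in> {z. Re z > 0}"
    hence z: "Re z > 0" by simp
    have near: "Re z / 2 \<le> Re w" if "w \<in> ball z (Re z / 2)" for w
      using that abs_Re_le_cmod[of "z - w"] by (auto simp: dist_norm abs_le_iff)
    show "\<exists>r>0. \<exists>g. integrable (lborel_on {0<..}) g \<and> ball z r \<subseteq> {z. Re z > 0} \<and>
            (\<forall>t\<in>space (lborel_on {0<..}). \<forall>w\<in>ball z r. norm (of_real t powr (s - 1) * exp (- w * of_real t)) \<le> g t)"
    proof (rule exI[of _ "Re z / 2"], rule conjI, use z in simp, rule exI, intro conjI ballI)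
      show "integrable (lborel_on {0<..}) (\<lambda>x. norm (of_real x powr (s - 1) * exp (- of_real (Re z / 2) * of_real x)))"
        using z by (intro integrable_norm Gamma_kernel_integrable s) auto
      show "ball z (Re z / 2) \<subseteq> {z. Re z > 0}" using near z by force
      show "norm (of_real t powr (s - 1) * exp (- w * of_real t)) \<le> norm (of_real t powr (s - 1) * exp (- of_real (Re z / 2) * of_real t))"
        if "t \<in> space (lborel_on {0<..})" "w \<in> ball z (Re z / 2)" for t w
        unfolding norm_mult using that near[of w] by (intro mult_left_mono) (auto intro: mult_right_mono)
    qed
  qed
  have G1: "?F 1 = Gamma s"
  proof -
    have "((\<lambda>t. of_real t powr (s - 1) * exp (- 1 * of_real t)) has_integral Gamma s) {0<..}"
      using Gamma_integral_complex'[OF s] by (simp add: exp_minus field_simps flip: exp_of_real)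
    moreover have "((\<lambda>t. of_real t powr (s - 1) * exp (- 1 * of_real t)) has_integral ?F 1) {0<..}"
      using Gamma_kernel_integrable[OF s, of 1] by (intro lborel_on_bridge(3)) auto
    ultimately show ?thesis by (rule has_integral_unique[symmetric])
  qed
  have real: "?F (of_real r) = Gamma s * of_real r powr (- s)" if r: "r > 0" for r
  proof -
    define f where "f x = indicator {0<..} x *\<^sub>R (complex_of_real x powr (s - 1) * exp (- 1 * of_real x))" for x
    have "Gamma s = (\<integral>x. f x \<partial>lborel)"
      unfolding G1[symmetric] f_def by (subst integral_restrict_space) auto
    also have "\<dots> = \<bar>r\<bar> *\<^sub>R (\<integral>x. f (0 + r * x) \<partial>lborel)" using r by (intro lborel_integral_real_affine) auto
    also have "(\<integral>x. f (0 + r * x) \<partial>lborel) = (\<integral>x. indicator {0<..} x *\<^sub>R (of_real r powr (s - 1) * (of_real x powr (s - 1) * exp (- of_real r * of_real x))) \<partial>lborel)"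
      using r by (intro Bochner_Integration.integral_cong) (auto simp: f_def indicator_def zero_less_mult_iff powr_times_real mult_ac)
    also have "\<dots> = integral\<^sup>L (lborel_on {0<..}) (\<lambda>x. of_real r powr (s - 1) * (of_real x powr (s - 1) * exp (- of_real r * of_real x)))"
      by (subst integral_restrict_space) auto
    also have "\<dots> = of_real r powr (s - 1) * ?F (of_real r)" by simp
    finally have "Gamma s = (of_real r * of_real r powr (s - 1)) * ?F (of_real r)"
      using r by (simp add: scaleR_conv_of_real mult_ac)
    also have "complex_of_real r * of_real r powr (s - 1) = of_real r powr s"
      using r by (simp add: powr_diff)
    finally show ?thesis using r by (simp add: powr_minus field_simps)
  qed
  show ?thesis
    by (rule holomorphic_eq_of_eq_on_reals[OF hol, of _ 0 1])
       (use b real in \<open>auto simp: open_halfspace_Re_gt convex_halfspace_Re_gt complex_nonpos_Reals_iff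
          intro!: holomorphic_intros convex_connected\<close>)
qed

section \<open>The connection formula between I and K, and products of I\<close>

lemma lborel_on_split:
  fixes f :: "real \<Rightarrow> 'a::{banach, second_countable_topology}"
  assumes [simp]: "A \<in> sets borel" "B \<in> sets borel" and disj: "A \<inter> B = {}"
    and f: "integrable (lborel_on (A \<union> B)) f"
  shows "integral\<^sup>L (lborel_on (A \<union> B)) f = integral\<^sup>L (lborel_on A) f + integral\<^sup>L (lborel_on B) f"
proof -
  have i: "set_integrable lborel (A \<union> B) f"
    using f unfolding set_integrable_def by (subst (asm) integrable_restrict_space) auto
  have iA: "set_integrable lborel A f" and iB: "set_integrable lborel B f"
    by (rule set_integrable_subset[OF i]; simp)+
  have c: "integral\<^sup>L (lborel_on C) f = (LINT x:C|lborel. f x)" if "C \<in> sets borel" for C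
    unfolding set_lebesgue_integral_def using that by (subst integral_restrict_space) auto
  have "A \<union> B \<in> sets borel" by (rule sets.Un[OF assms(1,2)])
  thus ?thesis using set_integral_Un[OF disj iA iB] by (simp only: c assms(1,2))
qed

lemma lborel_on_truncation_tendsto:
  fixes f :: "real \<Rightarrow> 'a::{banach, second_countable_topology}"
  assumes f: "integrable (lborel_on {0..}) f"
  shows "(\<lambda>n. integral\<^sup>L (lborel_on {0..real n}) f) \<longlonglongrightarrow> integral\<^sup>L (lborel_on {0..}) f"
proof -
  have i: "integrable lborel (\<lambda>x. indicator {0..} x *\<^sub>R f x)"
    using f by (subst (asm) integrable_restrict_space) auto
  have "(\<lambda>n. integral\<^sup>L lborel (\<lambda>x. indicator {..real n} x *\<^sub>R (indicator {0..} x *\<^sub>R f x))) \<longlonglongrightarrow>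
        integral\<^sup>L lborel (\<lambda>x. indicator {0..} x *\<^sub>R f x)"
  proof (rule integral_dominated_convergence[where w = "\<lambda>x. norm (indicator {0..} x *\<^sub>R f x)"])
    show "AE x in lborel. (\<lambda>n. indicator {..real n} x *\<^sub>R (indicator {0..} x *\<^sub>R f x)) \<longlonglongrightarrow> indicator {0..} x *\<^sub>R f x"
    proof (rule AE_I2)
      fix x :: real
      obtain N where N: "x \<le> real N" using real_arch_simple by blast
      have "eventually (\<lambda>n. indicator {..real n} x *\<^sub>R (indicator {0..} x *\<^sub>R f x) = indicator {0..} x *\<^sub>R f x) sequentially"
        using eventually_ge_at_top[of N] by eventually_elim (use N in auto)
      thus "(\<lambda>n. indicator {..real n} x *\<^sub>R (indicator {0..} x *\<^sub>R f x)) \<longlonglongrightarrow> indicator {0..} x *\<^sub>R f x"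
        by (rule tendsto_eventually)
    qed
    show m: "(\<lambda>x. indicator {0..} x *\<^sub>R f x) \<in> borel_measurable lborel"
      using i by (rule borel_measurable_integrable)
    show "(\<lambda>x. indicator {..real n} x *\<^sub>R (indicator {0..} x *\<^sub>R f x)) \<in> borel_measurable lborel" for n
      by (rule borel_measurable_scaleR[OF borel_measurable_indicator m]) simp
    show "integrable lborel (\<lambda>x. norm (indicator {0..} x *\<^sub>R f x))" using i by (rule integrable_norm)
    show "AE x in lborel. norm (indicator {..real n} x *\<^sub>R (indicator {0..} x *\<^sub>R f x)) \<le> norm (indicator {0..} x *\<^sub>R f x)" for n
      by (rule AE_I2) (simp add: indicator_def)
  qed
  moreover have "integral\<^sup>L lborel (\<lambda>x. indicator {..real n} x *\<^sub>R (indicator {0..} x *\<^sub>R f x)) = integral\<^sup>L (lborel_on {0..real n}) f" for n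
    by (subst integral_restrict_space) (auto intro!: Bochner_Integration.integral_cong simp: indicator_def)
  moreover have "integral\<^sup>L lborel (\<lambda>x. indicator {0..} x *\<^sub>R f x) = integral\<^sup>L (lborel_on {0..}) f"
    by (subst integral_restrict_space) auto
  ultimately show ?thesis by simp
qed

text \<open>After the substitution \<open>v = \<rho> e\<^sup>t\<close> this is the integrand of the incomplete Gamma function.\<close>

definition J_kernel :: "real \<Rightarrow> complex \<Rightarrow> real \<Rightarrow> complex" where
  "J_kernel \<rho> s t = exp (- of_real \<rho> * exp (of_real t)) * exp (s * of_real t)"

text \<open>The upper incomplete Gamma function at \<open>s\<close> and \<open>\<rho>\<close>, divided by \<open>\<rho>\<close> to the power \<open>s\<close>.\<close>

definition J_int :: "real \<Rightarrow> complex \<Rightarrow> complex" where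
  "J_int \<rho> s = integral\<^sup>L (lborel_on {0..}) (J_kernel \<rho> s)"

text \<open>The lower incomplete Gamma function, with the same normalisation as \<open>J_int\<close>, by its power series. The series makes sense
for all \<open>s\<close> outside the nonpositive integers.\<close>

definition J_series :: "real \<Rightarrow> complex \<Rightarrow> complex" where
  "J_series \<rho> s = (\<Sum>n. (- of_real \<rho>) ^ n / (fact n * (of_nat n + s)))"

lemma norm_J_kernel_le:
  assumes "\<rho> > 0" "t \<ge> 0"
  shows "norm (J_kernel \<rho> s t) \<le> norm (K_kernel s (of_real \<rho>) t)"
proof -
  have "cosh t \<le> exp t" using assms by (simp add: cosh_def)
  hence "\<rho> * cosh t \<le> \<rho> * exp t" using assms by (intro mult_left_mono) auto
  moreover have "Re (exp (complex_of_real t)) = exp t" by (simp add: exp_of_real)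
  ultimately show ?thesis
    unfolding norm_K_kernel by (simp add: J_kernel_def norm_mult)
qed

lemma J_kernel_measurable: "J_kernel \<rho> s \<in> borel_measurable (lborel_on S)"
  unfolding J_kernel_def by (intro borel_measurable_lborel_on continuous_intros)

lemma J_kernel_integrable:
  assumes "\<rho> > 0"
  shows "integrable (lborel_on {0..}) (J_kernel \<rho> s)"
proof (rule Bochner_Integration.integrable_bound[OF integrable_norm[OF integrable_K_kernel] J_kernel_measurable])
  show "Re (of_real \<rho>) > 0" using assms by simp
  show "AE t in lborel_on {0..}. norm (J_kernel \<rho> s t) \<le> norm (norm (K_kernel s (of_real \<rho>) t))"
    by (rule AE_I2) (use norm_J_kernel_le[OF assms] in simp)
qed

lemma J_int_recurrence:
  assumes \<rho>: "\<rho> > 0"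
  shows "s * J_int \<rho> s = of_real \<rho> * J_int \<rho> (s + 1) - exp (- of_real \<rho>)"
proof -
  define F where "F = J_kernel \<rho> s"
  define f where "f t = s * J_kernel \<rho> s t - of_real \<rho> * J_kernel \<rho> (s + 1) t" for t
  have der: "(F has_vector_derivative f t) (at t within A)" for t A
  proof -
    have "((\<lambda>z. exp (- of_real \<rho> * exp z) * exp (s * z)) has_field_derivative
            s * (exp (- of_real \<rho> * exp z) * exp (s * z)) - of_real \<rho> * (exp (- of_real \<rho> * exp z) * exp ((s + 1) * z))) (at z)" for z
      by (auto intro!: derivative_eq_intros simp: algebra_simps exp_add)
    from has_vector_derivative_real_field[OF this[of "of_real t"]]
    have "(F has_vector_derivative f t) (at t)"
      unfolding F_def f_def J_kernel_def[abs_def] by simp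
    thus ?thesis by (rule has_vector_derivative_at_within)
  qed
  have fi: "integrable (lborel_on {0..}) f"
    unfolding f_def using J_kernel_integrable[OF \<rho>] by auto
  have cf: "continuous_on A f" for A
    unfolding f_def J_kernel_def by (intro continuous_intros)
  have trunc: "integral\<^sup>L (lborel_on {0..real n}) f = F (real n) - F 0" for n
  proof -
    have "(f has_integral (F (real n) - F 0)) {0..real n}"
      by (rule fundamental_theorem_of_calculus) (auto intro: der)
    moreover have "integrable (lborel_on {0..real n}) f"
    proof -
      have "f absolutely_integrable_on {0..real n}"
        by (intro absolutely_integrable_continuous_real cf)
      thus ?thesis using lborel_on_bridge(1)[OF _ borel_measurable_lborel_on[OF cf]] by simp
    qed
    hence "(f has_integral integral\<^sup>L (lborel_on {0..real n}) f) {0..real n}"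
      by (intro lborel_on_bridge(3) borel_measurable_lborel_on cf) auto
    ultimately show ?thesis by (rule has_integral_unique[symmetric])
  qed
  have "(\<lambda>n. F (real n) - F 0) \<longlonglongrightarrow> integral\<^sup>L (lborel_on {0..}) f"
    using lborel_on_truncation_tendsto[OF fi] by (simp only: trunc)
  moreover have "(\<lambda>n. F (real n) - F 0) \<longlonglongrightarrow> 0 - F 0"
  proof (intro tendsto_diff tendsto_const)
    define \<tau> where "\<tau> = max (Re s) 0 + 1"
    define C where "C = K_const \<tau> * exp (- \<rho>) * (1 + \<rho> powr (- \<tau>))"
    have bd: "norm (F (real n)) \<le> C * exp (- real n)" for n
    proof -
      have "norm (F (real n)) \<le> norm (K_kernel s (of_real \<rho>) (real n))"
        unfolding F_def using \<rho> by (intro norm_J_kernel_le) auto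
      also have "\<dots> \<le> K_const \<tau> * exp (- \<rho>) * (1 + \<rho> powr (- \<tau>)) * exp (- (\<tau> - (\<tau> - 1)) * real n)"
        by (rule norm_K_kernel_le) (use \<rho> in \<open>auto simp: \<tau>_def\<close>)
      finally show ?thesis by (simp add: C_def)
    qed
    have lim: "(\<lambda>n. C * exp (- real n)) \<longlonglongrightarrow> 0" by real_asymp
    show "(\<lambda>n. F (real n)) \<longlonglongrightarrow> 0"
      by (rule Lim_null_comparison[OF always_eventually lim]) (simp add: bd)
  qed
  ultimately have "integral\<^sup>L (lborel_on {0..}) f = - F 0" using LIMSEQ_unique by fastforce
  moreover have "integral\<^sup>L (lborel_on {0..}) f = s * J_int \<rho> s - of_real \<rho> * J_int \<rho> (s + 1)"
    unfolding f_def J_int_def using J_kernel_integrable[OF \<rho>] by simp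
  moreover have "F 0 = exp (- of_real \<rho>)" by (simp add: F_def J_kernel_def)
  ultimately show ?thesis by (simp add: algebra_simps)
qed

lemma J_series_summable: "summable (\<lambda>n. norm ((- of_real \<rho>) ^ n / (fact n * (of_nat n + s)) :: complex))"
proof (rule summable_comparison_test_ev)
  show "summable (\<lambda>n. \<bar>\<rho>\<bar> ^ n / fact n)" using summable_exp[of "\<bar>\<rho>\<bar>"] by (simp add: field_simps)
  obtain N where N: "norm s + 1 \<le> real N" using real_arch_simple by blast
  show "eventually (\<lambda>n. norm (norm ((- of_real \<rho>) ^ n / (fact n * (of_nat n + s)) :: complex)) \<le> \<bar>\<rho>\<bar> ^ n / fact n) sequentially"
    using eventually_ge_at_top[of N]
  proof eventually_elim
    case (elim n)
    have "real n \<le> norm (of_nat n + s) + norm s"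
      using norm_triangle_ineq4[of "of_nat n + s" s] by simp
    hence "1 \<le> norm (of_nat n + s)" using N elim by (simp add: order_trans)
    hence "fact n * 1 \<le> fact n * norm (of_nat n + s)" by (intro mult_left_mono) auto
    hence "\<bar>\<rho>\<bar> ^ n / (fact n * norm (of_nat n + s)) \<le> \<bar>\<rho>\<bar> ^ n / fact n"
      by (intro divide_left_mono) (auto intro!: mult_pos_pos simp: less_le_trans[of 0 1])
    thus ?case by (simp add: norm_divide norm_mult norm_power)
  qed
qed

lemma J_series_recurrence:
  assumes "s \<notin> \<int>\<^sub>\<le>\<^sub>0"
  shows "s * J_series \<rho> s = of_real \<rho> * J_series \<rho> (s + 1) + exp (- of_real \<rho>)"
proof -
  define t where "t n = (- complex_of_real \<rho>) ^ n / fact n" for n :: nat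
  have nz: "of_nat n + s \<noteq> 0" for n
  proof
    assume "of_nat n + s = 0"
    from minus_unique[OF this] minus_of_nat_in_nonpos_Ints have "s \<in> \<int>\<^sub>\<le>\<^sub>0" by metis
    with assms show False by contradiction
  qed
  have sm: "summable (\<lambda>n. t n / (of_nat n + s))"
    using summable_norm_cancel[OF J_series_summable[of \<rho> s]] by (simp add: t_def)
  have ex: "t sums exp (- of_real \<rho>)" unfolding t_def using exp_converges[of "- complex_of_real \<rho>"]
    by (simp add: scaleR_conv_of_real field_simps)
  have e1: "t n - s * (t n / (of_nat n + s)) = of_nat n * t n / (of_nat n + s)" for n
    using nz[of n] by (simp add: field_simps)
  have "(\<lambda>n. t n - s * (t n / (of_nat n + s))) sums (exp (- of_real \<rho>) - s * J_series \<rho> s)"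
    unfolding J_series_def using sm by (intro sums_diff ex sums_mult) (simp add: t_def summable_sums)
  hence 1: "(\<lambda>n. of_nat n * t n / (of_nat n + s)) sums (exp (- of_real \<rho>) - s * J_series \<rho> s)"
    by (simp only: e1)
  hence 2: "(\<lambda>n. of_nat (Suc n) * t (Suc n) / (of_nat (Suc n) + s)) sums (exp (- of_real \<rho>) - s * J_series \<rho> s)"
    by (subst sums_Suc_iff) simp
  have e2: "of_nat (Suc n) * t (Suc n) / (of_nat (Suc n) + s) = - of_real \<rho> * (t n / (of_nat n + (s + 1)))" for n
    unfolding t_def fact_Suc power_Suc by (simp add: field_simps del: of_nat_Suc) (simp add: algebra_simps)
  have "(\<lambda>n. - of_real \<rho> * (t n / (of_nat n + (s + 1)))) sums (- of_real \<rho> * J_series \<rho> (s + 1))"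
    unfolding J_series_def using summable_norm_cancel[OF J_series_summable[of \<rho> "s + 1"]]
    by (intro sums_mult) (simp add: t_def summable_sums)
  with 2 have "exp (- of_real \<rho>) - s * J_series \<rho> s = - of_real \<rho> * J_series \<rho> (s + 1)"
    unfolding e2 by (rule sums_unique2)
  thus ?thesis by (simp add: algebra_simps)
qed

lemma J_formula_Re_pos:
  assumes \<rho>: "\<rho> > 0" and s: "Re s > 0"
  shows "J_int \<rho> s + J_series \<rho> s = Gamma s * of_real \<rho> powr (- s)"
proof -
  define g where "g x = complex_of_real x powr (s - 1) * exp (- of_real \<rho> * of_real x)" for x
  have gi: "integrable (lborel_on {0<..}) g"
    unfolding g_def using Gamma_kernel_integrable[OF s, of "of_real \<rho>"] \<rho> by simp
  have un: "{0<..} = {0<..<1} \<union> {1::real..}" by auto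
  have "Gamma s * of_real \<rho> powr (- s) = integral\<^sup>L (lborel_on ({0<..<1} \<union> {1..})) g"
    using Gamma_integral_scaled[OF s, of "of_real \<rho>"] \<rho> unfolding g_def un[symmetric] by simp
  also have "\<dots> = integral\<^sup>L (lborel_on {0<..<1}) g + integral\<^sup>L (lborel_on {1..}) g"
    by (rule lborel_on_split[OF _ _ _ gi[unfolded un]]) auto
  also have "integral\<^sup>L (lborel_on {0<..<1}) g = J_series \<rho> s"
  proof -
    define c where "c n = (- complex_of_real \<rho>) ^ n / fact n" for n :: nat
    have c: "summable (\<lambda>n. norm (c n))"
      using summable_exp[of "\<bar>\<rho>\<bar>"] by (simp add: c_def norm_divide norm_power field_simps)
    have B: "Beta (s + of_nat n) 1 = 1 / (of_nat n + s)" for n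
    proof -
      have z: "Re (s + of_nat n) > 0" using s by simp
      hence "s + of_nat n \<notin> \<int>\<^sub>\<le>\<^sub>0" by (rule Re_pos_notin_nonpos_Ints)
      moreover have "Gamma (s + of_nat n) \<noteq> 0" using Re_pos_notin_nonpos_Ints[OF z] by (simp add: Gamma_eq_zero_iff)
      ultimately show ?thesis
        unfolding Beta_def Gamma_plus1[OF \<open>s + of_nat n \<notin> \<int>\<^sub>\<le>\<^sub>0\<close>] by (simp add: add.commute)
    qed
    have "(\<lambda>n. c n * Beta (s + of_nat n) 1) sums
        integral\<^sup>L (lborel_on {0<..<1}) (\<lambda>t. beta_kernel s 1 t * (\<Sum>n. c n * of_real t ^ n))"
      by (rule beta_integral_power_series(2)) (use s c in auto)
    moreover have "integral\<^sup>L (lborel_on {0<..<1}) (\<lambda>t. beta_kernel s 1 t * (\<Sum>n. c n * of_real t ^ n)) =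
        integral\<^sup>L (lborel_on {0<..<1}) g"
    proof (rule Bochner_Integration.integral_cong[OF refl])
      fix t assume t: "t \<in> space (lborel_on {0<..<1})"
      have "(\<lambda>n. c n * of_real t ^ n) sums exp (- of_real \<rho> * of_real t)"
        using exp_converges[of "- complex_of_real \<rho> * of_real t"] unfolding power_mult_distrib
        by (simp add: c_def scaleR_conv_of_real field_simps)
      thus "beta_kernel s 1 t * (\<Sum>n. c n * of_real t ^ n) = g t"
        using t by (simp add: beta_kernel_def g_def sums_iff)
    qed
    ultimately show ?thesis by (simp add: J_series_def B c_def sums_iff)
  qed
  also have "integral\<^sup>L (lborel_on {1..}) g = J_int \<rho> s"
  proof -
    have img: "exp ` {0..} = {1::real..}"
    proof (intro equalityI subsetI)
      fix y :: real assume "y \<in> {1..}"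
      thus "y \<in> exp ` {0..}" by (intro image_eqI[of _ _ "ln y"]) auto
    qed auto
    have gm: "g \<in> borel_measurable (lborel_on {1..})"
      unfolding g_def by (intro borel_measurable_lborel_on continuous_intros) (auto simp: complex_nonpos_Reals_iff)
    have e: "\<bar>exp t\<bar> *\<^sub>R g (exp t) = J_kernel \<rho> s t" for t :: real
    proof -
      have "complex_of_real (exp t) powr (s - 1) = exp ((s - 1) * of_real t)"
        using of_real_powr_exp[of "exp t" "s - 1"] by simp
      thus ?thesis
        by (simp add: g_def J_kernel_def scaleR_conv_of_real exp_of_real[symmetric] exp_diff left_diff_distrib)
    qed
    have Ji: "J_kernel \<rho> s absolutely_integrable_on {0..}"
      using lborel_on_bridge(1)[OF _ J_kernel_measurable] J_kernel_integrable[OF \<rho>] by simp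
    have "(\<lambda>t. \<bar>exp t\<bar> *\<^sub>R g (exp t)) absolutely_integrable_on {0..} \<and>
          integral {0..} (\<lambda>t. \<bar>exp t\<bar> *\<^sub>R g (exp t)) = integral {0..} (J_kernel \<rho> s)"
      unfolding e using Ji by simp
    hence "g absolutely_integrable_on (exp ` {0..}) \<and> integral (exp ` {0..}) g = integral {0..} (J_kernel \<rho> s)"
      by (subst (asm) has_absolute_integral_change_of_variables_real)
         (auto intro!: derivative_eq_intros inj_onI)
    hence "integral\<^sup>L (lborel_on {1..}) g = integral {0..} (J_kernel \<rho> s)"
      unfolding img using lborel_on_bridge(1,2)[OF _ gm] by simp
    thus ?thesis
      unfolding J_int_def using lborel_on_bridge(2)[OF _ J_kernel_measurable J_kernel_integrable[OF \<rho>]] by simp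
  qed
  finally show ?thesis by simp
qed

text \<open>The two incomplete Gamma functions add up to the complete one. For \<open>Re s > 0\<close> this is splitting an integral; the recurrences
in \<open>s\<close>, all of the same shape, carry it to the left.\<close>

lemma J_formula:
  assumes \<rho>: "\<rho> > 0" and s: "s \<notin> \<int>\<^sub>\<le>\<^sub>0"
  shows "J_int \<rho> s + J_series \<rho> s = Gamma s * of_real \<rho> powr (- s)"
proof -
  have "J_int \<rho> s + J_series \<rho> s = Gamma s * of_real \<rho> powr (- s)" if "Re s > - real N" "s \<notin> \<int>\<^sub>\<le>\<^sub>0" for N s
    using that
  proof (induction N arbitrary: s)
    case 0
    thus ?case by (intro J_formula_Re_pos \<rho>) auto
  next
    case (Suc N)
    have "s + 1 \<notin> \<int>\<^sub>\<le>\<^sub>0"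
      using Suc.prems(2) plus_one_in_nonpos_Ints_imp by blast
    hence IH: "J_int \<rho> (s + 1) + J_series \<rho> (s + 1) = Gamma (s + 1) * of_real \<rho> powr (- (s + 1))"
      using Suc.prems(1) by (intro Suc.IH) auto
    have s0: "s \<noteq> 0" using Suc.prems(2) by auto
    have "s * (J_int \<rho> s + J_series \<rho> s) = of_real \<rho> * (J_int \<rho> (s + 1) + J_series \<rho> (s + 1))"
      using J_int_recurrence[OF \<rho>, of s] J_series_recurrence[OF Suc.prems(2), of \<rho>]
      by (simp add: algebra_simps)
    also have "\<dots> = s * (Gamma s * of_real \<rho> powr (- s))"
      unfolding IH Gamma_plus1[OF Suc.prems(2)] using \<rho>
      by (simp add: powr_diff mult_ac)
    finally show ?case using s0 by simp
  qed
  moreover obtain N where "- Re s < real N" using reals_Archimedean2 by blast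
  hence "Re s > - real N" by linarith
  ultimately show ?thesis using s by blast
qed

text \<open>In \<open>x cosh t = (x/2) e\<^sup>t + (x/2) e\<^sup>-\<^sup>t\<close> only the exponential of the second part, bounded for
\<open>t \<ge> 0\<close>, is expanded.\<close>

lemma half_K_integral_sums:
  assumes x: "x > 0"
  defines "\<rho> \<equiv> x / 2"
  shows "(\<lambda>k. (- of_real \<rho>) ^ k / fact k * J_int \<rho> (- \<nu> - of_nat k)) sums
           integral\<^sup>L (lborel_on {0..}) (K_kernel (- \<nu>) (of_real x))"
proof -
  have \<rho>: "\<rho> > 0" using x by (simp add: \<rho>_def)
  let ?M = "lborel_on {0::real..}"
  define s where "s n t = (\<Sum>k<n. (- of_real \<rho>) ^ k / fact k * J_kernel \<rho> (- \<nu> - of_nat k) t)" for n t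
  define p where "p k t = (- of_real \<rho> * exp (- complex_of_real t)) ^ k / fact k" for k :: nat and t
  have s_eq: "s n t = J_kernel \<rho> (- \<nu>) t * (\<Sum>k<n. p k t)" for n t
  proof -
    have "(- complex_of_real \<rho>) ^ k / fact k * J_kernel \<rho> (- \<nu> - of_nat k) t = J_kernel \<rho> (- \<nu>) t * p k t" for k
    proof -
      have "exp ((- \<nu> - of_nat k) * complex_of_real t) = exp (- \<nu> * of_real t) * exp (of_nat k * (- complex_of_real t))"
        unfolding exp_add[symmetric] by (simp add: algebra_simps)
      also have "exp (of_nat k * (- complex_of_real t)) = exp (- complex_of_real t) ^ k" by (rule exp_of_nat_mult)
      finally show ?thesis by (simp only: J_kernel_def p_def power_mult_distrib) (simp add: field_simps)
    qed
    thus ?thesis by (simp only: s_def sum_distrib_left)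
  qed
  have p_sums: "(\<lambda>k. p k t) sums exp (- of_real \<rho> * exp (- complex_of_real t))" for t
    using exp_converges[of "- of_real \<rho> * exp (- complex_of_real t)"]
    by (simp add: p_def scaleR_conv_of_real divide_inverse mult.commute)
  have KJ: "J_kernel \<rho> (- \<nu>) t * exp (- of_real \<rho> * exp (- complex_of_real t)) = K_kernel (- \<nu>) (of_real x) t" for t
    unfolding J_kernel_def K_kernel_def cosh_field_def exp_add[symmetric]
    by (rule arg_cong[where f = exp]) (simp add: \<rho>_def field_simps)
  have lim: "(\<lambda>n. s n t) \<longlonglongrightarrow> K_kernel (- \<nu>) (of_real x) t" for t
    unfolding s_eq KJ[symmetric] using p_sums[of t] by (intro tendsto_mult tendsto_const) (simp add: sums_def)
  have p_le: "norm (p k t) \<le> \<rho> ^ k / fact k" if "t \<ge> 0" for k t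
  proof -
    have "norm (- of_real \<rho> * exp (- complex_of_real t)) = \<rho> * exp (- t)" using \<rho> by (simp add: norm_mult)
    also have "\<dots> \<le> \<rho> * 1" using \<rho> that by (intro mult_left_mono) auto
    finally have "norm (- of_real \<rho> * exp (- complex_of_real t)) ^ k \<le> \<rho> ^ k" by (intro power_mono) auto
    thus ?thesis by (simp add: p_def norm_divide norm_power divide_right_mono)
  qed
  have ex: "(\<lambda>k. \<rho> ^ k / fact k) sums exp \<rho>" using exp_converges[of \<rho>] by (simp add: field_simps)
  have bd: "norm (s n t) \<le> norm (J_kernel \<rho> (- \<nu>) t) * exp \<rho>" if "t \<ge> 0" for n t
  proof -
    have "norm (\<Sum>k<n. p k t) \<le> (\<Sum>k<n. \<rho> ^ k / fact k)" using p_le[OF that] by (intro sum_norm_le) auto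
    also have "\<dots> \<le> (\<Sum>k. \<rho> ^ k / fact k)" using ex \<rho> by (intro sum_le_suminf) (auto simp: sums_iff)
    also have "\<dots> = exp \<rho>" using ex by (simp add: sums_iff)
    finally show ?thesis unfolding s_eq norm_mult by (intro mult_left_mono) auto
  qed
  have Ji: "integrable ?M (J_kernel \<rho> (- \<nu> - of_nat k))" for k by (rule J_kernel_integrable[OF \<rho>])
  have ms: "s n \<in> borel_measurable ?M" for n
    unfolding s_def by (intro borel_measurable_sum borel_measurable_times borel_measurable_const J_kernel_measurable)
  have "(\<lambda>n. integral\<^sup>L ?M (s n)) \<longlonglongrightarrow> integral\<^sup>L ?M (K_kernel (- \<nu>) (of_real x))"
  proof (rule integral_dominated_convergence)
    show "integrable ?M (\<lambda>t. norm (J_kernel \<rho> (- \<nu>) t) * exp \<rho>)"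
      using J_kernel_integrable[OF \<rho>] by auto
    show "AE t in ?M. (\<lambda>n. s n t) \<longlonglongrightarrow> K_kernel (- \<nu>) (of_real x) t" by (rule AE_I2) (rule lim)
    show "AE t in ?M. norm (s n t) \<le> norm (J_kernel \<rho> (- \<nu>) t) * exp \<rho>" for n by (rule AE_I2) (simp add: bd)
  qed (rule K_kernel_measurable ms)+
  moreover have "integral\<^sup>L ?M (s n) = (\<Sum>k<n. (- of_real \<rho>) ^ k / fact k * J_int \<rho> (- \<nu> - of_nat k))" for n
    unfolding s_def J_int_def
    by (subst Bochner_Integration.integral_sum) (simp_all only: integrable_mult_right[OF Ji] integral_mult_right_zero)
  ultimately show ?thesis by (simp add: sums_def)
qed

lemma sin_add_of_nat_pi: "sin (z + of_nat k * of_real pi) = (- 1) ^ k * sin (z :: complex)"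
proof (induction k)
  case (Suc k)
  have shift: "sin (y + of_real pi) = - sin y" for y :: complex
    by (simp add: sin_add cos_of_real sin_of_real)
  have "z + of_nat (Suc k) * of_real pi = (z + of_nat k * of_real pi) + of_real pi" by (simp add: algebra_simps)
  hence "sin (z + of_nat (Suc k) * of_real pi) = - sin (z + of_nat k * of_real pi)" by (simp only: shift)
  thus ?case using Suc.IH by simp
qed simp

lemma Gamma_neg_shift:
  fixes \<nu> :: complex
  assumes "\<nu> \<notin> \<int>"
  shows "Gamma (- \<nu> - of_nat k) = - (of_real pi / sin (of_real pi * \<nu>)) * (- 1) ^ k * rGamma (of_nat k + \<nu> + 1)"
proof -
  let ?z = "- \<nu> - of_nat k :: complex"
  have zi: "1 - ?z \<notin> \<int>\<^sub>\<le>\<^sub>0"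
  proof
    assume "1 - ?z \<in> \<int>\<^sub>\<le>\<^sub>0"
    hence "1 - ?z \<in> \<int>" by (rule nonpos_Ints_Int)
    hence "(1 - ?z) - (1 + of_nat k) \<in> \<int>" by (intro Ints_diff) auto
    thus False using assms by simp
  qed
  hence g: "Gamma (1 - ?z) \<noteq> 0" by (simp add: Gamma_eq_zero_iff)
  have "sin (of_real pi * ?z) = - sin (of_real pi * \<nu> + of_nat k * of_real pi)"
    unfolding sin_minus[symmetric] by (simp add: algebra_simps)
  hence sn: "sin (of_real pi * ?z) = - ((- 1) ^ k * sin (of_real pi * \<nu>))" by (simp only: sin_add_of_nat_pi)
  have "Gamma ?z = of_real pi / sin (of_real pi * ?z) / Gamma (1 - ?z)"
    using Gamma_reflection_complex[of ?z] by (simp only: nonzero_eq_divide_eq[OF g])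
  also have "\<dots> = - (of_real pi / sin (of_real pi * \<nu>)) * (- 1) ^ k * rGamma (1 - ?z)"
    unfolding sn rGamma_inverse_Gamma by (cases "even k") (auto simp: divide_inverse)
  also have "1 - ?z = of_nat k + \<nu> + 1" by simp
  finally show ?thesis .
qed

text \<open>Both sides are double sums over \<open>k\<close> and \<open>n\<close> of terms with denominators \<open>n - k - \<nu>\<close> and \<open>n - k + \<nu>\<close>;
exchanging the roles of \<open>k\<close> and \<open>n\<close> in one of them changes the sign.\<close>

lemma antisymmetric_double_series:
  assumes \<rho>: "\<rho> > 0" and \<nu>: "\<nu> \<notin> \<int>"
    and a: "(\<lambda>k. (- of_real \<rho>) ^ k / fact k * J_series \<rho> (- \<nu> - of_nat k)) sums A"
    and b: "(\<lambda>k. (- of_real \<rho>) ^ k / fact k * J_series \<rho> (\<nu> - of_nat k)) sums B"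
  shows "A + B = 0"
proof -
  obtain \<delta> where \<delta>: "\<delta> > 0" "\<And>m. m \<in> \<int> \<Longrightarrow> \<delta> \<le> dist \<nu> m"
    using separate_point_closed[OF closed_Ints \<nu>] by blast
  define r where "r k = (- complex_of_real \<rho>) ^ k / fact k" for k :: nat
  define p where "p k = \<rho> ^ k / fact k" for k :: nat
  have nr: "norm (r k) = p k" for k using \<rho> by (simp add: r_def p_def norm_divide norm_power)
  have ex: "p sums exp \<rho>" unfolding p_def using exp_converges[of \<rho>] by (simp add: field_simps)
  have p0: "p k \<ge> 0" for k using \<rho> by (simp add: p_def)
  define T where "T N = exp \<rho> - (\<Sum>n<N. p n)" for N
  have T: "(\<lambda>n. p (n + N)) sums T N" for N unfolding T_def by (rule sums_split_initial_segment[OF ex])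
  have T0: "T \<longlonglongrightarrow> 0"
  proof -
    have "(\<lambda>N. exp \<rho> - (\<Sum>n<N. p n)) \<longlonglongrightarrow> exp \<rho> - exp \<rho>"
      using ex by (intro tendsto_diff tendsto_const) (simp add: sums_def)
    thus ?thesis by (simp add: T_def[abs_def])
  qed
  \<comment> \<open>Square partial sums: on these the exchange of \<open>k\<close> and \<open>n\<close> is finite.\<close>
  define S where "S w N = (\<Sum>k<N. r k * (\<Sum>n<N. r n / (of_nat n + (w - of_nat k))))" for w N
  have approx: "(\<lambda>N. S w N) \<longlonglongrightarrow> C"
    if w: "\<And>m. m \<in> \<int> \<Longrightarrow> \<delta> \<le> norm (w + m)" and C: "(\<lambda>k. r k * J_series \<rho> (w - of_nat k)) sums C" for w C
  proof -
    have le: "norm (r n / (of_nat n + (w - of_nat k))) \<le> p n / \<delta>" for n k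
    proof -
      have "\<delta> \<le> norm (w + (of_nat n - of_nat k))" by (rule w) (intro Ints_diff Ints_of_nat)
      hence "\<delta> \<le> norm (of_nat n + (w - of_nat k))" by (simp add: algebra_simps)
      thus ?thesis unfolding norm_divide nr using p0 \<delta> by (intro divide_left_mono mult_pos_pos) auto
    qed
    have sm: "summable (\<lambda>n. r n / (of_nat n + (w - of_nat k)))" for k
      by (rule summable_comparison_test[OF _ sums_summable[OF sums_divide[OF ex, of \<delta>]]]) (use le in auto)
    have Js: "J_series \<rho> (w - of_nat k) = (\<Sum>n. r n / (of_nat n + (w - of_nat k)))" for k
      unfolding J_series_def r_def by simp
    have tail: "norm (J_series \<rho> (w - of_nat k) - (\<Sum>n<N. r n / (of_nat n + (w - of_nat k)))) \<le> T N / \<delta>" for k N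
    proof -
      have "J_series \<rho> (w - of_nat k) - (\<Sum>n<N. r n / (of_nat n + (w - of_nat k))) = (\<Sum>n. r (n + N) / (of_nat (n + N) + (w - of_nat k)))"
        unfolding Js by (subst suminf_minus_initial_segment[OF sm]) simp
      also have "norm \<dots> \<le> (\<Sum>n. p (n + N) / \<delta>)"
      proof (rule norm_suminf_le)
        show "norm (r (n + N) / (of_nat (n + N) + (w - of_nat k))) \<le> p (n + N) / \<delta>" for n by (rule le)
        show "summable (\<lambda>n. p (n + N) / \<delta>)" by (rule sums_summable[OF sums_divide[OF T]])
      qed
      also have "\<dots> = T N / \<delta>" using sums_divide[OF T[of N], of \<delta>] by (simp add: sums_iff)
      finally show ?thesis .
    qed
    have bd: "norm (S w N - (\<Sum>k<N. r k * J_series \<rho> (w - of_nat k))) \<le> exp \<rho> * (T N / \<delta>)" for N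
    proof -
      have "S w N - (\<Sum>k<N. r k * J_series \<rho> (w - of_nat k)) =
            (\<Sum>k<N. - (r k * (J_series \<rho> (w - of_nat k) - (\<Sum>n<N. r n / (of_nat n + (w - of_nat k))))))"
        unfolding S_def sum_subtractf[symmetric] by (intro sum.cong) (simp_all add: algebra_simps)
      also have "norm \<dots> \<le> (\<Sum>k<N. p k * (T N / \<delta>))"
        unfolding norm_minus_cancel by (intro sum_norm_le) (simp only: norm_minus_cancel norm_mult nr mult_left_mono p0 tail)
      also have "\<dots> = (\<Sum>k<N. p k) * (T N / \<delta>)" by (rule sum_distrib_right[symmetric])
      also have "\<dots> \<le> exp \<rho> * (T N / \<delta>)"
      proof (rule mult_right_mono)
        show "(\<Sum>k<N. p k) \<le> exp \<rho>" using sum_le_suminf[of p "{..<N}"] ex p0 by (simp add: sums_iff)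
        thus "T N / \<delta> \<ge> 0" using \<delta> by (simp add: T_def)
      qed
      finally show ?thesis .
    qed
    have "(\<lambda>N. exp \<rho> * (T N / \<delta>)) \<longlonglongrightarrow> exp \<rho> * (0 / \<delta>)" by (intro tendsto_intros T0) (use \<delta> in auto)
    hence z: "(\<lambda>N. exp \<rho> * (T N / \<delta>)) \<longlonglongrightarrow> 0" by simp
    have "(\<lambda>N. S w N - (\<Sum>k<N. r k * J_series \<rho> (w - of_nat k))) \<longlonglongrightarrow> 0"
      by (rule Lim_null_comparison[OF always_eventually z]) (rule allI, rule bd)
    from tendsto_add[OF this C[unfolded sums_def]] show ?thesis by simp
  qed
  have "(\<lambda>N. S (- \<nu>) N) \<longlonglongrightarrow> A"
  proof (rule approx)
    show "\<delta> \<le> norm (- \<nu> + m)" if "m \<in> \<int>" for m using \<delta>(2)[OF that] by (simp add: dist_norm norm_minus_commute)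
  qed (use a in \<open>simp add: r_def\<close>)
  moreover have "(\<lambda>N. S \<nu> N) \<longlonglongrightarrow> B"
  proof (rule approx)
    show "\<delta> \<le> norm (\<nu> + m)" if "m \<in> \<int>" for m using \<delta>(2)[of "- m"] that by (simp add: dist_norm)
  qed (use b in \<open>simp add: r_def\<close>)
  ultimately have "(\<lambda>N. S (- \<nu>) N + S \<nu> N) \<longlonglongrightarrow> A + B" by (rule tendsto_add)
  moreover have "S (- \<nu>) N + S \<nu> N = 0" for N
  proof -
    have "S \<nu> N = (\<Sum>k<N. \<Sum>n<N. r k * r n / (of_nat n + (\<nu> - of_nat k)))"
      by (simp add: S_def sum_distrib_left)
    also have "\<dots> = (\<Sum>n<N. \<Sum>k<N. r k * r n / (of_nat n + (\<nu> - of_nat k)))" by (rule sum.swap)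
    also have "\<dots> = (\<Sum>n<N. \<Sum>k<N. - (r n * r k / (of_nat k + (- \<nu> - of_nat n))))"
    proof (intro sum.cong refl)
      fix n k :: nat
      have "of_nat n + (\<nu> - of_nat k) = - (of_nat k + (- \<nu> - of_nat n))" by simp
      thus "r k * r n / (of_nat n + (\<nu> - of_nat k)) = - (r n * r k / (of_nat k + (- \<nu> - of_nat n)))"
        by (simp only: divide_minus_right mult.commute)
    qed
    also have "\<dots> = - S (- \<nu>) N" by (simp add: S_def sum_distrib_left sum_negf)
    finally show ?thesis by simp
  qed
  ultimately have "(\<lambda>N. 0) \<longlonglongrightarrow> A + B" by simp
  thus ?thesis by (simp add: LIMSEQ_const_iff)
qed

text \<open>Both halves of the integral are expanded in incomplete Gamma functions. By \<open>J_formula\<close> the complete Gamma values produce the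
two series \<open>I\<close>, via the reflection formula, while the contributions of \<open>J_series\<close> cancel each other.\<close>

lemma bessel_K_connection:
  assumes x: "x > 0" and \<nu>: "\<nu> \<notin> \<int>" "Re \<nu> > - 1" "Re \<nu> < 1"
  shows "bessel_K \<nu> (of_real x) = of_real pi / (2 * sin (of_real pi * \<nu>)) *
           (bessel_I (- \<nu>) (of_real x) - bessel_I \<nu> (of_real x))"
proof -
  define \<rho> where "\<rho> = x / 2"
  have \<rho>: "\<rho> > 0" using x by (simp add: \<rho>_def)
  define L where "L w = integral\<^sup>L (lborel_on {0..}) (K_kernel w (of_real x))" for w
  have main: "(\<lambda>k. (- of_real \<rho>) ^ k / fact k * J_series \<rho> (- w - of_nat k)) sums
          (- (of_real pi / sin (of_real pi * w)) * bessel_I w (of_real x) - L (- w))"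
    if w: "w \<notin> \<int>" "Re w > - 1" for w
  proof -
    define c where "c = - (of_real pi / sin (of_real pi * w))"
    have J: "J_int \<rho> (- w - of_nat k) = Gamma (- w - of_nat k) * of_real \<rho> powr (w + of_nat k) - J_series \<rho> (- w - of_nat k)" for k
    proof -
      have "- w - of_nat k \<notin> \<int>\<^sub>\<le>\<^sub>0"
      proof
        assume "- w - of_nat k \<in> \<int>\<^sub>\<le>\<^sub>0"
        hence "- w - of_nat k \<in> \<int>" by (rule nonpos_Ints_Int)
        hence "- (- w - of_nat k) - of_nat k \<in> \<int>" by (intro Ints_diff[OF Ints_minus]) auto
        thus False using w by simp
      qed
      from J_formula[OF \<rho> this] show ?thesis by (simp add: algebra_simps)
    qed
    have G: "(- of_real \<rho>) ^ k / fact k * (Gamma (- w - of_nat k) * of_real \<rho> powr (w + of_nat k)) =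
        c * (of_real \<rho> powr w * (bessel_coeff w k * ((of_real x)\<^sup>2 / 4) ^ k))" for k
    proof -
      have pw: "of_real \<rho> powr (w + of_nat k) = of_real \<rho> powr w * complex_of_real \<rho> ^ k"
        using \<rho> by (simp add: powr_add powr_nat')
      have sq: "((complex_of_real x)\<^sup>2 / 4) ^ k = complex_of_real \<rho> ^ k * complex_of_real \<rho> ^ k"
        by (simp add: \<rho>_def power2_eq_square flip: power_mult_distrib)
      have m: "(- complex_of_real \<rho>) ^ k = (- 1) ^ k * complex_of_real \<rho> ^ k" by (rule power_minus)
      have one: "(- 1 :: complex) ^ k * (- 1) ^ k = 1" by (simp flip: power_mult_distrib)
      have "(- of_real \<rho>) ^ k / fact k * (Gamma (- w - of_nat k) * of_real \<rho> powr (w + of_nat k)) =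
         ((- 1) ^ k * (- 1) ^ k) * (c * (of_real \<rho> powr w * (bessel_coeff w k * (complex_of_real \<rho> ^ k * complex_of_real \<rho> ^ k))))"
        unfolding pw m Gamma_neg_shift[OF w(1)] bessel_coeff_def c_def[symmetric] by (simp add: mult_ac)
      thus ?thesis unfolding one sq by simp
    qed
    have I: "(\<lambda>k. c * (of_real \<rho> powr w * (bessel_coeff w k * ((of_real x)\<^sup>2 / 4) ^ k))) sums (c * bessel_I w (of_real x))"
    proof -
      have "bessel_I w (of_real x) = of_real \<rho> powr w * (\<Sum>k. bessel_coeff w k * ((of_real x)\<^sup>2 / 4) ^ k)"
        using x w by (subst bessel_I_eq) (auto simp: \<rho>_def)
      thus ?thesis
        using summable_sums[OF summable_norm_cancel[OF bessel_coeff_summable(1)[OF w(2)]]]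
        by (auto intro!: sums_mult)
    qed
    have L: "(\<lambda>k. (- of_real \<rho>) ^ k / fact k * J_int \<rho> (- w - of_nat k)) sums L (- w)"
      unfolding L_def \<rho>_def by (rule half_K_integral_sums[OF x])
    have "(- of_real \<rho>) ^ k / fact k * J_series \<rho> (- w - of_nat k) =
        c * (of_real \<rho> powr w * (bessel_coeff w k * ((of_real x)\<^sup>2 / 4) ^ k)) - (- of_real \<rho>) ^ k / fact k * J_int \<rho> (- w - of_nat k)" for k
      unfolding G[symmetric] J by (simp add: algebra_simps)
    thus ?thesis using sums_diff[OF I L] unfolding c_def by (simp only:)
  qed
  have "- \<nu> \<notin> \<int>" using \<nu>(1) by (metis Ints_minus minus_minus)
  from main[OF this] have "(\<lambda>k. (- of_real \<rho>) ^ k / fact k * J_series \<rho> (\<nu> - of_nat k)) sums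
          (- (of_real pi / sin (of_real pi * - \<nu>)) * bessel_I (- \<nu>) (of_real x) - L \<nu>)"
    using \<nu> by simp
  from antisymmetric_double_series[OF \<rho> \<nu>(1) main[OF \<nu>(1,2)] this]
  have "L \<nu> + L (- \<nu>) = of_real pi / sin (of_real pi * \<nu>) * (bessel_I (- \<nu>) (of_real x) - bessel_I \<nu> (of_real x))"
    by (simp add: algebra_simps)
  moreover have "bessel_K \<nu> (of_real x) = (L \<nu> + L (- \<nu>)) / 2"
    using bessel_K_eq[of "of_real x" \<nu>] x by (simp add: L_def)
  ultimately show ?thesis by simp
qed

text \<open>The coefficient of \<open>(z/2)\<close> to the power \<open>2 k + \<mu> + \<nu>\<close> in the product of \<open>I\<close> at the orders
\<open>\<mu>\<close> and \<open>\<nu>\<close>.\<close>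

definition product_coeff :: "complex \<Rightarrow> complex \<Rightarrow> nat \<Rightarrow> complex" where
  "product_coeff \<mu> \<nu> k = pochhammer (\<mu> + \<nu> + of_nat k + 1) k / fact k * rGamma (\<mu> + of_nat k + 1) * rGamma (\<nu> + of_nat k + 1)"

text \<open>The Chu-Vandermonde identity evaluates the Cauchy product.\<close>

lemma bessel_coeff_convolution:
  "(\<Sum>i\<le>k. bessel_coeff \<mu> i * bessel_coeff \<nu> (k - i)) = product_coeff \<mu> \<nu> k"
proof -
  have g: "rGamma (of_nat i + \<mu> + 1) / fact (k - i) = rGamma (\<mu> + of_nat k + 1) * ((\<mu> + of_nat k) gchoose (k - i))"
    if "i \<le> k" for i and \<mu> :: complex
  proof -
    have k: "of_nat k = (of_nat i + of_nat (k - i) :: complex)" using that by (simp add: of_nat_diff)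
    have "rGamma (of_nat i + \<mu> + 1) = pochhammer (of_nat i + \<mu> + 1) (k - i) * rGamma (of_nat i + \<mu> + 1 + of_nat (k - i))"
      by (rule pochhammer_rGamma)
    moreover have "of_nat i + \<mu> + 1 + of_nat (k - i) = \<mu> + of_nat k + 1" unfolding k by simp
    ultimately have r: "rGamma (of_nat i + \<mu> + 1) = pochhammer (of_nat i + \<mu> + 1) (k - i) * rGamma (\<mu> + of_nat k + 1)"
      by (simp only:)
    have e: "\<mu> + of_nat k - of_nat (k - i) + 1 = of_nat i + \<mu> + 1" unfolding k by simp
    show ?thesis unfolding gbinomial_pochhammer' e r by simp
  qed
  have t: "bessel_coeff \<mu> i * bessel_coeff \<nu> (k - i) = rGamma (\<mu> + of_nat k + 1) * rGamma (\<nu> + of_nat k + 1) *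
        (((\<nu> + of_nat k) gchoose i) * ((\<mu> + of_nat k) gchoose (k - i)))" if "i \<le> k" for i
  proof -
    have "bessel_coeff \<mu> i * bessel_coeff \<nu> (k - i) = (rGamma (of_nat i + \<mu> + 1) / fact (k - i)) * (rGamma (of_nat (k - i) + \<nu> + 1) / fact (k - (k - i)))"
      using that by (simp add: bessel_coeff_def)
    also have "rGamma (of_nat (k - i) + \<nu> + 1) / fact (k - (k - i)) = rGamma (\<nu> + of_nat k + 1) * ((\<nu> + of_nat k) gchoose (k - (k - i)))"
      by (rule g) simp
    finally show ?thesis using that by (simp add: g mult_ac)
  qed
  have "(\<Sum>i\<le>k. bessel_coeff \<mu> i * bessel_coeff \<nu> (k - i)) = rGamma (\<mu> + of_nat k + 1) * rGamma (\<nu> + of_nat k + 1) *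
        (\<Sum>i = 0..k. ((\<nu> + of_nat k) gchoose i) * ((\<mu> + of_nat k) gchoose (k - i)))"
    unfolding sum_distrib_left atLeast0AtMost by (intro sum.cong) (simp_all add: t)
  also have "(\<Sum>i = 0..k. ((\<nu> + of_nat k) gchoose i) * ((\<mu> + of_nat k) gchoose (k - i))) =
      (\<nu> + of_nat k + (\<mu> + of_nat k)) gchoose k" by (rule gbinomial_Vandermonde)
  also have "\<dots> = pochhammer (\<mu> + \<nu> + of_nat k + 1) k / fact k"
  proof -
    have "\<nu> + of_nat k + (\<mu> + of_nat k) - of_nat k + 1 = \<mu> + \<nu> + of_nat k + 1" by simp
    thus ?thesis by (simp only: gbinomial_pochhammer')
  qed
  finally show ?thesis by (simp add: product_coeff_def)
qed

lemma product_coeff_sums: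
  assumes "Re \<mu> > - 1" "Re \<nu> > - 1"
  shows "(\<lambda>k. product_coeff \<mu> \<nu> k * u ^ k) sums ((\<Sum>k. bessel_coeff \<mu> k * u ^ k) * (\<Sum>k. bessel_coeff \<nu> k * u ^ k))"
    and "(\<Sum>k<N. norm (product_coeff \<mu> \<nu> k * u ^ k)) \<le> (\<Sum>k. norm (bessel_coeff \<mu> k * u ^ k)) * (\<Sum>k. norm (bessel_coeff \<nu> k * u ^ k))"
proof -
  note s1 = bessel_coeff_summable(1)[OF assms(1), of u] and s2 = bessel_coeff_summable(1)[OF assms(2), of u]
  have eq: "(\<Sum>i\<le>k. (bessel_coeff \<mu> i * u ^ i) * (bessel_coeff \<nu> (k - i) * u ^ (k - i))) = product_coeff \<mu> \<nu> k * u ^ k" for k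
  proof -
    have "u ^ k = u ^ i * u ^ (k - i)" if "i \<le> k" for i using that by (simp flip: power_add)
    thus ?thesis unfolding bessel_coeff_convolution[symmetric] sum_distrib_right
      by (intro sum.cong) (simp_all add: mult_ac)
  qed
  show "(\<lambda>k. product_coeff \<mu> \<nu> k * u ^ k) sums ((\<Sum>k. bessel_coeff \<mu> k * u ^ k) * (\<Sum>k. bessel_coeff \<nu> k * u ^ k))"
    using Cauchy_product_sums[OF s1 s2] unfolding eq .
  let ?a = "\<lambda>i. norm (bessel_coeff \<mu> i * u ^ i)" and ?b = "\<lambda>i. norm (bessel_coeff \<nu> i * u ^ i)"
  have cp: "(\<lambda>k. \<Sum>i\<le>k. ?a i * ?b (k - i)) sums ((\<Sum>k. ?a k) * (\<Sum>k. ?b k))"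
    by (rule Cauchy_product_sums) (use s1 s2 in simp_all)
  have "norm (product_coeff \<mu> \<nu> k * u ^ k) \<le> (\<Sum>i\<le>k. ?a i * ?b (k - i))" for k
    unfolding eq[symmetric] by (rule sum_norm_le) (simp add: norm_mult)
  hence "(\<Sum>k<N. norm (product_coeff \<mu> \<nu> k * u ^ k)) \<le> (\<Sum>k<N. \<Sum>i\<le>k. ?a i * ?b (k - i))" by (rule sum_mono)
  also have "\<dots> \<le> (\<Sum>k. \<Sum>i\<le>k. ?a i * ?b (k - i))"
    using cp by (intro sum_le_suminf) (auto simp: sums_iff intro!: sum_nonneg)
  also have "\<dots> = (\<Sum>k. ?a k) * (\<Sum>k. ?b k)" using cp by (simp add: sums_iff)
  finally show "(\<Sum>k<N. norm (product_coeff \<mu> \<nu> k * u ^ k)) \<le> (\<Sum>k. ?a k) * (\<Sum>k. ?b k)" .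
qed

section \<open>The Mellin transform of the square of K\<close>

lemma continuous_lborel_measurable:
  fixes f :: "'a::euclidean_space \<Rightarrow> 'b::topological_space"
  shows "continuous_on UNIV f \<Longrightarrow> f \<in> borel_measurable lborel"
  by (simp add: borel_measurable_continuous_onI)

lemma lborel_bridge:
  fixes f :: "real \<Rightarrow> complex"
  assumes "f \<in> borel_measurable borel"
  shows "integrable lborel f \<longleftrightarrow> f absolutely_integrable_on UNIV"
    and "integrable lborel f \<Longrightarrow> integral\<^sup>L lborel f = integral UNIV f"
proof -
  show "integrable lborel f \<longleftrightarrow> f absolutely_integrable_on UNIV"
    unfolding set_integrable_def using assms by (simp add: integrable_completion)
  show "integrable lborel f \<Longrightarrow> integral\<^sup>L lborel f = integral UNIV f"
    by (rule integral_lborel[symmetric])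
qed

lemma cosh_kernel_measurable:
  fixes \<beta> s :: complex
  shows
  "(\<lambda>p. exp (\<beta> * of_real p) * of_real (cosh p) powr (- s)) \<in> borel_measurable borel"
proof (rule borel_measurable_continuous_onI)
  have "complex_of_real (cosh p) \<notin> \<real>\<^sub>\<le>\<^sub>0" for p
    using cosh_real_ge_1[of p] by (subst complex_nonpos_Reals_iff) auto
  moreover have "continuous_on UNIV (\<lambda>p. complex_of_real (cosh p))"
    unfolding cosh_def by (intro continuous_intros)
  ultimately show "continuous_on UNIV (\<lambda>p. exp (\<beta> * of_real p) * of_real (cosh p) powr (- s))"
    by (intro continuous_intros) auto
qed

text \<open>The substitution \<open>t = 1 / (1 + exp (- 2 p))\<close> turns this into a beta integral.\<close>

lemma cosh_integral:
  assumes "Re s > 2 * \<bar>Re \<alpha>\<bar>"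
  shows "integrable lborel (\<lambda>p. exp (2 * \<alpha> * of_real p) * of_real (cosh p) powr (- s))" (is "integrable _ ?F")
    and "integral\<^sup>L lborel (\<lambda>p. exp (2 * \<alpha> * of_real p) * of_real (cosh p) powr (- s)) =
           2 powr (s - 1) * Beta (s / 2 + \<alpha>) (s / 2 - \<alpha>)"
proof -
  define P where "P = s / 2 + \<alpha>"
  define Q where "Q = s / 2 - \<alpha>"
  have PQ: "Re P > 0" "Re Q > 0" using assms by (auto simp: P_def Q_def)
  define g where "g p = 1 / (1 + exp (- 2 * p))" for p :: real
  define h where "h p = 2 * exp (- 2 * p) / (1 + exp (- 2 * p))\<^sup>2" for p :: real
  have pos: "1 + exp (- 2 * p) > 0" for p :: real by (intro add_pos_pos) auto
  have der: "(g has_field_derivative h p) (at p within UNIV)" for p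
    unfolding g_def h_def using pos[of p]
    by (auto intro!: derivative_eq_intros simp: power2_eq_square)
  have inj: "inj g" by (rule injI) (simp add: g_def)
  have img: "range g = {0<..<1}"
  proof (intro equalityI subsetI)
    fix t assume "t \<in> range g"
    thus "t \<in> {0<..<1}" using pos by (auto simp: g_def divide_simps)
  next
    fix t :: real assume t: "t \<in> {0<..<1}"
    define p where "p = - ln ((1 - t) / t) / 2"
    have "exp (- 2 * p) = (1 - t) / t" using t by (simp add: p_def)
    hence "1 + exp (- 2 * p) = 1 / t" using t by (simp add: field_simps)
    hence "g p = t" by (simp add: g_def)
    thus "t \<in> range g" by blast
  qed
  have eq: "\<bar>h p\<bar> *\<^sub>R beta_kernel P Q (g p) = 2 powr (1 - s) * ?F p" for p
  proof -
    define c where "c = cosh p"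
    have c: "c > 0" using cosh_real_ge_1[of p] by (simp add: c_def)
    have e1: "1 + exp (- 2 * p) = 2 * c * exp (- p)"
      by (simp add: c_def cosh_def algebra_simps flip: exp_add)
    have g1: "g p = exp p / (2 * c)" unfolding g_def e1 using c by (simp add: exp_minus field_simps)
    have "1 - g p = exp (- 2 * p) / (1 + exp (- 2 * p))" using pos[of p] by (simp add: g_def field_simps)
    also have "\<dots> = exp (- p) / (2 * c)"
    proof -
      have "exp (- 2 * p) = exp (- p) * exp (- p)" by (simp flip: exp_add)
      thus ?thesis unfolding e1 using c by simp
    qed
    finally have g2: "1 - g p = exp (- p) / (2 * c)" .
    have h1: "\<bar>h p\<bar> = 2 / (2 * c)\<^sup>2"
    proof -
      have "exp (- 2 * p) = exp (- p) * exp (- p)" by (simp flip: exp_add)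
      thus ?thesis unfolding h_def e1 using c by (simp add: power2_eq_square)
    qed
    have l1: "ln (g p) = p - ln (2 * c)" "ln (1 - g p) = - p - ln (2 * c)"
      unfolding g1 g2[unfolded g1] g1 using c by (simp_all add: ln_div)
    have "g p \<in> {0<..<1}" unfolding img[symmetric] by (rule rangeI)
    hence gp: "g p > 0" "1 - g p > 0" by simp_all
    have h2: "complex_of_real \<bar>h p\<bar> = 2 * exp (of_real (- 2 * ln (2 * c)))"
    proof -
      have E: "exp (ln (2 * c)) = 2 * c" using c by (intro exp_ln) simp
      have "exp (- 2 * L) * (exp L * exp L) = 1" for L :: real unfolding exp_add[symmetric] by simp
      from this[of "ln (2 * c)"] have e1: "exp (- 2 * ln (2 * c)) * (2 * c)\<^sup>2 = 1"
        unfolding E power2_eq_square .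
      have "(2 * c)\<^sup>2 \<noteq> 0" using c by simp
      from iffD2[OF nonzero_eq_divide_eq[OF this] e1] have "exp (- 2 * ln (2 * c)) = 1 / (2 * c)\<^sup>2" .
      hence "\<bar>h p\<bar> = 2 * exp (- 2 * ln (2 * c))" unfolding h1 by (simp only: times_divide_eq_right mult_1_right)
      from arg_cong[OF this, of complex_of_real] show ?thesis
        unfolding of_real_mult[of 2 "exp _"] of_real_numeral exp_of_real[symmetric] .
    qed
    have "complex_of_real \<bar>h p\<bar> * beta_kernel P Q (g p) =
        2 * exp (of_real (- 2 * ln (2 * c)) + ((P - 1) * of_real (p - ln (2 * c)) + (Q - 1) * of_real (- p - ln (2 * c))))"
      unfolding beta_kernel_def h2 of_real_powr_exp[OF gp(1)] of_real_powr_exp[OF gp(2)] l1 by (simp only: exp_add mult.assoc)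
    also have "of_real (- 2 * ln (2 * c)) + ((P - 1) * of_real (p - ln (2 * c)) + (Q - 1) * of_real (- p - ln (2 * c))) =
        - s * of_real (ln 2) + (2 * \<alpha> * of_real p + - s * of_real (ln c))"
      using c by (simp add: P_def Q_def ln_mult algebra_simps)
    also have "2 * exp (- s * of_real (ln 2) + (2 * \<alpha> * of_real p + - s * of_real (ln c))) =
        (2 * exp (- s * of_real (ln 2))) * ?F p"
      using of_real_powr_exp[OF c, of "- s"] by (simp only: exp_add c_def mult.assoc)
    also have "2 * exp (- s * of_real (ln 2)) = 2 powr (1 - s)"
      using of_real_powr_exp[of 2 "- s"] by (simp add: powr_diff powr_minus divide_inverse)
    finally show ?thesis by (simp add: scaleR_conv_of_real)
  qed
  note bm = beta_kernel_measurable[of P Q] and bi = integrable_beta_kernel[OF PQ]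
  have "beta_kernel P Q absolutely_integrable_on range g \<and> integral (range g) (beta_kernel P Q) = Beta P Q"
    unfolding img using lborel_on_bridge(1,2)[OF _ bm] bi beta_integral[OF PQ] by simp
  hence ai: "(\<lambda>p. \<bar>h p\<bar> *\<^sub>R beta_kernel P Q (g p)) absolutely_integrable_on UNIV"
    and iv: "integral UNIV (\<lambda>p. \<bar>h p\<bar> *\<^sub>R beta_kernel P Q (g p)) = Beta P Q"
    using has_absolute_integral_change_of_variables_real[of UNIV g h "beta_kernel P Q" "Beta P Q"] der inj by auto
  have m: "(\<lambda>p. 2 powr (1 - s) * ?F p) \<in> borel_measurable borel"
    by (intro borel_measurable_times borel_measurable_const cosh_kernel_measurable)
  have i: "integrable lborel (\<lambda>p. 2 powr (1 - s) * ?F p)"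
    using ai lborel_bridge(1)[OF m] unfolding eq by simp
  have F: "?F p = 2 powr (s - 1) * (2 powr (1 - s) * ?F p)" for p
    by (simp add: powr_diff)
  show "integrable lborel ?F" by (subst F) (rule integrable_mult_right[OF i])
  have "integral\<^sup>L lborel (\<lambda>p. 2 powr (1 - s) * ?F p) = Beta P Q"
    using lborel_bridge(2)[OF m i] iv unfolding eq by simp
  thus "integral\<^sup>L lborel ?F = 2 powr (s - 1) * Beta (s / 2 + \<alpha>) (s / 2 - \<alpha>)"
    unfolding P_def Q_def by (subst F) (simp only: integral_mult_right_zero)
qed

lemma lborel_of_half_lines:
  fixes f :: "real \<Rightarrow> complex"
  assumes m: "f \<in> borel_measurable borel"
    and i1: "integrable (lborel_on {0..}) f" and i2: "integrable (lborel_on {0..}) (\<lambda>x. f (- x))"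
  shows "integrable lborel f"
    and "integral\<^sup>L lborel f = integral\<^sup>L (lborel_on {0..}) f + integral\<^sup>L (lborel_on {0..}) (\<lambda>x. f (- x))"
proof -
  define g where "g x = indicator {0..} x *\<^sub>R f x" for x :: real
  define h where "h x = indicator {0..} x *\<^sub>R f (- x)" for x :: real
  have g: "integrable lborel g" "integral\<^sup>L lborel g = integral\<^sup>L (lborel_on {0..}) f"
    using i1 unfolding g_def by (simp_all add: integrable_restrict_space integral_restrict_space)
  have h: "integrable lborel h" "integral\<^sup>L lborel h = integral\<^sup>L (lborel_on {0..}) (\<lambda>x. f (- x))"
    using i2 unfolding h_def by (simp_all add: integrable_restrict_space integral_restrict_space)
  have h': "integrable lborel (\<lambda>x. h (0 + (- 1) * x))" by (rule lborel_integrable_real_affine[OF h(1)]) simp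
  have hv: "integral\<^sup>L lborel (\<lambda>x. h (0 + (- 1) * x)) = integral\<^sup>L lborel h"
    using lborel_integral_real_affine[of "- 1" h 0] by simp
  have AE: "AE x in lborel. f x = g x + h (0 + (- 1) * x)"
    using AE_lborel_singleton[of 0] by eventually_elim (auto simp: g_def h_def indicator_def)
  have mg: "(\<lambda>x. g x + h (0 + (- 1) * x)) \<in> borel_measurable lborel"
    using g(1) h' by (intro borel_measurable_add) auto
  have ig: "integrable lborel (\<lambda>x. g x + h (0 + (- 1) * x))" using g(1) h' by auto
  show "integrable lborel f"
    using integrable_cong_AE[OF _ mg AE] m ig by simp
  have "integral\<^sup>L lborel f = integral\<^sup>L lborel (\<lambda>x. g x + h (0 + (- 1) * x))"
    by (rule integral_cong_AE[OF _ mg AE]) (use m in simp)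
  also have "\<dots> = integral\<^sup>L lborel g + integral\<^sup>L lborel (\<lambda>x. h (0 + (- 1) * x))"
    by (rule Bochner_Integration.integral_add[OF g(1) h'])
  finally show "integral\<^sup>L lborel f = integral\<^sup>L (lborel_on {0..}) f + integral\<^sup>L (lborel_on {0..}) (\<lambda>x. f (- x))"
    by (simp only: g(2) hv h(2))
qed

lemma continuous_on_K_kernel: "continuous_on UNIV (K_kernel \<nu> z)"
  unfolding K_kernel_def cosh_field_def by (intro continuous_intros) auto

lemma K_kernel_line:
  assumes "Re z > 0"
  shows "integrable lborel (K_kernel \<nu> z)" and "integral\<^sup>L lborel (K_kernel \<nu> z) = 2 * bessel_K \<nu> z"
proof -
  have refl: "K_kernel \<nu> z (- t) = K_kernel (- \<nu>) z t" for t
    by (simp add: K_kernel_def)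
  have m: "K_kernel \<nu> z \<in> borel_measurable borel"
    by (rule borel_measurable_continuous_onI[OF continuous_on_K_kernel])
  note L = lborel_of_half_lines[OF m, unfolded refl, OF integrable_K_kernel[OF assms] integrable_K_kernel[OF assms]]
  show "integrable lborel (K_kernel \<nu> z)" by (rule L(1))
  show "integral\<^sup>L lborel (K_kernel \<nu> z) = 2 * bessel_K \<nu> z"
    unfolding L(2) bessel_K_eq[OF assms] by simp
qed

abbreviation plane :: "(real \<times> real) measure" where
  "plane \<equiv> lborel \<Otimes>\<^sub>M lborel"

text \<open>In the variables \<open>p\<close> (half the sum) and \<open>q\<close> (half the difference) of the two integrations, the exponent
\<open>cosh t + cosh u\<close> becomes \<open>2 cosh p cosh q\<close>.\<close>

definition K_square_kernel :: "complex \<Rightarrow> complex \<Rightarrow> real \<times> real \<Rightarrow> complex" where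
  "K_square_kernel \<nu> z = (\<lambda>(p, q). exp (- (2 * z) * of_real (cosh p * cosh q)) * exp (2 * \<nu> * of_real p))"

lemma K_kernel_alt: "K_kernel \<nu> z t = exp (- z * of_real (cosh t)) * exp (\<nu> * of_real t)"
  by (simp add: K_kernel_def cosh_field_def exp_of_real[symmetric] flip: of_real_minus)

lemma K_square_kernel_measurable: "K_square_kernel \<nu> z \<in> borel_measurable plane"
  unfolding lborel_prod K_square_kernel_def case_prod_unfold cosh_def
  by (intro continuous_lborel_measurable continuous_intros)

lemma product_integral:
  fixes f g :: "real \<Rightarrow> complex"
  assumes f: "integrable lborel f" and g: "integrable lborel g"
  shows "integrable plane (\<lambda>x. f (fst x) * g (snd x))"
    and "integral\<^sup>L plane (\<lambda>x. f (fst x) * g (snd x)) = integral\<^sup>L lborel f * integral\<^sup>L lborel g"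
proof -
  have [measurable]: "f \<in> borel_measurable borel" "g \<in> borel_measurable borel" using f g by auto
  show i: "integrable plane (\<lambda>x. f (fst x) * g (snd x))"
  proof (rule lborel_pair.Fubini_integrable)
    have "integrable lborel (\<lambda>x. norm (f x) * integral\<^sup>L lborel (\<lambda>y. norm (g y)))"
      using f by auto
    thus "integrable lborel (\<lambda>x. \<integral>y. norm (f (fst (x, y)) * g (snd (x, y))) \<partial>lborel)"
      by (simp add: norm_mult)
    show "AE x in lborel. integrable lborel (\<lambda>y. f (fst (x, y)) * g (snd (x, y)))"
      using g by (intro AE_I2) auto
  qed simp
  show "integral\<^sup>L plane (\<lambda>x. f (fst x) * g (snd x)) = integral\<^sup>L lborel f * integral\<^sup>L lborel g"
    using lborel_pair.integral_fst'[OF i] by simp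
qed

lemma cosh_mult_ge: "cosh (p::real) + cosh q \<le> 2 * (cosh p * cosh q)"
proof -
  have "(cosh p - 1) * (cosh q - 1) \<ge> 0" using cosh_real_ge_1[of p] cosh_real_ge_1[of q] by (intro mult_nonneg_nonneg) auto
  thus ?thesis using cosh_real_ge_1[of p] cosh_real_ge_1[of q] by (simp add: algebra_simps)
qed

lemma K_square_integrable:
  assumes "Re z > 0"
  shows "integrable plane (K_square_kernel \<nu> z)"
proof (rule Bochner_Integration.integrable_bound[OF product_integral(1)[OF K_kernel_line(1) K_kernel_line(1)] K_square_kernel_measurable])
  show "AE x in plane. norm (K_square_kernel \<nu> z x) \<le> norm (K_kernel (2 * \<nu>) z (fst x) * K_kernel 0 z (snd x))"
  proof (rule AE_I2)
    fix x :: "real \<times> real"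
    obtain p q where x: "x = (p, q)" by (cases x)
    have "Re z * (cosh p + cosh q) \<le> Re z * (2 * (cosh p * cosh q))"
      using assms cosh_mult_ge by (intro mult_left_mono) auto
    hence "exp (- (Re z * (2 * (cosh p * cosh q)))) * exp (2 * Re \<nu> * p) \<le> exp (- (Re z * (cosh p + cosh q))) * exp (2 * Re \<nu> * p)"
      by (intro mult_right_mono) auto
    also have "\<dots> = norm (K_kernel (2 * \<nu>) z p) * norm (K_kernel 0 z q)"
      unfolding norm_K_kernel by (simp add: algebra_simps flip: exp_add)
    also have "exp (- (Re z * (2 * (cosh p * cosh q)))) * exp (2 * Re \<nu> * p) = norm (K_square_kernel \<nu> z x)"
      unfolding x K_square_kernel_def case_prod_conv norm_mult norm_exp_eq_Re by (simp add: algebra_simps)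
    finally show "norm (K_square_kernel \<nu> z x) \<le> norm (K_kernel (2 * \<nu>) z (fst x) * K_kernel 0 z (snd x))"
      by (simp add: x norm_mult)
  qed
qed (use assms in auto)

text \<open>The square of \<open>2 K\<close> is an integral over the plane; the substitution \<open>t = p + q\<close>, \<open>u = p - q\<close> has
Jacobian 2. It is carried out one variable at a time, as affine substitutions inside iterated integrals.\<close>

lemma bessel_K_square:
  assumes z: "Re z > 0"
  shows "integral\<^sup>L plane (K_square_kernel \<nu> z) = 2 * (bessel_K \<nu> z)\<^sup>2"
proof -
  let ?k = "K_kernel \<nu> z"
  define f where "f w = ?k (fst w) * ?k (- fst w + 2 * snd w)" for w :: "real \<times> real"
  note k1 = K_kernel_line(1)[OF z, of \<nu>] and k2 = K_kernel_line(2)[OF z, of \<nu>]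
  have kc: "continuous_on UNIV ?k" by (rule continuous_on_K_kernel)
  have aff: "integrable lborel (\<lambda>p. ?k (- t + 2 * p))" for t
    by (rule lborel_integrable_real_affine[OF k1]) simp
  have fi: "integrable plane f"
  proof (rule lborel_pair.Fubini_integrable)
    show "f \<in> borel_measurable plane"
      unfolding lborel_prod f_def
      by (intro continuous_lborel_measurable continuous_on_mult continuous_on_compose2[OF kc] continuous_intros) auto
    have n: "(\<integral>p. norm (f (t, p)) \<partial>lborel) = norm (?k t) * ((\<integral>u. norm (?k u) \<partial>lborel) / 2)" for t
    proof -
      have "(\<integral>u. norm (?k u) \<partial>lborel) = \<bar>2\<bar> *\<^sub>R (\<integral>p. norm (?k (- t + 2 * p)) \<partial>lborel)"
        by (rule lborel_integral_real_affine) simp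
      thus ?thesis by (simp add: f_def norm_mult)
    qed
    show "integrable lborel (\<lambda>t. \<integral>p. norm (f (t, p)) \<partial>lborel)"
      unfolding n by (intro integrable_mult_left integrable_norm k1)
    show "AE t in lborel. integrable lborel (\<lambda>p. f (t, p))"
      unfolding f_def using aff by (intro AE_I2) simp
  qed
  have "4 * (bessel_K \<nu> z)\<^sup>2 = (\<integral>t. ?k t * (2 * bessel_K \<nu> z) \<partial>lborel)"
    using k2 by (simp add: power2_eq_square)
  also have "\<dots> = (\<integral>t. 2 * (\<integral>p. f (t, p) \<partial>lborel) \<partial>lborel)"
  proof (rule Bochner_Integration.integral_cong[OF refl])
    fix t :: real
    have "integral\<^sup>L lborel ?k = \<bar>2\<bar> *\<^sub>R (\<integral>p. ?k (- t + 2 * p) \<partial>lborel)"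
      by (rule lborel_integral_real_affine) simp
    hence "2 * bessel_K \<nu> z = 2 * (\<integral>p. ?k (- t + 2 * p) \<partial>lborel)"
      unfolding k2 by (simp add: scaleR_conv_of_real)
    thus "?k t * (2 * bessel_K \<nu> z) = 2 * (\<integral>p. f (t, p) \<partial>lborel)"
      by (simp add: f_def)
  qed
  also have "\<dots> = 2 * (\<integral>t. (\<integral>p. f (t, p) \<partial>lborel) \<partial>lborel)" by simp
  also have "(\<integral>t. (\<integral>p. f (t, p) \<partial>lborel) \<partial>lborel) = (\<integral>p. (\<integral>t. f (t, p) \<partial>lborel) \<partial>lborel)"
    using lborel_pair.Fubini_integral[of "\<lambda>x y. f (x, y)"] fi by simp
  also have "\<dots> = (\<integral>p. (\<integral>q. K_square_kernel \<nu> z (p, q) \<partial>lborel) \<partial>lborel)"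
  proof (rule Bochner_Integration.integral_cong[OF refl])
    fix p :: real
    have aff1: "(\<integral>t. f (t, p) \<partial>lborel) = \<bar>1\<bar> *\<^sub>R (\<integral>q. f (p + 1 * q, p) \<partial>lborel)"
      by (rule lborel_integral_real_affine) simp
    have fK: "f (p + 1 * q, p) = K_square_kernel \<nu> z (p, q)" for q
    proof -
      have c: "cosh (p + q) + cosh (p - q) = 2 * (cosh p * cosh q)" by (simp add: cosh_add cosh_diff)
      have "f (p + 1 * q, p) = exp (- z * of_real (cosh (p + q) + cosh (p - q)) + \<nu> * of_real ((p + q) + (p - q)))"
        unfolding f_def K_kernel_alt by (simp add: algebra_simps flip: exp_add)
      also have "\<dots> = K_square_kernel \<nu> z (p, q)"
        unfolding c K_square_kernel_def case_prod_conv exp_add[symmetric] by (rule arg_cong[where f = exp]) (simp add: algebra_simps)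
      finally show ?thesis .
    qed
    show "(\<integral>t. f (t, p) \<partial>lborel) = (\<integral>q. K_square_kernel \<nu> z (p, q) \<partial>lborel)"
      unfolding aff1 fK by simp
  qed
  also have "\<dots> = integral\<^sup>L plane (K_square_kernel \<nu> z)"
    by (rule lborel_pair.integral_fst'[OF K_square_integrable[OF z]])
  finally show ?thesis by simp
qed

lemma powr_times_pos_real:
  assumes "r > 0" "w \<noteq> 0"
  shows "(w * complex_of_real r) powr z = w powr z * of_real r powr z"
proof -
  have "Ln (w * of_real r) = of_real (ln r) + Ln w"
    using Ln_times_of_real[OF assms] by (simp only: mult.commute[of w] Ln_of_real[OF assms(1)])
  moreover have "w * of_real r \<noteq> 0" using assms by simp
  ultimately have "(w * complex_of_real r) powr z = exp (z * Ln w + z * of_real (ln r))"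
    by (simp add: powr_def algebra_simps)
  also have "\<dots> = w powr z * of_real r powr z"
    unfolding exp_add of_real_powr_exp[OF assms(1)] using assms(2) by (simp add: powr_def)
  finally show ?thesis .
qed

lemma norm_Gamma_integral:
  assumes s: "Re s > 0" and w: "Re w > 0"
  shows "integral\<^sup>L (lborel_on {0<..}) (\<lambda>x. norm (of_real x powr (s - 1) * exp (- w * of_real x))) =
           norm (Gamma (complex_of_real (Re s))) * Re w powr (- Re s)"
proof -
  let ?I = "integral\<^sup>L (lborel_on {0<..}) (\<lambda>x. norm (of_real x powr (s - 1) * exp (- w * of_real x)))"
  have "complex_of_real ?I = integral\<^sup>L (lborel_on {0<..}) (\<lambda>x. complex_of_real (norm (of_real x powr (s - 1) * exp (- w * of_real x))))"
    by (rule integral_complex_of_real[symmetric])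
  also have "\<dots> = integral\<^sup>L (lborel_on {0<..}) (\<lambda>x. of_real x powr (of_real (Re s) - 1) * exp (- of_real (Re w) * of_real x))"
  proof (rule Bochner_Integration.integral_cong[OF refl])
    fix x assume "x \<in> space (lborel_on {0<..})"
    hence x: "x > 0" by simp
    have "of_real (Re s) - 1 = complex_of_real (Re s - 1)" by simp
    thus "complex_of_real (norm (of_real x powr (s - 1) * exp (- w * of_real x))) =
          of_real x powr (of_real (Re s) - 1) * exp (- of_real (Re w) * of_real x)"
      using x by (simp only: norm_mult norm_of_real_powr[OF less_imp_le[OF x]]) (simp add: powr_of_real exp_of_real[symmetric] flip: of_real_diff)
  qed
  also have "\<dots> = Gamma (of_real (Re s)) * of_real (Re w) powr (- of_real (Re s))"
    by (rule Gamma_integral_scaled) (use s w in auto)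
  finally have "norm (complex_of_real ?I) = norm (Gamma (complex_of_real (Re s)) * of_real (Re w) powr (- of_real (Re s)))"
    by (rule arg_cong)
  moreover have "?I \<ge> 0" by (rule Bochner_Integration.integral_nonneg) simp
  ultimately show ?thesis using w by (simp add: norm_mult norm_of_real_powr)
qed

lemma sigma_finite_lborel_on: "S \<in> sets borel \<Longrightarrow> sigma_finite_measure (lborel_on S)"
  by (rule sigma_finite_measure_restrict_space) (simp_all add: lborel.sigma_finite_measure_axioms)

text \<open>Integrating over \<open>x\<close> first gives \<open>Gamma s\<close> times \<open>2 b cosh p cosh q\<close> to the power \<open>- s\<close>, which separates into
two instances of \<open>cosh_integral\<close>. The assumption on \<open>s\<close> is what makes the absolute double integral finite.\<close>

lemma bessel_K_square_moment:
  assumes b: "Re b > 0" and s: "Re s > 2 * \<bar>Re \<alpha>\<bar>"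
  shows "integral\<^sup>L (lborel_on {0<..}) (\<lambda>x. of_real x powr (s - 1) * (bessel_K \<alpha> (b * of_real x))\<^sup>2) =
           b powr (- s) * 2 powr (s - 3) * Gamma (s / 2 + \<alpha>) * Gamma (s / 2 - \<alpha>) * (Gamma (s / 2))\<^sup>2 / Gamma s"
proof -
  let ?M = "lborel_on {0::real<..}"
  have s0: "Re s > 0" using s by auto
  interpret M: sigma_finite_measure ?M by (rule sigma_finite_lborel_on) simp
  interpret plane: sigma_finite_measure plane unfolding lborel_prod by (rule lborel.sigma_finite_measure_axioms)
  interpret PM: pair_sigma_finite plane ?M ..
  define F where "F \<beta> p = exp (2 * \<beta> * of_real p) * of_real (cosh p) powr (- s)" for \<beta> and p :: real
  define f where "f w x = of_real x powr (s - 1) * K_square_kernel \<alpha> (b * of_real x) w" for w :: "real \<times> real" and x :: real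
  define c where "c w = cosh (fst w) * cosh (snd w)" for w :: "real \<times> real"
  have c1: "c w > 0" for w using cosh_real_ge_1[of "fst w"] cosh_real_ge_1[of "snd w"] by (simp add: c_def)
  have f_eq: "f w x = exp (2 * \<alpha> * of_real (fst w)) * (of_real x powr (s - 1) * exp (- (2 * b * of_real (c w)) * of_real x))" for w x
    by (simp add: f_def K_square_kernel_def case_prod_unfold c_def mult_ac)
  have Rec: "Re (2 * b * of_real (c w)) = 2 * Re b * c w" "2 * Re b * c w > 0" for w using b c1[of w] by auto
  have Fi: "integrable lborel (F \<alpha>)" "integrable lborel (F 0)"
    unfolding F_def using cosh_integral(1)[of \<alpha> s] cosh_integral(1)[of 0 s] s s0 by auto
  note FF = product_integral[OF Fi]
  have coshp: "cosh p > 0" for p :: real using cosh_real_ge_1[of p] by linarith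
  have nF: "norm (F \<beta> p) = exp (2 * Re \<beta> * p) * cosh p powr (- Re s)" for \<beta> p
    unfolding F_def norm_mult using norm_of_real_powr[of "cosh p" "- s"] coshp[of p] by (simp add: less_imp_le)
  have inner_norm: "(\<integral>x. norm (f w x) \<partial>?M) = norm (Gamma (complex_of_real (Re s))) * (2 * Re b) powr (- Re s) * norm (F \<alpha> (fst w) * F 0 (snd w))" for w
  proof -
    have "(\<integral>x. norm (f w x) \<partial>?M) = exp (2 * Re \<alpha> * fst w) * (\<integral>x. norm (of_real x powr (s - 1) * exp (- (2 * b * of_real (c w)) * of_real x)) \<partial>?M)"
      unfolding f_eq norm_mult[of "exp (2 * \<alpha> * _)"] by (simp only: integral_mult_right_zero norm_exp_eq_Re) simp
    also have "\<dots> = exp (2 * Re \<alpha> * fst w) * (norm (Gamma (complex_of_real (Re s))) * (2 * Re b * c w) powr (- Re s))"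
      by (subst norm_Gamma_integral[OF s0]) (use Rec in auto)
    also have "(2 * Re b * c w) powr (- Re s) = (2 * Re b) powr (- Re s) * (cosh (fst w) powr (- Re s) * cosh (snd w) powr (- Re s))"
      unfolding c_def by (simp add: powr_mult)
    finally show ?thesis by (simp add: norm_mult nF mult_ac)
  qed
  have fi: "integrable (plane \<Otimes>\<^sub>M ?M) (\<lambda>(w, x). f w x)"
  proof (rule PM.Fubini_integrable)
    show "(\<lambda>(w, x). f w x) \<in> borel_measurable (plane \<Otimes>\<^sub>M ?M)"
    proof -
      have h: "(\<lambda>y. exp (2 * \<alpha> * of_real (fst (fst y))) * exp (- (2 * b * of_real (c (fst y))) * of_real (snd y))) \<in> borel_measurable borel"
        unfolding c_def cosh_def by (intro borel_measurable_continuous_onI continuous_intros)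
      have id: "(\<lambda>x. x) \<in> ?M \<rightarrow>\<^sub>M borel" by (rule measurable_restrict_space1) simp
      have 1: "fst \<in> (plane \<Otimes>\<^sub>M ?M) \<rightarrow>\<^sub>M borel"
        using measurable_fst[of plane ?M] unfolding lborel_prod by (simp cong: measurable_cong_sets)
      have 2: "snd \<in> (plane \<Otimes>\<^sub>M ?M) \<rightarrow>\<^sub>M borel"
        using measurable_compose[OF measurable_snd id, of plane] by simp
      have "(\<lambda>y. (fst y, snd y)) \<in> (plane \<Otimes>\<^sub>M ?M) \<rightarrow>\<^sub>M borel \<Otimes>\<^sub>M borel"
        by (rule measurable_Pair[OF 1 2])
      hence pr: "(\<lambda>y. (fst y, snd y)) \<in> (plane \<Otimes>\<^sub>M ?M) \<rightarrow>\<^sub>M borel" by (simp only: borel_prod)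
      have m1: "(\<lambda>y. exp (2 * \<alpha> * of_real (fst (fst y))) * exp (- (2 * b * of_real (c (fst y))) * of_real (snd y))) \<in> borel_measurable (plane \<Otimes>\<^sub>M ?M)"
        using measurable_compose[OF pr h] by simp
      have pw: "(\<lambda>x. complex_of_real x powr (s - 1)) \<in> borel_measurable ?M"
        by (intro borel_measurable_lborel_on continuous_intros) (auto simp: complex_nonpos_Reals_iff)
      have m2: "(\<lambda>y. complex_of_real (snd y) powr (s - 1)) \<in> borel_measurable (plane \<Otimes>\<^sub>M ?M)"
        by (rule measurable_compose[OF measurable_snd pw])
      have "(\<lambda>(w, x). f w x) = (\<lambda>y. complex_of_real (snd y) powr (s - 1) * (exp (2 * \<alpha> * of_real (fst (fst y))) * exp (- (2 * b * of_real (c (fst y))) * of_real (snd y))))"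
        by (auto simp: f_eq fun_eq_iff)
      thus ?thesis using borel_measurable_times[OF m2 m1] by (simp only:)
    qed
    show "integrable plane (\<lambda>w. \<integral>x. norm (case (w, x) of (w, x) \<Rightarrow> f w x) \<partial>?M)"
      unfolding case_prod_conv inner_norm by (intro integrable_mult_right integrable_norm FF(1))
    show "AE w in plane. integrable ?M (\<lambda>x. case (w, x) of (w, x) \<Rightarrow> f w x)"
      unfolding case_prod_conv f_eq
      by (intro AE_I2 integrable_mult_right Gamma_kernel_integrable s0) (use Rec in auto)
  qed
  have "(\<integral>x. (\<integral>w. f w x \<partial>plane) \<partial>?M) = (\<integral>w. (\<integral>x. f w x \<partial>?M) \<partial>plane)"
    by (rule PM.Fubini_integral[OF fi])
  also have "(\<integral>x. (\<integral>w. f w x \<partial>plane) \<partial>?M) = (\<integral>x. 2 * (of_real x powr (s - 1) * (bessel_K \<alpha> (b * of_real x))\<^sup>2) \<partial>?M)"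
  proof (rule Bochner_Integration.integral_cong[OF refl])
    fix x assume "x \<in> space ?M"
    hence x: "Re (b * of_real x) > 0" using b by simp
    show "(\<integral>w. f w x \<partial>plane) = 2 * (of_real x powr (s - 1) * (bessel_K \<alpha> (b * of_real x))\<^sup>2)"
      unfolding f_def integral_mult_right_zero bessel_K_square[OF x] by simp
  qed
  also have "\<dots> = 2 * (\<integral>x. of_real x powr (s - 1) * (bessel_K \<alpha> (b * of_real x))\<^sup>2 \<partial>?M)" by simp
  also have "(\<integral>w. (\<integral>x. f w x \<partial>?M) \<partial>plane) = (\<integral>w. (Gamma s * (2 * b) powr (- s)) * (F \<alpha> (fst w) * F 0 (snd w)) \<partial>plane)"
  proof (rule Bochner_Integration.integral_cong[OF refl])
    fix w :: "real \<times> real"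
    have b0: "2 * b \<noteq> 0" "2 * b * of_real (cosh (fst w)) \<noteq> 0" using b coshp[of "fst w"] by auto
    have "(2 * b * of_real (c w)) powr (- s) = (2 * b * of_real (cosh (fst w)) * of_real (cosh (snd w))) powr (- s)"
      by (simp add: c_def mult.assoc)
    also have "\<dots> = (2 * b) powr (- s) * of_real (cosh (fst w)) powr (- s) * of_real (cosh (snd w)) powr (- s)"
      unfolding powr_times_pos_real[OF coshp b0(2)] powr_times_pos_real[OF coshp b0(1)] ..
    finally have pw: "(2 * b * of_real (c w)) powr (- s) = (2 * b) powr (- s) * of_real (cosh (fst w)) powr (- s) * of_real (cosh (snd w)) powr (- s)" .
    have "(\<integral>x. f w x \<partial>?M) = exp (2 * \<alpha> * of_real (fst w)) * (Gamma s * (2 * b * of_real (c w)) powr (- s))"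
      unfolding f_eq integral_mult_right_zero by (subst Gamma_integral_scaled[OF s0]) (use Rec in auto)
    thus "(\<integral>x. f w x \<partial>?M) = (Gamma s * (2 * b) powr (- s)) * (F \<alpha> (fst w) * F 0 (snd w))"
      unfolding pw F_def by (simp add: mult_ac)
  qed
  also have "\<dots> = (Gamma s * (2 * b) powr (- s)) * (integral\<^sup>L lborel (F \<alpha>) * integral\<^sup>L lborel (F 0))"
    unfolding integral_mult_right_zero FF(2) ..
  also have "integral\<^sup>L lborel (F \<alpha>) = 2 powr (s - 1) * Beta (s / 2 + \<alpha>) (s / 2 - \<alpha>)"
    unfolding F_def by (rule cosh_integral(2)[OF s])
  also have "integral\<^sup>L lborel (F 0) = 2 powr (s - 1) * Beta (s / 2) (s / 2)"
    unfolding F_def using cosh_integral(2)[of 0 s] s0 by simp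
  finally have eq: "2 * (\<integral>x. of_real x powr (s - 1) * (bessel_K \<alpha> (b * of_real x))\<^sup>2 \<partial>?M) =
      (Gamma s * (2 * b) powr (- s)) * (2 powr (s - 1) * Beta (s / 2 + \<alpha>) (s / 2 - \<alpha>) * (2 powr (s - 1) * Beta (s / 2) (s / 2)))" .
  have Gs: "Gamma s \<noteq> 0" using Re_pos_notin_nonpos_Ints[OF s0] by (simp add: Gamma_eq_zero_iff)
  have p2: "(2 * b) powr (- s) = b powr (- s) * 2 powr (- s)"
  proof -
    have "b \<noteq> 0" using b by auto
    from powr_times_pos_real[of 2, OF _ this, of "- s"] show ?thesis by (simp add: mult.commute[of 2 b])
  qed
  have p3: "2 powr (- s) * (2 powr (s - 1) * 2 powr (s - 1)) = 2 * (2 :: complex) powr (s - 3)"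
  proof -
    have "2 powr (- s) * (2 powr (s - 1) * 2 powr (s - 1)) = (2 :: complex) powr (s - 2)"
      by (simp flip: powr_add)
    also have "\<dots> = 2 powr (s - 3) * 2" using powr_add[of 2 "s - 3" 1] by simp
    finally show ?thesis by (simp only: mult.commute)
  qed
  have B: "Beta (s / 2 + \<alpha>) (s / 2 - \<alpha>) = Gamma (s / 2 + \<alpha>) * Gamma (s / 2 - \<alpha>) / Gamma s"
    "Beta (s / 2) (s / 2) = (Gamma (s / 2))\<^sup>2 / Gamma s" by (simp_all add: Beta_def power2_eq_square)
  have alg: "g * (x * v) * (u * (P / g) * (u * (Q / g))) = x * (v * (u * u)) * P * Q / g" if "g \<noteq> 0" for g x v u P Q :: complex
    using that by (simp add: field_simps)
  show ?thesis
  proof (rule mult_left_cancel[THEN iffD1])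
    show "2 * (\<integral>x. of_real x powr (s - 1) * (bessel_K \<alpha> (b * of_real x))\<^sup>2 \<partial>?M) =
       2 * (b powr (- s) * 2 powr (s - 3) * Gamma (s / 2 + \<alpha>) * Gamma (s / 2 - \<alpha>) * (Gamma (s / 2))\<^sup>2 / Gamma s)"
      unfolding eq p2 B alg[OF Gs] p3 by (simp add: mult_ac)
  qed simp
qed

section \<open>The moment integral as a function of a\<close>

text \<open>The shape of all dominating functions for the moment integral. The cube accounts for the three factors \<open>K\<close>, each of
which may be as singular at 0 as \<open>x\<close> to the power \<open>- \<tau>\<close>.\<close>

definition weight :: "real \<Rightarrow> real \<Rightarrow> real \<Rightarrow> real \<Rightarrow> real" where
  "weight \<beta> \<tau> B x = x powr \<beta> * (1 + x powr (- \<tau>)) ^ 3 * exp (- B * x)"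

lemma integrable_powr_exp:
  assumes "\<beta> > - 1" "B > 0"
  shows "integrable (lborel_on {0<..}) (\<lambda>x. x powr \<beta> * exp (- B * x))"
proof -
  have int: "integrable (lborel_on {0<..}) (\<lambda>x. norm (of_real x powr (of_real (\<beta> + 1) - 1) * exp (- of_real B * complex_of_real x)))"
    using assms by (intro integrable_norm Gamma_kernel_integrable) auto
  have eq: "norm (of_real x powr (of_real (\<beta> + 1) - 1) * exp (- of_real B * complex_of_real x)) = x powr \<beta> * exp (- B * x)"
    if "x \<in> space (lborel_on {0<..})" for x
  proof -
    have "x > 0" using that by simp
    thus ?thesis using norm_of_real_powr[of x "of_real (\<beta> + 1) - 1"] by (simp add: norm_mult)
  qed
  show ?thesis by (rule Bochner_Integration.integrable_cong[THEN iffD1, OF refl eq int])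
qed

lemma integrable_weight:
  assumes "\<tau> > 0" "\<beta> - 3 * \<tau> > - 1" "B > 0"
  shows "integrable (lborel_on {0<..}) (weight \<beta> \<tau> B)"
proof (rule Bochner_Integration.integrable_bound)
  show "integrable (lborel_on {0<..}) (\<lambda>x. 4 * (x powr \<beta> * exp (- B * x)) + 4 * (x powr (\<beta> - 3 * \<tau>) * exp (- B * x)))"
    using assms by (intro Bochner_Integration.integrable_add integrable_mult_right integrable_powr_exp) auto
  show "weight \<beta> \<tau> B \<in> borel_measurable (lborel_on {0<..})"
    unfolding weight_def[abs_def] by (intro borel_measurable_lborel_on continuous_intros) auto
  show "AE x in lborel_on {0<..}. norm (weight \<beta> \<tau> B x) \<le> norm (4 * (x powr \<beta> * exp (- B * x)) + 4 * (x powr (\<beta> - 3 * \<tau>) * exp (- B * x)))"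
  proof (rule AE_I2)
    fix x assume "x \<in> space (lborel_on {0<..})"
    hence x: "x > 0" by simp
    define y where "y = x powr (- \<tau>)"
    have y: "y \<ge> 0" by (simp add: y_def)
    have y3: "x powr (\<beta> - 3 * \<tau>) = x powr \<beta> * y ^ 3"
    proof -
      have "y ^ 3 = x powr (- 3 * \<tau>)" unfolding y_def using x by (simp add: powr_power mult.commute)
      thus ?thesis by (simp flip: powr_add)
    qed
    have c: "(1 + y) ^ 3 \<le> 4 * (1 + y ^ 3)"
    proof -
      have "4 * (1 + y ^ 3) - (1 + y) ^ 3 = 3 * (1 + y) * (1 - y)\<^sup>2" by algebra
      also have "\<dots> \<ge> 0" using y by simp
      finally show ?thesis by simp
    qed
    have "weight \<beta> \<tau> B x = (x powr \<beta> * exp (- B * x)) * (1 + y) ^ 3" by (simp add: weight_def y_def)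
    also have "\<dots> \<le> (x powr \<beta> * exp (- B * x)) * (4 * (1 + y ^ 3))" by (intro mult_left_mono c) simp
    also have "\<dots> = 4 * (x powr \<beta> * exp (- B * x)) + 4 * (x powr (\<beta> - 3 * \<tau>) * exp (- B * x))"
      unfolding y3 by (simp add: algebra_simps)
    finally have le: "weight \<beta> \<tau> B x \<le> 4 * (x powr \<beta> * exp (- B * x)) + 4 * (x powr (\<beta> - 3 * \<tau>) * exp (- B * x))" .
    have "weight \<beta> \<tau> B x \<ge> 0" by (simp add: weight_def)
    thus "norm (weight \<beta> \<tau> B x) \<le> norm (4 * (x powr \<beta> * exp (- B * x)) + 4 * (x powr (\<beta> - 3 * \<tau>) * exp (- B * x)))"
      using le unfolding real_norm_def by linarith
  qed
qed

definition integrand :: "nat \<Rightarrow> complex \<Rightarrow> complex \<Rightarrow> complex \<Rightarrow> real \<Rightarrow> complex" where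
  "integrand j \<alpha> a b x = of_real x ^ j * (bessel_I \<alpha> (a * of_real x) * bessel_K \<alpha> (a * of_real x) * (bessel_K \<alpha> (b * of_real x))\<^sup>2)"

definition bessel_integral :: "nat \<Rightarrow> complex \<Rightarrow> complex \<Rightarrow> complex \<Rightarrow> complex" where
  "bessel_integral j \<alpha> a b = integral\<^sup>L (lborel_on {0<..}) (integrand j \<alpha> a b)"

lemma one_plus_powr_le:
  fixes A r x \<tau> :: real
  assumes "A > 0" "A \<le> r" "x > 0" "\<tau> > 0"
  shows "1 + (r * x) powr (- \<tau>) \<le> (1 + A powr (- \<tau>)) * (1 + x powr (- \<tau>))"
proof -
  have "(r * x) powr (- \<tau>) \<le> (A * x) powr (- \<tau>)"
    using assms by (intro powr_mono2') auto
  also have "\<dots> = A powr (- \<tau>) * x powr (- \<tau>)" by (rule powr_mult)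
  finally have "1 + (r * x) powr (- \<tau>) \<le> 1 + A powr (- \<tau>) * x powr (- \<tau>)" by simp
  also have "\<dots> \<le> (1 + A powr (- \<tau>)) * (1 + x powr (- \<tau>))" by (simp add: algebra_simps)
  finally show ?thesis .
qed

text \<open>The growth of \<open>I\<close> at \<open>a x\<close> is cancelled by the decay of \<open>K\<close> at \<open>a x\<close>, so \<open>a\<close> enters the bound only through a
lower bound for its real part and through the factor \<open>L\<close>. All constants depend on \<open>\<alpha>\<close> only through bounds, so that the
estimate is uniform both for \<open>a\<close> and for \<open>\<alpha>\<close> in small sets.\<close>

lemma norm_integrand_le:
  assumes x: "x > 0" and A: "A > 0" "A \<le> Re a" and B: "B > 0" "B \<le> Re b"
    and \<alpha>: "Re \<alpha> > - 1/2" "\<bar>Re \<alpha>\<bar> \<le> \<sigma>" "\<sigma> < \<tau>"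
    and L: "norm (a / 2) powr Re \<alpha> \<le> L" and Q: "exp (pi * \<bar>Im \<alpha>\<bar>) * poisson_const \<alpha> \<le> Q"
  defines "C \<equiv> L * Q * K_bound_const \<sigma> \<tau> ^ 3 * (1 + A powr (- \<tau>)) * (1 + B powr (- \<tau>))\<^sup>2"
  shows "norm (integrand j \<alpha> a b x) \<le> C * weight (real j + Re \<alpha>) \<tau> (2 * B) x"
proof -
  define \<kappa> where "\<kappa> = K_bound_const \<sigma> \<tau>"
  have \<kappa>: "\<kappa> \<ge> 0" unfolding \<kappa>_def by (rule K_bound_const_nonneg)
  have \<tau>: "\<tau> > 0" using \<alpha> by auto
  have Ra: "Re (a * of_real x) = Re a * x" "Re (b * of_real x) = Re b * x" by simp_all
  have apos: "Re a > 0" "Re b > 0" using A B by auto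
  define X where "X = x powr Re \<alpha>"
  define Y where "Y = 1 + x powr (- \<tau>)"
  have Y: "Y \<ge> 0" by (simp add: Y_def)
  have L0: "L \<ge> 0" using L powr_ge_zero order_trans by blast
  have Q0: "Q \<ge> 0" using Q poisson_const_nonneg[of \<alpha>] by (meson exp_ge_zero mult_nonneg_nonneg order_trans)
  have I: "norm (bessel_I \<alpha> (a * of_real x)) \<le> (L * X) * Q * exp (Re a * x)"
  proof -
    have "a * of_real x \<noteq> 0" using apos x by auto
    from bessel_I_bound[OF \<alpha>(1) this]
    have "norm (bessel_I \<alpha> (a * of_real x)) \<le> (norm (a / 2) * x) powr Re \<alpha> * exp (pi * \<bar>Im \<alpha>\<bar>) * poisson_const \<alpha> * exp (Re a * x)"
      using apos x by (simp add: norm_mult norm_divide)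
    also have "(norm (a / 2) * x) powr Re \<alpha> = norm (a / 2) powr Re \<alpha> * X" unfolding X_def by (rule powr_mult)
    also have "norm (a / 2) powr Re \<alpha> * X * exp (pi * \<bar>Im \<alpha>\<bar>) * poisson_const \<alpha> * exp (Re a * x) =
         (norm (a / 2) powr Re \<alpha> * X) * (exp (pi * \<bar>Im \<alpha>\<bar>) * poisson_const \<alpha>) * exp (Re a * x)" by (simp only: mult.assoc)
    also have "\<dots> \<le> (L * X) * Q * exp (Re a * x)"
      using poisson_const_nonneg L0 by (intro mult_right_mono mult_mono L Q) (auto simp: X_def)
    finally show ?thesis .
  qed
  have Ka: "norm (bessel_K \<alpha> (a * of_real x)) \<le> \<kappa> * exp (- (Re a * x)) * ((1 + A powr (- \<tau>)) * Y)"
  proof -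
    have "norm (bessel_K \<alpha> (a * of_real x)) \<le> \<kappa> * exp (- (Re a * x)) * (1 + (Re a * x) powr (- \<tau>))"
      using bessel_K_bound[of "a * of_real x" \<alpha> \<sigma> \<tau>] apos x \<alpha> unfolding Ra \<kappa>_def by simp
    also have "\<dots> \<le> \<kappa> * exp (- (Re a * x)) * ((1 + A powr (- \<tau>)) * Y)"
      unfolding Y_def using \<kappa> by (intro mult_left_mono one_plus_powr_le A x \<tau>) auto
    finally show ?thesis .
  qed
  have Kb: "norm (bessel_K \<alpha> (b * of_real x)) \<le> \<kappa> * exp (- (B * x)) * ((1 + B powr (- \<tau>)) * Y)"
  proof -
    have "norm (bessel_K \<alpha> (b * of_real x)) \<le> \<kappa> * exp (- (Re b * x)) * (1 + (Re b * x) powr (- \<tau>))"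
      using bessel_K_bound[of "b * of_real x" \<alpha> \<sigma> \<tau>] apos x \<alpha> unfolding Ra \<kappa>_def by simp
    also have "\<dots> \<le> \<kappa> * exp (- (B * x)) * ((1 + B powr (- \<tau>)) * Y)"
      unfolding Y_def using \<kappa> x B
      by (intro mult_mono one_plus_powr_le B x \<tau> mult_left_mono) auto
    finally show ?thesis .
  qed
  have "norm (integrand j \<alpha> a b x) = x ^ j * (norm (bessel_I \<alpha> (a * of_real x)) * norm (bessel_K \<alpha> (a * of_real x)) * (norm (bessel_K \<alpha> (b * of_real x)))\<^sup>2)"
    using x by (simp add: integrand_def norm_mult norm_power)
  also have "\<dots> \<le> x ^ j * (((L * X) * Q * exp (Re a * x)) * (\<kappa> * exp (- (Re a * x)) * ((1 + A powr (- \<tau>)) * Y)) *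
        (\<kappa> * exp (- (B * x)) * ((1 + B powr (- \<tau>)) * Y))\<^sup>2)"
    using x \<kappa> Y L0 Q0 by (intro mult_left_mono mult_mono power_mono I Ka Kb) (auto simp: X_def)
  also have "\<dots> = (exp (Re a * x) * exp (- (Re a * x))) * (exp (- (B * x)) * exp (- (B * x))) * (x ^ j * X) * Y ^ 3 *
        (L * Q * \<kappa> ^ 3 * (1 + A powr (- \<tau>)) * (1 + B powr (- \<tau>))\<^sup>2)"
    by (simp only: power2_eq_square power3_eq_cube mult_ac)
  also have "exp (Re a * x) * exp (- (Re a * x)) = 1" by (simp flip: exp_add)
  also have "exp (- (B * x)) * exp (- (B * x)) = exp (- (2 * B) * x)" by (simp flip: exp_add)
  also have "x ^ j * X = x powr (real j + Re \<alpha>)" using x by (simp add: X_def powr_add powr_realpow)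
  also have "1 * exp (- (2 * B) * x) * x powr (real j + Re \<alpha>) * Y ^ 3 *
        (L * Q * \<kappa> ^ 3 * (1 + A powr (- \<tau>)) * (1 + B powr (- \<tau>))\<^sup>2) = C * weight (real j + Re \<alpha>) \<tau> (2 * B) x"
    unfolding weight_def C_def Y_def \<kappa>_def by (simp only: mult_1_left mult_ac)
  finally show ?thesis .
qed

text \<open>The last two conditions say that the integrand, which behaves near 0 like \<open>x\<close> to the power
\<open>j - 2 |Re \<alpha>|\<close> times \<open>x\<close> to the power \<open>Re \<alpha> - |Re \<alpha>|\<close>, is integrable there.\<close>

definition admissible :: "nat \<Rightarrow> complex \<Rightarrow> bool" where
  "admissible j \<alpha> \<longleftrightarrow> - 1/2 < Re \<alpha> \<and> Re \<alpha> < 1 \<and> 2 * Re \<alpha> < real j + 1 \<and> - 4 * Re \<alpha> < real j + 1"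

lemma admissible_exponent:
  assumes "admissible j \<alpha>"
  obtains \<tau> where "\<tau> > \<bar>Re \<alpha>\<bar>" "real j + Re \<alpha> - 3 * \<tau> > - 1"
proof -
  have "\<bar>Re \<alpha>\<bar> < (real j + Re \<alpha> + 1) / 3" using assms by (auto simp: admissible_def abs_if)
  from dense[OF this] obtain \<tau> where "\<bar>Re \<alpha>\<bar> < \<tau>" "\<tau> < (real j + Re \<alpha> + 1) / 3" by blast
  thus ?thesis by (intro that[of \<tau>]) auto
qed

lemma continuous_on_bessel_ray:
  assumes "Re c > 0" "f holomorphic_on {z. Re z > 0}"
  shows "continuous_on {0<..} (\<lambda>x. f (c * of_real x))"
  by (rule continuous_on_compose2[OF holomorphic_on_imp_continuous_on[OF assms(2)]])
     (use assms(1) in \<open>auto intro!: continuous_intros\<close>)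

lemma integrand_measurable:
  assumes "Re a > 0" "Re b > 0" "Re \<alpha> > - 1"
  shows "integrand j \<alpha> a b \<in> borel_measurable (lborel_on {0<..})"
  unfolding integrand_def[abs_def]
  by (intro borel_measurable_lborel_on continuous_on_mult continuous_on_power continuous_on_of_real continuous_on_id
        continuous_on_bessel_ray bessel_I_holomorphic bessel_K_holomorphic assms)

lemma bessel_integral_holomorphic:
  assumes b: "Re b > 0" and adm: "admissible j \<alpha>"
  shows "(\<lambda>a. bessel_integral j \<alpha> a b) holomorphic_on {a. Re a > 0}"
    and "Re a > 0 \<Longrightarrow> integrable (lborel_on {0<..}) (integrand j \<alpha> a b)"
proof -
  obtain \<tau> where \<tau>: "\<tau> > \<bar>Re \<alpha>\<bar>" "real j + Re \<alpha> - 3 * \<tau> > - 1" by (rule admissible_exponent[OF adm])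
  have \<alpha>: "Re \<alpha> > - 1/2" "Re \<alpha> > - 1" using adm by (auto simp: admissible_def)
  have dom: "\<exists>r>0. \<exists>g. integrable (lborel_on {0<..}) g \<and> ball z r \<subseteq> {a. Re a > 0} \<and>
            (\<forall>x\<in>space (lborel_on {0<..}). \<forall>w\<in>ball z r. norm (integrand j \<alpha> w b x) \<le> g x)"
    if z: "Re z > 0" for z
  proof -
    define A where "A = Re z / 2"
    define R where "R = norm z + A"
    have A: "A > 0" using z by (simp add: A_def)
    have near: "A \<le> Re w" "norm w \<le> R" if "w \<in> ball z A" for w
    proof -
      have d: "norm (z - w) < A" using that by (simp add: dist_norm)
      show "A \<le> Re w" using d abs_Re_le_cmod[of "z - w"] by (auto simp: A_def abs_le_iff)
      show "norm w \<le> R" using d norm_triangle_ineq4[of z "z - w"] by (simp add: R_def)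
    qed
    define L where "L = (R / 2) powr Re \<alpha> + (A / 2) powr Re \<alpha>"
    have L: "norm (w / 2) powr Re \<alpha> \<le> L" if "w \<in> ball z A" for w
    proof (cases "Re \<alpha> \<ge> 0")
      case True
      have "norm (w / 2) powr Re \<alpha> \<le> (R / 2) powr Re \<alpha>"
        using near[OF that] True by (intro powr_mono2) (auto simp: norm_divide)
      thus ?thesis by (simp add: L_def add_increasing2)
    next
      case False
      have "A \<le> norm w" using near(1)[OF that] complex_Re_le_cmod[of w] by linarith
      hence "norm (w / 2) powr Re \<alpha> \<le> (A / 2) powr Re \<alpha>"
        using False A by (intro powr_mono2') (auto simp: norm_divide)
      thus ?thesis by (simp add: L_def add_increasing)
    qed
    define C where "C = L * (exp (pi * \<bar>Im \<alpha>\<bar>) * poisson_const \<alpha>) * K_bound_const \<bar>Re \<alpha>\<bar> \<tau> ^ 3 * (1 + A powr (- \<tau>)) * (1 + Re b powr (- \<tau>))\<^sup>2"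
    show ?thesis
    proof (rule exI[of _ A], rule conjI, rule A, rule exI, intro conjI ballI)
      show "integrable (lborel_on {0<..}) (\<lambda>x. C * weight (real j + Re \<alpha>) \<tau> (2 * Re b) x)"
        using \<tau> b by (intro integrable_mult_right integrable_weight) auto
      show "ball z A \<subseteq> {a. Re a > 0}"
      proof
        fix w assume "w \<in> ball z A"
        from near(1)[OF this] A show "w \<in> {a. Re a > 0}" by simp
      qed
      show "norm (integrand j \<alpha> w b x) \<le> C * weight (real j + Re \<alpha>) \<tau> (2 * Re b) x"
        if "x \<in> space (lborel_on {0<..})" "w \<in> ball z A" for x w
        unfolding C_def
        by (rule norm_integrand_le[OF _ A near(1)[OF that(2)] b order_refl \<alpha>(1) order_refl \<tau>(1) L[OF that(2)] order_refl])
           (use that in simp)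
    qed
  qed
  have hol: "(\<lambda>w. integrand j \<alpha> w b x) holomorphic_on {a. Re a > 0}" if "x \<in> space (lborel_on {0<..})" for x
  proof -
    have x: "x > 0" using that by simp
    have c: "(\<lambda>w. f (w * of_real x)) holomorphic_on {a. Re a > 0}" if "f holomorphic_on {z. Re z > 0}" for f
      by (rule holomorphic_on_compose_gen[OF _ that, unfolded o_def]) (use x in \<open>auto intro!: holomorphic_intros\<close>)
    show ?thesis unfolding integrand_def
      by (intro holomorphic_on_mult holomorphic_on_const c bessel_I_holomorphic bessel_K_holomorphic \<alpha>)
  qed
  show "(\<lambda>a. bessel_integral j \<alpha> a b) holomorphic_on {a. Re a > 0}"
    unfolding bessel_integral_def
    by (rule holomorphic_on_parameter_integral[where f = "\<lambda>x w. integrand j \<alpha> w b x"])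
       (use hol dom b \<alpha> in \<open>simp_all add: open_halfspace_Re_gt integrand_measurable\<close>)
  assume a: "Re a > 0"
  from dom[OF a] obtain r g where rg: "r > 0" "integrable (lborel_on {0<..}) g"
    "\<And>x w. x \<in> space (lborel_on {0<..}) \<Longrightarrow> w \<in> ball a r \<Longrightarrow> norm (integrand j \<alpha> w b x) \<le> g x" by blast
  show "integrable (lborel_on {0<..}) (integrand j \<alpha> a b)"
  proof (rule Bochner_Integration.integrable_bound[OF rg(2) integrand_measurable[OF a b \<alpha>(2)]], rule AE_I2)
    fix x assume "x \<in> space (lborel_on {0<..})"
    from rg(3)[OF this, of a] rg(1) show "norm (integrand j \<alpha> a b x) \<le> norm (g x)" by simp
  qed
qed

text \<open>The closed form of \<open>bessel_K_square_moment\<close>.\<close>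

definition K_moment :: "complex \<Rightarrow> complex \<Rightarrow> complex \<Rightarrow> complex" where
  "K_moment \<alpha> b s = b powr (- s) * 2 powr (s - 3) * Gamma (s / 2 + \<alpha>) * Gamma (s / 2 - \<alpha>) * (Gamma (s / 2))\<^sup>2 / Gamma s"

lemma K_square_bound:
  assumes x: "x > 0" and b: "Re b > 0" and \<tau>: "\<tau> > \<bar>Re \<alpha>\<bar>"
  shows "norm ((bessel_K \<alpha> (b * of_real x))\<^sup>2) \<le>
     (K_bound_const \<bar>Re \<alpha>\<bar> \<tau>)\<^sup>2 * (1 + Re b powr (- \<tau>))\<^sup>2 * ((1 + x powr (- \<tau>))\<^sup>2 * exp (- (2 * Re b) * x))"
proof -
  have "norm (bessel_K \<alpha> (b * of_real x)) \<le> K_bound_const \<bar>Re \<alpha>\<bar> \<tau> * exp (- (Re b * x)) * (1 + (Re b * x) powr (- \<tau>))"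
    using bessel_K_bound[of "b * of_real x" \<alpha> "\<bar>Re \<alpha>\<bar>" \<tau>] b x \<tau> by simp
  also have "\<dots> \<le> K_bound_const \<bar>Re \<alpha>\<bar> \<tau> * exp (- (Re b * x)) * ((1 + Re b powr (- \<tau>)) * (1 + x powr (- \<tau>)))"
    using K_bound_const_nonneg b x \<tau> by (intro mult_left_mono one_plus_powr_le) auto
  finally have "norm (bessel_K \<alpha> (b * of_real x)) ^ 2 \<le> (K_bound_const \<bar>Re \<alpha>\<bar> \<tau> * exp (- (Re b * x)) * ((1 + Re b powr (- \<tau>)) * (1 + x powr (- \<tau>)))) ^ 2"
    by (intro power_mono) auto
  also have "\<dots> = (K_bound_const \<bar>Re \<alpha>\<bar> \<tau>)\<^sup>2 * (1 + Re b powr (- \<tau>))\<^sup>2 * ((1 + x powr (- \<tau>))\<^sup>2 * (exp (- (Re b * x)) * exp (- (Re b * x))))"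
    by (simp only: power2_eq_square mult_ac)
  also have "exp (- (Re b * x)) * exp (- (Re b * x)) = exp (- (2 * Re b) * x)" by (simp flip: exp_add)
  finally show ?thesis by (simp only: norm_power)
qed

text \<open>The partial sums of the product series are dominated by \<open>exp (Re b * x)\<close> if \<open>a\<close> is small, and half of the decay of the
squared \<open>K\<close> is enough to absorb this factor. Dominated convergence then allows termwise integration.\<close>

lemma series_moment:
  assumes b: "Re b > 0" and a: "a > 0" and \<mu>\<nu>: "Re \<mu> > - 1" "Re \<nu> > - 1"
    and s: "real j + 1 + Re (\<mu> + \<nu>) > 2 * \<bar>Re \<alpha>\<bar>"
    and small: "a * (1 / sqrt (coeff_decay \<mu>) + 1 / sqrt (coeff_decay \<nu>)) \<le> Re b"
  defines "P \<equiv> \<lambda>x. of_real x ^ j * (of_real (a * x / 2) powr (\<mu> + \<nu>) * (\<Sum>k. product_coeff \<mu> \<nu> k * ((of_real (a * x))\<^sup>2 / 4) ^ k))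
                 * (bessel_K \<alpha> (b * of_real x))\<^sup>2"
  shows "integrable (lborel_on {0<..}) P"
    and "(\<lambda>k. product_coeff \<mu> \<nu> k * (of_real (a / 2) ^ (2 * k) * of_real (a / 2) powr (\<mu> + \<nu>)) *
           K_moment \<alpha> b (of_nat j + 1 + (\<mu> + \<nu>) + 2 * of_nat k)) sums integral\<^sup>L (lborel_on {0<..}) P"
proof -
  let ?M = "lborel_on {0::real<..}"
  define m where "m = \<mu> + \<nu>"
  define pc where "pc = product_coeff \<mu> \<nu>"
  define K2 where "K2 x = (bessel_K \<alpha> (b * of_real x))\<^sup>2" for x :: real
  define u where "u x = (complex_of_real (a * x))\<^sup>2 / 4" for x :: real
  define W where "W x = complex_of_real x ^ j * complex_of_real (a * x / 2) powr m * K2 x" for x :: real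
  define S where "S n x = W x * (\<Sum>k<n. pc k * u x ^ k)" for n x
  have P_eq: "P x = W x * (\<Sum>k. pc k * u x ^ k)" for x
    by (simp add: P_def W_def m_def pc_def u_def K2_def mult_ac)
  obtain \<tau> where \<tau>: "\<tau> > \<bar>Re \<alpha>\<bar>" "real j + Re m - 2 * \<tau> > - 1"
  proof -
    have "\<bar>Re \<alpha>\<bar> < (real j + 1 + Re m) / 2" using s by (simp add: m_def)
    from dense[OF this] obtain \<tau> where "\<bar>Re \<alpha>\<bar> < \<tau>" "\<tau> < (real j + 1 + Re m) / 2" by blast
    thus ?thesis by (intro that[of \<tau>]) auto
  qed
  have \<tau>0: "\<tau> > 0" using \<tau> by auto
  note prod = product_coeff_sums[OF \<mu>\<nu>, folded pc_def]
  have lim: "(\<lambda>n. S n x) \<longlonglongrightarrow> P x" for x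
    unfolding S_def P_eq by (intro tendsto_mult tendsto_const summable_LIMSEQ sums_summable[OF prod(1)])
  define R where "R = norm (rGamma (\<mu> + 1)) * norm (rGamma (\<nu> + 1))"
  have psum: "norm (\<Sum>k<n. pc k * u x ^ k) \<le> R * exp (Re b * x)" if x: "x > 0" for n x
  proof -
    have nu: "norm (u x) = (a * x / 2)\<^sup>2" using x a by (simp add: u_def norm_divide norm_mult norm_power power_divide)
    have y: "sqrt (norm (u x) / coeff_decay w) = a * x / 2 / sqrt (coeff_decay w)" for w
      unfolding nu real_sqrt_divide using x a by (simp add: abs_mult)
    have "norm (\<Sum>k<n. pc k * u x ^ k) \<le> (\<Sum>k<n. norm (pc k * u x ^ k))" by (rule norm_sum)
    also have "\<dots> \<le> (\<Sum>k. norm (bessel_coeff \<mu> k * u x ^ k)) * (\<Sum>k. norm (bessel_coeff \<nu> k * u x ^ k))" by (rule prod(2))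
    also have "\<dots> \<le> (norm (rGamma (\<mu> + 1)) * exp (2 * (a * x / 2 / sqrt (coeff_decay \<mu>)))) * (norm (rGamma (\<nu> + 1)) * exp (2 * (a * x / 2 / sqrt (coeff_decay \<nu>))))"
      using bessel_coeff_summable[OF \<mu>\<nu>(1), of "u x"] bessel_coeff_summable[OF \<mu>\<nu>(2), of "u x"] unfolding y
      by (intro mult_mono) (auto intro!: suminf_nonneg)
    also have "\<dots> = R * (exp (2 * (a * x / 2 / sqrt (coeff_decay \<mu>))) * exp (2 * (a * x / 2 / sqrt (coeff_decay \<nu>))))"
      by (simp only: R_def mult_ac)
    also have "exp (2 * (a * x / 2 / sqrt (coeff_decay \<mu>))) * exp (2 * (a * x / 2 / sqrt (coeff_decay \<nu>))) =
       exp (a * (1 / sqrt (coeff_decay \<mu>) + 1 / sqrt (coeff_decay \<nu>)) * x)"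
      unfolding exp_add[symmetric] by (rule arg_cong[where f = exp]) (simp add: algebra_simps)
    also have "R * \<dots> \<le> R * exp (Re b * x)"
      using small x by (intro mult_left_mono) (auto simp: R_def intro: mult_right_mono)
    finally show ?thesis .
  qed
  define C where "C = (a / 2) powr Re m * ((K_bound_const \<bar>Re \<alpha>\<bar> \<tau>)\<^sup>2 * (1 + Re b powr (- \<tau>))\<^sup>2) * R"
  define g where "g x = C * (x powr (real j + Re m) * (1 + x powr (- \<tau>))\<^sup>2 * exp (- Re b * x))" for x
  have bd: "norm (S n x) \<le> g x" if x: "x > 0" for n x
  proof -
    have "norm (W x) = x ^ j * (a / 2 * x) powr Re m * norm (K2 x)"
      using x a norm_of_real_powr[of "a * x / 2" m] by (simp add: W_def norm_mult norm_power)
    also have "\<dots> = (a / 2) powr Re m * (x ^ j * x powr Re m) * norm (K2 x)" by (simp only: powr_mult mult_ac)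
    also have "x ^ j * x powr Re m = x powr (real j + Re m)" using x by (simp add: powr_add powr_realpow)
    finally have "norm (S n x) = (a / 2) powr Re m * x powr (real j + Re m) * norm (K2 x) * norm (\<Sum>k<n. pc k * u x ^ k)"
      by (simp only: S_def norm_mult)
    also have "\<dots> \<le> (a / 2) powr Re m * x powr (real j + Re m) * ((K_bound_const \<bar>Re \<alpha>\<bar> \<tau>)\<^sup>2 * (1 + Re b powr (- \<tau>))\<^sup>2 * ((1 + x powr (- \<tau>))\<^sup>2 * exp (- (2 * Re b) * x))) * (R * exp (Re b * x))"
      unfolding K2_def by (intro mult_mono mult_left_mono K_square_bound x b \<tau> psum) auto
    also have "\<dots> = C * (x powr (real j + Re m) * (1 + x powr (- \<tau>))\<^sup>2 * (exp (- (2 * Re b) * x) * exp (Re b * x)))"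
      unfolding C_def by (simp only: mult_ac)
    also have "exp (- (2 * Re b) * x) * exp (Re b * x) = exp (- Re b * x)" by (simp flip: exp_add)
    finally show ?thesis by (simp only: g_def)
  qed
  have gi: "integrable ?M g"
    unfolding g_def
  proof (rule integrable_mult_right, rule Bochner_Integration.integrable_bound)
    show "integrable ?M (\<lambda>x. 2 * (x powr (real j + Re m) * exp (- Re b * x)) + 2 * (x powr (real j + Re m - 2 * \<tau>) * exp (- Re b * x)))"
      using \<tau> \<tau>0 b by (intro Bochner_Integration.integrable_add integrable_mult_right integrable_powr_exp) auto
    show "(\<lambda>x. x powr (real j + Re m) * (1 + x powr (- \<tau>))\<^sup>2 * exp (- Re b * x)) \<in> borel_measurable ?M"
      by (intro borel_measurable_lborel_on continuous_intros) auto
    show "AE x in ?M. norm (x powr (real j + Re m) * (1 + x powr (- \<tau>))\<^sup>2 * exp (- Re b * x)) \<le>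
        norm (2 * (x powr (real j + Re m) * exp (- Re b * x)) + 2 * (x powr (real j + Re m - 2 * \<tau>) * exp (- Re b * x)))"
    proof (rule AE_I2)
      fix x assume "x \<in> space ?M"
      hence x: "x > 0" by simp
      define y where "y = x powr (- \<tau>)"
      define X where "X = x powr (real j + Re m) * exp (- Re b * x)"
      have X: "X \<ge> 0" by (simp add: X_def)
      have y2: "x powr (real j + Re m - 2 * \<tau>) = x powr (real j + Re m) * y\<^sup>2"
      proof -
        have "y\<^sup>2 = x powr (- 2 * \<tau>)" unfolding y_def using x by (simp add: powr_power mult.commute)
        thus ?thesis by (simp flip: powr_add)
      qed
      have "(1 + y)\<^sup>2 \<le> 2 * (1 + y\<^sup>2)" using zero_le_power2[of "1 - y"] by (simp add: power2_eq_square algebra_simps)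
      hence "X * (1 + y)\<^sup>2 \<le> X * (2 * (1 + y\<^sup>2))" using X by (intro mult_left_mono)
      hence "x powr (real j + Re m) * (1 + x powr (- \<tau>))\<^sup>2 * exp (- Re b * x) \<le>
        2 * (x powr (real j + Re m) * exp (- Re b * x)) + 2 * (x powr (real j + Re m - 2 * \<tau>) * exp (- Re b * x))"
        unfolding y2 by (simp add: X_def y_def[symmetric] algebra_simps)
      moreover have "x powr (real j + Re m) * (1 + x powr (- \<tau>))\<^sup>2 * exp (- Re b * x) \<ge> 0" by simp
      ultimately show "norm (x powr (real j + Re m) * (1 + x powr (- \<tau>))\<^sup>2 * exp (- Re b * x)) \<le>
        norm (2 * (x powr (real j + Re m) * exp (- Re b * x)) + 2 * (x powr (real j + Re m - 2 * \<tau>) * exp (- Re b * x)))"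
        unfolding real_norm_def by linarith
    qed
  qed
  have cW: "continuous_on {0<..} W"
  proof -
    have "continuous_on {0<..} (\<lambda>x. complex_of_real (a * x / 2) powr m)"
      using a by (intro continuous_intros) (auto simp: complex_nonpos_Reals_iff)
    thus ?thesis unfolding W_def[abs_def] K2_def
      by (intro continuous_on_mult continuous_on_power continuous_on_of_real continuous_on_id
          continuous_on_bessel_ray bessel_K_holomorphic b)
  qed
  have mS: "S n \<in> borel_measurable ?M" for n
    unfolding S_def[abs_def] u_def
    by (intro borel_measurable_lborel_on continuous_on_mult cW continuous_intros) auto
  have mP: "P \<in> borel_measurable ?M"
    by (rule borel_measurable_LIMSEQ_metric[where f = S, OF mS lim])
  have AE1: "AE x in ?M. (\<lambda>n. S n x) \<longlonglongrightarrow> P x" by (rule AE_I2) (rule lim)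
  have AE2: "AE x in ?M. norm (S n x) \<le> g x" for n by (rule AE_I2) (simp add: bd)
  show "integrable ?M P" by (rule integrable_dominated_convergence[OF mP mS gi AE1 AE2])
  have conv: "(\<lambda>n. integral\<^sup>L ?M (S n)) \<longlonglongrightarrow> integral\<^sup>L ?M P"
    by (rule integral_dominated_convergence[OF mP mS gi AE1 AE2])
  have iS: "integrable ?M (S n)" for n by (rule integrable_dominated_convergence2[OF mP mS gi AE1 AE2])
  define T where "T k = pc k * (of_real (a / 2) ^ (2 * k) * of_real (a / 2) powr m) * K_moment \<alpha> b (of_nat j + 1 + m + 2 * of_nat k)" for k
  have tm: "integral\<^sup>L ?M (\<lambda>x. W x * (pc k * u x ^ k)) = T k" for k
  proof -
    define s where "s = of_nat j + 1 + m + 2 * of_nat k"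
    have sr: "Re s > 2 * \<bar>Re \<alpha>\<bar>" using \<open>real j + 1 + Re (\<mu> + \<nu>) > 2 * \<bar>Re \<alpha>\<bar>\<close> by (simp add: s_def m_def)
    have eq: "W x * (pc k * u x ^ k) = (pc k * (of_real (a / 2) ^ (2 * k) * of_real (a / 2) powr m)) * (of_real x powr (s - 1) * (bessel_K \<alpha> (b * of_real x))\<^sup>2)"
      if "x > 0" for x
    proof -
      have 1: "complex_of_real (a * x / 2) powr m = of_real (a / 2) powr m * of_real x powr m"
        using a that powr_times_pos_real[of x "of_real (a / 2)" m] by simp
      have p2: "complex_of_real x powr (of_nat n + m) = of_real x ^ n * of_real x powr m" for n
        using that by (subst powr_add) (simp add: powr_nat')
      have "s - 1 = of_nat (j + 2 * k) + m" by (simp add: s_def)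
      hence 2: "complex_of_real x powr (s - 1) = of_real x ^ (j + 2 * k) * of_real x powr m"
        by (simp only: p2)
      have "u x = (of_real (a / 2) * of_real x)\<^sup>2" by (simp add: u_def power2_eq_square)
      hence 3: "u x ^ k = of_real (a / 2) ^ (2 * k) * of_real x ^ (2 * k)"
        by (simp only: power_mult[symmetric] power_mult_distrib)
      show ?thesis unfolding W_def K2_def 1 2 3 power_add by (simp only: mult_ac)
    qed
    have "integral\<^sup>L ?M (\<lambda>x. W x * (pc k * u x ^ k)) =
      integral\<^sup>L ?M (\<lambda>x. (pc k * (of_real (a / 2) ^ (2 * k) * of_real (a / 2) powr m)) * (of_real x powr (s - 1) * (bessel_K \<alpha> (b * of_real x))\<^sup>2))"
      by (rule Bochner_Integration.integral_cong[OF refl]) (simp only: space_lborel_on greaterThan_iff eq)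
    also have "\<dots> = T k"
      unfolding integral_mult_right_zero bessel_K_square_moment[OF b sr] by (simp only: T_def K_moment_def s_def)
    finally show ?thesis .
  qed
  have iT: "integrable ?M (\<lambda>x. W x * (pc k * u x ^ k))" for k
  proof -
    have "W x * (pc k * u x ^ k) = S (Suc k) x - S k x" for x by (simp add: S_def algebra_simps)
    thus ?thesis using iS by simp
  qed
  have "integral\<^sup>L ?M (S n) = (\<Sum>k<n. T k)" for n
    unfolding S_def[abs_def] sum_distrib_left tm[symmetric] by (rule Bochner_Integration.integral_sum) (rule iT)
  hence "T sums integral\<^sup>L ?M P" using conv by (simp add: sums_def)
  thus "(\<lambda>k. product_coeff \<mu> \<nu> k * (of_real (a / 2) ^ (2 * k) * of_real (a / 2) powr (\<mu> + \<nu>)) *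
           K_moment \<alpha> b (of_nat j + 1 + (\<mu> + \<nu>) + 2 * of_nat k)) sums integral\<^sup>L ?M P"
    by (simp only: T_def[abs_def] pc_def m_def)
qed

section \<open>Evaluation for small a by termwise integration\<close>

text \<open>The coefficient of \<open>product_coeff\<close> times the matching moment of the squared \<open>K\<close>, freed of all powers of \<open>a\<close>, \<open>b\<close>
and 2.\<close>

definition moment_coeff :: "nat \<Rightarrow> complex \<Rightarrow> complex \<Rightarrow> complex \<Rightarrow> nat \<Rightarrow> complex" where
  "moment_coeff j \<alpha> \<mu> \<nu> k = (let s = of_nat j + 1 + (\<mu> + \<nu>) + 2 * of_nat k in
     product_coeff \<mu> \<nu> k * Gamma (s / 2 + \<alpha>) * Gamma (s / 2 - \<alpha>) * (Gamma (s / 2))\<^sup>2 / Gamma s)"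

lemma Re_pos_notin_nonpos_Reals: "Re z > 0 \<Longrightarrow> z \<notin> \<real>\<^sub>\<le>\<^sub>0"
  by (auto simp: complex_nonpos_Reals_iff)

lemma powr_quotient:
  assumes "a > 0" "Re b > 0"
  shows "(of_real a / b) powr m = of_real a powr m * b powr (- m)"
proof -
  have b: "b \<noteq> 0" using assms by auto
  have "Ln (inverse b) = - Ln b" using Re_pos_notin_nonpos_Reals[OF assms(2)] by (rule Ln_inverse)
  hence "inverse b powr m = b powr (- m)" using b by (simp add: powr_def)
  thus ?thesis using powr_times_pos_real[OF assms(1), of "inverse b" m] b
    by (simp add: divide_inverse mult.commute)
qed

lemma moment_term_eq:
  fixes a :: real
  assumes a: "a > 0" and b: "Re b > 0"
  shows "product_coeff \<mu> \<nu> k * (of_real (a / 2) ^ (2 * k) * of_real (a / 2) powr (\<mu> + \<nu>)) *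
           K_moment \<alpha> b (of_nat j + 1 + (\<mu> + \<nu>) + 2 * of_nat k) =
         2 ^ j / (4 * b ^ (j + 1)) * (of_real a / b) powr (\<mu> + \<nu>) * (moment_coeff j \<alpha> \<mu> \<nu> k * ((of_real a / b)\<^sup>2) ^ k)"
proof -
  define m where "m = \<mu> + \<nu>"
  define n where "n = j + 1 + 2 * k"
  define s where "s = of_nat j + 1 + m + 2 * of_nat k"
  have s: "s = of_nat n + m" by (simp add: s_def n_def)
  have b0: "b \<noteq> 0" using b by auto
  have 1: "b powr (- s) = b powr (- m) / b ^ n"
    using b0 by (simp add: s powr_diff powr_nat' powr_minus_divide)
  have 2: "2 powr (s - 3) = (2 :: complex) powr m * 2 ^ n / 8"
  proof -
    have "(2 :: complex) powr (s - 3) = 2 powr (m + of_nat n) / 2 powr (of_nat 3)"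
      unfolding s by (simp add: powr_diff add.commute)
    also have "\<dots> = 2 powr m * 2 powr of_nat n / 2 powr of_nat 3" by (simp only: powr_add)
    also have "\<dots> = 2 powr m * 2 ^ n / 2 ^ 3"
      using powr_nat'[of "2::complex" n] powr_nat'[of "2::complex" 3] by simp
    finally show ?thesis by simp
  qed
  have 3: "of_real (a / 2) powr m * 2 powr m = complex_of_real a powr m"
  proof -
    have "(of_real (a / 2) * of_real 2) powr m = complex_of_real (a / 2) powr m * of_real 2 powr m"
      using a by (intro powr_times_pos_real) auto
    thus ?thesis by simp
  qed
  have 4: "(complex_of_real a / b) powr m = of_real a powr m * b powr (- m)" by (rule powr_quotient[OF a b])
  have 5: "complex_of_real (a / 2) ^ (2 * k) * 2 ^ n / 8 / b ^ n = 2 ^ j / (4 * b ^ (j + 1)) * ((of_real a / b)\<^sup>2) ^ k"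
  proof -
    have "complex_of_real (a / 2) ^ (2 * k) = of_real a ^ (2 * k) / 2 ^ (2 * k)" by (simp add: power_divide)
    moreover have "((of_real a / b)\<^sup>2) ^ k = of_real a ^ (2 * k) / b ^ (2 * k)" by (simp add: power_divide power_mult)
    moreover have "(2 :: complex) ^ n = 2 * 2 ^ j * 2 ^ (2 * k)" "b ^ n = b ^ (j + 1) * b ^ (2 * k)"
      by (simp_all add: n_def power_add)
    ultimately show ?thesis using b0 by (simp add: divide_simps)
  qed
  define G where "G = product_coeff \<mu> \<nu> k * Gamma (s / 2 + \<alpha>) * Gamma (s / 2 - \<alpha>) * (Gamma (s / 2))\<^sup>2 / Gamma s"
  have "product_coeff \<mu> \<nu> k * (of_real (a / 2) ^ (2 * k) * of_real (a / 2) powr m) * K_moment \<alpha> b s =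
      (of_real (a / 2) powr m * 2 powr m) * b powr (- m) * (of_real (a / 2) ^ (2 * k) * 2 ^ n / 8 / b ^ n) * G"
    unfolding K_moment_def 1 2 G_def by (simp add: mult_ac)
  also have "\<dots> = (of_real a / b) powr m * (2 ^ j / (4 * b ^ (j + 1)) * ((of_real a / b)\<^sup>2) ^ k) * G"
    unfolding 3 5 4 ..
  also have "\<dots> = 2 ^ j / (4 * b ^ (j + 1)) * (of_real a / b) powr m * (G * ((of_real a / b)\<^sup>2) ^ k)"
    by (simp only: mult_ac)
  finally show ?thesis by (simp only: m_def s_def G_def moment_coeff_def Let_def)
qed

lemma admissible_notin_Ints:
  assumes "admissible j \<alpha>" "\<alpha> \<noteq> 0"
  shows "\<alpha> \<notin> \<int>"
proof
  assume "\<alpha> \<in> \<int>"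
  then obtain n where n: "\<alpha> = of_int n" by (elim Ints_cases)
  hence "- 1/2 < real_of_int n" "real_of_int n < 1" using assms(1) by (auto simp: admissible_def)
  hence "n = 0" by linarith
  thus False using n assms(2) by simp
qed

lemma sin_pi_neq_0:
  fixes \<alpha> :: complex
  assumes "\<alpha> \<notin> \<int>"
  shows "sin (of_real pi * \<alpha>) \<noteq> 0"
proof
  assume "sin (of_real pi * \<alpha>) = 0"
  then obtain n where n: "of_real pi * \<alpha> = of_real (of_int n * pi)" unfolding sin_eq_0 by blast
  hence "of_real pi * (\<alpha> - of_int n) = 0" by (simp add: algebra_simps)
  hence "\<alpha> = of_int n" by simp
  thus False using assms by simp
qed

text \<open>The connection formula splits \<open>I K\<close> at \<open>a x\<close> into products of the orders \<open>\<alpha>, - \<alpha>\<close> and \<open>\<alpha>, \<alpha>\<close>; both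
are integrated termwise.\<close>

lemma core_series:
  assumes b: "Re b > 0" and adm: "admissible j \<alpha>" and \<alpha>: "\<alpha> \<noteq> 0"
  shows "eventually (\<lambda>a. norm (of_real a / b) < 1 \<and>
       bessel_integral j \<alpha> (of_real a) b = of_real pi / (2 * sin (of_real pi * \<alpha>)) * (2 ^ j / (4 * b ^ (j + 1))) *
         ((\<Sum>k. moment_coeff j \<alpha> \<alpha> (- \<alpha>) k * ((of_real a / b)\<^sup>2) ^ k) -
          (of_real a / b) powr (2 * \<alpha>) * (\<Sum>k. moment_coeff j \<alpha> \<alpha> \<alpha> k * ((of_real a / b)\<^sup>2) ^ k))) (at_right 0)"
proof -
  have re: "Re \<alpha> > - 1" "Re (- \<alpha>) > - 1" "Re \<alpha> < 1" using adm by (auto simp: admissible_def)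
  define D where "D = min (sqrt (coeff_decay \<alpha>)) (sqrt (coeff_decay (- \<alpha>)))"
  have cd: "coeff_decay \<alpha> > 0" "coeff_decay (- \<alpha>) > 0" using re by (auto simp: coeff_decay_def)
  have D: "D > 0" "D \<le> 1" "D \<le> sqrt (coeff_decay \<alpha>)" "D \<le> sqrt (coeff_decay (- \<alpha>))"
    using cd by (auto simp: D_def coeff_decay_def min_le_iff_disj)
  \<comment> \<open>This makes \<open>series_moment\<close> applicable to both products at once.\<close>
  define \<epsilon> where "\<epsilon> = Re b * D / 2"
  have \<epsilon>: "\<epsilon> > 0" using b D by (simp add: \<epsilon>_def)
  have main: "norm (of_real a / b) < 1 \<and>
       bessel_integral j \<alpha> (of_real a) b = of_real pi / (2 * sin (of_real pi * \<alpha>)) * (2 ^ j / (4 * b ^ (j + 1))) *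
         ((\<Sum>k. moment_coeff j \<alpha> \<alpha> (- \<alpha>) k * ((of_real a / b)\<^sup>2) ^ k) -
          (of_real a / b) powr (2 * \<alpha>) * (\<Sum>k. moment_coeff j \<alpha> \<alpha> \<alpha> k * ((of_real a / b)\<^sup>2) ^ k))"
    if a: "0 < a" "a < \<epsilon>" for a
  proof -
    define w where "w = of_real a / b"
    have b0: "b \<noteq> 0" using b by auto
    have w0: "w \<noteq> 0" using a b0 by (simp add: w_def)
    have "a < Re b"
    proof -
      have "Re b * D \<le> Re b * 1" using b D by (intro mult_left_mono) auto
      thus ?thesis using a b unfolding \<epsilon>_def by linarith
    qed
    hence "a < norm b" using complex_Re_le_cmod[of b] by linarith
    hence w1: "norm w < 1" using a b0 by (simp add: w_def norm_divide)
    have sm1: "a * (1 / sqrt (coeff_decay \<mu>)) \<le> Re b / 2" if "D \<le> sqrt (coeff_decay \<mu>)" for \<mu>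
    proof -
      have "a * (1 / sqrt (coeff_decay \<mu>)) \<le> a * (1 / D)" using that D a less_le_trans[OF D(1) that] by (intro mult_left_mono divide_left_mono mult_pos_pos) auto
      also have "\<dots> \<le> \<epsilon> * (1 / D)" using a D by (intro mult_right_mono) auto
      also have "\<dots> = Re b / 2" using D by (simp add: \<epsilon>_def)
      finally show ?thesis .
    qed
    have small: "a * (1 / sqrt (coeff_decay \<alpha>) + 1 / sqrt (coeff_decay \<mu>)) \<le> Re b" if "D \<le> sqrt (coeff_decay \<mu>)" for \<mu>
      using sm1[OF D(3)] sm1[OF that] unfolding distrib_left by linarith
    define P where "P \<mu> x = of_real x ^ j * (of_real (a * x / 2) powr (\<alpha> + \<mu>) * (\<Sum>k. product_coeff \<alpha> \<mu> k * ((of_real (a * x))\<^sup>2 / 4) ^ k))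
                 * (bessel_K \<alpha> (b * of_real x))\<^sup>2" for \<mu> and x :: real
    have s1: "real j + 1 + Re (\<alpha> + - \<alpha>) > 2 * \<bar>Re \<alpha>\<bar>" and s2: "real j + 1 + Re (\<alpha> + \<alpha>) > 2 * \<bar>Re \<alpha>\<bar>"
      using adm by (auto simp: admissible_def abs_if)
    note M1 = series_moment[OF b a(1) re(1,2) s1 small[OF D(4)], folded P_def, unfolded moment_term_eq[OF a(1) b]]
    note M2 = series_moment[OF b a(1) re(1,1) s2 small[OF D(3)], folded P_def, unfolded moment_term_eq[OF a(1) b]]
    define q where "q = 2 ^ j / (4 * b ^ (j + 1))"
    have q: "q \<noteq> 0" using b0 by (simp add: q_def)
    have wp: "w powr z \<noteq> 0" for z using w0 by simp
    define SA where "SA = integral\<^sup>L (lborel_on {0<..}) (P (- \<alpha>)) / (q * w powr (\<alpha> + - \<alpha>))"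
    define SB where "SB = integral\<^sup>L (lborel_on {0<..}) (P \<alpha>) / (q * w powr (\<alpha> + \<alpha>))"
    have A: "(\<lambda>k. moment_coeff j \<alpha> \<alpha> (- \<alpha>) k * (w\<^sup>2) ^ k) sums SA"
      using sums_divide[OF M1(2)[folded w_def q_def], of "q * w powr (\<alpha> + - \<alpha>)"] q wp by (simp add: SA_def)
    have B: "(\<lambda>k. moment_coeff j \<alpha> \<alpha> \<alpha> k * (w\<^sup>2) ^ k) sums SB"
      using sums_divide[OF M2(2)[folded w_def q_def], of "q * w powr (\<alpha> + \<alpha>)"] q wp by (simp add: SB_def)
    have iA: "integral\<^sup>L (lborel_on {0<..}) (P (- \<alpha>)) = q * SA" using q w0 by (simp add: SA_def)
    have iB: "integral\<^sup>L (lborel_on {0<..}) (P \<alpha>) = q * (w powr (2 * \<alpha>) * SB)" using q w0 by (simp add: SB_def mult_2[symmetric])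
    define c where "c = of_real pi / (2 * sin (of_real pi * \<alpha>))"
    have int: "integrand j \<alpha> (of_real a) b x = c * (P (- \<alpha>) x - P \<alpha> x)" if x: "x > 0" for x
    proof -
      have ax: "a * x > 0" using a x by simp
      define y where "y = a * x"
      have y: "y > 0" using ax by (simp add: y_def)
      have ay: "complex_of_real a * of_real x = of_real y" by (simp add: y_def)
      define u where "u = (complex_of_real y)\<^sup>2 / 4"
      have I: "bessel_I \<mu> (of_real y) = of_real (y / 2) powr \<mu> * (\<Sum>k. bessel_coeff \<mu> k * u ^ k)" if "Re \<mu> > - 1" for \<mu>
        using y that by (subst bessel_I_eq) (auto simp: u_def)
      have K: "bessel_K \<alpha> (of_real y) = c * (bessel_I (- \<alpha>) (of_real y) - bessel_I \<alpha> (of_real y))"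
        unfolding c_def by (rule bessel_K_connection[OF y admissible_notin_Ints[OF adm \<alpha>] re(1,3)])
      have pr: "bessel_I \<alpha> (of_real y) * bessel_I \<mu> (of_real y) = of_real (y / 2) powr (\<alpha> + \<mu>) * (\<Sum>k. product_coeff \<alpha> \<mu> k * u ^ k)"
        if \<mu>: "Re \<mu> > - 1" for \<mu>
        unfolding I[OF re(1)] I[OF \<mu>] sums_unique[OF product_coeff_sums(1)[OF re(1) \<mu>], symmetric] powr_add
        by (simp only: mult_ac)
      have "integrand j \<alpha> (of_real a) b x = of_real x ^ j * (c * (bessel_I \<alpha> (of_real y) * bessel_I (- \<alpha>) (of_real y) - bessel_I \<alpha> (of_real y) * bessel_I \<alpha> (of_real y)) * (bessel_K \<alpha> (b * of_real x))\<^sup>2)"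
        unfolding integrand_def ay K by (simp add: algebra_simps)
      also have "\<dots> = c * (P (- \<alpha>) x - P \<alpha> x)"
        unfolding pr[OF re(1)] pr[OF re(2)] unfolding P_def u_def y_def by (simp only: right_diff_distrib left_diff_distrib mult_ac)
      finally show ?thesis .
    qed
    have "bessel_integral j \<alpha> (of_real a) b = integral\<^sup>L (lborel_on {0<..}) (\<lambda>x. c * (P (- \<alpha>) x - P \<alpha> x))"
      unfolding bessel_integral_def by (rule Bochner_Integration.integral_cong[OF refl]) (simp only: space_lborel_on greaterThan_iff int)
    also have "\<dots> = c * (q * SA - q * (w powr (2 * \<alpha>) * SB))"
      unfolding iA[symmetric] iB[symmetric] using M1(1) M2(1) by simp
    also have "\<dots> = c * q * (SA - w powr (2 * \<alpha>) * SB)" by (simp add: algebra_simps)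
    finally have G: "bessel_integral j \<alpha> (of_real a) b = c * q * (SA - w powr (2 * \<alpha>) * SB)" .
    show ?thesis
      unfolding w_def[symmetric] using w1 A B G by (simp only: sums_iff c_def q_def)
  qed
  show ?thesis unfolding eventually_at_right_field using \<epsilon> main by blast
qed

text \<open>Gamma quotients and Pochhammer symbols are exchanged freely below; in the right half plane no poles interfere.\<close>

lemma pochhammer_eq_Gamma:
  assumes "Re z > 0"
  shows "pochhammer z n = Gamma (z + of_nat n) * rGamma z" "Gamma z \<noteq> 0" "rGamma z \<noteq> 0" "Gamma z = inverse (rGamma z)"
proof -
  have z: "z \<notin> \<int>\<^sub>\<le>\<^sub>0" by (rule Re_pos_notin_nonpos_Ints[OF assms])
  show "pochhammer z n = Gamma (z + of_nat n) * rGamma z"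
    using pochhammer_Gamma[OF z] by (simp add: rGamma_inverse_Gamma divide_inverse)
  show "Gamma z \<noteq> 0" "rGamma z \<noteq> 0" using z by (auto simp: Gamma_eq_zero_iff rGamma_eq_zero_iff)
  show "Gamma z = inverse (rGamma z)" by (simp add: rGamma_inverse_Gamma)
qed

lemma product_coeff_even:
  "product_coeff \<alpha> (- \<alpha>) k = fact (2 * k) / (fact k)\<^sup>2 * rGamma (\<alpha> + of_nat k + 1) * rGamma (- \<alpha> + of_nat k + 1)"
proof -
  have "pochhammer (of_nat k + 1 :: complex) k = fact (2 * k) / fact k"
  proof -
    have "(fact (2 * k) :: complex) = pochhammer 1 (k + k)" by (simp add: pochhammer_fact mult_2)
    also have "\<dots> = pochhammer 1 k * pochhammer (1 + of_nat k) k" by (rule pochhammer_product')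
    finally show ?thesis by (simp add: pochhammer_fact[symmetric] add.commute)
  qed
  thus ?thesis by (simp add: product_coeff_def power2_eq_square)
qed

lemma product_coeff_same:
  assumes "Re \<alpha> > - 1/2"
  shows "product_coeff \<alpha> \<alpha> k = Gamma (2 * \<alpha> + 2 * of_nat k + 1) * rGamma (2 * \<alpha> + of_nat k + 1) / fact k * (rGamma (\<alpha> + of_nat k + 1))\<^sup>2"
proof -
  have "Re (\<alpha> + \<alpha> + of_nat k + 1) > 0" using assms by simp
  from pochhammer_eq_Gamma(1)[OF this, of k]
  have "pochhammer (\<alpha> + \<alpha> + of_nat k + 1) k = Gamma (2 * \<alpha> + 2 * of_nat k + 1) * rGamma (2 * \<alpha> + of_nat k + 1)"
    by (simp add: algebra_simps)
  thus ?thesis by (simp add: product_coeff_def power2_eq_square)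
qed

text \<open>For the first moment everything cancels down to a single linear factor: this is why the inverse hyperbolic tangent appears.\<close>

lemma moment_coeff_1_even:
  assumes "- 1/2 < Re \<alpha>" "Re \<alpha> < 1"
  shows "moment_coeff 1 \<alpha> \<alpha> (- \<alpha>) k = 1 / (2 * of_nat k + 1)"
proof -
  have s: "of_nat 1 + 1 + (\<alpha> + - \<alpha>) + 2 * of_nat k = 2 * (of_nat k + 1)" by simp
  have g1: "Gamma (of_nat k + 1 + \<alpha>) * rGamma (\<alpha> + of_nat k + 1) = 1"
    using pochhammer_eq_Gamma(3,4)[of "of_nat k + 1 + \<alpha>"] assms by (simp add: add_ac)
  have g2: "Gamma (of_nat k + 1 - \<alpha>) * rGamma (- \<alpha> + of_nat k + 1) = 1"
    using pochhammer_eq_Gamma(3,4)[of "of_nat k + 1 - \<alpha>"] assms by (simp add: algebra_simps)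
  have g3: "Gamma (of_nat k + 1) = (fact k :: complex)" using Gamma_fact[of k] by (simp add: add.commute)
  have g4: "Gamma (2 * (of_nat k + 1)) = ((2 * of_nat k + 1) * fact (2 * k) :: complex)"
    using Gamma_fact[of "2 * k + 1", where ?'a = complex] by (simp add: algebra_simps)
  have h: "2 * (of_nat k + 1) / 2 = (of_nat k + 1 :: complex)" by simp
  have "moment_coeff 1 \<alpha> \<alpha> (- \<alpha>) k = (Gamma (of_nat k + 1 + \<alpha>) * rGamma (\<alpha> + of_nat k + 1)) *
      (Gamma (of_nat k + 1 - \<alpha>) * rGamma (- \<alpha> + of_nat k + 1)) * (fact (2 * k) / (fact k)\<^sup>2 * (fact k)\<^sup>2 / ((2 * of_nat k + 1) * fact (2 * k)))"
    unfolding moment_coeff_def Let_def s product_coeff_even g4 h g3 by (simp add: mult_ac)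
  thus ?thesis unfolding g1 g2 by simp
qed

lemma moment_coeff_1_same:
  assumes "- 1/2 < Re \<alpha>"
  shows "moment_coeff 1 \<alpha> \<alpha> \<alpha> k = 1 / (2 * of_nat k + 1 + 2 * \<alpha>)"
proof -
  have s: "of_nat 1 + 1 + (\<alpha> + \<alpha>) + 2 * of_nat k = 2 * (of_nat k + 1 + \<alpha>)" by simp
  define G where "G = Gamma (2 * \<alpha> + 2 * of_nat k + 1)"
  have re: "Re (2 * \<alpha> + 2 * of_nat k + 1) > 0" using assms by simp
  have G0: "G \<noteq> 0" unfolding G_def by (rule pochhammer_eq_Gamma(2)[OF re])
  have z0: "2 * of_nat k + 1 + 2 * \<alpha> \<noteq> 0" using re by (metis add.commute add.left_commute zero_complex.sel(1) less_irrefl)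
  have g1: "Gamma (of_nat k + 1 + \<alpha> + \<alpha>) * rGamma (2 * \<alpha> + of_nat k + 1) = 1"
    using pochhammer_eq_Gamma(3,4)[of "of_nat k + 1 + \<alpha> + \<alpha>"] assms by (simp add: algebra_simps)
  have g2: "Gamma (of_nat k + 1 + \<alpha>) * rGamma (\<alpha> + of_nat k + 1) = 1"
    using pochhammer_eq_Gamma(3,4)[of "of_nat k + 1 + \<alpha>"] assms by (simp add: algebra_simps)
  have g3: "Gamma (of_nat k + 1 + \<alpha> - \<alpha>) = (fact k :: complex)" using Gamma_fact[of k] by (simp add: add.commute)
  have g4: "Gamma (2 * (of_nat k + 1 + \<alpha>)) = (2 * of_nat k + 1 + 2 * \<alpha>) * G"
    using Gamma_plus1[OF Re_pos_notin_nonpos_Ints[OF re]] unfolding G_def by (simp add: algebra_simps)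
  have h: "2 * (of_nat k + 1 + \<alpha>) / 2 = of_nat k + 1 + \<alpha>" by simp
  have e: "of_nat k + 1 + \<alpha> - \<alpha> = (of_nat k + 1 :: complex)" by simp
  have "moment_coeff 1 \<alpha> \<alpha> \<alpha> k = (Gamma (of_nat k + 1 + \<alpha> + \<alpha>) * rGamma (2 * \<alpha> + of_nat k + 1)) *
      (Gamma (of_nat k + 1 + \<alpha>) * rGamma (\<alpha> + of_nat k + 1)) * (Gamma (of_nat k + 1 + \<alpha>) * rGamma (\<alpha> + of_nat k + 1)) *
      (Gamma (of_nat k + 1 + \<alpha> - \<alpha>) / fact k) * (G / ((2 * of_nat k + 1 + 2 * \<alpha>) * G))"
    unfolding moment_coeff_def Let_def s product_coeff_same[OF assms] g4 G_def[symmetric] h by (simp add: power2_eq_square mult_ac)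
  thus ?thesis unfolding g1 g2 g3 using G0 by simp
qed

lemma moment_coeff_0_even:
  assumes "- 1/2 < Re \<alpha>" "Re \<alpha> < 1/2"
  shows "moment_coeff 0 \<alpha> \<alpha> (- \<alpha>) k = (Gamma (\<alpha> + 1/2) * Gamma (1/2 - \<alpha>) * of_real pi * rGamma (\<alpha> + 1) * rGamma (1 - \<alpha>)) *
    fps_nth (fps_hypergeo [1/2, 1/2, \<alpha> + 1/2, 1/2 - \<alpha>] [1, \<alpha> + 1, 1 - \<alpha>] 1) k"
proof -
  have s: "of_nat 0 + 1 + (\<alpha> + - \<alpha>) + 2 * of_nat k = 2 * (of_nat k + 1/2)" by simp
  have G: "Gamma (z + of_nat k) = Gamma z * pochhammer z k" if "Re z > 0" for z
    using pochhammer_eq_Gamma[OF that] by (simp add: field_simps)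
  have R: "rGamma (z + of_nat k) = rGamma z / pochhammer z k" if "Re z > 0" for z
  proof -
    have "pochhammer z k \<noteq> 0"
      using pochhammer_eq_Gamma(1)[OF that, of k] pochhammer_eq_Gamma(3)[OF that] pochhammer_eq_Gamma(2)[of "z + of_nat k"] that by simp
    thus ?thesis using pochhammer_rGamma[of z k] by simp
  qed
  have a1: "Gamma (of_nat k + 1/2 + \<alpha>) = Gamma (\<alpha> + 1/2) * pochhammer (\<alpha> + 1/2) k"
    using G[of "\<alpha> + 1/2"] assms by (simp add: add_ac)
  have a2: "Gamma (of_nat k + 1/2 - \<alpha>) = Gamma (1/2 - \<alpha>) * pochhammer (1/2 - \<alpha>) k"
    using G[of "1/2 - \<alpha>"] assms by (simp add: algebra_simps)
  have a3: "Gamma (of_nat k + 1/2 :: complex) = of_real (sqrt pi) * pochhammer (1/2) k"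
    using G[of "1/2"] by (simp add: add.commute Gamma_one_half_complex)
  have a4: "Gamma (2 * (of_nat k + 1/2)) = (fact (2 * k) :: complex)"
    using Gamma_fact[of "2 * k", where ?'a = complex] by (simp add: algebra_simps)
  have r1: "rGamma (\<alpha> + of_nat k + 1) = rGamma (\<alpha> + 1) / pochhammer (\<alpha> + 1) k"
    using R[of "\<alpha> + 1"] assms by (simp add: add_ac)
  have r2: "rGamma (- \<alpha> + of_nat k + 1) = rGamma (1 - \<alpha>) / pochhammer (1 - \<alpha>) k"
    using R[of "1 - \<alpha>"] assms by (simp add: algebra_simps)
  have sq: "(complex_of_real (sqrt pi))\<^sup>2 = of_real pi" by (simp flip: of_real_power)
  have h: "2 * (of_nat k + 1/2) / 2 = (of_nat k + 1/2 :: complex)" by simp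
  have "moment_coeff 0 \<alpha> \<alpha> (- \<alpha>) k = fact (2 * k) / (fact k)\<^sup>2 * (rGamma (\<alpha> + 1) / pochhammer (\<alpha> + 1) k) * (rGamma (1 - \<alpha>) / pochhammer (1 - \<alpha>) k) *
      (Gamma (\<alpha> + 1/2) * pochhammer (\<alpha> + 1/2) k) * (Gamma (1/2 - \<alpha>) * pochhammer (1/2 - \<alpha>) k) * ((complex_of_real (sqrt pi))\<^sup>2 * (pochhammer (1/2) k)\<^sup>2) / fact (2 * k)"
    unfolding moment_coeff_def Let_def s product_coeff_even a4 r1 r2 h a1 a2 a3 by (simp only: power_mult_distrib mult.assoc)
  thus ?thesis unfolding sq by (simp add: pochhammer_fact[symmetric] power2_eq_square mult_ac)
qed

lemma moment_coeff_0_same: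
  assumes "- 1/4 < Re \<alpha>" "Re \<alpha> < 1/2"
  shows "moment_coeff 0 \<alpha> \<alpha> \<alpha> k = (Gamma (2 * \<alpha> + 1/2) * of_real (sqrt pi) * (Gamma (\<alpha> + 1/2))\<^sup>2 * (rGamma (\<alpha> + 1))\<^sup>2 * rGamma (2 * \<alpha> + 1)) *
    fps_nth (fps_hypergeo [1/2, \<alpha> + 1/2, \<alpha> + 1/2, 2 * \<alpha> + 1/2] [\<alpha> + 1, \<alpha> + 1, 2 * \<alpha> + 1] 1) k"
proof -
  have s: "of_nat 0 + 1 + (\<alpha> + \<alpha>) + 2 * of_nat k = 2 * (of_nat k + 1/2 + \<alpha>)" by simp
  have G: "Gamma (z + of_nat k) = Gamma z * pochhammer z k" if "Re z > 0" for z
    using pochhammer_eq_Gamma[OF that] by (simp add: field_simps)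
  have R: "rGamma (z + of_nat k) = rGamma z / pochhammer z k" if "Re z > 0" for z
  proof -
    have "pochhammer z k \<noteq> 0"
      using pochhammer_eq_Gamma(1)[OF that, of k] pochhammer_eq_Gamma(3)[OF that] pochhammer_eq_Gamma(2)[of "z + of_nat k"] that by simp
    thus ?thesis using pochhammer_rGamma[of z k] by simp
  qed
  have a1: "Gamma (of_nat k + 1/2 + \<alpha> + \<alpha>) = Gamma (2 * \<alpha> + 1/2) * pochhammer (2 * \<alpha> + 1/2) k"
    using G[of "2 * \<alpha> + 1/2"] assms by (simp add: algebra_simps)
  have a2: "Gamma (of_nat k + 1/2 + \<alpha> - \<alpha>) = of_real (sqrt pi) * pochhammer (1/2) k"
    using G[of "1/2"] by (simp add: add.commute Gamma_one_half_complex)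
  have a3: "Gamma (of_nat k + 1/2 + \<alpha>) = Gamma (\<alpha> + 1/2) * pochhammer (\<alpha> + 1/2) k"
    using G[of "\<alpha> + 1/2"] assms by (simp add: add_ac)
  define g where "g = Gamma (2 * \<alpha> + 2 * of_nat k + 1)"
  have g0: "g \<noteq> 0" unfolding g_def by (rule pochhammer_eq_Gamma(2)) (use assms in simp)
  have a4: "Gamma (2 * (of_nat k + 1/2 + \<alpha>)) = g" unfolding g_def by (simp add: algebra_simps)
  have r1: "rGamma (\<alpha> + of_nat k + 1) = rGamma (\<alpha> + 1) / pochhammer (\<alpha> + 1) k"
    using R[of "\<alpha> + 1"] assms by (simp add: add_ac)
  have r2: "rGamma (2 * \<alpha> + of_nat k + 1) = rGamma (2 * \<alpha> + 1) / pochhammer (2 * \<alpha> + 1) k"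
    using R[of "2 * \<alpha> + 1"] assms by (simp add: algebra_simps)
  have half: "- 1/2 < Re \<alpha>" using assms by simp
  have h: "2 * (of_nat k + 1/2 + \<alpha>) / 2 = of_nat k + 1/2 + \<alpha>" by simp
  have "moment_coeff 0 \<alpha> \<alpha> \<alpha> k = (g * (rGamma (2 * \<alpha> + 1) / pochhammer (2 * \<alpha> + 1) k) / fact k * (rGamma (\<alpha> + 1) / pochhammer (\<alpha> + 1) k)\<^sup>2) *
      (Gamma (2 * \<alpha> + 1/2) * pochhammer (2 * \<alpha> + 1/2) k) * (of_real (sqrt pi) * pochhammer (1/2) k) * (Gamma (\<alpha> + 1/2) * pochhammer (\<alpha> + 1/2) k)\<^sup>2 / g"
    unfolding moment_coeff_def Let_def s product_coeff_same[OF half] h a1 a2 a3 a4 r1 r2 g_def[symmetric] ..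
  also have "\<dots> = (rGamma (2 * \<alpha> + 1) / pochhammer (2 * \<alpha> + 1) k) / fact k * (rGamma (\<alpha> + 1) / pochhammer (\<alpha> + 1) k)\<^sup>2 *
      (Gamma (2 * \<alpha> + 1/2) * pochhammer (2 * \<alpha> + 1/2) k) * (of_real (sqrt pi) * pochhammer (1/2) k) * (Gamma (\<alpha> + 1/2) * pochhammer (\<alpha> + 1/2) k)\<^sup>2"
    using g0 by simp
  finally show ?thesis by (simp add: power2_eq_square mult_ac)
qed

section \<open>Continuation in a and boundary values on the cut\<close>

lemma quotient_notin_nonpos_Reals:
  assumes "Re a > 0" "Re b > 0"
  shows "a / b \<notin> \<real>\<^sub>\<le>\<^sub>0"
proof
  assume "a / b \<in> \<real>\<^sub>\<le>\<^sub>0"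
  then obtain r where r: "a / b = of_real r" "r \<le> 0" by (rule nonpos_Reals_cases)
  have "b \<noteq> 0" using assms by auto
  hence "a = of_real r * b" using r(1) by (simp add: field_simps)
  hence "Re a = r * Re b" by simp
  thus False using assms r(2) by (simp add: mult_nonpos_nonneg not_less[symmetric] zero_less_mult_iff)
qed

text \<open>The set of all \<open>a\<close> with \<open>Re a > 0\<close> and \<open>a / b \<in> U\<close> is starlike about \<open>b / 2\<close>, hence connected, and contains a real interval to the right of 0.
The region \<open>U\<close> is a parameter because two different ones occur: cut along both rays, or along the negative axis only.\<close>

lemma bessel_integral_continuation:
  assumes b: "Re b > 0" and adm: "admissible j \<alpha>"
    and U: "open U" "\<And>w. w \<in> U \<Longrightarrow> closed_segment (1/2) w \<subseteq> U" "ball 0 1 - \<real>\<^sub>\<le>\<^sub>0 \<subseteq> U" and h: "h holomorphic_on U"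
    and eq: "eventually (\<lambda>a. bessel_integral j \<alpha> (of_real a) b = h (of_real a / b)) (at_right 0)"
    and a: "Re a > 0" "a / b \<in> U"
  shows "bessel_integral j \<alpha> a b = h (a / b)"
proof -
  have b0: "b \<noteq> 0" using b by auto
  define S where "S = {z. 0 < Re z} \<inter> (\<lambda>z. z / b) -` U"
  have "open ((\<lambda>z. z / b) -` U)" using b0 by (intro open_vimage U(1) continuous_intros) auto
  hence oS: "open S" unfolding S_def by (intro open_Int open_halfspace_Re_gt)
  have star: "starlike S" unfolding starlike_def
  proof (intro bexI[of _ "b / 2"] ballI subsetI)
    fix z y assume z: "z \<in> S" and "y \<in> closed_segment (b / 2) z"
    then obtain u where u: "0 \<le> u" "u \<le> 1" "y = (1 - u) *\<^sub>R (b / 2) + u *\<^sub>R z" by (auto simp: in_segment)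
    have "y / b = (1 - u) *\<^sub>R (1 / 2) + u *\<^sub>R (z / b)" using b0 by (simp add: u(3) add_divide_distrib scaleR_conv_of_real)
    hence "y / b \<in> closed_segment (1/2) (z / b)" using u by (auto simp: in_segment)
    moreover have "z / b \<in> U" using z by (simp add: S_def)
    ultimately have yU: "y / b \<in> U" using U(2)[of "z / b"] by (rule_tac subsetD)
    have Rz: "Re z > 0" using z by (simp add: S_def)
    have Ry: "Re y = (1 - u) * (Re b / 2) + u * Re z" by (simp add: u(3))
    have "Re y > 0"
    proof (cases "u = 0")
      case False
      hence "u * Re z > 0" using u Rz by simp
      moreover have "(1 - u) * (Re b / 2) \<ge> 0" using u b by simp
      ultimately show ?thesis unfolding Ry by linarith
    qed (use b Ry in simp)
    thus "y \<in> S" using yU by (simp add: S_def)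
  next
    have "(1/2 :: complex) \<in> U" using U(3) by (rule subsetD) (auto simp: complex_nonpos_Reals_iff)
    thus "b / 2 \<in> S" using b b0 by (simp add: S_def)
  qed
  have conn: "connected S" by (rule starlike_imp_connected[OF star])
  obtain \<epsilon> where \<epsilon>: "\<epsilon> > 0" "\<And>x. 0 < x \<Longrightarrow> x < \<epsilon> \<Longrightarrow> bessel_integral j \<alpha> (of_real x) b = h (of_real x / b)"
    using eq unfolding eventually_at_right_field by blast
  \<comment> \<open>The bound by \<open>norm b\<close> keeps the quotient inside the unit disc, hence in \<open>U\<close>.\<close>
  define \<delta> where "\<delta> = min \<epsilon> (norm b)"
  have \<delta>: "\<delta> > 0" using \<epsilon> b0 by (simp add: \<delta>_def)
  show ?thesis
  proof (rule holomorphic_eq_of_eq_on_reals[where f = "\<lambda>a. bessel_integral j \<alpha> a b" and g = "\<lambda>a. h (a / b)", OF _ _ oS conn \<delta>])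
    show "(\<lambda>a. bessel_integral j \<alpha> a b) holomorphic_on S"
      by (rule holomorphic_on_subset[OF bessel_integral_holomorphic(1)[OF b adm]]) (auto simp: S_def)
    have "(h \<circ> (\<lambda>a. a / b)) holomorphic_on S"
      by (rule holomorphic_on_compose_gen[OF _ h]) (use b0 in \<open>auto simp: S_def intro!: holomorphic_intros\<close>)
    thus "(\<lambda>a. h (a / b)) holomorphic_on S" by (simp add: o_def)
    show "a \<in> S" using a by (simp add: S_def)
    fix x assume x: "0 < x" "x < \<delta>"
    have "norm (of_real x / b) < 1" using x b0 by (simp add: \<delta>_def norm_divide)
    moreover have "of_real x / b \<notin> \<real>\<^sub>\<le>\<^sub>0" using x b by (intro quotient_notin_nonpos_Reals) auto
    ultimately have "of_real x / b \<in> U" by (intro subsetD[OF U(3)]) auto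
    thus "of_real x \<in> S" using x by (simp add: S_def)
    show "bessel_integral j \<alpha> (of_real x) b = h (of_real x / b)" using x by (intro \<epsilon>(2)) (auto simp: \<delta>_def)
  qed
qed

text \<open>The half plane \<open>Re a > 0\<close> is mapped by \<open>a / b\<close> into the complement of the negative axis, so removing that axis costs nothing;
removing \<open>[1, \<infinity>)\<close> makes all functions of the statement holomorphic.\<close>

definition ratio_domain :: "complex set" where
  "ratio_domain = slit_plane - \<real>\<^sub>\<le>\<^sub>0"

lemma ratio_domain_iff: "w \<in> ratio_domain \<longleftrightarrow> Im w \<noteq> 0 \<or> (0 < Re w \<and> Re w < 1)"
  by (auto simp: ratio_domain_def slit_plane_iff complex_nonpos_Reals_iff)

lemma open_ratio_domain: "open ratio_domain"
  unfolding ratio_domain_def by (intro open_Diff open_slit_plane closed_nonpos_Reals_complex)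

lemma closed_segment_ratio_domain:
  assumes "w \<in> ratio_domain"
  shows "closed_segment (1/2) w \<subseteq> ratio_domain"
proof
  fix y assume "y \<in> closed_segment (1/2) w"
  then obtain u where u: "0 \<le> u" "u \<le> 1" "y = (1 - u) *\<^sub>R (1/2) + u *\<^sub>R w" by (auto simp: in_segment)
  show "y \<in> ratio_domain"
  proof (cases "Im w = 0 \<and> u \<noteq> 0")
    case True
    hence w: "0 < Re w" "Re w < 1" using assms by (auto simp: ratio_domain_iff)
    have y: "Re y = (1 - u) / 2 + u * Re w" by (simp add: u(3))
    have "u > 0" using True u by simp
    hence "u * Re w > 0" "u * Re w < u * 1" using w by (auto intro: mult_strict_left_mono)
    hence lo: "0 < u * Re w" and hi: "u * Re w < u" by auto
    have "0 < (1 - u) / 2 + p \<and> (1 - u) / 2 + p < 1" if "0 < p" "p < u" for p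
      using that u(2) by (simp add: field_simps)
    from this[OF lo hi] show ?thesis by (simp add: ratio_domain_iff y)
  qed (auto simp: ratio_domain_iff u(3))
qed

lemma ball_subset_ratio_domain: "ball 0 1 - \<real>\<^sub>\<le>\<^sub>0 \<subseteq> ratio_domain"
  by (auto simp: ratio_domain_def intro: ball_subset_slit_plane)

lemma power2_ratio_domain:
  assumes "w \<in> ratio_domain"
  shows "w\<^sup>2 \<in> slit_plane"
proof (cases "Im (w\<^sup>2) = 0")
  case True
  have im: "Im (w\<^sup>2) = 2 * Re w * Im w" by (simp add: power2_eq_square)
  have re: "Re (w\<^sup>2) = (Re w)\<^sup>2 - (Im w)\<^sup>2" by (simp add: power2_eq_square)
  have "Re (w\<^sup>2) < 1"
  proof (cases "Im w = 0")
    case False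
    hence "Re w = 0" using True im by simp
    thus ?thesis using re by (simp add: power2_eq_square) (smt (verit) not_square_less_zero)
  next
    case True
    hence "0 < Re w" "Re w < 1" using assms by (auto simp: ratio_domain_iff)
    hence "Re w * Re w < 1 * 1" by (intro mult_strict_mono) auto
    thus ?thesis using re True by (simp add: power2_eq_square)
  qed
  thus ?thesis by (simp add: slit_plane_iff)
qed (simp add: slit_plane_iff)

lemma side_filter_neq_bot:
  assumes "s \<in> {1, - 1 :: real}"
  shows "at (complex_of_real r) within {w. 0 < s * Im w} \<noteq> bot"
proof -
  have "complex_of_real r islimpt {w. 0 < s * Im w}" unfolding islimpt_approachable
  proof (intro allI impI)
    fix e :: real assume e: "e > 0"
    show "\<exists>x'\<in>{w. 0 < s * Im w}. x' \<noteq> complex_of_real r \<and> dist x' (complex_of_real r) < e"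
      using e assms by (intro bexI[of _ "Complex r (s * (e / 2))"])
        (auto simp: complex_eq_iff dist_norm norm_complex_def real_sqrt_unique)
  qed
  thus ?thesis by (simp add: trivial_limit_within)
qed

lemma side_value_eqI:
  assumes "s \<in> {1, - 1 :: real}" "r > 1" "(f \<longlongrightarrow> l) (at (complex_of_real r) within {w. 0 < s * Im w})"
  shows "side_value s f (of_real r) = l"
  unfolding side_value_def using assms(2) tendsto_Lim[OF side_filter_neq_bot[OF assms(1)] assms(3)] by simp

lemma side_value_tendsto:
  assumes "s \<in> {1, - 1 :: real}" "r > 1" "has_side_limits f"
  shows "(f \<longlongrightarrow> side_value s f (of_real r)) (at (complex_of_real r) within {w. 0 < s * Im w})"
proof -
  obtain l where l: "(f \<longlongrightarrow> l) (at (complex_of_real r) within {w. 0 < s * Im w})"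
    using assms unfolding has_side_limits_def by blast
  show ?thesis unfolding side_value_eqI[OF assms(1,2) l] by (rule l)
qed

text \<open>Near a point of the right half of the real axis squaring preserves the sign of the imaginary part.\<close>

lemma has_side_limits_power2:
  assumes "has_side_limits f"
  shows "has_side_limits (\<lambda>w. f (w\<^sup>2))"
  unfolding has_side_limits_def
proof (intro ballI allI impI)
  fix s r :: real assume s: "s \<in> {1, - 1}" and r: "r > 1"
  have "1 * 1 < r * r" using r by (intro mult_strict_mono) auto
  hence r2: "r\<^sup>2 > 1" by (simp add: power2_eq_square)
  obtain l where l: "(f \<longlongrightarrow> l) (at (complex_of_real (r\<^sup>2)) within {w. 0 < s * Im w})"
    using assms s r2 unfolding has_side_limits_def by blast
  define F where "F = at (complex_of_real r) within {w. 0 < s * Im w}"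
  have tr: "((\<lambda>w. w) \<longlongrightarrow> complex_of_real r) F" unfolding F_def by (rule tendsto_ident_at)
  have t: "((\<lambda>w. w\<^sup>2) \<longlongrightarrow> complex_of_real (r\<^sup>2)) F" using tendsto_power[OF tr, of 2] by simp
  have "eventually (\<lambda>w. Re w > 0) F"
    using tendsto_Re[OF tr] r by (intro order_tendstoD(1)[of _ "r"]) auto
  moreover have "eventually (\<lambda>w. 0 < s * Im w) F" unfolding F_def by (rule eventually_at_filter[THEN iffD2]) simp
  ultimately have ev: "eventually (\<lambda>w. w\<^sup>2 \<in> {w. 0 < s * Im w} \<and> w\<^sup>2 \<noteq> complex_of_real (r\<^sup>2)) F"
  proof eventually_elim
    case (elim w)
    have "Im (w\<^sup>2) = 2 * Re w * Im w" by (simp add: power2_eq_square)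
    hence e: "s * Im (w\<^sup>2) = 2 * Re w * (s * Im w)" by simp
    have p: "s * Im (w\<^sup>2) > 0" unfolding e using elim by simp
    hence "w\<^sup>2 \<noteq> complex_of_real (r\<^sup>2)" by (metis Im_complex_of_real less_irrefl mult_zero_right)
    thus ?case using p by simp
  qed
  have "filterlim (\<lambda>w. w\<^sup>2) (at (complex_of_real (r\<^sup>2)) within {w. 0 < s * Im w}) F"
    unfolding filterlim_at using ev t by blast
  from filterlim_compose[OF l this]
  show "\<exists>l. ((\<lambda>w. f (w\<^sup>2)) \<longlongrightarrow> l) (at (complex_of_real r) within {w. 0 < s * Im w})"
    unfolding F_def by (rule exI)
qed

lemma bessel_integral_tendsto:
  assumes b: "Re b > 0" and adm: "admissible j \<alpha>" and r: "r > 0"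
  shows "((\<lambda>w. bessel_integral j \<alpha> (w * b) b) \<longlongrightarrow> bessel_integral j \<alpha> (of_real r * b) b) (at (of_real r) within T)"
proof -
  have "continuous_on {a. Re a > 0} (\<lambda>a. bessel_integral j \<alpha> a b)"
    by (rule holomorphic_on_imp_continuous_on[OF bessel_integral_holomorphic(1)[OF b adm]])
  hence "isCont (\<lambda>a. bessel_integral j \<alpha> a b) (of_real r * b)"
    by (rule continuous_on_interior) (use r b in \<open>simp add: interior_open open_halfspace_Re_gt\<close>)
  moreover have "((\<lambda>w. w * b) \<longlongrightarrow> of_real r * b) (at (of_real r) within T)" by (intro tendsto_intros)
  ultimately show ?thesis by (rule isCont_tendsto_compose)
qed

text \<open>The integral is continuous in \<open>a\<close> also where \<open>a / b\<close> lies on the cut. Used for the two sides of the cut and, with the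
unit disc, for \<open>a = b\<close>.\<close>

lemma bessel_integral_eq_limit:
  assumes b: "Re b > 0" and adm: "admissible j \<alpha>" and r: "r > 0"
    and T: "at (complex_of_real r) within T \<noteq> bot" "eventually (\<lambda>w. w \<in> ratio_domain) (at (of_real r) within T)"
    and eq: "\<And>a. Re a > 0 \<Longrightarrow> a / b \<in> ratio_domain \<Longrightarrow> bessel_integral j \<alpha> a b = h (a / b)"
    and l: "(h \<longlongrightarrow> l) (at (complex_of_real r) within T)"
  shows "bessel_integral j \<alpha> (of_real r * b) b = l"
proof -
  have b0: "b \<noteq> 0" using b by auto
  have t: "((\<lambda>w. bessel_integral j \<alpha> (w * b) b) \<longlongrightarrow> bessel_integral j \<alpha> (of_real r * b) b) (at (of_real r) within T)"
    by (rule bessel_integral_tendsto[OF b adm r])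
  have "((\<lambda>w. Re (w * b)) \<longlongrightarrow> Re (of_real r * b)) (at (of_real r) within T)" by (intro tendsto_intros)
  hence "eventually (\<lambda>w. Re (w * b) > 0) (at (of_real r) within T)" by (rule order_tendstoD) (use r b in simp)
  with T(2) have "eventually (\<lambda>w. bessel_integral j \<alpha> (w * b) b = h w) (at (of_real r) within T)"
  proof eventually_elim
    case (elim w)
    thus ?case using eq[of "w * b"] b0 by simp
  qed
  from Lim_transform_eventually[OF t this] have "(h \<longlongrightarrow> bessel_integral j \<alpha> (of_real r * b) b) (at (of_real r) within T)" .
  thus ?thesis using l T(1) by (intro tendsto_unique)
qed

text \<open>The common shape of the evaluations for \<open>a \<noteq> b\<close>: coefficients that are holomorphic across the cut, times functions that jump there.\<close>

lemma bessel_integral_side_value: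
  assumes b: "Re b > 0" and adm: "admissible j \<alpha>" and s: "s \<in> {1, - 1 :: real}" and a: "Re a > 0" "a \<noteq> b"
    and c: "c1 holomorphic_on - \<real>\<^sub>\<le>\<^sub>0" "c2 holomorphic_on - \<real>\<^sub>\<le>\<^sub>0"
    and F: "F1 holomorphic_on ratio_domain" "F2 holomorphic_on ratio_domain" "has_side_limits F1" "has_side_limits F2"
    and eq: "eventually (\<lambda>a. bessel_integral j \<alpha> (of_real a) b =
            c1 (of_real a / b) * F1 (of_real a / b) - c2 (of_real a / b) * F2 (of_real a / b)) (at_right 0)"
  shows "bessel_integral j \<alpha> a b = c1 (a / b) * side_value s F1 (a / b) - c2 (a / b) * side_value s F2 (a / b)"
proof -
  have b0: "b \<noteq> 0" using b by auto
  define h where "h w = c1 w * F1 w - c2 w * F2 w" for w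
  have sub: "ratio_domain \<subseteq> - \<real>\<^sub>\<le>\<^sub>0" by (auto simp: ratio_domain_def)
  have hol: "h holomorphic_on ratio_domain" unfolding h_def
    by (intro holomorphic_on_mult holomorphic_on_diff F holomorphic_on_subset[OF c(1) sub] holomorphic_on_subset[OF c(2) sub])
  have small: "eventually (\<lambda>a. bessel_integral j \<alpha> (of_real a) b = h (of_real a / b)) (at_right 0)"
    using eq unfolding h_def .
  have main: "bessel_integral j \<alpha> a b = h (a / b)" if "Re a > 0" "a / b \<in> ratio_domain" for a
    by (rule bessel_integral_continuation[OF b adm open_ratio_domain closed_segment_ratio_domain ball_subset_ratio_domain hol small that])
  show ?thesis
  proof (cases "a / b \<in> complex_of_real ` {1<..}")
    case False
    have n: "a / b \<notin> \<real>\<^sub>\<le>\<^sub>0" by (rule quotient_notin_nonpos_Reals[OF a(1) b])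
    have "a / b \<in> ratio_domain"
    proof (rule ccontr)
      assume "a / b \<notin> ratio_domain"
      hence 1: "Im (a / b) = 0" "Re (a / b) \<ge> 1" using n by (auto simp: ratio_domain_iff complex_nonpos_Reals_iff)
      hence q: "a / b = of_real (Re (a / b))" by (simp add: complex_eq_iff)
      have "a / b \<noteq> 1" using a(2) b0 by simp
      hence "Re (a / b) \<noteq> 1" using q by (metis of_real_1)
      hence "Re (a / b) \<in> {1<..}" using 1 by simp
      thus False using False q by blast
    qed
    from main[OF a(1) this] show ?thesis using False by (simp add: h_def side_value_def)
  next
    case True
    then obtain r where r: "a / b = of_real r" "r > 1" by auto
    have ar: "a = of_real r * b" using r(1) b0 by (simp add: field_simps)
    have ct: "(c \<longlongrightarrow> c (of_real r)) (at (of_real r) within T)" if "c holomorphic_on - \<real>\<^sub>\<le>\<^sub>0" for c :: "complex \<Rightarrow> complex" and T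
    proof -
      have "isCont c (of_real r)"
        by (rule continuous_on_interior[OF holomorphic_on_imp_continuous_on[OF that]])
           (use r(2) in \<open>simp add: interior_open open_Compl complex_nonpos_Reals_iff\<close>)
      hence "(c \<longlongrightarrow> c (of_real r)) (at (of_real r))" by (rule isContD)
      thus ?thesis by (rule tendsto_within_subset) simp
    qed
    have l: "(h \<longlongrightarrow> c1 (of_real r) * side_value s F1 (of_real r) - c2 (of_real r) * side_value s F2 (of_real r))
        (at (of_real r) within {w. 0 < s * Im w})" unfolding h_def
      by (intro tendsto_mult tendsto_diff ct c side_value_tendsto s r(2) F)
    have ev: "eventually (\<lambda>w. w \<in> ratio_domain) (at (complex_of_real r) within {w. 0 < s * Im w})"
      unfolding eventually_at_filter by (rule always_eventually) (auto simp: ratio_domain_iff)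
    have "r > 0" using r(2) by simp
    from bessel_integral_eq_limit[OF b adm this side_filter_neq_bot[OF s] ev main l]
    show ?thesis unfolding r(1) ar[symmetric] .
  qed
qed

lemma arctanh_holomorphic: "arctanh holomorphic_on ratio_domain"
proof -
  have "(\<lambda>w. (Ln (1 + w) - Ln (1 - w)) / 2) holomorphic_on ratio_domain"
    by (intro holomorphic_intros) (auto simp: ratio_domain_iff complex_nonpos_Reals_iff)
  thus ?thesis by (simp add: arctanh_def[abs_def])
qed

text \<open>Across the cut \<open>Ln (1 - w)\<close> jumps by \<open>2 \<pi> \<i>\<close>; on each side it differs from the continuous \<open>Ln (w - 1)\<close> by a
constant.\<close>

lemma arctanh_side_limits: "has_side_limits arctanh"
  unfolding has_side_limits_def
proof (intro ballI allI impI exI)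
  fix s r :: real assume s: "s \<in> {1, - 1}" and r: "r > 1"
  define F where "F = at (complex_of_real r) within {w. 0 < s * Im w}"
  have tr: "((\<lambda>w. w) \<longlongrightarrow> complex_of_real r) F" unfolding F_def by (rule tendsto_ident_at)
  have "((\<lambda>w. (Ln (1 + w) - (Ln (w - 1) - of_real s * (\<i> * of_real pi))) / 2) \<longlongrightarrow>
         (Ln (1 + of_real r) - (Ln (of_real r - 1) - of_real s * (\<i> * of_real pi))) / 2) F"
    using r by (intro tendsto_intros tr) (auto simp: complex_nonpos_Reals_iff)
  moreover have "eventually (\<lambda>w. 0 < s * Im w) F" unfolding F_def by (rule eventually_at_filter[THEN iffD2]) simp
  hence "eventually (\<lambda>w. (Ln (1 + w) - (Ln (w - 1) - of_real s * (\<i> * of_real pi))) / 2 = arctanh w) F"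
  proof eventually_elim
    case (elim w)
    have "w - 1 \<noteq> 0" using elim by auto
    from Ln_minus[OF this] have "Ln (1 - w) = Ln (w - 1) - of_real s * (\<i> * of_real pi)"
      using s elim by auto
    thus ?case by (simp add: arctanh_def)
  qed
  ultimately show "(arctanh \<longlongrightarrow> (Ln (1 + of_real r) - (Ln (of_real r - 1) - of_real s * (\<i> * of_real pi))) / 2)
      (at (complex_of_real r) within {w. 0 < s * Im w})" unfolding F_def by (rule Lim_transform_eventually)
qed

lemma arctanh_sums:
  assumes "norm w < 1"
  shows "(\<lambda>k. w ^ (2 * k + 1) / of_nat (2 * k + 1)) sums arctanh w"
proof -
  \<comment> \<open>The even terms of the two logarithmic series cancel.\<close>
  define g where "g n = (w ^ n - (- w) ^ n) / of_nat n / 2" for n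
  have "(\<lambda>n. - ((- w) ^ n) / of_nat n) sums Ln (1 + w)" by (rule Ln_series'[OF assms])
  moreover have "(\<lambda>n. - (w ^ n) / of_nat n) sums Ln (1 - w)" using Ln_series'[of "- w"] assms by simp
  ultimately have "(\<lambda>n. (- ((- w) ^ n) / of_nat n - - (w ^ n) / of_nat n) / 2) sums arctanh w"
    unfolding arctanh_def by (intro sums_divide sums_diff)
  hence "g sums arctanh w" by (simp add: g_def[abs_def] diff_divide_distrib)
  moreover have "g n = 0" if "n \<notin> range (\<lambda>k. 2 * k + 1)" for n
  proof -
    have "even n"
    proof (rule ccontr)
      assume "odd n"
      then obtain k where "n = 2 * k + 1" by (rule oddE)
      thus False using that by blast
    qed
    thus ?thesis by (simp add: g_def)
  qed
  ultimately have "(\<lambda>k. g (2 * k + 1)) sums arctanh w"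
    by (subst sums_mono_reindex) (auto simp: strict_mono_def)
  moreover have "g (2 * k + 1) = w ^ (2 * k + 1) / of_nat (2 * k + 1)" for k
  proof -
    have "(X - - X) / N / 2 = X / N" for X N :: complex by simp
    moreover have "(- w) ^ (2 * k + 1) = - (w ^ (2 * k + 1))" by simp
    ultimately show ?thesis unfolding g_def by metis
  qed
  ultimately show ?thesis by (simp only:)
qed

lemma arctanh_sums_even:
  assumes "norm w < 1" "w \<noteq> 0"
  shows "(\<lambda>k. 1 / (2 * of_nat k + 1) * (w\<^sup>2) ^ k) sums (arctanh w / w)"
proof -
  have "w ^ (2 * k + 1) / of_nat (2 * k + 1) / w = 1 / (2 * of_nat k + 1) * (w\<^sup>2) ^ k" for k
    using assms(2) by (simp add: power_mult[symmetric] add.commute)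
  thus ?thesis using sums_divide[OF arctanh_sums[OF assms(1)], of w] by (simp only:)
qed

lemma hypergeo_power2_regular:
  assumes "hypergeo_regular as bs"
  shows "(\<lambda>w. hypergeo as bs (w\<^sup>2)) holomorphic_on ratio_domain" "has_side_limits (\<lambda>w. hypergeo as bs (w\<^sup>2))"
    "norm w < 1 \<Longrightarrow> (\<lambda>k. fps_nth (fps_hypergeo as bs 1) k * (w\<^sup>2) ^ k) sums hypergeo as bs (w\<^sup>2)"
proof -
  have "(hypergeo as bs \<circ> (\<lambda>w. w\<^sup>2)) holomorphic_on ratio_domain"
    using assms power2_ratio_domain unfolding hypergeo_regular_def
    by (intro holomorphic_on_compose_gen[of _ _ _ slit_plane]) (auto intro!: holomorphic_intros)
  thus "(\<lambda>w. hypergeo as bs (w\<^sup>2)) holomorphic_on ratio_domain" by (simp add: o_def)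
  show "has_side_limits (\<lambda>w. hypergeo as bs (w\<^sup>2))"
    using assms unfolding hypergeo_regular_def by (intro has_side_limits_power2) blast
  assume "norm w < 1"
  hence "norm (w\<^sup>2) < 1" by (simp add: norm_power power_less_one_iff)
  thus "(\<lambda>k. fps_nth (fps_hypergeo as bs 1) k * (w\<^sup>2) ^ k) sums hypergeo as bs (w\<^sup>2)"
    using assms unfolding hypergeo_regular_def by blast
qed

lemma powr_holomorphic: "(\<lambda>w. w powr c) holomorphic_on - \<real>\<^sub>\<le>\<^sub>0"
  by (intro holomorphic_intros) auto

lemma pochhammer_shift_quotient:
  assumes "Re p > 0"
  shows "pochhammer p k / pochhammer (p + 1) k = p / (p + of_nat k)"
proof -
  have p: "p \<noteq> 0" "p + of_nat k \<noteq> 0" using assms by (auto simp: complex_eq_iff)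
  have "pochhammer (p + 1) k \<noteq> 0"
    using assms by (auto simp: pochhammer_eq_0_iff dest: arg_cong[of _ _ Re])
  moreover have "p * pochhammer (p + 1) k = pochhammer p k * (p + of_nat k)"
    using pochhammer_rec[of p k] pochhammer_rec'[of p k] by (simp add: mult.commute)
  ultimately show ?thesis using p by (simp add: field_simps)
qed

lemma fps_nth_2F1:
  assumes "Re \<alpha> > - 1/2"
  shows "fps_nth (fps_hypergeo [1, 1/2 + \<alpha>] [3/2 + \<alpha>] 1) k = (1 + 2 * \<alpha>) * (1 / (2 * of_nat k + 1 + 2 * \<alpha>))"
proof -
  have "fps_nth (fps_hypergeo [1, 1/2 + \<alpha>] [3/2 + \<alpha>] 1) k = pochhammer (1/2 + \<alpha>) k / pochhammer (1/2 + \<alpha> + 1) k"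
    by (simp add: pochhammer_fact[symmetric] add.commute add.left_commute)
  also have "\<dots> = (1/2 + \<alpha>) / (1/2 + \<alpha> + of_nat k)" by (rule pochhammer_shift_quotient) (use assms in simp)
  also have "\<dots> = (2 * (1/2 + \<alpha>)) / (2 * (1/2 + \<alpha> + of_nat k))" by (rule mult_divide_mult_cancel_left[symmetric]) simp
  also have "\<dots> = (1 + 2 * \<alpha>) * (1 / (2 * of_nat k + 1 + 2 * \<alpha>))" by (simp add: algebra_simps)
  finally show ?thesis .
qed

lemma admissible_0: "- 1/4 < Re \<alpha> \<Longrightarrow> Re \<alpha> < 1/2 \<Longrightarrow> admissible 0 \<alpha>"
  by (simp add: admissible_def)

lemma admissible_1: "- 1/2 < Re \<alpha> \<Longrightarrow> Re \<alpha> < 1 \<Longrightarrow> admissible 1 \<alpha>"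
  by (simp add: admissible_def)

text \<open>The first moment in the shape required by \<open>bessel_integral_side_value\<close>.\<close>

lemma small_parameter_1:
  assumes b: "Re b > 0" and \<alpha>: "\<alpha> \<noteq> 0" "- 1/2 < Re \<alpha>" "Re \<alpha> < 1"
  defines "K \<equiv> of_real pi * (1 / sin (of_real pi * \<alpha>)) / (4 * b\<^sup>2)"
  shows "eventually (\<lambda>a. bessel_integral 1 \<alpha> (of_real a) b =
      K * (1 / (of_real a / b)) * arctanh (of_real a / b) -
      K / (1 + 2 * \<alpha>) * (of_real a / b) powr (2 * \<alpha>) * hypergeo [1, 1/2 + \<alpha>] [3/2 + \<alpha>] ((of_real a / b)\<^sup>2)) (at_right 0)"
proof -
  have b0: "b \<noteq> 0" using b by auto
  note core = core_series[OF b admissible_1[OF \<alpha>(2,3)] \<alpha>(1)]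
  have reg: "hypergeo_regular [1, 1/2 + \<alpha>] [3/2 + \<alpha>]"
    using hypergeo_2F1_regular[of "1/2 + \<alpha>"] \<alpha>(2) by (simp add: add.commute add.left_commute)
  from core eventually_at_right_less[of 0] show ?thesis
  proof eventually_elim
    case (elim a)
    define w where "w = of_real a / b"
    have w: "w \<noteq> 0" "norm w < 1" using elim b0 by (auto simp: w_def)
    have S1: "(\<Sum>k. moment_coeff 1 \<alpha> \<alpha> (- \<alpha>) k * (w\<^sup>2) ^ k) = arctanh w / w"
      using sums_unique[OF arctanh_sums_even[OF w(2,1)]] by (simp only: moment_coeff_1_even[OF \<alpha>(2,3)])
    have \<alpha>1: "1 + 2 * \<alpha> \<noteq> 0"
    proof
      assume "1 + 2 * \<alpha> = 0"
      hence "Re (1 + 2 * \<alpha>) = 0" by simp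
      thus False using \<alpha>(2) by simp
    qed
    have "moment_coeff 1 \<alpha> \<alpha> \<alpha> k * (w\<^sup>2) ^ k = fps_nth (fps_hypergeo [1, 1/2 + \<alpha>] [3/2 + \<alpha>] 1) k * (w\<^sup>2) ^ k / (1 + 2 * \<alpha>)" for k
      unfolding fps_nth_2F1[OF \<alpha>(2)] moment_coeff_1_same[OF \<alpha>(2)] using \<alpha>1 by simp
    hence S2: "(\<Sum>k. moment_coeff 1 \<alpha> \<alpha> \<alpha> k * (w\<^sup>2) ^ k) = hypergeo [1, 1/2 + \<alpha>] [3/2 + \<alpha>] (w\<^sup>2) / (1 + 2 * \<alpha>)"
      using sums_unique[OF sums_divide[OF hypergeo_power2_regular(3)[OF reg w(2)], of "1 + 2 * \<alpha>"]] by (simp only:)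
    have K: "of_real pi / (2 * sin (of_real pi * \<alpha>)) * (2 ^ 1 / (4 * b ^ (1 + 1))) = K"
      by (simp add: K_def power2_eq_square)
    have "bessel_integral 1 \<alpha> (of_real a) b = K * (arctanh w / w - w powr (2 * \<alpha>) * (hypergeo [1, 1/2 + \<alpha>] [3/2 + \<alpha>] (w\<^sup>2) / (1 + 2 * \<alpha>)))"
      using elim unfolding w_def[symmetric] S1 S2 K by blast
    also have "\<dots> = K * (1 / w) * arctanh w - K / (1 + 2 * \<alpha>) * w powr (2 * \<alpha>) * hypergeo [1, 1/2 + \<alpha>] [3/2 + \<alpha>] (w\<^sup>2)"
      by (simp add: algebra_simps)
    finally show ?case
      unfolding w_def .
  qed
qed

lemma first_moment_integral:
  assumes a: "Re a > 0" and b: "Re b > 0" and \<alpha>: "\<alpha> \<noteq> 0" "- 1/2 < Re \<alpha>" "Re \<alpha> < 1" and ab: "a \<noteq> b"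
    and s: "s \<in> {1, - 1 :: real}"
  shows "bessel_integral 1 \<alpha> a b = of_real pi * (1 / sin (of_real pi * \<alpha>)) / (4 * b ^ 2) *
              (b / a * side_value s arctanh (a / b)
               - (a / b) powr (2 * \<alpha>) / (1 + 2 * \<alpha>) *
                 side_value s (\<lambda>w. hypergeo [1, 1/2 + \<alpha>] [3/2 + \<alpha>] (w ^ 2)) (a / b))"
proof -
  define K where "K = of_real pi * (1 / sin (of_real pi * \<alpha>)) / (4 * b\<^sup>2)"
  note small = small_parameter_1[OF b \<alpha>, folded K_def]
  have reg: "hypergeo_regular [1, 1/2 + \<alpha>] [3/2 + \<alpha>]"
    using hypergeo_2F1_regular[of "1/2 + \<alpha>"] \<alpha>(2) by (simp add: add.commute add.left_commute)
  have c1: "(\<lambda>w. K * (1 / w)) holomorphic_on - \<real>\<^sub>\<le>\<^sub>0" by (intro holomorphic_intros) auto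
  have c2: "(\<lambda>w. K / (1 + 2 * \<alpha>) * w powr (2 * \<alpha>)) holomorphic_on - \<real>\<^sub>\<le>\<^sub>0" by (intro holomorphic_on_mult holomorphic_on_const powr_holomorphic)
  have "bessel_integral 1 \<alpha> a b = K * (1 / (a / b)) * side_value s arctanh (a / b) -
      K / (1 + 2 * \<alpha>) * (a / b) powr (2 * \<alpha>) * side_value s (\<lambda>w. hypergeo [1, 1/2 + \<alpha>] [3/2 + \<alpha>] (w\<^sup>2)) (a / b)"
    by (rule bessel_integral_side_value[OF b admissible_1[OF \<alpha>(2,3)] s a ab c1 c2 arctanh_holomorphic
          hypergeo_power2_regular(1)[OF reg] arctanh_side_limits hypergeo_power2_regular(2)[OF reg] small])
  thus ?thesis unfolding K_def[symmetric] by (simp add: right_diff_distrib mult.assoc)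
qed

text \<open>The constant in \<open>moment_coeff_0_even\<close>, by the reflection formula at \<open>\<alpha> + 1/2\<close> and at \<open>\<alpha>\<close>.\<close>

lemma reflection_constant:
  fixes \<alpha> :: complex
  assumes "\<alpha> \<noteq> 0"
  shows "Gamma (\<alpha> + 1/2) * Gamma (1/2 - \<alpha>) * of_real pi * rGamma (\<alpha> + 1) * rGamma (1 - \<alpha>) =
    of_real pi * sin (of_real pi * \<alpha>) / (\<alpha> * cos (of_real pi * \<alpha>))"
proof -
  have "Gamma (\<alpha> + 1/2) * Gamma (1 - (\<alpha> + 1/2)) = of_real pi / sin (of_real pi * (\<alpha> + 1/2))" by (rule Gamma_reflection_complex)
  moreover have "sin (of_real pi * (\<alpha> + 1/2)) = cos (of_real pi * \<alpha>)"
  proof -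
    have "of_real pi * (\<alpha> + 1/2) = of_real pi * \<alpha> + of_real pi / 2" by (simp add: algebra_simps)
    thus ?thesis by (simp only: sin_add) simp
  qed
  moreover have "1 - (\<alpha> + 1/2) = 1/2 - \<alpha>" by simp
  ultimately have g: "Gamma (\<alpha> + 1/2) * Gamma (1/2 - \<alpha>) = of_real pi / cos (of_real pi * \<alpha>)" by simp
  have "\<alpha> * rGamma (\<alpha> + 1) * rGamma (1 - \<alpha>) = sin (of_real pi * \<alpha>) / of_real pi"
    using rGamma_reflection_complex[of \<alpha>] rGamma_plus1[of \<alpha>] by simp
  hence r: "rGamma (\<alpha> + 1) * rGamma (1 - \<alpha>) = sin (of_real pi * \<alpha>) / (of_real pi * \<alpha>)"
    using assms by (simp add: field_simps)
  have "Gamma (\<alpha> + 1/2) * Gamma (1/2 - \<alpha>) * of_real pi * rGamma (\<alpha> + 1) * rGamma (1 - \<alpha>) =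
     (Gamma (\<alpha> + 1/2) * Gamma (1/2 - \<alpha>)) * of_real pi * (rGamma (\<alpha> + 1) * rGamma (1 - \<alpha>))" by (simp only: mult.assoc)
  thus ?thesis unfolding g r using assms by simp
qed

text \<open>The constant in \<open>moment_coeff_0_same\<close>; the duplication formula at \<open>\<alpha> + 1/2\<close> supplies the power of 2 that turns
\<open>a / b\<close> into \<open>a / (2 b)\<close>.\<close>

lemma duplication_constant:
  fixes \<alpha> :: complex
  assumes "Re \<alpha> > - 1/4"
  shows "Gamma (2 * \<alpha> + 1/2) * of_real (sqrt pi) * (Gamma (\<alpha> + 1/2))\<^sup>2 * (rGamma (\<alpha> + 1))\<^sup>2 * rGamma (2 * \<alpha> + 1) =
    of_real pi * Gamma (\<alpha> + 1/2) * Gamma (2 * \<alpha> + 1/2) / Gamma (\<alpha> + 1) ^ 3 * 2 powr (- (2 * \<alpha>))"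
proof -
  have n: "\<alpha> + 1/2 \<notin> \<int>\<^sub>\<le>\<^sub>0" "\<alpha> + 1/2 + 1/2 \<notin> \<int>\<^sub>\<le>\<^sub>0"
    using assms by (auto intro!: Re_pos_notin_nonpos_Ints)
  have "Gamma (\<alpha> + 1/2) * Gamma (\<alpha> + 1/2 + 1/2) = exp ((1 - 2 * (\<alpha> + 1/2)) * of_real (ln 2)) * of_real (sqrt pi) * Gamma (2 * (\<alpha> + 1/2))"
    by (rule Gamma_legendre_duplication[OF n])
  moreover have "exp ((1 - 2 * (\<alpha> + 1/2)) * of_real (ln 2)) = 2 powr (- (2 * \<alpha>))"
  proof -
    have "1 - 2 * (\<alpha> + 1/2) = - (2 * \<alpha>)" by (simp add: algebra_simps)
    thus ?thesis using of_real_powr_exp[of 2 "- (2 * \<alpha>)"] by simp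
  qed
  moreover have "2 * (\<alpha> + 1/2) = 2 * \<alpha> + 1" "\<alpha> + 1/2 + 1/2 = \<alpha> + 1" by (simp_all add: algebra_simps)
  ultimately have d: "Gamma (\<alpha> + 1/2) * Gamma (\<alpha> + 1) = 2 powr (- (2 * \<alpha>)) * of_real (sqrt pi) * Gamma (2 * \<alpha> + 1)" by simp
  define g where "g = Gamma (\<alpha> + 1/2)"
  define h where "h = Gamma (\<alpha> + 1)"
  define k where "k = Gamma (2 * \<alpha> + 1)"
  have nz: "g \<noteq> 0" "h \<noteq> 0" "k \<noteq> 0" unfolding g_def h_def k_def using assms by (auto intro!: pochhammer_eq_Gamma(2))
  have sq: "complex_of_real (sqrt pi) * of_real (sqrt pi) = of_real pi" by (simp flip: of_real_mult)
  have "of_real (sqrt pi) * g / k = of_real (sqrt pi) * (g * h) / (k * h)" using nz by simp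
  also have "\<dots> = (complex_of_real (sqrt pi) * of_real (sqrt pi)) * 2 powr (- (2 * \<alpha>)) / h"
    unfolding d[folded g_def h_def k_def] using nz by simp
  finally have e: "of_real (sqrt pi) * g / k = of_real pi * 2 powr (- (2 * \<alpha>)) / h" unfolding sq .
  have "Gamma (2 * \<alpha> + 1/2) * of_real (sqrt pi) * g\<^sup>2 * (inverse h)\<^sup>2 * inverse k =
      Gamma (2 * \<alpha> + 1/2) * g * (inverse h)\<^sup>2 * (of_real (sqrt pi) * g / k)"
    by (simp only: power2_eq_square divide_inverse mult_ac)
  also have "\<dots> = of_real pi * g * Gamma (2 * \<alpha> + 1/2) / h ^ 3 * 2 powr (- (2 * \<alpha>))"
  proof -
    have "G * g * (inverse h)\<^sup>2 * (P * T / h) = P * g * G / h ^ 3 * T" for G P T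
      by (simp add: power2_eq_square power3_eq_cube field_simps)
    thus ?thesis unfolding e .
  qed
  finally show ?thesis unfolding g_def h_def k_def rGamma_inverse_Gamma .
qed

lemma half_powr:
  fixes w z :: complex
  assumes "w \<noteq> 0"
  shows "(w / 2) powr z = w powr z * 2 powr (- z)"
proof -
  have "(w * of_real (1/2)) powr z = w powr z * of_real (1/2) powr z" by (rule powr_times_pos_real) (use assms in auto)
  moreover have "complex_of_real (1/2) powr z = 2 powr (- z)"
  proof -
    have "complex_of_real (1/2) powr z = exp (z * of_real (- ln 2))" using of_real_powr_exp[of "1/2" z] by (simp only: ln_div) simp
    moreover have "(2 :: complex) powr (- z) = exp (- z * of_real (ln 2))" using of_real_powr_exp[of 2 "- z"] by simp
    ultimately show ?thesis by (simp only: of_real_minus mult_minus_left mult_minus_right)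
  qed
  ultimately show ?thesis by simp
qed

lemma hypergeo_4F3_regular_even:
  assumes "- 1/2 < Re \<alpha>" "Re \<alpha> < 1/2"
  shows "hypergeo_regular [1/2, 1/2, \<alpha> + 1/2, 1/2 - \<alpha>] [1, \<alpha> + 1, 1 - \<alpha>]"
  by (rule hypergeo_4F3_regular[of "1/2" "\<alpha> + 1/2" "1/2 - \<alpha>"]) (use assms in \<open>simp_all add: add.commute add.left_commute\<close>)

lemma hypergeo_4F3_regular_same:
  assumes "- 1/4 < Re \<alpha>"
  shows "hypergeo_regular [1/2, \<alpha> + 1/2, \<alpha> + 1/2, 2 * \<alpha> + 1/2] [\<alpha> + 1, \<alpha> + 1, 2 * \<alpha> + 1]"
  by (rule hypergeo_4F3_regular[of "\<alpha> + 1/2" "\<alpha> + 1/2" "2 * \<alpha> + 1/2"]) (use assms in \<open>simp_all add: add.commute add.left_commute\<close>)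

lemma small_parameter_0:
  assumes b: "Re b > 0" and \<alpha>: "\<alpha> \<noteq> 0" "- 1/4 < Re \<alpha>" "Re \<alpha> < 1/2"
  defines "K \<equiv> of_real pi ^ 2 / (8 * b)"
  defines "C \<equiv> Gamma (\<alpha> + 1/2) * Gamma (2 * \<alpha> + 1/2) * (1 / sin (of_real pi * \<alpha>)) / Gamma (\<alpha> + 1) ^ 3"
  shows "eventually (\<lambda>a. bessel_integral 0 \<alpha> (of_real a) b =
      K * (1 / cos (of_real pi * \<alpha>) / \<alpha>) * hypergeo [1/2, 1/2, \<alpha> + 1/2, 1/2 - \<alpha>] [1, \<alpha> + 1, 1 - \<alpha>] ((of_real a / b)\<^sup>2) -
      K * C * 2 powr (- (2 * \<alpha>)) * (of_real a / b) powr (2 * \<alpha>) *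
        hypergeo [1/2, \<alpha> + 1/2, \<alpha> + 1/2, 2 * \<alpha> + 1/2] [\<alpha> + 1, \<alpha> + 1, 2 * \<alpha> + 1] ((of_real a / b)\<^sup>2)) (at_right 0)"
proof -
  have b0: "b \<noteq> 0" using b by auto
  note adm = admissible_0[OF \<alpha>(2,3)]
  have half: "- 1/2 < Re \<alpha>" using \<alpha>(2) by simp
  note core = core_series[OF b adm \<alpha>(1)]
  note rA = hypergeo_4F3_regular_even[OF half \<alpha>(3)] and rB = hypergeo_4F3_regular_same[OF \<alpha>(2)]
  have sin0: "sin (of_real pi * \<alpha>) \<noteq> 0" by (rule sin_pi_neq_0[OF admissible_notin_Ints[OF adm \<alpha>(1)]])
  from core eventually_at_right_less[of 0] show ?thesis
  proof eventually_elim
    case (elim a)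
    define w where "w = of_real a / b"
    have w: "norm w < 1" using elim by (simp add: w_def)
    define HA where "HA = hypergeo [1/2, 1/2, \<alpha> + 1/2, 1/2 - \<alpha>] [1, \<alpha> + 1, 1 - \<alpha>] (w\<^sup>2)"
    define HB where "HB = hypergeo [1/2, \<alpha> + 1/2, \<alpha> + 1/2, 2 * \<alpha> + 1/2] [\<alpha> + 1, \<alpha> + 1, 2 * \<alpha> + 1] (w\<^sup>2)"
    define S where "S = sin (of_real pi * \<alpha>)"
    have S0: "S \<noteq> 0" using sin0 by (simp add: S_def)
    have e1: "moment_coeff 0 \<alpha> \<alpha> (- \<alpha>) k * z = of_real pi * S / (\<alpha> * cos (of_real pi * \<alpha>)) *
        (fps_nth (fps_hypergeo [1/2, 1/2, \<alpha> + 1/2, 1/2 - \<alpha>] [1, \<alpha> + 1, 1 - \<alpha>] 1) k * z)" for k z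
      unfolding moment_coeff_0_even[OF half \<alpha>(3)] reflection_constant[OF \<alpha>(1)] S_def by (rule mult.assoc)
    have S1: "(\<Sum>k. moment_coeff 0 \<alpha> \<alpha> (- \<alpha>) k * (w\<^sup>2) ^ k) = of_real pi * S / (\<alpha> * cos (of_real pi * \<alpha>)) * HA"
      using sums_unique[OF sums_mult[OF hypergeo_power2_regular(3)[OF rA w], of "of_real pi * S / (\<alpha> * cos (of_real pi * \<alpha>))"]]
      unfolding e1 HA_def by (rule sym)
    have S2: "(\<Sum>k. moment_coeff 0 \<alpha> \<alpha> \<alpha> k * (w\<^sup>2) ^ k) = of_real pi * (C * S) * 2 powr (- (2 * \<alpha>)) * HB"
    proof -
      have c: "of_real pi * Gamma (\<alpha> + 1/2) * Gamma (2 * \<alpha> + 1/2) / Gamma (\<alpha> + 1) ^ 3 = of_real pi * (C * S)"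
        using S0 by (simp add: C_def S_def)
      have e2: "moment_coeff 0 \<alpha> \<alpha> \<alpha> k * z = of_real pi * (C * S) * 2 powr (- (2 * \<alpha>)) *
        (fps_nth (fps_hypergeo [1/2, \<alpha> + 1/2, \<alpha> + 1/2, 2 * \<alpha> + 1/2] [\<alpha> + 1, \<alpha> + 1, 2 * \<alpha> + 1] 1) k * z)" for k z
        unfolding moment_coeff_0_same[OF \<alpha>(2,3)] duplication_constant[OF \<alpha>(2)] c by (rule mult.assoc)
      show ?thesis
        using sums_unique[OF sums_mult[OF hypergeo_power2_regular(3)[OF rB w], of "of_real pi * (C * S) * 2 powr (- (2 * \<alpha>))"]]
        unfolding e2 HB_def by (rule sym)
    qed
    have K: "of_real pi / (2 * S) * (2 ^ 0 / (4 * b ^ (0 + 1))) = K / (of_real pi * S)"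
      by (simp add: K_def power2_eq_square)
    have pi0: "complex_of_real pi \<noteq> 0" by simp
    have "bessel_integral 0 \<alpha> (of_real a) b = K / (of_real pi * S) *
       (of_real pi * S / (\<alpha> * cos (of_real pi * \<alpha>)) * HA - w powr (2 * \<alpha>) * (of_real pi * (C * S) * 2 powr (- (2 * \<alpha>)) * HB))"
      using elim unfolding w_def[symmetric] S1 S2 S_def[symmetric] K by blast
    also have "\<dots> = K * (1 / cos (of_real pi * \<alpha>) / \<alpha>) * HA - K * C * 2 powr (- (2 * \<alpha>)) * w powr (2 * \<alpha>) * HB"
    proof -
      have "K / (P * S) * (P * S / (\<alpha> * c) * HA - W * (P * (C * S) * T * HB)) = K * (1 / c / \<alpha>) * HA - K * C * T * W * HB"
        if P: "P \<noteq> 0" for P c W T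
      proof -
        have 1: "K / (P * S) * (P * S / (\<alpha> * c) * HA) = K * (1 / c / \<alpha>) * HA"
          using S0 P \<alpha>(1) by (cases "c = 0") (simp_all add: field_simps)
        have 2: "K / (P * S) * (W * (P * (C * S) * T * HB)) = K * C * T * W * HB"
          using S0 P by (simp add: field_simps)
        show ?thesis unfolding right_diff_distrib 1 2 ..
      qed
      from this[OF pi0] show ?thesis .
    qed
    finally show ?case
      unfolding HA_def HB_def w_def .
  qed
qed

section \<open>The zeroth moment, and the limits as a tends to b\<close>

lemma zeroth_moment_integral_unequal:
  assumes a: "Re a > 0" and b: "Re b > 0" and \<alpha>: "\<alpha> \<noteq> 0" "- 1/4 < Re \<alpha>" "Re \<alpha> < 1/2" and ab: "a \<noteq> b"
    and s: "s \<in> {1, - 1 :: real}"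
  shows "bessel_integral 0 \<alpha> a b = of_real pi ^ 2 / (8 * b) *
              (1 / cos (of_real pi * \<alpha>) / \<alpha> *
                 side_value s (\<lambda>w. hypergeo [1/2, 1/2, \<alpha> + 1/2, 1/2 - \<alpha>] [1, \<alpha> + 1, 1 - \<alpha>] (w ^ 2)) (a / b)
               - Gamma (\<alpha> + 1/2) * Gamma (2 * \<alpha> + 1/2) * (1 / sin (of_real pi * \<alpha>)) / Gamma (\<alpha> + 1) ^ 3
                 * (a / (2 * b)) powr (2 * \<alpha>) *
                 side_value s (\<lambda>w. hypergeo [1/2, \<alpha> + 1/2, \<alpha> + 1/2, 2 * \<alpha> + 1/2] [\<alpha> + 1, \<alpha> + 1, 2 * \<alpha> + 1] (w ^ 2)) (a / b))"
proof -
  define K where "K = of_real pi ^ 2 / (8 * b)"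
  define C where "C = Gamma (\<alpha> + 1/2) * Gamma (2 * \<alpha> + 1/2) * (1 / sin (of_real pi * \<alpha>)) / Gamma (\<alpha> + 1) ^ 3"
  have half: "- 1/2 < Re \<alpha>" using \<alpha>(2) by simp
  note rA = hypergeo_power2_regular[OF hypergeo_4F3_regular_even[OF half \<alpha>(3)]]
    and rB = hypergeo_power2_regular[OF hypergeo_4F3_regular_same[OF \<alpha>(2)]]
  have c1: "(\<lambda>w. K * (1 / cos (of_real pi * \<alpha>) / \<alpha>)) holomorphic_on - \<real>\<^sub>\<le>\<^sub>0" by (rule holomorphic_on_const)
  have c2: "(\<lambda>w. K * C * 2 powr (- (2 * \<alpha>)) * w powr (2 * \<alpha>)) holomorphic_on - \<real>\<^sub>\<le>\<^sub>0"
    by (intro holomorphic_on_mult holomorphic_on_const powr_holomorphic)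
  have "a / b \<noteq> 0" using a b by auto
  from half_powr[OF this] have p: "(a / (2 * b)) powr (2 * \<alpha>) = (a / b) powr (2 * \<alpha>) * 2 powr (- (2 * \<alpha>))" by (simp add: mult.commute)
  show ?thesis
    unfolding bessel_integral_side_value[OF b admissible_0[OF \<alpha>(2,3)] s a ab c1 c2 rA(1) rB(1) rA(2) rB(2)
        small_parameter_0[OF b \<alpha>, folded K_def C_def]] p K_def[symmetric] C_def[symmetric]
    by (simp only: right_diff_distrib mult_ac)
qed

lemma continuous_on_power_series:
  fixes c :: "nat \<Rightarrow> complex"
  assumes "summable (\<lambda>k. norm (c k))"
  shows "continuous_on (cball 0 1) (\<lambda>z. \<Sum>k. c k * z ^ k)"
proof (rule uniform_limit_theorem)
  show "uniform_limit (cball 0 1) (\<lambda>n z. \<Sum>k<n. c k * z ^ k) (\<lambda>z. \<Sum>k. c k * z ^ k) sequentially"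
  proof (rule Weierstrass_m_test[OF _ assms])
    fix k and z :: complex assume "z \<in> cball 0 1"
    hence "norm (c k) * norm z ^ k \<le> norm (c k) * 1" by (intro mult_left_mono power_le_one) auto
    thus "norm (c k * z ^ k) \<le> norm (c k)" by (simp add: norm_mult norm_power)
  qed
qed (auto intro!: always_eventually continuous_intros)

text \<open>The quotient decays like \<open>1 / sqrt k\<close>. The constant \<open>M\<close> is chosen so that \<open>M + k\<close> times the square of the quotient is
nonincreasing in \<open>k\<close>; in each step this is an elementary inequality between quadratic polynomials.\<close>

lemma pochhammer_half_shift_bound:
  fixes p :: complex
  assumes p: "Re p > 0"
  defines "M \<equiv> Re p + 4 * (Im p)\<^sup>2"
  shows "(norm (pochhammer p k / pochhammer (p + 1/2) k))\<^sup>2 \<le> M / (M + real k)"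
proof (induction k)
  case 0
  have "M > 0" unfolding M_def by (intro add_pos_nonneg p) simp
  thus ?case by simp
next
  case (Suc k)
  define u where "u = Re p + real k"
  define y where "y = (Im p)\<^sup>2"
  define N where "N = M + real k"
  have M: "M > 0" unfolding M_def by (intro add_pos_nonneg p) simp
  have u: "u > 0" "y \<ge> 0" "N > 0" using p M by (auto simp: u_def y_def N_def)
  have N: "N = u + 4 * y" by (simp add: N_def M_def u_def y_def)
  define A where "A = (norm (p + of_nat k))\<^sup>2"
  define B where "B = (norm (p + 1/2 + of_nat k))\<^sup>2"
  have A: "A = u\<^sup>2 + y" and B: "B = (u + 1/2)\<^sup>2 + y" by (simp_all add: A_def B_def cmod_power2 u_def y_def algebra_simps)
  have B0: "B > 0" unfolding B using u by (intro add_pos_nonneg) auto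
  have "A * (N + 1) \<le> B * N"
  proof -
    have "B * N - A * (N + 1) = u / 4 + 4 * (u * y)" unfolding A B N by (simp add: power2_eq_square algebra_simps)
    moreover have "u * y \<ge> 0" using u by simp
    ultimately show ?thesis using u by linarith
  qed
  hence AB: "A / B \<le> N / (N + 1)" using B0 u by (simp add: field_simps)
  have "(norm (pochhammer p (Suc k) / pochhammer (p + 1/2) (Suc k)))\<^sup>2 =
      (norm (pochhammer p k / pochhammer (p + 1/2) k))\<^sup>2 * (A / B)"
    by (simp only: pochhammer_Suc A_def B_def norm_mult norm_divide power_mult_distrib power_divide times_divide_times_eq)
  also have "\<dots> \<le> M / N * (N / (N + 1))"
    using Suc.IH AB B0 M u unfolding N_def[symmetric] by (intro mult_mono) (auto simp: A_def)
  also have "\<dots> = M / (M + real (Suc k))" using u by (simp add: N_def add_ac)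
  finally show ?case .
qed

text \<open>Four factors of size \<open>1 / sqrt k\<close> make the coefficients \<open>O(1/k\<^sup>2)\<close>, so the series converges absolutely also on the
unit circle.\<close>

lemma summable_4F3_coefficients:
  assumes p: "Re p1 > 0" "Re p2 > 0" "Re p3 > 0"
    and c: "\<And>k. c k = pochhammer (1/2) k / fact k * (pochhammer p1 k / pochhammer (p1 + 1/2) k) *
       (pochhammer p2 k / pochhammer (p2 + 1/2) k) * (pochhammer p3 k / pochhammer (p3 + 1/2) k)"
  shows "summable (\<lambda>k. norm (c k :: complex))"
proof -
  define M where "M p = Re p + 4 * (Im p)\<^sup>2" for p :: complex
  define q where "q p k = norm (pochhammer p k / pochhammer (p + 1/2) k)" for p :: complex and k
  have q: "(q p k)\<^sup>2 \<le> M p / real k" if "Re p > 0" "k \<ge> 1" for p k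
  proof -
    have M: "M p > 0" unfolding M_def by (intro add_pos_nonneg that) simp
    have "(q p k)\<^sup>2 \<le> M p / (M p + real k)" unfolding q_def M_def by (rule pochhammer_half_shift_bound[OF that(1)])
    also have "\<dots> \<le> M p / real k" using that M by (intro divide_left_mono) auto
    finally show ?thesis .
  qed
  define P where "P = M (1/2) * M p1 * M p2 * M p3"
  have P: "P \<ge> 0" unfolding P_def M_def using p by (intro mult_nonneg_nonneg add_nonneg_nonneg) auto
  have "norm (c k) \<le> sqrt P * inverse (real k ^ 2)" if k: "k \<ge> 1" for k
  proof (rule power2_le_imp_le)
    have e: "(fact k :: complex) = pochhammer (1/2 + 1/2) k" by (simp add: pochhammer_fact)
    have "norm (c k) = q (1/2) k * q p1 k * q p2 k * q p3 k"
      unfolding c q_def e by (simp only: norm_mult)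
    hence "(norm (c k))\<^sup>2 = (q (1/2) k)\<^sup>2 * (q p1 k)\<^sup>2 * (q p2 k)\<^sup>2 * (q p3 k)\<^sup>2" by (simp add: power_mult_distrib)
    also have "\<dots> \<le> (M (1/2) / real k) * (M p1 / real k) * (M p2 / real k) * (M p3 / real k)"
      using p k by (intro mult_mono q mult_nonneg_nonneg divide_nonneg_nonneg) (auto simp: M_def)
    also have "\<dots> = (sqrt P * inverse (real k ^ 2))\<^sup>2"
      using P k by (simp add: power_mult_distrib P_def field_simps power2_eq_square)
    finally show "(norm (c k))\<^sup>2 \<le> (sqrt P * inverse (real k ^ 2))\<^sup>2" .
  qed (use P in simp)
  thus ?thesis
    by (intro summable_comparison_test'[OF summable_mult[OF inverse_power_summable[of 2]], of 1 _ "sqrt P"]) auto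
qed

text \<open>The limit \<open>w \<rightarrow> 1\<close> inside the unit disc, in which \<open>a = b\<close> is approached.\<close>

lemma unit_ball_filter:
  "at (1 :: complex) within ball 0 1 \<noteq> bot"
  "eventually (\<lambda>w. w \<in> ratio_domain) (at (1 :: complex) within ball 0 1)"
  "eventually (\<lambda>w. norm w < 1 \<and> w \<noteq> 0 \<and> w \<noteq> 1) (at (1 :: complex) within ball 0 1)"
proof -
  have "(1 :: complex) islimpt ball 0 1" by (simp add: islimpt_ball)
  thus "at (1 :: complex) within ball 0 1 \<noteq> bot" by (simp add: trivial_limit_within)
  have b: "eventually (\<lambda>w. norm w < 1 \<and> w \<noteq> 1) (at (1 :: complex) within ball 0 1)"
    unfolding eventually_at_filter by (rule always_eventually) auto
  have "((\<lambda>w. Re w) \<longlongrightarrow> Re 1) (at (1 :: complex) within ball 0 1)" by (intro tendsto_intros)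
  hence r: "eventually (\<lambda>w. Re w > 0) (at (1 :: complex) within ball 0 1)" by (rule order_tendstoD) simp
  from b r show "eventually (\<lambda>w. w \<in> ratio_domain) (at (1 :: complex) within ball 0 1)"
  proof eventually_elim
    case (elim w)
    thus ?case using complex_Re_le_cmod[of w] unfolding ratio_domain_iff by linarith
  qed
  from b r show "eventually (\<lambda>w. norm w < 1 \<and> w \<noteq> 0 \<and> w \<noteq> 1) (at (1 :: complex) within ball 0 1)"
    by eventually_elim auto
qed

lemma power_series_tendsto_1:
  fixes c :: "nat \<Rightarrow> complex"
  assumes "summable (\<lambda>k. norm (c k))"
  shows "((\<lambda>w. \<Sum>k. c k * (w\<^sup>2) ^ k) \<longlongrightarrow> (\<Sum>k. c k)) (at 1 within ball 0 1)"
proof -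
  have "continuous_on (cball 0 1) (\<lambda>w::complex. \<Sum>k. c k * (w\<^sup>2) ^ k)"
    by (rule continuous_on_compose2[OF continuous_on_power_series[OF assms]])
       (auto intro!: continuous_intros simp: norm_power power_le_one)
  hence t: "((\<lambda>w::complex. \<Sum>k. c k * (w\<^sup>2) ^ k) \<longlongrightarrow> (\<Sum>k. c k * (1\<^sup>2) ^ k)) (at 1 within cball 0 1)"
    unfolding continuous_on_def by (rule bspec) simp
  have e: "c k * (1\<^sup>2) ^ k = c k" for k by simp
  from tendsto_within_subset[OF t ball_subset_cball] show ?thesis unfolding e .
qed

lemma hypergeo_tendsto_1:
  assumes "hypergeo_regular as bs" "summable (\<lambda>k. norm (fps_nth (fps_hypergeo as bs 1) k))"
  shows "((\<lambda>w. hypergeo as bs (w\<^sup>2)) \<longlongrightarrow> hypergeo as bs (1\<^sup>2)) (at 1 within ball 0 1)"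
proof -
  have "hypergeo as bs (1\<^sup>2) = (\<Sum>k. fps_nth (fps_hypergeo as bs 1) k)"
    by (simp add: hypergeo_def hypergeo_series_def eval_fps_def)
  moreover have "eventually (\<lambda>w. (\<Sum>k. fps_nth (fps_hypergeo as bs 1) k * (w\<^sup>2) ^ k) = hypergeo as bs (w\<^sup>2)) (at 1 within ball 0 1)"
    using unit_ball_filter(3) by eventually_elim (blast intro: sums_unique[symmetric] hypergeo_power2_regular(3)[OF assms(1)])
  ultimately show ?thesis using power_series_tendsto_1[OF assms(2)] by (simp only:) (rule Lim_transform_eventually)
qed

lemma zeroth_moment_integral_equal:
  assumes b: "Re b > 0" and \<alpha>: "\<alpha> \<noteq> 0" "- 1/4 < Re \<alpha>" "Re \<alpha> < 1/2"
  shows "bessel_integral 0 \<alpha> b b = of_real pi ^ 2 / (8 * b) *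
              (1 / cos (of_real pi * \<alpha>) / \<alpha> * hypergeo [1/2, 1/2, \<alpha> + 1/2, 1/2 - \<alpha>] [1, \<alpha> + 1, 1 - \<alpha>] (1 ^ 2)
               - Gamma (\<alpha> + 1/2) * Gamma (2 * \<alpha> + 1/2) * (1 / sin (of_real pi * \<alpha>)) / Gamma (\<alpha> + 1) ^ 3
                 * (1 / 2) powr (2 * \<alpha>) * hypergeo [1/2, \<alpha> + 1/2, \<alpha> + 1/2, 2 * \<alpha> + 1/2] [\<alpha> + 1, \<alpha> + 1, 2 * \<alpha> + 1] (1 ^ 2))"
proof -
  define K where "K = of_real pi ^ 2 / (8 * b)"
  define C where "C = Gamma (\<alpha> + 1/2) * Gamma (2 * \<alpha> + 1/2) * (1 / sin (of_real pi * \<alpha>)) / Gamma (\<alpha> + 1) ^ 3"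
  define HA where "HA = (\<lambda>w. hypergeo [1/2, 1/2, \<alpha> + 1/2, 1/2 - \<alpha>] [1, \<alpha> + 1, 1 - \<alpha>] (w\<^sup>2))"
  define HB where "HB = (\<lambda>w. hypergeo [1/2, \<alpha> + 1/2, \<alpha> + 1/2, 2 * \<alpha> + 1/2] [\<alpha> + 1, \<alpha> + 1, 2 * \<alpha> + 1] (w\<^sup>2))"
  have half: "- 1/2 < Re \<alpha>" using \<alpha>(2) by simp
  note regA = hypergeo_4F3_regular_even[OF half \<alpha>(3)] and regB = hypergeo_4F3_regular_same[OF \<alpha>(2)]
  note adm = admissible_0[OF \<alpha>(2,3)]
  define h where "h w = K * (1 / cos (of_real pi * \<alpha>) / \<alpha>) * HA w - K * C * 2 powr (- (2 * \<alpha>)) * w powr (2 * \<alpha>) * HB w" for w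
  have sub: "ratio_domain \<subseteq> - \<real>\<^sub>\<le>\<^sub>0" by (auto simp: ratio_domain_def)
  have hol: "h holomorphic_on ratio_domain" unfolding h_def HA_def HB_def
    by (intro holomorphic_on_mult holomorphic_on_diff holomorphic_on_const hypergeo_power2_regular(1) regA regB
         holomorphic_on_subset[OF powr_holomorphic sub])
  have small: "eventually (\<lambda>a. bessel_integral 0 \<alpha> (of_real a) b = h (of_real a / b)) (at_right 0)"
    using small_parameter_0[OF b \<alpha>] unfolding h_def HA_def HB_def K_def C_def .
  have main: "bessel_integral 0 \<alpha> a b = h (a / b)" if "Re a > 0" "a / b \<in> ratio_domain" for a
    by (rule bessel_integral_continuation[OF b adm open_ratio_domain closed_segment_ratio_domain ball_subset_ratio_domain hol small that])
  have sA: "summable (\<lambda>k. norm (fps_nth (fps_hypergeo [1/2, 1/2, \<alpha> + 1/2, 1/2 - \<alpha>] [1, \<alpha> + 1, 1 - \<alpha>] 1) k))"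
    by (rule summable_4F3_coefficients[of "1/2" "\<alpha> + 1/2" "1/2 - \<alpha>"]) (use \<alpha> in \<open>simp_all add: add.commute add.left_commute\<close>)
  have sB: "summable (\<lambda>k. norm (fps_nth (fps_hypergeo [1/2, \<alpha> + 1/2, \<alpha> + 1/2, 2 * \<alpha> + 1/2] [\<alpha> + 1, \<alpha> + 1, 2 * \<alpha> + 1] 1) k))"
    by (rule summable_4F3_coefficients[of "\<alpha> + 1/2" "\<alpha> + 1/2" "2 * \<alpha> + 1/2"]) (use \<alpha> in \<open>simp_all add: add.commute add.left_commute\<close>)
  have pw: "((\<lambda>w. w powr (2 * \<alpha>)) \<longlongrightarrow> 1 powr (2 * \<alpha>)) (at 1 within ball 0 1)"
    by (intro tendsto_intros) (auto simp: complex_nonpos_Reals_iff)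
  have l: "(h \<longlongrightarrow> K * (1 / cos (of_real pi * \<alpha>) / \<alpha>) * HA 1 - K * C * 2 powr (- (2 * \<alpha>)) * 1 powr (2 * \<alpha>) * HB 1) (at (of_real 1) within ball 0 1)"
    unfolding h_def HA_def HB_def of_real_1
    by (intro tendsto_mult tendsto_diff tendsto_const pw hypergeo_tendsto_1 regA regB sA sB)
  have "bessel_integral 0 \<alpha> (of_real 1 * b) b = K * (1 / cos (of_real pi * \<alpha>) / \<alpha>) * HA 1 - K * C * 2 powr (- (2 * \<alpha>)) * 1 powr (2 * \<alpha>) * HB 1"
    by (rule bessel_integral_eq_limit[OF b adm _ _ _ main l]) (simp_all add: unit_ball_filter)
  moreover have "((1::complex) / 2) powr (2 * \<alpha>) = 2 powr (- (2 * \<alpha>))" using half_powr[of 1 "2 * \<alpha>", OF one_neq_zero]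
    unfolding powr_one_eq_one mult_1_left .
  ultimately show ?thesis unfolding K_def[symmetric] C_def[symmetric]
    HA_def HB_def
    by (simp only: of_real_1 mult_1_left mult_1_right powr_one_eq_one right_diff_distrib mult.assoc)
qed

text \<open>The logarithmic singularity is weaker than any power; here \<open>ln y \<le> y\<close> is applied to \<open>y = 1 / sqrt |z|\<close>.\<close>

lemma norm_times_Ln_le:
  assumes "z \<noteq> 0" "norm z \<le> 1"
  shows "norm (z * Ln z) \<le> 2 * sqrt (norm z) + pi * norm z"
proof -
  define x where "x = norm z"
  have x: "x > 0" "x \<le> 1" using assms by (auto simp: x_def)
  have "norm (Ln z) \<le> \<bar>Re (Ln z)\<bar> + \<bar>Im (Ln z)\<bar>" by (rule cmod_le)
  also have "\<bar>Im (Ln z)\<bar> \<le> pi" using mpi_less_Im_Ln[OF assms(1)] Im_Ln_le_pi[OF assms(1)] by linarith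
  also have "\<bar>Re (Ln z)\<bar> = - ln x" using assms x by (simp add: x_def)
  also have "- ln x = 2 * ln (1 / sqrt x)" using x by (simp add: ln_div ln_sqrt)
  also have "ln (1 / sqrt x) \<le> 1 / sqrt x" using ln_bound[of "1 / sqrt x"] x by simp
  finally have "norm (Ln z) \<le> 2 * (1 / sqrt x) + pi" by simp
  hence "x * norm (Ln z) \<le> x * (2 * (1 / sqrt x) + pi)" using x by (intro mult_left_mono) auto
  also have "x * (2 * (1 / sqrt x) + pi) = 2 * (x / sqrt x) + pi * x" by (simp add: algebra_simps)
  also have "x / sqrt x = sqrt x" using x by (simp add: real_div_sqrt)
  finally show ?thesis by (simp add: norm_mult x_def)
qed

lemma arctanh_times_tendsto_0:
  "((\<lambda>w. (1 - w) * arctanh w) \<longlongrightarrow> 0) (at 1 within ball 0 1)"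
proof -
  have t1: "((\<lambda>w. (1 - w) * Ln (1 + w)) \<longlongrightarrow> (1 - 1) * Ln (1 + 1)) (at (1 :: complex) within ball 0 1)"
    by (intro tendsto_intros) (auto simp: complex_nonpos_Reals_iff)
  have t2: "((\<lambda>w. (1 - w) * Ln (1 - w)) \<longlongrightarrow> 0) (at (1 :: complex) within ball 0 1)"
  proof (rule Lim_null_comparison)
    have n: "((\<lambda>w::complex. norm (1 - w)) \<longlongrightarrow> norm (1 - 1 :: complex)) (at 1 within ball 0 1)" by (intro tendsto_intros)
    hence "eventually (\<lambda>w. norm (1 - w :: complex) < 1) (at 1 within ball 0 1)" by (rule order_tendstoD) simp
    with unit_ball_filter(3) show "eventually (\<lambda>w. norm ((1 - w) * Ln (1 - w)) \<le> 2 * sqrt (norm (1 - w)) + pi * norm (1 - w)) (at (1::complex) within ball 0 1)"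
      by eventually_elim (intro norm_times_Ln_le, auto)
    have "((\<lambda>w. 2 * sqrt (norm (1 - w)) + pi * norm (1 - w)) \<longlongrightarrow> 2 * sqrt (norm (1 - 1 :: complex)) + pi * norm (1 - 1 :: complex)) (at (1::complex) within ball 0 1)"
      by (intro tendsto_add tendsto_mult tendsto_const tendsto_real_sqrt n)
    thus "((\<lambda>w. 2 * sqrt (norm (1 - w)) + pi * norm (1 - w)) \<longlongrightarrow> 0) (at (1::complex) within ball 0 1)" by simp
  qed
  have "((\<lambda>w. ((1 - w) * Ln (1 + w) - (1 - w) * Ln (1 - w)) / 2) \<longlongrightarrow> ((1 - 1) * Ln (1 + 1) - 0) / 2) (at (1 :: complex) within ball 0 1)"
    by (intro tendsto_divide tendsto_diff t1 t2 tendsto_const) auto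
  thus ?thesis by (simp add: arctanh_def right_diff_distrib)
qed

lemma geometric_over_linear_sums:
  assumes \<alpha>: "Re \<alpha> > - 1/2" and w: "norm w < 1"
  shows "(\<lambda>k. 1 / (2 * of_nat k + 1 + 2 * \<alpha>) * (w\<^sup>2) ^ k) sums (hypergeo [1, 1/2 + \<alpha>] [3/2 + \<alpha>] (w\<^sup>2) / (1 + 2 * \<alpha>))"
proof -
  have reg: "hypergeo_regular [1, 1/2 + \<alpha>] [3/2 + \<alpha>]"
    using hypergeo_2F1_regular[of "1/2 + \<alpha>"] \<alpha> by (simp add: add.commute add.left_commute)
  have \<alpha>1: "1 + 2 * \<alpha> \<noteq> 0" using \<alpha> by (auto dest!: arg_cong[of _ _ Re])
  have "fps_nth (fps_hypergeo [1, 1/2 + \<alpha>] [3/2 + \<alpha>] 1) k * (w\<^sup>2) ^ k / (1 + 2 * \<alpha>) = 1 / (2 * of_nat k + 1 + 2 * \<alpha>) * (w\<^sup>2) ^ k" for k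
    unfolding fps_nth_2F1[OF \<alpha>] using \<alpha>1 by simp
  thus ?thesis using sums_divide[OF hypergeo_power2_regular(3)[OF reg w], of "1 + 2 * \<alpha>"] by (simp only:)
qed

text \<open>The terms left over when the series of \<open>arctanh w / w\<close> and of the 2F1 are subtracted, divided by \<open>2 \<alpha>\<close>. Each of
the two series diverges at \<open>w = 1\<close>, their difference converges absolutely.\<close>

definition odd_difference :: "complex \<Rightarrow> nat \<Rightarrow> complex" where
  "odd_difference \<alpha> k = 1 / ((2 * of_nat k + 1) * (2 * of_nat k + 1 + 2 * \<alpha>))"

lemma odd_difference_eq:
  assumes "Re \<alpha> > - 1/2"
  shows "1 / (2 * of_nat k + 1) - 1 / (2 * of_nat k + 1 + 2 * \<alpha>) = 2 * \<alpha> * odd_difference \<alpha> k"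
proof -
  have 1: "2 * of_nat k + 1 + 2 * \<alpha> \<noteq> 0" using assms by (auto dest!: arg_cong[of _ _ Re])
  have 2: "2 * of_nat k + 1 \<noteq> (0 :: complex)" by (auto dest!: arg_cong[of _ _ Re])
  have "1 / x - 1 / y = (y - x) * (1 / (x * y))" if "x \<noteq> 0" "y \<noteq> 0" for x y :: complex
    using that by (simp add: field_simps)
  from this[OF 2 1] show ?thesis by (simp add: odd_difference_def)
qed

lemma summable_odd_difference:
  assumes "Re \<alpha> > - 1/2"
  shows "summable (\<lambda>k. norm (odd_difference \<alpha> k))"
proof -
  have "norm (odd_difference \<alpha> k) \<le> inverse (real k ^ 2)" if k: "k \<ge> 1" for k
  proof -
    have "real k \<le> Re (2 * of_nat k + 1 + 2 * \<alpha>)" using assms by simp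
    hence 1: "real k \<le> norm (2 * of_nat k + 1 + 2 * \<alpha>)" using complex_Re_le_cmod order_trans by blast
    have "real k \<le> Re (2 * of_nat k + 1)" by simp
    hence 2: "real k \<le> norm (2 * of_nat k + 1 :: complex)" using complex_Re_le_cmod order_trans by blast
    have "1 / (norm (2 * of_nat k + 1 :: complex) * norm (2 * of_nat k + 1 + 2 * \<alpha>)) \<le> 1 / (real k * real k)"
      using 1 2 k by (intro divide_left_mono mult_mono mult_pos_pos) auto
    thus ?thesis by (simp only: odd_difference_def norm_divide norm_mult norm_one power2_eq_square inverse_eq_divide)
  qed
  thus ?thesis by (intro summable_comparison_test'[OF inverse_power_summable[of 2], of 1]) auto
qed

text \<open>The first summand extends continuously to \<open>w = 1\<close>. In the second, the zero of \<open>1 - w powr (2 * \<alpha>)\<close> at 1 beats the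
logarithmic singularity of \<open>arctanh\<close>. Dividing by \<open>\<alpha>\<close>, the same form also has a limit as \<open>\<alpha> \<rightarrow> 0\<close>.\<close>

lemma first_moment_bracket:
  assumes \<alpha>: "Re \<alpha> > - 1/2" and w: "norm w < 1" "w \<noteq> 0"
  shows "1 / w * arctanh w - w powr (2 * \<alpha>) * (hypergeo [1, 1/2 + \<alpha>] [3/2 + \<alpha>] (w\<^sup>2) / (1 + 2 * \<alpha>)) =
    w powr (2 * \<alpha>) * (2 * \<alpha> * (\<Sum>k. odd_difference \<alpha> k * (w\<^sup>2) ^ k)) + (1 - w powr (2 * \<alpha>)) * (arctanh w / w)"
    and "(\<lambda>k. 2 * \<alpha> * odd_difference \<alpha> k * (w\<^sup>2) ^ k) sums (2 * \<alpha> * (\<Sum>k. odd_difference \<alpha> k * (w\<^sup>2) ^ k))"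
proof -
  define H where "H = hypergeo [1, 1/2 + \<alpha>] [3/2 + \<alpha>] (w\<^sup>2) / (1 + 2 * \<alpha>)"
  have "(\<lambda>k. (1 / (2 * of_nat k + 1) - 1 / (2 * of_nat k + 1 + 2 * \<alpha>)) * (w\<^sup>2) ^ k) sums (arctanh w / w - H)"
    unfolding left_diff_distrib H_def
    by (rule sums_diff[OF arctanh_sums_even[OF w] geometric_over_linear_sums[OF \<alpha> w(1)]])
  hence s: "(\<lambda>k. 2 * \<alpha> * odd_difference \<alpha> k * (w\<^sup>2) ^ k) sums (arctanh w / w - H)"
    by (simp only: odd_difference_eq[OF \<alpha>])
  have "summable (\<lambda>k. odd_difference \<alpha> k * (w\<^sup>2) ^ k)"
  proof (rule summable_comparison_test'[OF summable_odd_difference[OF \<alpha>], of 0])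
    fix k
    have "norm (odd_difference \<alpha> k) * norm (w\<^sup>2) ^ k \<le> norm (odd_difference \<alpha> k) * 1"
      using w by (intro mult_left_mono power_le_one) (auto simp: norm_power power_le_one)
    thus "norm (odd_difference \<alpha> k * (w\<^sup>2) ^ k) \<le> norm (odd_difference \<alpha> k)" by (simp add: norm_mult norm_power)
  qed
  from sums_mult[OF summable_sums[OF this], of "2 * \<alpha>"]
  show s2: "(\<lambda>k. 2 * \<alpha> * odd_difference \<alpha> k * (w\<^sup>2) ^ k) sums (2 * \<alpha> * (\<Sum>k. odd_difference \<alpha> k * (w\<^sup>2) ^ k))"
    by (simp only: mult.assoc)
  have e: "2 * \<alpha> * (\<Sum>k. odd_difference \<alpha> k * (w\<^sup>2) ^ k) = arctanh w / w - H" by (rule sums_unique2[OF s2 s])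
  have "1 / w * X - p * h = p * (X / w - h) + (1 - p) * (X / w)" for X p h :: complex
    by (simp add: algebra_simps diff_divide_distrib)
  thus "1 / w * arctanh w - w powr (2 * \<alpha>) * (hypergeo [1, 1/2 + \<alpha>] [3/2 + \<alpha>] (w\<^sup>2) / (1 + 2 * \<alpha>)) =
    w powr (2 * \<alpha>) * (2 * \<alpha> * (\<Sum>k. odd_difference \<alpha> k * (w\<^sup>2) ^ k)) + (1 - w powr (2 * \<alpha>)) * (arctanh w / w)"
    unfolding e H_def[symmetric] .
qed

text \<open>Termwise difference of the series of \<open>Digamma\<close> at \<open>1/2 + \<alpha>\<close> and at \<open>1/2\<close>, where the value is known.\<close>

lemma Digamma_half_shift:
  assumes \<alpha>: "Re \<alpha> > - 1/2"
  shows "2 * \<alpha> * (\<Sum>k. odd_difference \<alpha> k) = (Digamma (1/2 + \<alpha>) + 2 * of_real (ln 2) + euler_mascheroni) / 2"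
proof -
  have z: "1/2 + \<alpha> \<noteq> 0" using \<alpha> by (auto dest!: arg_cong[of _ _ Re])
  have s: "(\<lambda>k. inverse (of_nat (Suc k)) - inverse (z + of_nat k)) sums (Digamma z + euler_mascheroni)" if "z \<noteq> 0" for z :: complex
    using summable_sums[OF summable_Digamma[OF that]] by (simp add: Digamma_def)
  have half: "(1/2 :: complex) \<noteq> 0" by simp
  have eq: "(inverse (of_nat (Suc k)) - inverse (1/2 + \<alpha> + of_nat k)) - (inverse (of_nat (Suc k)) - inverse (1/2 + of_nat k)) =
      2 * (2 * \<alpha> * odd_difference \<alpha> k)" for k
  proof -
    have i: "inverse (x / 2) = 2 * (1 / x)" for x :: complex by (simp add: inverse_eq_divide)
    have e1: "1/2 + \<alpha> + of_nat k = (2 * of_nat k + 1 + 2 * \<alpha>) / 2" by (simp add: add_divide_distrib)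
    have e2: "1/2 + of_nat k = (2 * of_nat k + 1 :: complex) / 2" by (simp add: add_divide_distrib)
    have "(X - 2 * P) - (X - 2 * Q) = 2 * (Q - P)" for X P Q :: complex by (simp add: algebra_simps)
    thus ?thesis unfolding odd_difference_eq[OF \<alpha>, symmetric] e1 e2 i .
  qed
  have "(\<lambda>k. 2 * (2 * \<alpha> * odd_difference \<alpha> k)) sums
      ((Digamma (1/2 + \<alpha>) + euler_mascheroni) - (Digamma (1/2) + euler_mascheroni))"
    by (rule sums_diff[OF s[OF z] s[OF half], unfolded eq])
  hence "(\<lambda>k. 2 * (2 * \<alpha> * odd_difference \<alpha> k)) sums (Digamma (1/2 + \<alpha>) - Digamma (1/2))"
    by (simp only: add_diff_cancel_right)
  moreover have "(\<lambda>k. 2 * (2 * \<alpha> * odd_difference \<alpha> k)) sums (2 * (2 * \<alpha> * (\<Sum>k. odd_difference \<alpha> k)))"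
    by (intro sums_mult summable_sums summable_norm_cancel[OF summable_odd_difference[OF \<alpha>]])
  ultimately have "2 * (2 * \<alpha> * (\<Sum>k. odd_difference \<alpha> k)) = Digamma (1/2 + \<alpha>) - Digamma (1/2)" by (rule sums_unique2[symmetric])
  also have "\<dots> = Digamma (1/2 + \<alpha>) + 2 * of_real (ln 2) + euler_mascheroni"
    unfolding Digamma_one_half by simp
  finally show ?thesis by (simp add: field_simps)
qed

lemma first_moment_integral_equal:
  assumes b: "Re b > 0" and \<alpha>: "\<alpha> \<noteq> 0" "- 1/2 < Re \<alpha>" "Re \<alpha> < 1"
  shows "bessel_integral 1 \<alpha> b b = of_real pi / (8 * b\<^sup>2) * (1 / sin (of_real pi * \<alpha>)) *
            (Digamma (1/2 + \<alpha>) + 2 * of_real (ln 2) + euler_mascheroni)"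
proof -
  define K where "K = of_real pi * (1 / sin (of_real pi * \<alpha>)) / (4 * b\<^sup>2)"
  define H where "H = (\<lambda>w. hypergeo [1, 1/2 + \<alpha>] [3/2 + \<alpha>] (w\<^sup>2))"
  define h where "h w = K * (1 / w) * arctanh w - K / (1 + 2 * \<alpha>) * w powr (2 * \<alpha>) * H w" for w
  note adm = admissible_1[OF \<alpha>(2,3)]
  have reg: "hypergeo_regular [1, 1/2 + \<alpha>] [3/2 + \<alpha>]"
    using hypergeo_2F1_regular[of "1/2 + \<alpha>"] \<alpha>(2) by (simp add: add.commute add.left_commute)
  have sub: "ratio_domain \<subseteq> - \<real>\<^sub>\<le>\<^sub>0" by (auto simp: ratio_domain_def)
  have inv: "(\<lambda>w. 1 / w) holomorphic_on ratio_domain" using sub by (intro holomorphic_intros) auto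
  have hol: "h holomorphic_on ratio_domain" unfolding h_def H_def
    by (intro holomorphic_on_mult holomorphic_on_diff holomorphic_on_const inv arctanh_holomorphic hypergeo_power2_regular(1)[OF reg]
         holomorphic_on_subset[OF powr_holomorphic sub])
  have small: "eventually (\<lambda>a. bessel_integral 1 \<alpha> (of_real a) b = h (of_real a / b)) (at_right 0)"
    using small_parameter_1[OF b \<alpha>] unfolding h_def H_def K_def .
  have main: "bessel_integral 1 \<alpha> a b = h (a / b)" if "Re a > 0" "a / b \<in> ratio_domain" for a
    by (rule bessel_integral_continuation[OF b adm open_ratio_domain closed_segment_ratio_domain ball_subset_ratio_domain hol small that])
  \<comment> \<open>The bracket with its second summand written as a difference quotient at 1 times a factor tending to 0.\<close>
  define g where "g w = K * (w powr (2 * \<alpha>) * (2 * \<alpha> * (\<Sum>k. odd_difference \<alpha> k * (w\<^sup>2) ^ k)) -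
      (w powr (2 * \<alpha>) - 1 powr (2 * \<alpha>)) / (w - 1) * - ((1 - w) * arctanh w) * (1 / w))" for w
  have pw: "((\<lambda>w. w powr (2 * \<alpha>)) \<longlongrightarrow> 1 powr (2 * \<alpha>)) (at 1 within ball 0 1)"
    by (intro tendsto_intros) (auto simp: complex_nonpos_Reals_iff)
  have "((\<lambda>z. z powr (2 * \<alpha>)) has_field_derivative 2 * \<alpha> * 1 powr (2 * \<alpha> - 1)) (at 1)"
    by (rule has_field_derivative_powr) (simp add: complex_nonpos_Reals_iff)
  hence "((\<lambda>w. (w powr (2 * \<alpha>) - 1 powr (2 * \<alpha>)) / (w - 1)) \<longlongrightarrow> 2 * \<alpha> * 1 powr (2 * \<alpha> - 1)) (at 1)"
    unfolding has_field_derivative_iff .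
  hence dq: "((\<lambda>w. (w powr (2 * \<alpha>) - 1 powr (2 * \<alpha>)) / (w - 1)) \<longlongrightarrow> 2 * \<alpha> * 1 powr (2 * \<alpha> - 1)) (at 1 within ball 0 1)"
    by (rule tendsto_within_subset) simp
  have iv: "((\<lambda>w. 1 / w) \<longlongrightarrow> 1 / 1) (at (1 :: complex) within ball 0 1)" by (intro tendsto_intros) auto
  have gl: "(g \<longlongrightarrow> K * (1 powr (2 * \<alpha>) * (2 * \<alpha> * (\<Sum>k. odd_difference \<alpha> k)) - 2 * \<alpha> * 1 powr (2 * \<alpha> - 1) * - 0 * (1 / 1))) (at 1 within ball 0 1)"
    unfolding g_def
    by (intro tendsto_mult tendsto_diff tendsto_minus tendsto_const pw dq iv arctanh_times_tendsto_0
         power_series_tendsto_1 summable_odd_difference \<alpha>(2))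
  have "eventually (\<lambda>w. g w = h w) (at 1 within ball 0 1)"
    using unit_ball_filter(3)
  proof eventually_elim
    case (elim w)
    have "h w = K * (1 / w * arctanh w - w powr (2 * \<alpha>) * (H w / (1 + 2 * \<alpha>)))"
    proof -
      have "K * i * A - K / d * P * Y = K * (i * A - P * (Y / d))" for i A d P Y by (simp add: algebra_simps)
      thus ?thesis unfolding h_def .
    qed
    also have "\<dots> = K * (w powr (2 * \<alpha>) * (2 * \<alpha> * (\<Sum>k. odd_difference \<alpha> k * (w\<^sup>2) ^ k)) + (1 - w powr (2 * \<alpha>)) * (arctanh w / w))"
      unfolding H_def using first_moment_bracket(1)[OF \<alpha>(2), of w] elim by simp
    also have "\<dots> = g w"
    proof -
      have w1: "w - 1 \<noteq> 0" using elim by simp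
      have "A + (1 - p) * (X / w) = A - (p - 1) / (w - 1) * - ((1 - w) * X) * (1 / w)" for p X A
      proof -
        have m: "- ((1 - w) * X) = (w - 1) * X" by (simp add: algebra_simps)
        have "(p - 1) / (w - 1) * ((w - 1) * X) = (p - 1) * X" using w1 by simp
        hence "(p - 1) / (w - 1) * ((w - 1) * X) * (1 / w) = (p - 1) * (X / w)" by (simp only: times_divide_eq_right mult_1_right)
        hence "A - (p - 1) / (w - 1) * ((w - 1) * X) * (1 / w) = A - (p - 1) * (X / w)" by (rule arg_cong)
        thus ?thesis unfolding m by (simp only: left_diff_distrib diff_diff_eq2 mult_1_left) (simp only: diff_conv_add_uminus add_ac minus_add_distrib minus_minus)
      qed
      thus ?thesis unfolding g_def powr_one_eq_one by (rule arg_cong)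
    qed
    finally show ?case by simp
  qed
  from Lim_transform_eventually[OF gl this]
  have l: "(h \<longlongrightarrow> K * (2 * \<alpha> * (\<Sum>k. odd_difference \<alpha> k))) (at (of_real 1) within ball 0 1)" by simp
  have "bessel_integral 1 \<alpha> (of_real 1 * b) b = K * (2 * \<alpha> * (\<Sum>k. odd_difference \<alpha> k))"
    by (rule bessel_integral_eq_limit[OF b adm _ _ _ main l]) (simp_all add: unit_ball_filter)
  thus ?thesis unfolding Digamma_half_shift[OF \<alpha>(2)] K_def by simp
qed

section \<open>The first moment of order zero, and the dilogarithm\<close>

lemma bounded_on_unit_interval:
  fixes f :: "real \<Rightarrow> complex"
  assumes "continuous_on {0..1} f"
  obtains R where "R \<ge> 0" "\<And>x. 0 \<le> x \<Longrightarrow> x \<le> 1 \<Longrightarrow> norm (f x) \<le> R"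
proof -
  have "bounded (f ` {0..1})" by (intro compact_imp_bounded compact_continuous_image assms) simp
  then obtain R where R: "\<forall>y\<in>f ` {0..1}. norm y \<le> R" unfolding bounded_iff by blast
  hence r: "norm (f x) \<le> R" if "0 \<le> x" "x \<le> 1" for x using that by simp
  have "norm (f 0) \<le> R" by (rule r) simp_all
  hence "R \<ge> 0" using norm_ge_zero order_trans by blast
  thus ?thesis using that r by blast
qed

lemma continuous_on_rGamma_shift: "continuous_on {0..1} (\<lambda>x. rGamma (complex_of_real x + c))"
  by (rule continuous_on_compose2[OF continuous_on_rGamma[of UNIV]]) (auto intro!: continuous_intros)

text \<open>Raising the order raises a power of \<open>1 - t \<le> 1\<close>, so the integral is largest at order 0.\<close>

lemma poisson_const_bounded:
  obtains Q where "\<And>x. 0 \<le> x \<Longrightarrow> x \<le> 1 \<Longrightarrow> poisson_const (of_real x) \<le> Q"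
proof -
  obtain R where R: "R \<ge> 0" "\<And>x. 0 \<le> x \<Longrightarrow> x \<le> 1 \<Longrightarrow> norm (rGamma (complex_of_real x + 1/2)) \<le> R"
    by (rule bounded_on_unit_interval[OF continuous_on_rGamma_shift[of "1/2"]]) blast
  define J where "J = integral\<^sup>L (lborel_on {0<..<1}) (\<lambda>t. norm (beta_kernel (1/2) (of_real 0 + 1/2) t))"
  have "poisson_const (of_real x) \<le> R / sqrt pi * J" if x: "0 \<le> x" "x \<le> 1" for x
  proof -
    have "integral\<^sup>L (lborel_on {0<..<1}) (\<lambda>t. norm (beta_kernel (1/2) (of_real x + 1/2) t)) \<le> J"
      unfolding J_def
    proof (rule integral_mono)
      fix t assume "t \<in> space (lborel_on {0<..<1})"
      hence t: "t \<in> {0<..<1}" by simp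
      hence "t powr (Re (1/2) - 1) * (1 - t) powr (Re (of_real x + 1/2) - 1) \<le> t powr (Re (1/2) - 1) * (1 - t) powr (Re (of_real 0 + 1/2) - 1)"
        using x by (intro mult_left_mono powr_mono') auto
      thus "norm (beta_kernel (1/2) (of_real x + 1/2) t) \<le> norm (beta_kernel (1/2) (of_real 0 + 1/2) t)"
        unfolding norm_beta_kernel[OF t] .
    qed (use x in \<open>auto intro!: integrable_norm_beta_kernel\<close>)
    thus ?thesis unfolding poisson_const_def using R x
      by (intro mult_mono divide_right_mono) auto
  qed
  thus ?thesis by (rule that)
qed

lemma bessel_I_continuous_order:
  assumes z: "z \<noteq> 0"
  shows "continuous_on {0..1} (\<lambda>x. bessel_I (of_real x) z)"
proof -
  define u where "u = z\<^sup>2 / 4"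
  obtain R where R: "R \<ge> 0" "\<And>x. 0 \<le> x \<Longrightarrow> x \<le> 1 \<Longrightarrow> norm (rGamma (complex_of_real x + 1)) \<le> R"
    by (rule bounded_on_unit_interval[OF continuous_on_rGamma_shift[of 1]]) blast
  have "continuous_on {0..1} (\<lambda>x. \<Sum>k. bessel_coeff (of_real x) k * u ^ k)"
  proof (rule uniform_limit_theorem)
    show "uniform_limit {0..1} (\<lambda>n x. \<Sum>k<n. bessel_coeff (of_real x) k * u ^ k) (\<lambda>x. \<Sum>k. bessel_coeff (of_real x) k * u ^ k) sequentially"
    proof (rule Weierstrass_m_test)
      show "summable (\<lambda>k. R * (inverse (fact k) * norm u ^ k))" by (intro summable_mult summable_exp)
      fix k and x :: real assume x: "x \<in> {0..1}"
      have d: "coeff_decay (of_real x) = 1" using x by (simp add: coeff_decay_def)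
      have f: "(fact k :: real) \<le> (fact k)\<^sup>2" by (simp add: power2_eq_square)
      have "norm (bessel_coeff (of_real x) k) \<le> norm (rGamma (complex_of_real x + 1)) / (coeff_decay (of_real x) ^ k * (fact k)\<^sup>2)"
        by (rule norm_bessel_coeff_le) (use x in simp)
      also have "\<dots> \<le> R / fact k" unfolding d power_one mult_1_left using x f by (intro frac_le R) auto
      finally have "norm (bessel_coeff (of_real x) k) * norm u ^ k \<le> R / fact k * norm u ^ k" by (rule mult_right_mono) simp
      thus "norm (bessel_coeff (of_real x) k * u ^ k) \<le> R * (inverse (fact k) * norm u ^ k)"
        by (simp add: norm_mult norm_power field_simps)
    qed
  next
    have "continuous_on {0..1} (\<lambda>x. rGamma (of_nat k + complex_of_real x + 1) / fact k * u ^ k)" for k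
      by (intro continuous_intros continuous_on_compose2[OF continuous_on_rGamma[of UNIV]]) auto
    thus "eventually (\<lambda>n. continuous_on {0..1} (\<lambda>x. \<Sum>k<n. bessel_coeff (of_real x) k * u ^ k)) sequentially"
      by (intro always_eventually allI continuous_on_sum) (simp add: bessel_coeff_def)
  qed simp
  moreover have "continuous_on {0..1} (\<lambda>x. exp (complex_of_real x * Ln (z / 2)))" by (intro continuous_intros)
  ultimately have "continuous_on {0..1} (\<lambda>x. exp (complex_of_real x * Ln (z / 2)) * (\<Sum>k. bessel_coeff (of_real x) k * u ^ k))"
    by (intro continuous_on_mult)
  moreover have "exp (complex_of_real x * Ln (z / 2)) * (\<Sum>k. bessel_coeff (of_real x) k * u ^ k) = bessel_I (of_real x) z"
    if "x \<in> {0..1}" for x using that z by (subst bessel_I_eq) (auto simp: powr_def u_def)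
  ultimately show ?thesis by (subst (asm) continuous_on_cong[OF refl]) auto
qed

lemma K_integral_holomorphic_order:
  assumes z: "Re z > 0"
  shows "(\<lambda>\<nu>. integral\<^sup>L (lborel_on {0..}) (K_kernel \<nu> z)) holomorphic_on {\<nu>. Re \<nu> < 2}"
proof (rule holomorphic_on_parameter_integral[where f = "\<lambda>t \<nu>. K_kernel \<nu> z t"])
  show "open {\<nu>. Re \<nu> < 2}" by (rule open_halfspace_Re_lt)
  show "(\<lambda>\<nu>. K_kernel \<nu> z t) holomorphic_on {\<nu>. Re \<nu> < 2}" for t
    unfolding K_kernel_def by (intro holomorphic_intros)
  show "(\<lambda>t. K_kernel \<nu> z t) \<in> borel_measurable (lborel_on {0..})" for \<nu> by (rule K_kernel_measurable)
  fix \<nu> assume \<nu>: "\<nu> \<in> {\<nu>. Re \<nu> < 2}"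
  obtain r where r: "r > 0" "ball \<nu> r \<subseteq> {\<nu>. Re \<nu> < 2}" using openE[OF open_halfspace_Re_lt \<nu>] by blast
  have "norm (K_kernel w z t) \<le> K_const 3 * exp (- Re z) * (1 + Re z powr (- 3)) * exp (- (3 - 2) * t)"
    if "t \<in> space (lborel_on {0..})" "w \<in> ball \<nu> r" for t w
    by (rule norm_K_kernel_le) (use that r z in \<open>auto simp: subset_iff intro: less_imp_le\<close>)
  moreover have "integrable (lborel_on {0..}) (\<lambda>t. K_const 3 * exp (- Re z) * (1 + Re z powr (- 3)) * exp (- (3 - 2) * t))"
    by (rule integrable_K_dominator) simp
  ultimately show "\<exists>r>0. \<exists>g. integrable (lborel_on {0..}) g \<and> ball \<nu> r \<subseteq> {\<nu>. Re \<nu> < 2} \<and>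
      (\<forall>t\<in>space (lborel_on {0..}). \<forall>w\<in>ball \<nu> r. norm (K_kernel w z t) \<le> g t)" using r by blast
qed

lemma bessel_K_continuous_order:
  assumes z: "Re z > 0"
  shows "continuous_on {0..1} (\<lambda>x. bessel_K (of_real x) z)"
proof -
  note c = holomorphic_on_imp_continuous_on[OF K_integral_holomorphic_order[OF z]]
  have "continuous_on {0..1} (\<lambda>x. integral\<^sup>L (lborel_on {0..}) (K_kernel (of_real x) z))"
    by (rule continuous_on_compose2[OF c]) (auto intro!: continuous_intros)
  moreover have "continuous_on {0..1} (\<lambda>x. integral\<^sup>L (lborel_on {0..}) (K_kernel (- of_real x) z))"
    by (rule continuous_on_compose2[OF c]) (auto intro!: continuous_intros)
  ultimately show ?thesis unfolding bessel_K_eq[OF z] by (intro continuous_intros) auto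
qed

definition small_order :: "nat \<Rightarrow> real" where
  "small_order n = inverse (real n + 8)"

lemma small_order:
  "0 < small_order n" "small_order n \<le> 1/8" "small_order \<longlonglongrightarrow> 0"
proof -
  show "0 < small_order n" by (simp add: small_order_def)
  have "inverse (real n + 8) \<le> inverse 8" by (rule le_imp_inverse_le) auto
  thus "small_order n \<le> 1/8" by (simp add: small_order_def)
  have "filterlim (\<lambda>n. real n + 8) at_top sequentially"
    by (rule filterlim_at_top_mono[OF filterlim_real_sequentially]) simp
  thus "small_order \<longlonglongrightarrow> 0" unfolding small_order_def[abs_def] by (rule tendsto_inverse_0_at_top)
qed

lemma tendsto_small_order:
  assumes "continuous_on {0..1} f"
  shows "(\<lambda>n. f (small_order n)) \<longlonglongrightarrow> f 0"
proof (rule continuous_on_tendsto_compose[OF assms small_order(3)])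
  have "small_order n \<in> {0..1}" for n using small_order(1,2)[of n] by auto
  thus "eventually (\<lambda>n. small_order n \<in> {0..1}) sequentially" by (simp add: always_eventually)
qed simp

text \<open>Dominated convergence with the bound of \<open>norm_integrand_le\<close>, in which the order now varies. A variable power of \<open>x\<close> is
dominated by the sum of its two extreme powers.\<close>

lemma bessel_integral_order_zero:
  assumes a: "Re a > 0" and b: "Re b > 0"
  shows "(\<lambda>n. bessel_integral 1 (of_real (small_order n)) a b) \<longlonglongrightarrow> bessel_integral 1 0 a b"
proof -
  obtain Q where Q: "\<And>x. 0 \<le> x \<Longrightarrow> x \<le> 1 \<Longrightarrow> poisson_const (of_real x) \<le> Q" by (rule poisson_const_bounded) blast
  define L where "L = 1 + norm (a / 2)"
  define C where "C = L * Q * K_bound_const (1/8) (1/4) ^ 3 * (1 + Re a powr (- (1/4))) * (1 + Re b powr (- (1/4)))\<^sup>2"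
  have "0 \<le> Q" using Q[of 0] poisson_const_nonneg[of "of_real 0"] by linarith
  hence C: "C \<ge> 0" unfolding C_def L_def
    by (intro mult_nonneg_nonneg add_nonneg_nonneg zero_le_power K_bound_const_nonneg) auto
  \<comment> \<open>The orders are at most \<open>1/8\<close>, so that \<open>\<tau> = 1/4\<close> serves for all of them.\<close>
  define W where "W x = C * (weight 1 (1/4) (2 * Re b) x + weight (9/8) (1/4) (2 * Re b) x)" for x
  have pm: "y powr s \<le> y powr p + y powr q" if "p \<le> s" "s \<le> q" "y > 0" for y s p q :: real
  proof (cases "y \<le> 1")
    case True
    hence "y powr s \<le> y powr p" using that by (intro powr_mono') auto
    thus ?thesis using powr_ge_zero[of y q] by linarith
  next
    case False
    hence "y powr s \<le> y powr q" using that by (intro powr_mono) auto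
    thus ?thesis using powr_ge_zero[of y p] by linarith
  qed
  show ?thesis unfolding bessel_integral_def
  proof (rule integral_dominated_convergence[where w = W])
    show "integrable (lborel_on {0<..}) W" unfolding W_def
      by (intro integrable_mult_right Bochner_Integration.integrable_add integrable_weight) (use b in auto)
    show "integrand 1 0 a b \<in> borel_measurable (lborel_on {0<..})"
      by (rule integrand_measurable[OF a b]) simp
    show "integrand 1 (of_real (small_order n)) a b \<in> borel_measurable (lborel_on {0<..})" for n
      by (rule integrand_measurable[OF a b]) (use small_order(1)[of n] in simp)
    show "AE x in lborel_on {0<..}. (\<lambda>n. integrand 1 (of_real (small_order n)) a b x) \<longlonglongrightarrow> integrand 1 0 a b x"
    proof (rule AE_I2)
      fix x assume "x \<in> space (lborel_on {0<..})"
      hence x: "x > 0" by simp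
      have ax: "Re (a * of_real x) > 0" "a * of_real x \<noteq> 0" and bx: "Re (b * of_real x) > 0" using a b x by auto
      have "(\<lambda>n. integrand 1 (of_real (small_order n)) a b x) \<longlonglongrightarrow> integrand 1 (of_real 0) a b x"
        unfolding integrand_def
        by (intro tendsto_mult tendsto_power tendsto_const tendsto_small_order[OF bessel_I_continuous_order[OF ax(2)]]
            tendsto_small_order[OF bessel_K_continuous_order[OF ax(1)]] tendsto_small_order[OF bessel_K_continuous_order[OF bx]])
      thus "(\<lambda>n. integrand 1 (of_real (small_order n)) a b x) \<longlonglongrightarrow> integrand 1 0 a b x" by simp
    qed
    show "AE x in lborel_on {0<..}. norm (integrand 1 (of_real (small_order n)) a b x) \<le> W x" for n
    proof (rule AE_I2)
      fix x assume "x \<in> space (lborel_on {0<..})"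
      hence x: "x > 0" by simp
      define s where "s = small_order n"
      have s: "0 < s" "s \<le> 1/8" using small_order(1,2)[of n] by (auto simp: s_def)
      have "norm (integrand 1 (of_real s) a b x) \<le> C * weight (real 1 + Re (of_real s)) (1/4) (2 * Re b) x"
        unfolding C_def
      proof (rule norm_integrand_le[OF x])
        have "norm (a / 2) powr s \<le> norm (a / 2) powr 0 + norm (a / 2) powr 1" by (rule pm) (use s a in auto)
        thus "norm (a / 2) powr Re (complex_of_real s) \<le> L" unfolding L_def using a by (auto split: if_splits)
        show "exp (pi * \<bar>Im (complex_of_real s)\<bar>) * poisson_const (of_real s) \<le> Q" using Q[of s] s by simp
      qed (use a b s in auto)
      also have "\<dots> \<le> W x"
      proof -
        have "x powr (1 + s) \<le> x powr 1 + x powr (9/8)" by (rule pm) (use s x in auto)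
        hence "x powr (1 + s) * ((1 + x powr (- (1/4))) ^ 3 * exp (- (2 * Re b) * x)) \<le>
              (x powr 1 + x powr (9/8)) * ((1 + x powr (- (1/4))) ^ 3 * exp (- (2 * Re b) * x))"
          by (rule mult_right_mono) simp
        hence "weight (real 1 + Re (of_real s)) (1/4) (2 * Re b) x \<le> weight 1 (1/4) (2 * Re b) x + weight (9/8) (1/4) (2 * Re b) x"
          unfolding weight_def by (simp only: Re_complex_of_real of_nat_1 distrib_right mult.assoc)
        thus ?thesis unfolding W_def by (rule mult_left_mono[OF _ C])
      qed
      finally show "norm (integrand 1 (of_real (small_order n)) a b x) \<le> W x" by (simp add: s_def)
    qed
  qed
qed

lemma odd_difference_series_continuous:
  assumes w: "norm w < 1"
  shows "continuous_on {0..1} (\<lambda>x. \<Sum>k. odd_difference (of_real x) k * (w\<^sup>2) ^ k)"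
proof (rule uniform_limit_theorem)
  show "uniform_limit {0..1} (\<lambda>n x. \<Sum>k<n. odd_difference (of_real x) k * (w\<^sup>2) ^ k) (\<lambda>x. \<Sum>k. odd_difference (of_real x) k * (w\<^sup>2) ^ k) sequentially"
  proof (rule Weierstrass_m_test)
    have "norm w ^ 2 < 1" using w by (simp add: power_less_one_iff)
    thus "summable (\<lambda>k. (norm w ^ 2) ^ k)" by (intro summable_geometric) simp
    fix k and x :: real assume x: "x \<in> {0..1}"
    have "1 \<le> Re (2 * of_nat k + 1 + 2 * of_real x)" "1 \<le> Re (2 * of_nat k + 1)" using x by auto
    hence "1 \<le> norm (2 * of_nat k + 1 + 2 * complex_of_real x)" "1 \<le> norm (2 * of_nat k + 1 :: complex)"
      using complex_Re_le_cmod order_trans by blast+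
    hence "1 * 1 \<le> norm (2 * of_nat k + 1 :: complex) * norm (2 * of_nat k + 1 + 2 * complex_of_real x)" by (intro mult_mono) auto
    hence "norm (odd_difference (of_real x) k) \<le> 1"
      unfolding odd_difference_def norm_divide norm_mult norm_one by (simp add: divide_le_eq_1)
    hence "norm (odd_difference (of_real x) k) * (norm w ^ 2) ^ k \<le> 1 * (norm w ^ 2) ^ k" by (rule mult_right_mono) simp
    thus "norm (odd_difference (of_real x) k * (w\<^sup>2) ^ k) \<le> (norm w ^ 2) ^ k" by (simp add: norm_mult norm_power)
  qed
next
  have "continuous_on {0..1} (\<lambda>x. 1 / ((2 * of_nat k + 1) * (2 * of_nat k + 1 + 2 * complex_of_real x)) * (w\<^sup>2) ^ k)" for k
    by (intro continuous_intros) (auto dest!: arg_cong[of _ _ Re])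
  thus "eventually (\<lambda>n. continuous_on {0..1} (\<lambda>x. \<Sum>k<n. odd_difference (of_real x) k * (w\<^sup>2) ^ k)) sequentially"
    by (intro always_eventually allI continuous_on_sum) (simp add: odd_difference_def)
qed simp

lemma tendsto_small_order_quotient:
  fixes f :: "complex \<Rightarrow> complex"
  assumes "(f has_field_derivative D) (at 0)" "f 0 = 0"
  shows "(\<lambda>n. f (of_real (small_order n)) / of_real (small_order n)) \<longlonglongrightarrow> D"
proof -
  have "((\<lambda>x. (f x - f 0) / (x - 0)) \<longlongrightarrow> D) (at 0)" using assms(1) unfolding has_field_derivative_iff .
  hence l: "((\<lambda>x. f x / x) \<longlongrightarrow> D) (at 0)" using assms(2) by simp
  have "(\<lambda>n. complex_of_real (small_order n)) \<longlonglongrightarrow> of_real 0" by (intro tendsto_of_real small_order(3))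
  moreover have "complex_of_real (small_order n) \<noteq> 0" for n using small_order(1)[of n] by simp
  ultimately have "filterlim (\<lambda>n. complex_of_real (small_order n)) (at 0) sequentially"
    unfolding filterlim_at by (simp add: always_eventually)
  from filterlim_compose[OF l this] show ?thesis .
qed

text \<open>With \<open>w\<close> fixed in the unit disc and \<open>\<alpha> \<rightarrow> 0\<close>, the factor \<open>\<alpha> / sin (\<pi> \<alpha>)\<close> tends to \<open>1 / \<pi>\<close>
and \<open>(w powr (2 * \<alpha>) - 1) / \<alpha>\<close> to \<open>2 Ln w\<close>.\<close>

lemma first_moment_integral_zero_series:
  assumes a: "Re a > 0" and b: "Re b > 0" and w1: "norm (a / b) < 1"
  shows "bessel_integral 1 0 a b = 1 / (2 * b\<^sup>2) * ((\<Sum>k. odd_difference 0 k * ((a / b)\<^sup>2) ^ k) - Ln (a / b) * (arctanh (a / b) / (a / b)))"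
proof -
  define w where "w = a / b"
  have w: "norm w < 1" "w \<noteq> 0" using a b w1 by (auto simp: w_def)
  have "b \<noteq> 0" using b by auto
  hence ab: "a \<noteq> b" using w1 by auto
  have cut: "w \<notin> complex_of_real ` {1<..}" using w(1) by auto
  define L where "L = arctanh w / w"
  define S where "S x = (\<Sum>k. odd_difference (of_real x) k * (w\<^sup>2) ^ k)" for x :: real
  define B where "B = of_real pi / (4 * b\<^sup>2)"
  have eq: "bessel_integral 1 (of_real x) a b =
      B * (inverse (sin (of_real pi * of_real x) / of_real x) *
        (exp (2 * of_real x * Ln w) * (2 * S x) - (exp (2 * of_real x * Ln w) - 1) / of_real x * L))"
    if x: "0 < x" "x \<le> 1/8" for x
  proof -
    have \<alpha>: "complex_of_real x \<noteq> 0" "- 1/2 < Re (of_real x)" "Re (of_real x) < 1" using x by auto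
    have si: "sin (of_real pi * complex_of_real x) \<noteq> 0"
      by (rule sin_pi_neq_0[OF admissible_notin_Ints[OF admissible_1[OF \<alpha>(2,3)] \<alpha>(1)]])
    have p: "w powr (2 * of_real x) = exp (2 * of_real x * Ln w)" using w(2) by (simp add: powr_def)
    have "bessel_integral 1 (of_real x) a b = of_real pi * (1 / sin (of_real pi * of_real x)) / (4 * b ^ 2) *
              (1 / w * arctanh w - w powr (2 * of_real x) * (hypergeo [1, 1/2 + of_real x] [3/2 + of_real x] (w\<^sup>2) / (1 + 2 * of_real x)))"
      using first_moment_integral[OF a b \<alpha> ab, of 1] cut unfolding w_def[symmetric] side_value_def by (simp add: w_def)
    also have "\<dots> = B * (1 / sin (of_real pi * of_real x)) *
        (exp (2 * of_real x * Ln w) * (2 * of_real x * S x) + (1 - exp (2 * of_real x * Ln w)) * L)"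
      unfolding first_moment_bracket(1)[OF \<alpha>(2) w] unfolding p S_def L_def B_def by simp
    also have "\<dots> = B * (inverse (sin (of_real pi * of_real x) / of_real x) *
        (exp (2 * of_real x * Ln w) * (2 * S x) - (exp (2 * of_real x * Ln w) - 1) / of_real x * L))"
    proof -
      have "B * (1 / s) * (E * (2 * y * T) + (1 - E) * L) = B * (inverse (s / y) * (E * (2 * T) - (E - 1) / y * L))"
        if "s \<noteq> 0" "y \<noteq> 0" for s y E T using that by (simp add: field_simps)
      from this[OF si \<alpha>(1)] show ?thesis .
    qed
    finally show ?thesis .
  qed
  have d1: "((\<lambda>x. sin (of_real pi * x)) has_field_derivative of_real pi) (at (0 :: complex))"
    by (auto intro!: derivative_eq_intros)
  have d2: "((\<lambda>x. exp (2 * x * Ln w) - 1) has_field_derivative 2 * Ln w) (at (0 :: complex))"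
    by (auto intro!: derivative_eq_intros)
  have l1: "(\<lambda>n. inverse (sin (of_real pi * of_real (small_order n)) / of_real (small_order n))) \<longlonglongrightarrow> inverse (complex_of_real pi)"
    by (rule tendsto_inverse[OF tendsto_small_order_quotient[OF d1]]) auto
  have l2: "(\<lambda>n. (exp (2 * of_real (small_order n) * Ln w) - 1) / of_real (small_order n)) \<longlonglongrightarrow> 2 * Ln w"
    by (rule tendsto_small_order_quotient[OF d2]) simp
  have l3: "(\<lambda>n. S (small_order n)) \<longlonglongrightarrow> S 0"
    unfolding S_def by (rule tendsto_small_order[OF odd_difference_series_continuous[OF w(1)]])
  have "continuous_on {0..1} (\<lambda>x. exp (2 * complex_of_real x * Ln w))" by (intro continuous_intros)
  from tendsto_small_order[OF this] have l4: "(\<lambda>n. exp (2 * complex_of_real (small_order n) * Ln w)) \<longlonglongrightarrow> 1" by simp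
  have "(\<lambda>n. bessel_integral 1 (of_real (small_order n)) a b) \<longlonglongrightarrow> B * (inverse (of_real pi) * (1 * (2 * S 0) - 2 * Ln w * L))"
    unfolding eq[OF small_order(1,2)] by (intro tendsto_mult tendsto_diff tendsto_const l1 l2 l3 l4)
  from LIMSEQ_unique[OF bessel_integral_order_zero[OF a b] this]
  have "bessel_integral 1 0 a b = B * (inverse (of_real pi) * (1 * (2 * S 0) - 2 * Ln w * L))" .
  also have "\<dots> = 1 / (2 * b\<^sup>2) * (S 0 - Ln w * L)"
  proof -
    have "P / (4 * b\<^sup>2) * (inverse P * (1 * (2 * s) - 2 * l * L)) = 1 / (2 * b\<^sup>2) * (s - l * L)" if "P \<noteq> 0" for P s l
    proof -
      have "P / (4 * b\<^sup>2) * (inverse P * (1 * (2 * s) - 2 * l * L)) = (P * inverse P) * (2 / (4 * b\<^sup>2)) * (s - l * L)"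
        by (simp add: algebra_simps diff_divide_distrib)
      also have "\<dots> = 1 / (2 * b\<^sup>2) * (s - l * L)" using that by simp
      finally show ?thesis .
    qed
    from this[of "of_real pi" "S 0" "Ln w"] show ?thesis unfolding B_def by simp
  qed
  finally show ?thesis by (simp add: S_def L_def w_def)
qed

lemma closed_segment_slit:
  assumes "c > 0" "w \<notin> \<real>\<^sub>\<le>\<^sub>0"
  shows "closed_segment (complex_of_real c) w \<subseteq> - \<real>\<^sub>\<le>\<^sub>0"
proof
  fix y assume "y \<in> closed_segment (complex_of_real c) w"
  then obtain u where u: "0 \<le> u" "u \<le> 1" "y = (1 - u) *\<^sub>R complex_of_real c + u *\<^sub>R w" by (auto simp: in_segment)
  have im: "Im y = u * Im w" and re: "Re y = (1 - u) * c + u * Re w" by (simp_all add: u(3))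
  show "y \<in> - \<real>\<^sub>\<le>\<^sub>0"
  proof (cases "Im w = 0 \<or> u = 0")
    case True
    have "Re y > 0"
    proof (cases "u = 0")
      case False
      hence "Re w > 0" using True assms(2) by (auto simp: complex_nonpos_Reals_iff)
      hence "u * Re w > 0" using u False by simp
      moreover have "(1 - u) * c \<ge> 0" using u assms(1) by simp
      ultimately show ?thesis unfolding re by linarith
    qed (use assms(1) re in simp)
    thus ?thesis by (simp add: complex_nonpos_Reals_iff)
  next
    case False
    thus ?thesis using im by (simp add: complex_nonpos_Reals_iff)
  qed
qed

text \<open>The derivative, with respect to \<open>w = a / b\<close>, of \<open>4 a b\<close> times the first moment of order 0. The value at 1 removes the
singularity: the zeros of \<open>Ln w\<close> and \<open>w\<^sup>2 - 1\<close> cancel.\<close>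

definition log_quotient :: "complex \<Rightarrow> complex" where
  "log_quotient w = (if w = 1 then 1 else 2 * Ln w / (w\<^sup>2 - 1))"

lemma power2_neq_1:
  fixes w :: complex
  assumes "w \<notin> \<real>\<^sub>\<le>\<^sub>0" "w \<noteq> 1"
  shows "w\<^sup>2 - 1 \<noteq> 0"
proof
  assume "w\<^sup>2 - 1 = 0"
  hence "w = 1 \<or> w = - 1" by (simp add: power2_eq_1_iff)
  thus False using assms by (auto simp: complex_nonpos_Reals_iff)
qed

lemma Ln_quotient_tendsto_1: "((\<lambda>w::complex. Ln w / (w - 1)) \<longlongrightarrow> 1) (at 1)"
proof -
  have "(Ln has_field_derivative inverse 1) (at (1 :: complex))" by (rule has_field_derivative_Ln) (simp add: complex_nonpos_Reals_iff)
  hence "((\<lambda>w. (Ln w - Ln 1) / (w - 1)) \<longlongrightarrow> inverse 1) (at (1 :: complex))" unfolding has_field_derivative_iff .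
  thus ?thesis by simp
qed

text \<open>The plane without the negative axis is starlike about 1, and continuity at the exceptional point 1 is enough for a primitive to exist.
The normalisation at 1 is the limit computed in \<open>disc_primitive_tendsto_1\<close>.\<close>

lemma log_quotient_primitive:
  obtains F where "\<And>w. w \<notin> \<real>\<^sub>\<le>\<^sub>0 \<Longrightarrow> (F has_field_derivative log_quotient w) (at w)" "F 1 = of_real (pi\<^sup>2 / 4)"
proof -
  have op: "open (- \<real>\<^sub>\<le>\<^sub>0 :: complex set)" by (simp add: open_Compl)
  have fd: "log_quotient field_differentiable at w" if w: "w \<in> - \<real>\<^sub>\<le>\<^sub>0 - {1}" for w
  proof -
    have o: "open (- \<real>\<^sub>\<le>\<^sub>0 - {1} :: complex set)" using op by (intro open_Diff) auto
    have "(\<lambda>w. 2 * Ln w / (w\<^sup>2 - 1)) holomorphic_on (- \<real>\<^sub>\<le>\<^sub>0 - {1})"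
      by (intro holomorphic_intros) (auto dest: power2_neq_1)
    hence "log_quotient holomorphic_on (- \<real>\<^sub>\<le>\<^sub>0 - {1})"
      by (rule holomorphic_transform) (auto simp: log_quotient_def)
    thus ?thesis using o w by (simp add: holomorphic_on_imp_differentiable_at)
  qed
  \<comment> \<open>Split off \<open>Ln w / (w - 1)\<close>, a difference quotient of \<open>Ln\<close> at 1.\<close>
  have "isCont log_quotient 1"
  proof -
    have "((\<lambda>w::complex. Ln w / (w - 1) * (2 / (w + 1))) \<longlongrightarrow> 1 * (2 / (1 + 1))) (at 1)"
      by (intro tendsto_mult Ln_quotient_tendsto_1 tendsto_intros) simp
    moreover have "eventually (\<lambda>w. Ln w / (w - 1) * (2 / (w + 1)) = log_quotient w) (at (1 :: complex))"
      unfolding eventually_at_filter by (rule always_eventually) (auto simp: log_quotient_def power2_eq_square algebra_simps)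
    ultimately have "(log_quotient \<longlongrightarrow> 1 * (2 / (1 + 1))) (at 1)" by (rule Lim_transform_eventually)
    thus ?thesis by (simp add: isCont_def log_quotient_def)
  qed
  hence "isCont log_quotient w" if "w \<in> - \<real>\<^sub>\<le>\<^sub>0" for w
    using fd[of w] that by (cases "w = 1") (auto intro: field_differentiable_imp_continuous_at)
  hence cont: "continuous_on (- \<real>\<^sub>\<le>\<^sub>0) log_quotient" by (intro continuous_at_imp_continuous_on ballI)
  have "closed_segment 1 w \<subseteq> - \<real>\<^sub>\<le>\<^sub>0" if "w \<notin> \<real>\<^sub>\<le>\<^sub>0" for w :: complex using closed_segment_slit[of 1 w] that by simp
  hence star: "starlike (- \<real>\<^sub>\<le>\<^sub>0 :: complex set)" unfolding starlike_def
    by (intro bexI[of _ 1] ballI) (auto simp: complex_nonpos_Reals_iff)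
  obtain G where G: "\<forall>w\<in>- \<real>\<^sub>\<le>\<^sub>0. (G has_field_derivative log_quotient w) (at w)"
    using holomorphic_starlike_primitive[OF cont star op finite.insertI[OF finite.emptyI, of 1] fd] by blast
  show thesis
  proof (rule that[of "\<lambda>w. G w - G 1 + of_real (pi\<^sup>2 / 4)"])
    fix w :: complex assume "w \<notin> \<real>\<^sub>\<le>\<^sub>0"
    hence "(G has_field_derivative log_quotient w) (at w)" using G by simp
    thus "((\<lambda>w. G w - G 1 + of_real (pi\<^sup>2 / 4)) has_field_derivative log_quotient w) (at w)"
      by (auto intro!: derivative_eq_intros)
  qed simp
qed

text \<open>The form \<open>log_quotient w dw\<close> changes sign under \<open>w \<mapsto> 1 / w\<close>, so the sum has derivative 0; the constant is
found at the fixed point 1.\<close>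

lemma primitive_inversion:
  assumes F: "\<And>w. w \<notin> \<real>\<^sub>\<le>\<^sub>0 \<Longrightarrow> (F has_field_derivative log_quotient w) (at w)" and w: "w \<notin> \<real>\<^sub>\<le>\<^sub>0"
  shows "F w + F (inverse w) = 2 * F 1"
proof -
  have inv: "inverse z \<notin> \<real>\<^sub>\<le>\<^sub>0" if "z \<notin> \<real>\<^sub>\<le>\<^sub>0" for z :: complex
    using that nonpos_Reals_inverse_I[of "inverse z"] by auto
  have d: "((\<lambda>w. F w + F (inverse w)) has_field_derivative 0) (at z)" if z: "z \<notin> \<real>\<^sub>\<le>\<^sub>0" for z
  proof -
    have z0: "z \<noteq> 0" using z by auto
    have "((\<lambda>w. F (inverse w)) has_field_derivative log_quotient (inverse z) * - (inverse z ^ Suc (Suc 0))) (at z)"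
      by (rule DERIV_chain2[OF F[OF inv[OF z]] DERIV_inverse[OF z0]])
    from DERIV_add[OF F[OF z] this]
    have D: "((\<lambda>w. F w + F (inverse w)) has_field_derivative log_quotient z + log_quotient (inverse z) * - (inverse z ^ Suc (Suc 0))) (at z)" .
    have "log_quotient z + log_quotient (inverse z) * - (inverse z ^ Suc (Suc 0)) = 0"
    proof (cases "z = 1")
      case False
      have n: "z\<^sup>2 - 1 \<noteq> 0" by (rule power2_neq_1[OF z False])
      have i1: "inverse z \<noteq> 1" using False by (metis inverse_1 inverse_inverse_eq)
      have L: "Ln (inverse z) = - Ln z" by (rule Ln_inverse[OF z])
      have "((inverse z)\<^sup>2 - 1) * z\<^sup>2 = - (z\<^sup>2 - 1)" using z0 by (simp add: left_diff_distrib power_inverse)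
      have "(2 * - l / q) * - (inverse z ^ Suc (Suc 0)) = 2 * l / (q * z\<^sup>2)" for l q
        using z0 by (simp add: field_simps power2_eq_square)
      moreover have "log_quotient (inverse z) = 2 * - Ln z / ((inverse z)\<^sup>2 - 1)"
        unfolding log_quotient_def L using i1 by (simp only: if_False)
      ultimately have "log_quotient (inverse z) * - (inverse z ^ Suc (Suc 0)) = 2 * Ln z / (((inverse z)\<^sup>2 - 1) * z\<^sup>2)"
        by (simp only:)
      also have "\<dots> = - log_quotient z" unfolding \<open>((inverse z)\<^sup>2 - 1) * z\<^sup>2 = - (z\<^sup>2 - 1)\<close> using False
        by (simp only: log_quotient_def if_False divide_minus_right)
      finally show ?thesis by simp
    qed (simp add: log_quotient_def)
    thus ?thesis using D by simp
  qed
  have conn: "connected (- \<real>\<^sub>\<le>\<^sub>0 :: complex set)"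
  proof (rule starlike_imp_connected)
    have "closed_segment 1 w \<subseteq> - \<real>\<^sub>\<le>\<^sub>0" if "w \<notin> \<real>\<^sub>\<le>\<^sub>0" for w :: complex using closed_segment_slit[of 1 w] that by simp
    thus "starlike (- \<real>\<^sub>\<le>\<^sub>0 :: complex set)" unfolding starlike_def
      by (intro bexI[of _ 1] ballI) (auto simp: complex_nonpos_Reals_iff)
  qed
  have op: "open (- \<real>\<^sub>\<le>\<^sub>0 :: complex set)" by (simp add: open_Compl)
  have cont: "continuous_on (- \<real>\<^sub>\<le>\<^sub>0) (\<lambda>w. F w + F (inverse w))"
    by (intro continuous_at_imp_continuous_on ballI DERIV_isCont[OF d]) simp
  have zero: "\<forall>z\<in>- \<real>\<^sub>\<le>\<^sub>0 - {}. ((\<lambda>w. F w + F (inverse w)) has_field_derivative 0) (at z)" using d by simp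
  obtain c where c: "\<And>z. z \<in> - \<real>\<^sub>\<le>\<^sub>0 \<Longrightarrow> F z + F (inverse z) = c"
    by (rule DERIV_zero_connected_constant[OF conn op finite.emptyI cont zero]) blast
  show ?thesis using c[of w] c[of 1] w by (simp add: complex_nonpos_Reals_iff)
qed

text \<open>The coefficients of the dilogarithm. The convention \<open>1 / 0 = 0\<close> gives the vanishing constant term.\<close>

definition inverse_square :: "nat \<Rightarrow> complex" where
  "inverse_square n = 1 / of_nat n ^ 2"

lemma summable_inverse_square: "summable (\<lambda>n. norm (inverse_square n))"
proof -
  have "norm (inverse_square n) = inverse (real n ^ 2)" for n
    by (simp add: inverse_square_def norm_divide norm_power inverse_eq_divide)
  thus ?thesis using inverse_power_summable[of 2, where ?'a = real] by simp
qed

lemma dilog_sums: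
  assumes "norm z \<le> 1"
  shows "(\<lambda>n. inverse_square n * z ^ n) sums dilog z"
proof -
  have s: "summable (\<lambda>n. inverse_square n * z ^ n)"
  proof (rule summable_comparison_test'[OF summable_inverse_square, of 0])
    fix n
    have "norm (inverse_square n) * norm z ^ n \<le> norm (inverse_square n) * 1"
      using assms by (intro mult_left_mono power_le_one) auto
    thus "norm (inverse_square n * z ^ n) \<le> norm (inverse_square n)" by (simp add: norm_mult norm_power)
  qed
  have "(\<lambda>n. inverse_square (Suc n) * z ^ Suc n) sums ((\<Sum>n. inverse_square n * z ^ n) - inverse_square 0 * z ^ 0)"
    by (rule sums_Suc_iff[of "\<lambda>n. inverse_square n * z ^ n", THEN iffD2]) (use summable_sums[OF s] in simp)
  hence "(\<lambda>n. z ^ Suc n / of_nat (Suc n) ^ 2) sums (\<Sum>n. inverse_square n * z ^ n)" by (simp add: inverse_square_def)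
  hence "dilog z = (\<Sum>n. inverse_square n * z ^ n)" unfolding dilog_def by (rule sums_unique[symmetric])
  thus ?thesis using summable_sums[OF s] by simp
qed

lemma dilog_eq: "norm z \<le> 1 \<Longrightarrow> dilog z = (\<Sum>n. inverse_square n * z ^ n)"
  using dilog_sums by (rule sums_unique)

lemma continuous_on_dilog: "continuous_on (cball 0 1) dilog"
proof -
  have "continuous_on (cball 0 1) (\<lambda>z. \<Sum>n. inverse_square n * z ^ n)"
    by (rule continuous_on_power_series[OF summable_inverse_square])
  thus ?thesis by (rule continuous_on_eq) (simp add: dilog_eq)
qed

text \<open>The derivative is specified through its product with \<open>z\<close>, to include \<open>z = 0\<close>.\<close>

lemma DERIV_dilog:
  assumes z: "norm z < 1"
  obtains D where "(dilog has_field_derivative D) (at z)" "z * D = - Ln (1 - z)"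
proof -
  define D where "D = (\<Sum>n. diffs inverse_square n * z ^ n)"
  have d: "((\<lambda>z. \<Sum>n. inverse_square n * z ^ n) has_field_derivative D) (at z)"
    unfolding D_def by (rule termdiffs_strong[of _ 1]) (use z summable_norm_cancel[OF summable_inverse_square] in auto)
  have "(dilog has_field_derivative D) (at z)"
    by (rule DERIV_cong_ev[THEN iffD1, OF refl _ refl d])
       (use z in \<open>auto intro!: eventually_nhds_in_open[THEN eventually_mono, of "ball 0 1"] simp: dilog_eq\<close>)
  moreover have "z * D = - Ln (1 - z)"
  proof -
    have "(\<lambda>n. - (z ^ n) / of_nat n) sums Ln (1 - z)" using Ln_series'[of "- z"] z by simp
    hence "(\<lambda>n. z ^ n / of_nat n) sums - Ln (1 - z)" using sums_minus by fastforce
    hence 1: "(\<lambda>n. z ^ Suc n / of_nat (Suc n)) sums - Ln (1 - z)"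
      using sums_Suc_iff[of "\<lambda>n. z ^ n / of_nat n" "- Ln (1 - z)"] by simp
    have e: "diffs inverse_square n * z ^ n = z ^ n / of_nat (Suc n)" for n
    proof -
      have "(of_nat (Suc n) :: complex) \<noteq> 0" by (rule of_nat_neq_0)
      thus ?thesis unfolding diffs_def inverse_square_def by (simp only: power2_eq_square) simp
    qed
    show ?thesis
    proof (cases "z = 0")
      case False
      have "z ^ Suc n / of_nat (Suc n) / z = z ^ n / of_nat (Suc n)" for n using False by simp
      hence "(\<lambda>n. z ^ n / of_nat (Suc n)) sums (- Ln (1 - z) / z)" using sums_divide[OF 1, of z] by (simp only:)
      hence "D = - Ln (1 - z) / z" unfolding D_def e by (rule sums_unique[symmetric])
      thus ?thesis using False by simp
    qed simp
  qed
  ultimately show ?thesis by (rule that)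
qed

text \<open>A primitive of \<open>log_quotient\<close> on the unit disc, and continuous up to its boundary away from 1 and the negative axis.\<close>

definition disc_primitive :: "complex \<Rightarrow> complex" where
  "disc_primitive w = dilog w - dilog (- w) - 2 * Ln w * arctanh w"

text \<open>The terms with even index in the series of \<open>dilog 1\<close> sum to a quarter of it.\<close>

lemma dilog_difference_1: "dilog 1 - dilog (- 1) = of_real (pi\<^sup>2 / 4)"
proof -
  have "(\<lambda>n. complex_of_real (1 / real ((n + 1)\<^sup>2))) sums of_real (pi\<^sup>2 / 6)"
    by (rule sums_of_real[OF inverse_squares_sums])
  moreover have "complex_of_real (1 / real ((n + 1)\<^sup>2)) = inverse_square (Suc n)" for n by (simp add: inverse_square_def add.commute)
  ultimately have s: "(\<lambda>n. inverse_square (Suc n)) sums of_real (pi\<^sup>2 / 6)" by (simp only:)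
  have s0: "inverse_square sums of_real (pi\<^sup>2 / 6)"
    using s sums_Suc_iff[of inverse_square] by (simp add: inverse_square_def)
  hence d1: "dilog 1 = of_real (pi\<^sup>2 / 6)" using dilog_sums[of 1] by (simp add: sums_iff)
  have sm: "(\<lambda>n. inverse_square n * 1 ^ n + inverse_square n * (- 1) ^ n) sums (dilog 1 + dilog (- 1))"
    by (intro sums_add dilog_sums) auto
  have "(\<lambda>n. (1/2) * inverse_square n) sums ((1/2) * of_real (pi\<^sup>2 / 6))" by (rule sums_mult[OF s0])
  moreover have "(1/2) * inverse_square n = inverse_square (2 * n) * 1 ^ (2 * n) + inverse_square (2 * n) * (- 1) ^ (2 * n)" for n
    by (cases "n = 0") (simp_all add: inverse_square_def power_mult_distrib field_simps)
  ultimately have "(\<lambda>n. inverse_square (2 * n) * 1 ^ (2 * n) + inverse_square (2 * n) * (- 1) ^ (2 * n)) sums ((1/2) * of_real (pi\<^sup>2 / 6))"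
    by (simp only:)
  moreover have "inverse_square n * 1 ^ n + inverse_square n * (- 1) ^ n = 0" if "n \<notin> range (\<lambda>k. 2 * k)" for n
  proof -
    have "odd n"
    proof
      assume "even n"
      then obtain k where "n = 2 * k" by (rule evenE)
      thus False using that by blast
    qed
    thus ?thesis by simp
  qed
  ultimately have "(\<lambda>n. inverse_square n * 1 ^ n + inverse_square n * (- 1) ^ n) sums ((1/2) * of_real (pi\<^sup>2 / 6))"
    using sums_mono_reindex[of "\<lambda>k. 2 * k" "\<lambda>n. inverse_square n * 1 ^ n + inverse_square n * (- 1) ^ n"] by (simp add: strict_mono_def)
  from sums_unique2[OF sm this] have "dilog 1 + dilog (- 1) = (1/2) * of_real (pi\<^sup>2 / 6)" .
  hence "dilog (- 1) = (1/2) * of_real (pi\<^sup>2 / 6) - dilog 1" by (simp add: algebra_simps)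
  thus ?thesis unfolding d1 by simp
qed

lemma disc_primitive_tendsto_1: "(disc_primitive \<longlongrightarrow> of_real (pi\<^sup>2 / 4)) (at 1 within ball 0 1)"
proof -
  have c: "(dilog \<longlongrightarrow> dilog z) (at z within cball 0 1)" if "norm z = 1" for z
    using continuous_on_dilog that unfolding continuous_on_def by auto
  have d1: "(dilog \<longlongrightarrow> dilog 1) (at 1 within ball 0 1)"
    by (rule tendsto_within_subset[OF c ball_subset_cball]) simp
  have "continuous_on (cball 0 1) (\<lambda>w. dilog (- w))"
    by (rule continuous_on_compose2[OF continuous_on_dilog]) (auto intro!: continuous_intros)
  hence "((\<lambda>w. dilog (- w)) \<longlongrightarrow> dilog (- 1)) (at 1 within cball 0 1)" unfolding continuous_on_def by simp
  hence d2: "((\<lambda>w. dilog (- w)) \<longlongrightarrow> dilog (- 1)) (at 1 within ball 0 1)" by (rule tendsto_within_subset[OF _ ball_subset_cball])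
  have q: "((\<lambda>w::complex. Ln w / (w - 1)) \<longlongrightarrow> 1) (at 1 within ball 0 1)" by (rule tendsto_within_subset[OF Ln_quotient_tendsto_1]) simp
  have l: "((\<lambda>w. dilog w - dilog (- w) + 2 * (Ln w / (w - 1)) * ((1 - w) * arctanh w)) \<longlongrightarrow> dilog 1 - dilog (- 1) + 2 * 1 * 0) (at 1 within ball 0 1)"
    by (intro tendsto_add tendsto_diff tendsto_mult tendsto_const d1 d2 q arctanh_times_tendsto_0)
  have "eventually (\<lambda>w. dilog w - dilog (- w) + 2 * (Ln w / (w - 1)) * ((1 - w) * arctanh w) = disc_primitive w) (at 1 within ball 0 1)"
    using unit_ball_filter(3)
  proof eventually_elim
    case (elim w)
    hence "w - 1 \<noteq> 0" by simp
    hence "2 * (X / (w - 1)) * ((1 - w) * Y) = - (2 * X * Y)" for X Y by (simp add: field_simps)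
    thus ?case by (simp add: disc_primitive_def)
  qed
  from Lim_transform_eventually[OF l this] show ?thesis unfolding dilog_difference_1 by simp
qed

lemma DERIV_disc_primitive:
  assumes w: "norm w < 1" "w \<notin> \<real>\<^sub>\<le>\<^sub>0"
  shows "(disc_primitive has_field_derivative log_quotient w) (at w)"
proof -
  obtain D1 where D1: "(dilog has_field_derivative D1) (at w)" "w * D1 = - Ln (1 - w)" by (rule DERIV_dilog[OF w(1)])
  obtain D2 where D2: "(dilog has_field_derivative D2) (at (- w))" "- w * D2 = - Ln (1 - - w)"
    by (rule DERIV_dilog[of "- w"]) (use w(1) in auto)
  have w0: "w \<noteq> 0" "w \<noteq> 1" "w \<noteq> - 1" using w by auto
  have p: "1 + w \<notin> \<real>\<^sub>\<le>\<^sub>0" "1 - w \<notin> \<real>\<^sub>\<le>\<^sub>0"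
    using w(1) abs_Re_le_cmod[of w] by (auto simp: complex_nonpos_Reals_iff)
  have p0: "1 + w \<noteq> 0" "1 - w \<noteq> 0" using p by auto
  have A: "(arctanh has_field_derivative (inverse (1 + w) + inverse (1 - w)) / 2) (at w)"
    unfolding arctanh_def[abs_def] using p by (auto intro!: derivative_eq_intros simp: inverse_eq_divide)
  have L: "((\<lambda>w. 2 * Ln w) has_field_derivative 2 * inverse w) (at w)"
    by (rule DERIV_cmult[OF has_field_derivative_Ln[OF w(2)]])
  have N: "((\<lambda>w. dilog (- w)) has_field_derivative D2 * - 1) (at w)"
    by (rule DERIV_chain2[where f = dilog and g = "\<lambda>x. - x" and x = w, OF D2(1)]) (auto intro!: derivative_eq_intros)
  have "((\<lambda>w. dilog w - dilog (- w) - 2 * Ln w * arctanh w) has_field_derivative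
      D1 - D2 * - 1 - (2 * inverse w * arctanh w + (inverse (1 + w) + inverse (1 - w)) / 2 * (2 * Ln w))) (at w)"
    by (rule DERIV_diff[OF DERIV_diff[OF D1(1) N] DERIV_mult[OF L A]])
  moreover have "D1 - D2 * - 1 - (2 * inverse w * arctanh w + (inverse (1 + w) + inverse (1 - w)) / 2 * (2 * Ln w)) = log_quotient w"
  proof -
    have "w * (D1 + D2) = 2 * arctanh w" using D1(2) D2(2) by (simp add: arctanh_def algebra_simps)
    hence X: "D1 + D2 = 2 * inverse w * arctanh w" using w0 by (simp add: field_simps)
    have Y: "(inverse (1 + w) + inverse (1 - w)) / 2 = - (1 / (w\<^sup>2 - 1))"
    proof -
      have f: "w\<^sup>2 - 1 = - ((1 + w) * (1 - w))" by (simp add: power2_eq_square algebra_simps)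
      have "(inverse p + inverse q) / 2 = 1 / (p * q)" if "p \<noteq> 0" "q \<noteq> 0" "p + q = 2" for p q :: complex
      proof -
        have e: "inverse p + inverse q = (p + q) / (p * q)" using that(1,2) by (simp add: field_simps)
        show ?thesis unfolding e that(3) by simp
      qed
      moreover have "(1 + w) + (1 - w) = 2" by simp
      ultimately have "(inverse (1 + w) + inverse (1 - w)) / 2 = 1 / ((1 + w) * (1 - w))" using p0 by blast
      thus ?thesis unfolding f by (simp only: divide_minus_right minus_minus)
    qed
    have "D1 - D2 * - 1 - (x + y * l) = (D1 + D2) - x - y * l" for x y l by (simp add: algebra_simps)
    moreover have "x - x - - (1 / q) * l = l / q" for x q l :: complex by simp
    ultimately show ?thesis using w0(2) by (simp only: X Y log_quotient_def if_False)
  qed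
  ultimately show ?thesis unfolding disc_primitive_def[abs_def] by simp
qed

text \<open>Two primitives on a connected set differ by a constant, which is determined in the limit \<open>w \<rightarrow> 1\<close>. Points of the unit circle
are reached by continuity from inside.\<close>

lemma primitive_eq_disc_primitive:
  assumes F: "\<And>w. w \<notin> \<real>\<^sub>\<le>\<^sub>0 \<Longrightarrow> (F has_field_derivative log_quotient w) (at w)" "F 1 = of_real (pi\<^sup>2 / 4)"
    and w: "norm w \<le> 1" "w \<notin> \<real>\<^sub>\<le>\<^sub>0" "w \<noteq> 1"
  shows "F w = disc_primitive w"
proof -
  define S where "S = ball 0 1 - (\<real>\<^sub>\<le>\<^sub>0 :: complex set)"
  have S: "open S" unfolding S_def by (intro open_Diff) auto
  have h: "(1/2 :: complex) = complex_of_real (1/2)" by simp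
  have "starlike S" unfolding starlike_def
  proof (intro bexI[of _ "1/2"] ballI)
    show half: "(1/2 :: complex) \<in> S" by (simp add: S_def complex_nonpos_Reals_iff)
    fix z assume z: "z \<in> S"
    have "closed_segment (1/2) z \<subseteq> ball 0 1" using z half by (intro closed_segment_subset) (auto simp: S_def)
    moreover have "closed_segment (1/2) z \<subseteq> - \<real>\<^sub>\<le>\<^sub>0" unfolding h using z by (intro closed_segment_slit) (auto simp: S_def)
    ultimately show "closed_segment (1/2) z \<subseteq> S" by (auto simp: S_def)
  qed
  hence conn: "connected S" by (rule starlike_imp_connected)
  have d: "((\<lambda>w. F w - disc_primitive w) has_field_derivative 0) (at z)" if "z \<in> S" for z
  proof -
    have "norm z < 1" "z \<notin> \<real>\<^sub>\<le>\<^sub>0" using that by (auto simp: S_def)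
    from DERIV_diff[OF F(1)[OF this(2)] DERIV_disc_primitive[OF this]] show ?thesis by simp
  qed
  have cont: "continuous_on S (\<lambda>w. F w - disc_primitive w)"
    by (intro continuous_at_imp_continuous_on ballI DERIV_isCont[OF d])
  obtain c where c: "\<And>z. z \<in> S \<Longrightarrow> F z - disc_primitive z = c"
    using DERIV_zero_connected_constant[OF conn S finite.emptyI cont] d by auto
  have FC: "(F \<longlongrightarrow> F z) (at z within ball 0 1)" if "z \<notin> \<real>\<^sub>\<le>\<^sub>0" for z
    by (rule tendsto_within_subset[OF isContD[OF DERIV_isCont[OF F(1)[OF that]]]]) simp
  have "((\<lambda>w. F w - disc_primitive w) \<longlongrightarrow> F 1 - of_real (pi\<^sup>2 / 4)) (at 1 within ball 0 1)"
    by (intro tendsto_diff FC disc_primitive_tendsto_1) (simp add: complex_nonpos_Reals_iff)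
  moreover have "eventually (\<lambda>w. F w - disc_primitive w = c) (at 1 within ball 0 1)"
    using unit_ball_filter(2,3) by eventually_elim (intro c, auto simp: S_def ratio_domain_def)
  ultimately have "((\<lambda>_. c) \<longlongrightarrow> F 1 - of_real (pi\<^sup>2 / 4)) (at (1::complex) within ball 0 1)" by (rule Lim_transform_eventually)
  hence "c = F 1 - of_real (pi\<^sup>2 / 4)" using unit_ball_filter(1) by (simp add: tendsto_const_iff)
  hence c0: "c = 0" using F(2) by simp
  show ?thesis
  proof (cases "norm w < 1")
    case True
    hence "w \<in> S" using w by (simp add: S_def)
    thus ?thesis using c[of w] c0 by simp
  next
    case False
    hence n1: "norm w = 1" using w(1) by simp
    \<comment> \<open>On the unit circle the two real points have been excluded, so \<open>w\<close> stays away from all cuts.\<close>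
    have im: "Im w \<noteq> 0"
    proof
      assume i: "Im w = 0"
      hence "w = of_real (Re w)" by (simp add: complex_eq_iff)
      hence "\<bar>Re w\<bar> = 1" using n1 by (metis norm_of_real)
      thus False using w(2,3) i by (auto simp: complex_nonpos_Reals_iff complex_eq_iff abs_if split: if_splits)
    qed
    have nb: "at w within ball 0 1 \<noteq> bot"
    proof -
      have "w islimpt ball 0 1" using n1 by (simp add: islimpt_ball)
      thus ?thesis by (simp add: trivial_limit_within)
    qed
    have "continuous_on (cball 0 1) (\<lambda>w. dilog (- w))"
      by (rule continuous_on_compose2[OF continuous_on_dilog]) (auto intro!: continuous_intros)
    hence d2: "((\<lambda>w. dilog (- w)) \<longlongrightarrow> dilog (- w)) (at w within cball 0 1)" using n1 unfolding continuous_on_def by simp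
    have d1: "(dilog \<longlongrightarrow> dilog w) (at w within cball 0 1)" using continuous_on_dilog n1 unfolding continuous_on_def by simp
    have at: "((\<lambda>w. 2 * Ln w * arctanh w) \<longlongrightarrow> 2 * Ln w * arctanh w) (at w within ball 0 1)"
      unfolding arctanh_def using im by (intro tendsto_intros) (auto simp: complex_nonpos_Reals_iff)
    have D: "(disc_primitive \<longlongrightarrow> disc_primitive w) (at w within ball 0 1)" unfolding disc_primitive_def[abs_def]
      by (intro tendsto_diff at tendsto_within_subset[OF d1 ball_subset_cball] tendsto_within_subset[OF d2 ball_subset_cball])
    have "((\<lambda>z. Im z) \<longlongrightarrow> Im w) (at w within ball 0 1)" by (intro tendsto_intros)
    hence "eventually (\<lambda>z. Im z \<noteq> 0) (at w within ball 0 1)" using im by (rule tendsto_imp_eventually_ne)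
    moreover have "eventually (\<lambda>z. norm z < 1) (at w within ball 0 1)"
      unfolding eventually_at_filter by (rule always_eventually) auto
    ultimately have "eventually (\<lambda>z. disc_primitive z = F z) (at w within ball 0 1)"
    proof eventually_elim
      case (elim z)
      hence "z \<in> S" by (simp add: S_def complex_nonpos_Reals_iff)
      thus ?case using c[of z] c0 by simp
    qed
    from Lim_transform_eventually[OF D this] have "(F \<longlongrightarrow> disc_primitive w) (at w within ball 0 1)" .
    thus ?thesis using FC[OF w(2)] nb by (intro tendsto_unique)
  qed
qed

section \<open>The evaluations\<close>

lemma dilog_odd_part:
  assumes w: "norm w \<le> 1"
  shows "(\<lambda>k. 2 * w * (odd_difference 0 k * (w\<^sup>2) ^ k)) sums (dilog w - dilog (- w))"
proof -
  have "(\<lambda>n. inverse_square n * w ^ n - inverse_square n * (- w) ^ n) sums (dilog w - dilog (- w))"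
    by (intro sums_diff dilog_sums) (use w in auto)
  moreover have "inverse_square n * w ^ n - inverse_square n * (- w) ^ n = 0" if "n \<notin> range (\<lambda>k. 2 * k + 1)" for n
  proof -
    have "even n"
    proof (rule ccontr)
      assume "odd n"
      then obtain k where "n = 2 * k + 1" by (rule oddE)
      thus False using that by blast
    qed
    thus ?thesis by simp
  qed
  ultimately have "(\<lambda>k. inverse_square (2 * k + 1) * w ^ (2 * k + 1) - inverse_square (2 * k + 1) * (- w) ^ (2 * k + 1)) sums (dilog w - dilog (- w))"
    using sums_mono_reindex[of "\<lambda>k. 2 * k + 1" "\<lambda>n. inverse_square n * w ^ n - inverse_square n * (- w) ^ n"] by (simp add: strict_mono_def)
  moreover have "inverse_square (2 * k + 1) * w ^ (2 * k + 1) - inverse_square (2 * k + 1) * (- w) ^ (2 * k + 1) =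
      2 * w * (odd_difference 0 k * (w\<^sup>2) ^ k)" for k
  proof -
    have m: "(- w) ^ (2 * k + 1) = - (w ^ (2 * k + 1))" by simp
    have e: "inverse_square (2 * k + 1) = odd_difference 0 k" by (simp add: inverse_square_def odd_difference_def power2_eq_square add.commute)
    have p: "w ^ (2 * k + 1) = w * (w\<^sup>2) ^ k" by (simp add: power_mult)
    show ?thesis unfolding m e unfolding p by simp
  qed
  ultimately show ?thesis by (simp only:)
qed

text \<open>Known on the disc, the identity continues to all \<open>a\<close> at once, because \<open>F\<close> is holomorphic also across \<open>[1, \<infinity>)\<close>.\<close>

lemma first_moment_integral_zero:
  assumes a: "Re a > 0" and b: "Re b > 0"
    and F: "\<And>w. w \<notin> \<real>\<^sub>\<le>\<^sub>0 \<Longrightarrow> (F has_field_derivative log_quotient w) (at w)" "F 1 = of_real (pi\<^sup>2 / 4)"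
  shows "bessel_integral 1 0 a b = F (a / b) / (4 * a * b)"
proof -
  have b0: "b \<noteq> 0" and a0: "a \<noteq> 0" using a b by auto
  define h where "h w = F w / (4 * b\<^sup>2 * w)" for w
  have op: "open (- \<real>\<^sub>\<le>\<^sub>0 :: complex set)" by (simp add: open_Compl)
  have "F holomorphic_on - \<real>\<^sub>\<le>\<^sub>0" using F(1) op by (auto simp: holomorphic_on_open)
  hence hol: "h holomorphic_on - \<real>\<^sub>\<le>\<^sub>0" unfolding h_def using b0 by (intro holomorphic_intros) auto
  have seg: "closed_segment (1/2) w \<subseteq> - \<real>\<^sub>\<le>\<^sub>0" if "w \<in> - \<real>\<^sub>\<le>\<^sub>0" for w :: complex
    using closed_segment_slit[of "1/2" w] that by simp
  have eq: "bessel_integral 1 0 (of_real x) b = h (of_real x / b)" if x: "0 < x" "x < norm b" for x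
  proof -
    define w where "w = of_real x / b"
    have w: "norm w < 1" "w \<noteq> 0" "w \<noteq> 1" using x b0 by (auto simp: w_def norm_divide divide_eq_1_iff)
    have wr: "w \<notin> \<real>\<^sub>\<le>\<^sub>0" unfolding w_def by (rule quotient_notin_nonpos_Reals) (use x b in auto)
    define S where "S = (\<Sum>k. odd_difference 0 k * (w\<^sup>2) ^ k)"
    have "(\<lambda>k. 2 * w * (odd_difference 0 k * (w\<^sup>2) ^ k) / (2 * w)) sums ((dilog w - dilog (- w)) / (2 * w))"
      by (intro sums_divide dilog_odd_part) (use w in simp)
    hence "(\<lambda>k. odd_difference 0 k * (w\<^sup>2) ^ k) sums ((dilog w - dilog (- w)) / (2 * w))" using w(2) by simp
    hence S: "S = (dilog w - dilog (- w)) / (2 * w)" unfolding S_def by (rule sums_unique[symmetric])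
    have "bessel_integral 1 0 (of_real x) b = 1 / (2 * b\<^sup>2) * (S - Ln w * (arctanh w / w))"
      unfolding S_def w_def by (rule first_moment_integral_zero_series) (use x b w in \<open>auto simp: w_def\<close>)
    also have "\<dots> = disc_primitive w / (4 * b\<^sup>2 * w)"
    proof -
      have "1 / (2 * b\<^sup>2) * (D / (2 * w) - l * (A / w)) = (D - 2 * l * A) / (4 * b\<^sup>2 * w)" for D l A
        using w(2) b0 by (simp add: field_simps)
      thus ?thesis unfolding S disc_primitive_def .
    qed
    also have "disc_primitive w = F w"
      by (rule primitive_eq_disc_primitive[OF F, symmetric]) (use w wr in auto)
    finally show ?thesis unfolding h_def w_def .
  qed
  have small: "eventually (\<lambda>x. bessel_integral 1 0 (of_real x) b = h (of_real x / b)) (at_right 0)"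
    unfolding eventually_at_right_field using eq b0 by (intro exI[of _ "norm b"]) auto
  have adm: "admissible 1 0" by (simp add: admissible_def)
  have "bessel_integral 1 0 a b = h (a / b)"
    by (rule bessel_integral_continuation[OF b adm op seg _ hol small a])
       (use quotient_notin_nonpos_Reals[OF a b] in auto)
  also have "\<dots> = F (a / b) / (4 * a * b)" unfolding h_def using a0 b0 by (simp add: power2_eq_square)
  finally show ?thesis .
qed

lemma integrand_has_integral:
  assumes a: "Re a > 0" and b: "Re b > 0" and adm: "admissible j \<alpha>"
    and f: "\<And>x. f x = integrand j \<alpha> a b x" and I: "bessel_integral j \<alpha> a b = I"
  shows "(f has_integral I) {0<..}"
proof -
  have "Re \<alpha> > - 1" using adm by (simp add: admissible_def)
  from lborel_on_bridge(3)[OF _ integrand_measurable[OF a b this] bessel_integral_holomorphic(2)[OF b adm a]]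
  have "(integrand j \<alpha> a b has_integral bessel_integral j \<alpha> a b) {0<..}" unfolding bessel_integral_def by simp
  moreover have "f = integrand j \<alpha> a b" using f by (rule ext)
  ultimately show ?thesis unfolding I by simp
qed

text \<open>The point 1 is not on the open cut, so \<open>side_value\<close> returns the value of the series there and one formula covers \<open>a = b\<close>.\<close>

lemma zeroth_moment_integral:
  assumes a: "Re a > 0" and b: "Re b > 0" and \<alpha>: "\<alpha> \<noteq> 0" "- 1/4 < Re \<alpha>" "Re \<alpha> < 1/2" and s: "s \<in> {1, - 1 :: real}"
  shows "bessel_integral 0 \<alpha> a b = of_real pi ^ 2 / (8 * b) *
              (1 / cos (of_real pi * \<alpha>) / \<alpha> *
                 side_value s (\<lambda>w. hypergeo [1/2, 1/2, \<alpha> + 1/2, 1/2 - \<alpha>] [1, \<alpha> + 1, 1 - \<alpha>] (w ^ 2)) (a / b)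
               - Gamma (\<alpha> + 1/2) * Gamma (2 * \<alpha> + 1/2) * (1 / sin (of_real pi * \<alpha>)) / Gamma (\<alpha> + 1) ^ 3
                 * (a / (2 * b)) powr (2 * \<alpha>) *
                 side_value s (\<lambda>w. hypergeo [1/2, \<alpha> + 1/2, \<alpha> + 1/2, 2 * \<alpha> + 1/2] [\<alpha> + 1, \<alpha> + 1, 2 * \<alpha> + 1] (w ^ 2)) (a / b))"
proof (cases "a = b")
  case False
  from zeroth_moment_integral_unequal[OF a b \<alpha> False s] show ?thesis .
next
  case True
  have "b \<noteq> 0" using b by auto
  hence q: "b / b = 1" "b / (2 * b) = 1 / 2" by auto
  have sv: "side_value s f 1 = f 1" for f by (auto simp: side_value_def)
  show ?thesis unfolding True q sv by (rule zeroth_moment_integral_equal[OF b \<alpha>])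
qed

theorem theorem2p7:
  fixes a b \<alpha> :: complex
  assumes "Re a > 0" and "Re b > 0"
  shows
   "(\<alpha> \<noteq> 0 \<and> - 1 / 4 < Re \<alpha> \<and> Re \<alpha> < 1 / 2 \<longrightarrow>
      (\<forall>s \<in> {1, - 1}.
        ((\<lambda>x::real. bessel_I \<alpha> (a * x) * bessel_K \<alpha> (a * x) * bessel_K \<alpha> (b * x) ^ 2)
          has_integral
            pi ^ 2 / (8 * b) *
              (1 / cos (pi * \<alpha>) / \<alpha> *
                 side_value s
                   (\<lambda>w. hypergeo [1/2, 1/2, \<alpha> + 1/2, 1/2 - \<alpha>] [1, \<alpha> + 1, 1 - \<alpha>] (w ^ 2)) (a / b)
               - Gamma (\<alpha> + 1/2) * Gamma (2 * \<alpha> + 1/2) * (1 / sin (pi * \<alpha>)) / Gamma (\<alpha> + 1) ^ 3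
                 * (a / (2 * b)) powr (2 * \<alpha>) *
                 side_value s
                   (\<lambda>w. hypergeo [1/2, \<alpha> + 1/2, \<alpha> + 1/2, 2 * \<alpha> + 1/2]
                          [\<alpha> + 1, \<alpha> + 1, 2 * \<alpha> + 1] (w ^ 2)) (a / b))) {0<..}))
    \<and>
    (\<alpha> \<noteq> 0 \<and> - 1 / 2 < Re \<alpha> \<and> Re \<alpha> < 1 \<and> a \<noteq> b \<longrightarrow>
      (\<forall>s \<in> {1, - 1}.
        ((\<lambda>x::real. x * bessel_I \<alpha> (a * x) * bessel_K \<alpha> (a * x) * bessel_K \<alpha> (b * x) ^ 2)
          has_integral
            pi * (1 / sin (pi * \<alpha>)) / (4 * b ^ 2) *
              (b / a * side_value s arctanh (a / b)
               - (a / b) powr (2 * \<alpha>) / (1 + 2 * \<alpha>) *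
                 side_value s (\<lambda>w. hypergeo [1, 1/2 + \<alpha>] [3/2 + \<alpha>] (w ^ 2)) (a / b))) {0<..}))
    \<and>
    (\<alpha> \<noteq> 0 \<and> - 1 / 2 < Re \<alpha> \<and> Re \<alpha> < 1 \<and> a = b \<longrightarrow>
      ((\<lambda>x::real. x * bessel_I \<alpha> (a * x) * bessel_K \<alpha> (a * x) ^ 3)
        has_integral
          pi / (8 * a ^ 2) * (1 / sin (pi * \<alpha>)) *
            (Digamma (1/2 + \<alpha>) + 2 * ln 2 + euler_mascheroni)) {0<..})
    \<and>
    (norm (a / b) \<le> 1 \<and> a \<noteq> b \<longrightarrow>
      ((\<lambda>x::real. x * bessel_I 0 (a * x) * bessel_K 0 (a * x) * bessel_K 0 (b * x) ^ 2)
        has_integral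
          1 / (4 * a * b) *
            (dilog (a / b) - dilog (- (a / b)) - 2 * Ln (a / b) * arctanh (a / b))) {0<..})
    \<and>
    (norm (a / b) \<ge> 1 \<and> a \<noteq> b \<longrightarrow>
      ((\<lambda>x::real. x * bessel_I 0 (a * x) * bessel_K 0 (a * x) * bessel_K 0 (b * x) ^ 2)
        has_integral
          1 / (4 * a * b) *
            (pi ^ 2 / 2 - dilog (b / a) + dilog (- (b / a))
             + 2 * Ln (b / a) * arctanh (b / a))) {0<..})
    \<and>
    (a = b \<longrightarrow>
      ((\<lambda>x::real. x * bessel_K 0 (a * x) ^ 3 * bessel_I 0 (a * x))
        has_integral pi ^ 2 / (16 * a ^ 2)) {0<..})"
proof (intro conjI impI ballI, goal_cases)
  case (1 s)
  have \<alpha>: "\<alpha> \<noteq> 0" "- 1/4 < Re \<alpha>" "Re \<alpha> < 1/2" using 1(1) by blast+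
  show ?case
    by (rule integrand_has_integral[OF assms admissible_0[OF \<alpha>(2,3)]])
       (simp add: integrand_def, use zeroth_moment_integral[OF assms \<alpha> 1(2)] in simp)
next
  case (2 s)
  have \<alpha>: "\<alpha> \<noteq> 0" "- 1/2 < Re \<alpha>" "Re \<alpha> < 1" and ab: "a \<noteq> b" using 2(1) by blast+
  show ?case
    by (rule integrand_has_integral[OF assms admissible_1[OF \<alpha>(2,3)]])
       (simp add: integrand_def, use first_moment_integral[OF assms \<alpha> ab 2(2)] in simp)
next
  case 3
  have \<alpha>: "\<alpha> \<noteq> 0" "- 1/2 < Re \<alpha>" "Re \<alpha> < 1" and ab: "a = b" using 3 by blast+
  have "ln (2 :: complex) = of_real (ln 2)" using Ln_of_real[of 2] by simp
  thus ?case unfolding ab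
    by (intro integrand_has_integral[OF assms(2,2) admissible_1[OF \<alpha>(2,3)]])
       (simp add: integrand_def power2_eq_square power3_eq_cube, use first_moment_integral_equal[OF assms(2) \<alpha>] in simp)
next
  case 4
  obtain F where F: "\<And>w. w \<notin> \<real>\<^sub>\<le>\<^sub>0 \<Longrightarrow> (F has_field_derivative log_quotient w) (at w)" "F 1 = of_real (pi\<^sup>2 / 4)"
    using log_quotient_primitive by blast
  have b0: "b \<noteq> 0" using assms by auto
  have B: "bessel_integral 1 0 a b = F (a / b) / (4 * a * b)" by (rule first_moment_integral_zero[OF assms F])
  have e: "F (a / b) = disc_primitive (a / b)"
    by (rule primitive_eq_disc_primitive[OF F]) (use 4 b0 quotient_notin_nonpos_Reals[OF assms] in auto)
  have I: "bessel_integral 1 0 a b = 1 / (4 * a * b) * (dilog (a / b) - dilog (- (a / b)) - 2 * Ln (a / b) * arctanh (a / b))"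
    unfolding B e disc_primitive_def by simp
  have adm: "admissible 1 0" by (simp add: admissible_def)
  show ?case by (rule integrand_has_integral[OF assms adm _ I]) (simp add: integrand_def)
next
  case 5
  obtain F where F: "\<And>w. w \<notin> \<real>\<^sub>\<le>\<^sub>0 \<Longrightarrow> (F has_field_derivative log_quotient w) (at w)" "F 1 = of_real (pi\<^sup>2 / 4)"
    using log_quotient_primitive by blast
  have a0: "a \<noteq> 0" and b0: "b \<noteq> 0" using assms by auto
  have n: "norm (b / a) \<le> 1" using 5 a0 b0 by (simp add: norm_divide divide_simps)
  have "F (b / a) = disc_primitive (b / a)"
    by (rule primitive_eq_disc_primitive[OF F n]) (use 5 a0 quotient_notin_nonpos_Reals[OF assms(2,1)] in auto)
  moreover have "F (a / b) + F (inverse (a / b)) = 2 * F 1"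
    by (rule primitive_inversion[OF F(1) quotient_notin_nonpos_Reals[OF assms]])
  ultimately have e: "F (a / b) = 2 * F 1 - disc_primitive (b / a)" by (simp add: eq_diff_eq)
  have B: "bessel_integral 1 0 a b = F (a / b) / (4 * a * b)" by (rule first_moment_integral_zero[OF assms F])
  have I: "bessel_integral 1 0 a b = 1 / (4 * a * b) *
            (of_real pi ^ 2 / 2 - dilog (b / a) + dilog (- (b / a)) + 2 * Ln (b / a) * arctanh (b / a))"
  proof -
    have p: "2 * complex_of_real (pi\<^sup>2 / 4) = of_real pi ^ 2 / 2" by simp
    have "(P - (X - Y - L)) / D = 1 / D * (P - X + Y + L)" for P X Y L D :: complex
    proof -
      have "P - (X - Y - L) = P - X + Y + L" by simp
      thus ?thesis by simp
    qed
    thus ?thesis unfolding B e disc_primitive_def F(2) p .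
  qed
  have adm: "admissible 1 0" by (simp add: admissible_def)
  show ?case by (rule integrand_has_integral[OF assms adm]) (simp add: integrand_def, use I in simp)
next
  case 6
  obtain F where F: "\<And>w. w \<notin> \<real>\<^sub>\<le>\<^sub>0 \<Longrightarrow> (F has_field_derivative log_quotient w) (at w)" "F 1 = of_real (pi\<^sup>2 / 4)"
    using log_quotient_primitive by blast
  have a0: "a \<noteq> 0" using assms by auto
  have "bessel_integral 1 0 a a = F (a / a) / (4 * a * a)" by (rule first_moment_integral_zero[OF assms(1,1) F])
  hence I: "bessel_integral 1 0 a a = of_real pi ^ 2 / (16 * a ^ 2)" using a0 by (simp add: F(2) power2_eq_square)
  have adm: "admissible 1 0" by (simp add: admissible_def)
  show ?case by (rule integrand_has_integral[OF assms(1,1) adm]) (simp add: integrand_def power2_eq_square power3_eq_cube, use I in simp)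
qed

end
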